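(* Let $k\in Y^\ast=(-1/2,1/2)$ and let $(\mu^\varepsilon,U^\varepsilon)$, associated with a normalized eigenelement $(\lambda^\varepsilon,w^\varepsilon)$ as in the context, be solution of $$A^\varepsilon U^\varepsilon=i\mu^\varepsilon U^\varepsilon\ \text{ in }\Omega,\qquad U_2^\varepsilon=0\ \text{ on }\partial\Omega ,$$ where $U^\varepsilon_2$ is the second component of $U^\varepsilon$. Then $\sum_{\sigma\in I^k}S_\sigma^\varepsilon U^\varepsilon$ is bounded in $L^2(\Omega\times Y)^2$. For $\varepsilon\in E_k$, assume that $$\mu^\varepsilon=\frac{\mu_0}{\varepsilon}+\mu_1+O(\varepsilon),$$ with $\mu_0=\mu_n^k$ ($n\in\mathbb Z^\ast$) an eigenvalue of the Bloch wave spectrum, and that the weak limit of $S_k^\varepsilon U^\varepsilon$ in $L^2(\Omega\times Y)^2$ is not vanishing. Then any weak limit $G_k$ of $\sum_{\sigma\in I^k}S_\sigma^\varepsilon U^\varepsilon$ in $L^2(\Omega\times Y)^2$ has the form $$G_k(x,y)=\sum_{\sigma\in I^k}\sum_{m\in M_n^\sigma}u_m^\sigma(x)\,e_m^\sigma(y),$$ where, with $\lambda^1=2\mu_0\mu_1$, the $(u_m^\sigma)_{m,\sigma}$ are solutions of the following macroscopic problem. (i) If $k\ne0$ (so that $M_n^\sigma=\{n\}$): for each $\sigma\in I^k$, $$c(\sigma,|n|,|n|)\,\partial_xu_n^\sigma+\lambda^1b(\sigma,|n|,|n|)\,u_n^\sigma=0\ \text{ in }\Omega,$$ with $u_n^k(x)\phi_{|n|}^k(0)e^{2i\pi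 l^kx/\alpha}+u_n^{-k}(x)\phi_{|n|}^{-k}(0)e^{-2i\pi l^kx/\alpha}=0$ for $x\in\partial\Omega$. (ii) If $k=0$ (so that $M_n^0=\{n,m\}$): for each $p\in\{n,m\}$, $$\sum_{q\in\{n,m\}}\big(c(0,|p|,|q|)\,\partial_xu_q^0+\lambda^1b(0,|p|,|q|)\,u_q^0\big)=0\ \text{ in }\Omega,$$ with $\sum_{q\in\{n,m\}}u_q^0(x)\phi_{|q|}^0(0)=0$ for $x\in\partial\Omega$.
   Context: Setting: $\Omega=(0,\alpha)$ with $\alpha>0$, $Y=(0,1)$. The functions $\rho\in L^\infty(\mathbb R)$ and $a\in W^{1,\infty}(\mathbb R)$ are real, $1$-periodic, with $\rho^0\le\rho\le\rho^1$, $a^0\le a\le a^1$ for strictly positive constants; $a^\varepsilon(x)=a(x/\varepsilon)$, $\rho^\varepsilon(x)=\rho(x/\varepsilon)$. The parameter $\varepsilon>0$ ranges over values $\alpha/N$, $N\in\mathbb N^\ast$. $L^2$ spaces are over $\mathbb C$. $O(\varepsilon)$ denotes a quantity tending to $0$ as $\varepsilon\to0$. Physical problem: $(\lambda^\varepsilon,w^\varepsilon)$ satisfies $-\partial_x(a^\varepsilon\partial_xw^\varepsilon)=\lambda^\varepsilon\rho^\varepsilon w^\varepsilon$ in $\Omega$, $w^\varepsilon=0$ on $\partial\Omega$, $w^\varepsilon\in H^2(\Omega)\cap H_0^1(\Omega)$, $\|w^\varepsilon\|_{L^2(\Omega)}=1$. One sets $$U^\varepsilon=\Big(\frac{\sqrt{a^\varepsilon}\,\partial_xw^\varepsilon}{i\sqrt{\lambda^\varepsilon}},\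 \sqrt{\rho^\varepsilon}\,w^\varepsilon\Big),\qquad \mu^\varepsilon=\sqrt{\lambda^\varepsilon},$$ $$A^\varepsilon(\varphi,\phi)=\Big(\sqrt{a^\varepsilon}\,\partial_x\big(\tfrac{1}{\sqrt{\rho^\varepsilon}}\phi\big),\ \tfrac1{\sqrt{\rho^\varepsilon}}\,\partial_x(\sqrt{a^\varepsilon}\,\varphi)\Big).$$ $I^k=\{k,-k\}$ if $k\ne0$ and $I^0=\{0\}$. Modulated two-scale transform (acting componentwise on vectors): for $k\in Y^\ast$, $$S_k^\varepsilon u(x,y)=\sum_{l\in\mathbb Z,\ \varepsilon l+\varepsilon Y\subset\Omega}u(\varepsilon l+\varepsilon y)\,\chi_{\varepsilon l+\varepsilon Y}(x)\,e^{-2i\pi kl}.$$ Bloch waves: $H^s_k(Y)$ denotes (restrictions to $Y$ of) functions $u\in H^s_{loc}(\mathbb R)$ with $u(x+\ell)=u(x)e^{2i\pi k\ell}$ for all $\ell\in\mathbb Z$. $(\lambda_n^k,\phi_n^k)_{n\in\mathbb N^\ast}$ are the eigenelements (counted with multiplicity) of $-\partial_y(a\,\partial_y\phi_n^k)=\lambda_n^k\rho\,\phi_n^k$ in $Y$, $\phi_n^k\in H^2_k(Y)$, $\|\phi_n^k\|_{L^2(Y)}=1$. For $k\ne0$ the numbering is such that $\phi_n^{-k}=\overline{\phi_n^k}$, $\lambda_n^{-k}=\lambda_n^k$; in one dimension the eigenvalues are simple for $k\ne0$. For $n\in\mathbb Z^\ast$, with $s_n$ the sign of $n$, $$\mu_n^k=s_n\sqrt{\lambda_{|n|}^k},\qquad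 e_n^k=\frac1{\sqrt2}\Big(\frac{-i s_n}{\sqrt{\lambda_{|n|}^k}}\sqrt a\,\partial_y\phi_{|n|}^k,\ \sqrt\rho\,\phi_{|n|}^k\Big),$$ and $M_n^k=\{i\in\mathbb Z^\ast:\mu_i^k=\mu_n^k\}$. It is assumed that $\mu_0\ne0$ (and $\mu_0=\lim\varepsilon\mu^\varepsilon\geq 0$). Coefficients: $c(k,n,m)=\int_Y\big(a\,\partial_y\phi_m^k\,\overline{\phi_n^k}-\phi_m^k\,a\,\overline{\partial_y\phi_n^k}\big)dy$ and $b(k,n,m)=\int_Y\rho\,\phi_m^k\,\overline{\phi_n^k}\,dy$. Non-degeneracy assumptions: if $k\ne0$, $c(\sigma,|n|,|n|)\ne0$ for each $\sigma\in I^k$; if $k=0$, $\lambda^0_{|n|}$ is a double eigenvalue with two linearly independent real-valued eigenvectors $\phi_{|n|}^0,\phi_{|m|}^0$ ($\mu_n^0=\mu_m^0$), and $c(0,|n|,|m|)\ne0$. The set $E_k$ and $l^k$: write $\alpha k/\varepsilon=h_\varepsilon^k+l_\varepsilon^k$ with $h_\varepsilon^k=[\alpha k/\varepsilon]\in\mathbb Z$ the integer part and $l_\varepsilon^k\in[0,1)$. $E_k\subset(0,\infty)$ is a set of values of $\varepsilon$, accumulating at $0$, such that $l_\varepsilon^k\to l^k$ as $\varepsilon\to0$, $\varepsilon\in E_k$, for some $l^k\in[0,1)$ (for $k=0$, $l^k=0$ and there is no restriction). *)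

theory Defs
  imports "HOL-Analysis.Analysis"
begin

text \<open>Elements of Lebesgue and Sobolev spaces are represented by functions; membership in these
  spaces, and being a weak derivative, do not depend on the values on null sets. Consequently
  \<open>wderiv\<close> depends only on the class of its argument.\<close>

definition L2_on :: "'a::euclidean_space set \<Rightarrow> ('a \<Rightarrow> 'b::{banach, second_countable_topology}) \<Rightarrow> bool" where
  "L2_on S f \<longleftrightarrow> f \<in> borel_measurable (lebesgue_on S) \<and>
     integrable (lebesgue_on S) (\<lambda>x. (norm (f x))\<^sup>2)"

definition L2_norm :: "'a::euclidean_space set \<Rightarrow> ('a \<Rightarrow> 'b::{banach, second_countable_topology}) \<Rightarrow> real" where
  "L2_norm S f = sqrt (integral\<^sup>L (lebesgue_on S) (\<lambda>x. (norm (f x))\<^sup>2))"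

definition Linf_real :: "(real \<Rightarrow> real) \<Rightarrow> bool" where
  "Linf_real f \<longleftrightarrow> f \<in> borel_measurable lebesgue \<and> (\<exists>C. AE x in lebesgue. \<bar>f x\<bar> \<le> C)"

definition loc_integrable :: "real set \<Rightarrow> (real \<Rightarrow> 'b::{banach, second_countable_topology}) \<Rightarrow> bool" where
  "loc_integrable I f \<longleftrightarrow> (\<forall>K. compact K \<and> K \<subseteq> I \<longrightarrow> integrable (lebesgue_on K) f)"

text \<open>\<open>\<psi>\<close> is a test function of class \<open>C\<^sup>1\<close> with compact support in \<open>I\<close>, and \<open>\<psi>'\<close> is its
  derivative. Testing with these or with smooth functions yields the same weak derivatives, and
  both have the same closure in the first-order Sobolev norm.\<close>

definition test_fun :: "real set \<Rightarrow> (real \<Rightarrow> 'b::real_normed_vector) \<Rightarrow> (real \<Rightarrow> 'b) \<Rightarrow> bool" where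
  "test_fun I \<psi> \<psi>' \<longleftrightarrow>
     (\<forall>t. (\<psi> has_vector_derivative \<psi>' t) (at t)) \<and> continuous_on UNIV \<psi>' \<and>
     (\<exists>K. compact K \<and> K \<subseteq> I \<and> (\<forall>t. t \<notin> K \<longrightarrow> \<psi> t = 0))"

definition weak_deriv ::
  "real set \<Rightarrow> (real \<Rightarrow> 'b::{banach, second_countable_topology}) \<Rightarrow> (real \<Rightarrow> 'b) \<Rightarrow> bool" where
  "weak_deriv I f g \<longleftrightarrow> loc_integrable I f \<and> loc_integrable I g \<and>
     (\<forall>\<psi> \<psi>' :: real \<Rightarrow> real. test_fun I \<psi> \<psi>' \<longrightarrow>
        integral\<^sup>L (lebesgue_on I) (\<lambda>t. \<psi>' t *\<^sub>R f t) =
        - integral\<^sup>L (lebesgue_on I) (\<lambda>t. \<psi> t *\<^sub>R g t))"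

definition wderiv ::
  "real set \<Rightarrow> (real \<Rightarrow> 'b::{banach, second_countable_topology}) \<Rightarrow> real \<Rightarrow> 'b" where
  "wderiv I f = (SOME g. weak_deriv I f g)"

primrec Sob :: "nat \<Rightarrow> real set \<Rightarrow> (real \<Rightarrow> 'b::{banach, second_countable_topology}) \<Rightarrow> bool" where
  "Sob 0 I f = L2_on I f"
| "Sob (Suc s) I f = (L2_on I f \<and> (\<exists>g. weak_deriv I f g \<and> Sob s I g))"

definition Sob_loc :: "nat \<Rightarrow> (real \<Rightarrow> complex) \<Rightarrow> bool" where
  "Sob_loc s f \<longleftrightarrow> (\<forall>c d. c < d \<longrightarrow> Sob s {c<..<d} f)"

definition Sob1_0 :: "real set \<Rightarrow> (real \<Rightarrow> complex) \<Rightarrow> bool" where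
  "Sob1_0 I f \<longleftrightarrow> Sob 1 I f \<and>
     (\<exists>\<psi> \<psi>' :: nat \<Rightarrow> real \<Rightarrow> complex.
        (\<forall>j. test_fun I (\<psi> j) (\<psi>' j)) \<and>
        (\<lambda>j. L2_norm I (\<lambda>x. f x - \<psi> j x)) \<longlonglongrightarrow> 0 \<and>
        (\<lambda>j. L2_norm I (\<lambda>x. wderiv I f x - \<psi>' j x)) \<longlonglongrightarrow> 0)"

definition W1inf_real :: "(real \<Rightarrow> real) \<Rightarrow> bool" where
  "W1inf_real f \<longleftrightarrow> Linf_real f \<and> (\<exists>g. weak_deriv UNIV f g \<and> Linf_real g)"

definition cinner2 :: "complex \<times> complex \<Rightarrow> complex \<times> complex \<Rightarrow> complex" where
  "cinner2 p q = fst p * cnj (fst q) + snd p * cnj (snd q)"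

definition cscale2 :: "complex \<Rightarrow> complex \<times> complex \<Rightarrow> complex \<times> complex" where
  "cscale2 z p = (z * fst p, z * snd p)"

definition weakly_tendsto ::
  "'a::euclidean_space set \<Rightarrow> (nat \<Rightarrow> 'a \<Rightarrow> complex \<times> complex) \<Rightarrow> ('a \<Rightarrow> complex \<times> complex) \<Rightarrow> bool" where
  "weakly_tendsto S F G \<longleftrightarrow> (\<forall>j. L2_on S (F j)) \<and> L2_on S G \<and>
     (\<forall>\<Psi>. L2_on S \<Psi> \<longrightarrow>
        (\<lambda>j. integral\<^sup>L (lebesgue_on S) (\<lambda>z. cinner2 (F j z) (\<Psi> z)))
          \<longlonglongrightarrow> integral\<^sup>L (lebesgue_on S) (\<lambda>z. cinner2 (G z) (\<Psi> z)))"

text \<open>A weak limit of a family indexed by \<open>\<epsilon> \<in> E\<close> is a weak limit along some sequence in \<open>E\<close> tending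
  to zero.\<close>

definition weak_limit ::
  "'a::euclidean_space set \<Rightarrow> real set \<Rightarrow> (real \<Rightarrow> 'a \<Rightarrow> complex \<times> complex) \<Rightarrow>
     ('a \<Rightarrow> complex \<times> complex) \<Rightarrow> bool" where
  "weak_limit S E F G \<longleftrightarrow>
     (\<exists>\<epsilon> :: nat \<Rightarrow> real. (\<forall>j. \<epsilon> j \<in> E) \<and> \<epsilon> \<longlonglongrightarrow> 0 \<and> weakly_tendsto S (\<lambda>j. F (\<epsilon> j)) G)"

abbreviation Omega :: "real \<Rightarrow> real set" where "Omega \<alpha> \<equiv> {0<..<\<alpha>}"
abbreviation Ycell :: "real set" where "Ycell \<equiv> {0<..<1}"
abbreviation Ystar :: "real set" where "Ystar \<equiv> {-1/2<..<1/2}"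

definition periodic_coeff :: "real \<Rightarrow> real \<Rightarrow> (real \<Rightarrow> real) \<Rightarrow> bool" where
  "periodic_coeff f0 f1 f \<longleftrightarrow> 0 < f0 \<and> 0 < f1 \<and>
     (AE x in lebesgue. f0 \<le> f x \<and> f x \<le> f1) \<and> (AE x in lebesgue. f (x + 1) = f x)"

definition osc :: "real \<Rightarrow> (real \<Rightarrow> real) \<Rightarrow> real \<Rightarrow> real" where
  "osc \<epsilon> f x = f (x / \<epsilon>)"

definition eps_values :: "real \<Rightarrow> real set" where
  "eps_values \<alpha> = {\<alpha> / real N | N :: nat. N \<ge> 1}"

text \<open>In the next definitions \<open>a\<close> and \<open>r\<close> are the oscillating coefficients. The eigenfunction \<open>w\<close> is
  taken to be its continuous representative on the closed interval.\<close>

definition physical_eigen ::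
  "real \<Rightarrow> (real \<Rightarrow> real) \<Rightarrow> (real \<Rightarrow> real) \<Rightarrow> real \<Rightarrow> (real \<Rightarrow> complex) \<Rightarrow> bool" where
  "physical_eigen \<alpha> a r \<Lambda> w \<longleftrightarrow>
     Sob 2 (Omega \<alpha>) w \<and> Sob1_0 (Omega \<alpha>) w \<and>
     continuous_on {0..\<alpha>} w \<and> w 0 = 0 \<and> w \<alpha> = 0 \<and>
     weak_deriv (Omega \<alpha>)
       (\<lambda>x. of_real (a x) * wderiv (Omega \<alpha>) w x) (\<lambda>x. - (of_real \<Lambda> * of_real (r x) * w x)) \<and>
     L2_norm (Omega \<alpha>) w = 1"

definition phys_vec ::
  "real \<Rightarrow> (real \<Rightarrow> real) \<Rightarrow> (real \<Rightarrow> real) \<Rightarrow> real \<Rightarrow> (real \<Rightarrow> complex) \<Rightarrow> real \<Rightarrow> complex \<times> complex" where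
  "phys_vec \<alpha> a r \<Lambda> w x =
     (of_real (sqrt (a x)) * wderiv (Omega \<alpha>) w x / (\<i> * of_real (sqrt \<Lambda>)),
      of_real (sqrt (r x)) * w x)"

definition A_op ::
  "real \<Rightarrow> (real \<Rightarrow> real) \<Rightarrow> (real \<Rightarrow> real) \<Rightarrow> (real \<Rightarrow> complex \<times> complex) \<Rightarrow> real \<Rightarrow> complex \<times> complex" where
  "A_op \<alpha> a r U x =
     (of_real (sqrt (a x)) * wderiv (Omega \<alpha>) (\<lambda>t. 1 / of_real (sqrt (r t)) * snd (U t)) x,
      1 / of_real (sqrt (r x)) * wderiv (Omega \<alpha>) (\<lambda>t. of_real (sqrt (a t)) * fst (U t)) x)"

text \<open>Since \<open>r\<close> is merely bounded, the condition that the second component of \<open>U\<close> vanishes on the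
  boundary is imposed on its quotient by \<open>sqrt r\<close>, which has a trace.\<close>

definition A_eigen ::
  "real \<Rightarrow> (real \<Rightarrow> real) \<Rightarrow> (real \<Rightarrow> real) \<Rightarrow> real \<Rightarrow> (real \<Rightarrow> complex \<times> complex) \<Rightarrow> bool" where
  "A_eigen \<alpha> a r \<mu> U \<longleftrightarrow>
     L2_on (Omega \<alpha>) U \<and>
     Sob 1 (Omega \<alpha>) (\<lambda>t. of_real (sqrt (a t)) * fst (U t)) \<and>
     Sob1_0 (Omega \<alpha>) (\<lambda>t. 1 / of_real (sqrt (r t)) * snd (U t)) \<and>
     (AE x in lebesgue_on (Omega \<alpha>). A_op \<alpha> a r U x = cscale2 (\<i> * of_real \<mu>) (U x))"

definition cell :: "real \<Rightarrow> int \<Rightarrow> real set" where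
  "cell \<epsilon> l = (\<lambda>y. \<epsilon> * of_int l + \<epsilon> * y) ` Ycell"

definition two_scale :: "real \<Rightarrow> real \<Rightarrow> real \<Rightarrow> (real \<Rightarrow> complex) \<Rightarrow> real \<times> real \<Rightarrow> complex" where
  "two_scale \<alpha> \<epsilon> k u = (\<lambda>(x, y).
     \<Sum>l | cell \<epsilon> l \<subseteq> Omega \<alpha>.
       u (\<epsilon> * of_int l + \<epsilon> * y) * indicator (cell \<epsilon> l) x * exp (- 2 * \<i> * pi * k * of_int l))"

definition two_scale2 ::
  "real \<Rightarrow> real \<Rightarrow> real \<Rightarrow> (real \<Rightarrow> complex \<times> complex) \<Rightarrow> real \<times> real \<Rightarrow> complex \<times> complex" where
  "two_scale2 \<alpha> \<epsilon> k U z =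
     (two_scale \<alpha> \<epsilon> k (\<lambda>x. fst (U x)) z, two_scale \<alpha> \<epsilon> k (\<lambda>x. snd (U x)) z)"

definition Ik :: "real \<Rightarrow> real set" where
  "Ik k = (if k \<noteq> 0 then {k, -k} else {0})"

definition admissible_eps :: "real \<Rightarrow> real \<Rightarrow> real set \<Rightarrow> real \<Rightarrow> bool" where
  "admissible_eps \<alpha> k E lk \<longleftrightarrow> E \<subseteq> eps_values \<alpha> \<and> 0 islimpt E \<and> 0 \<le> lk \<and> lk < 1 \<and>
     ((\<lambda>\<epsilon>. \<alpha> * k / \<epsilon> - of_int \<lfloor>\<alpha> * k / \<epsilon>\<rfloor>) \<longlongrightarrow> lk) (at 0 within E)"

definition Sob_bloch :: "nat \<Rightarrow> real \<Rightarrow> (real \<Rightarrow> complex) \<Rightarrow> bool" where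
  "Sob_bloch s k u \<longleftrightarrow> Sob_loc s u \<and>
     (\<forall>l :: int. AE x in lebesgue. u (x + of_int l) = u x * exp (2 * \<i> * pi * k * of_int l))"

text \<open>A Bloch function on the cell is represented by the continuous representative of its
  quasi-periodic extension to the line, so that its value at the origin makes sense.\<close>

definition bloch_solution ::
  "(real \<Rightarrow> real) \<Rightarrow> (real \<Rightarrow> real) \<Rightarrow> real \<Rightarrow> real \<Rightarrow> (real \<Rightarrow> complex) \<Rightarrow> bool" where
  "bloch_solution a r k \<Lambda> \<phi> \<longleftrightarrow>
     Sob_bloch 2 k \<phi> \<and> continuous_on UNIV \<phi> \<and>
     weak_deriv Ycell
       (\<lambda>y. of_real (a y) * wderiv Ycell \<phi> y) (\<lambda>y. - (of_real \<Lambda> * of_real (r y) * \<phi> y))"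

definition solution_basis ::
  "(real \<Rightarrow> real) \<Rightarrow> (real \<Rightarrow> real) \<Rightarrow> real \<Rightarrow> real \<Rightarrow> nat set \<Rightarrow> (nat \<Rightarrow> real \<Rightarrow> complex) \<Rightarrow> bool" where
  "solution_basis a r k \<Lambda> J \<phi> \<longleftrightarrow> finite J \<and>
     (\<forall>j\<in>J. bloch_solution a r k \<Lambda> (\<phi> j)) \<and>
     (\<forall>d :: nat \<Rightarrow> complex. (\<forall>y. (\<Sum>j\<in>J. d j * \<phi> j y) = 0) \<longrightarrow> (\<forall>j\<in>J. d j = 0)) \<and>
     (\<forall>f. bloch_solution a r k \<Lambda> f \<longrightarrow> (\<exists>d. \<forall>y. f y = (\<Sum>j\<in>J. d j * \<phi> j y)))"

text \<open>All eigenelements, counted with multiplicity: for every \<open>\<Lambda>\<close> (for a \<open>\<Lambda>\<close> which is not an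
  eigenvalue the index set is empty) the functions with eigenvalue \<open>\<Lambda>\<close> form a basis of the
  solution space. The index 0 is not used.\<close>

definition bloch_eigenelements ::
  "(real \<Rightarrow> real) \<Rightarrow> (real \<Rightarrow> real) \<Rightarrow> real \<Rightarrow> (nat \<Rightarrow> real) \<Rightarrow> (nat \<Rightarrow> real \<Rightarrow> complex) \<Rightarrow> bool" where
  "bloch_eigenelements a r k lam \<phi> \<longleftrightarrow>
     (\<forall>n\<ge>1. L2_norm Ycell (\<phi> n) = 1) \<and>
     (\<forall>\<Lambda>. solution_basis a r k \<Lambda> {n. n \<ge> 1 \<and> lam n = \<Lambda>} \<phi>)"

definition bloch_family ::
  "(real \<Rightarrow> real) \<Rightarrow> (real \<Rightarrow> real) \<Rightarrow> (real \<Rightarrow> nat \<Rightarrow> real) \<Rightarrow> (real \<Rightarrow> nat \<Rightarrow> real \<Rightarrow> complex) \<Rightarrow> bool" where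
  "bloch_family a r lam \<phi> \<longleftrightarrow>
     (\<forall>k\<in>Ystar. bloch_eigenelements a r k (lam k) (\<phi> k)) \<and>
     (\<forall>k\<in>Ystar. k \<noteq> 0 \<longrightarrow> (\<forall>n\<ge>1. lam (-k) n = lam k n \<and> (\<forall>y. \<phi> (-k) n y = cnj (\<phi> k n y))))"

abbreviation nabs :: "int \<Rightarrow> nat" where "nabs n \<equiv> nat \<bar>n\<bar>"

definition bloch_mu :: "(real \<Rightarrow> nat \<Rightarrow> real) \<Rightarrow> real \<Rightarrow> int \<Rightarrow> real" where
  "bloch_mu lam k n = of_int (sgn n) * sqrt (lam k (nabs n))"

definition bloch_vec ::
  "(real \<Rightarrow> real) \<Rightarrow> (real \<Rightarrow> real) \<Rightarrow> (real \<Rightarrow> nat \<Rightarrow> real) \<Rightarrow> (real \<Rightarrow> nat \<Rightarrow> real \<Rightarrow> complex) \<Rightarrow>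
     real \<Rightarrow> int \<Rightarrow> real \<Rightarrow> complex \<times> complex" where
  "bloch_vec a r lam \<phi> k n y = cscale2 (1 / of_real (sqrt 2))
     (- \<i> * of_int (sgn n) / of_real (sqrt (lam k (nabs n))) *
        of_real (sqrt (a y)) * wderiv Ycell (\<phi> k (nabs n)) y,
      of_real (sqrt (r y)) * \<phi> k (nabs n) y)"

definition bloch_M :: "(real \<Rightarrow> nat \<Rightarrow> real) \<Rightarrow> real \<Rightarrow> int \<Rightarrow> int set" where
  "bloch_M lam k n = {i. i \<noteq> 0 \<and> bloch_mu lam k i = bloch_mu lam k n}"

definition coef_c ::
  "(real \<Rightarrow> real) \<Rightarrow> (real \<Rightarrow> nat \<Rightarrow> real \<Rightarrow> complex) \<Rightarrow> real \<Rightarrow> nat \<Rightarrow> nat \<Rightarrow> complex" where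
  "coef_c a \<phi> k n m = integral\<^sup>L (lebesgue_on Ycell)
     (\<lambda>y. of_real (a y) * wderiv Ycell (\<phi> k m) y * cnj (\<phi> k n y)
          - \<phi> k m y * of_real (a y) * cnj (wderiv Ycell (\<phi> k n) y))"

definition coef_b ::
  "(real \<Rightarrow> real) \<Rightarrow> (real \<Rightarrow> nat \<Rightarrow> real \<Rightarrow> complex) \<Rightarrow> real \<Rightarrow> nat \<Rightarrow> nat \<Rightarrow> complex" where
  "coef_b r \<phi> k n m = integral\<^sup>L (lebesgue_on Ycell)
     (\<lambda>y. of_real (r y) * \<phi> k m y * cnj (\<phi> k n y))"

text \<open>The condition at \<open>k = 0\<close>: the eigenvalue is double, and its eigenspace has the two real-valued
  functions with indices \<open>\<bar>n\<bar>\<close> and \<open>\<bar>m\<bar>\<close> as a basis.\<close>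

definition nondegenerate ::
  "(real \<Rightarrow> real) \<Rightarrow> (real \<Rightarrow> real) \<Rightarrow> (real \<Rightarrow> nat \<Rightarrow> real) \<Rightarrow> (real \<Rightarrow> nat \<Rightarrow> real \<Rightarrow> complex) \<Rightarrow>
     real \<Rightarrow> int \<Rightarrow> int \<Rightarrow> bool" where
  "nondegenerate a r lam \<phi> k n m \<longleftrightarrow>
     (k \<noteq> 0 \<longrightarrow> (\<forall>\<sigma>\<in>Ik k. coef_c a \<phi> \<sigma> (nabs n) (nabs n) \<noteq> 0)) \<and>
     (k = 0 \<longrightarrow> m \<noteq> 0 \<and> nabs m \<noteq> nabs n \<and> bloch_mu lam 0 m = bloch_mu lam 0 n \<and>
        solution_basis a r 0 (lam 0 (nabs n)) {nabs n, nabs m} (\<phi> 0) \<and>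
        (\<forall>y. \<phi> 0 (nabs n) y \<in> \<real> \<and> \<phi> 0 (nabs m) y \<in> \<real>) \<and>
        coef_c a \<phi> 0 (nabs n) (nabs m) \<noteq> 0)"

end

theory Submission
  imports Defs "HOL-Complex_Analysis.Great_Picard" "HOL-Real_Asymp.Real_Asymp"
begin

text \<open>
  The proof works with solutions of the ordinary differential equation rather than with two-scale
  test functions. Written with the flux \<open>Q = a w'\<close>, the eigenvalue problem becomes a first-order
  system, and its solutions can be expanded by variation of constants in Bloch waves at the
  frequency \<open>\<mu>\<^sub>0 / \<epsilon>\<close>: the waves with quasi-momenta \<open>k\<close> and \<open>-k\<close> if \<open>k \<noteq> 0\<close>, the two real
  eigenfunctions if \<open>k = 0\<close>. The non-degeneracy assumption says that the Wronskian of this pair,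
  which is the coefficient \<open>c\<close>, does not vanish. So \<open>w(x) = \<Sum> A\<^sub>i(x) \<phi>\<^sub>i(x/\<epsilon>)\<close>, where the amplitudes
  \<open>A\<^sub>i\<close> are combinations of Wronskians of \<open>w\<close> with the Bloch waves. The derivative of such a Wronskian is
  \<open>- \<epsilon> (\<lambda>\<^sup>\<epsilon> - \<mu>\<^sub>0\<^sup>2/\<epsilon>\<^sup>2) \<rho> w\<close> times a conjugate Bloch wave, and its factor tends to \<open>- 2 \<mu>\<^sub>0 \<mu>\<^sub>1\<close>. Hence the
  amplitudes are bounded and equi-Lipschitz, a subsequence converges uniformly, and averaging of
  periodic and quasi-periodic functions turns the exact integral equation for the amplitudes into the macroscopic one.
  The boundary values of \<open>w\<close> give the boundary conditions. Testing with indicators of rectangles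
  shows that any weak two-scale limit is the sum of the limit amplitudes times the Bloch vectors;
  the factor \<open>sqrt 2\<close> between \<open>u\<close> and the limit amplitude comes from the normalization of \<open>e_n^k\<close>.
\<close>

section \<open>Locally bounded functions and averaging\<close>

text \<open>Low regularity dictates the first-order form: \<rho> is merely bounded, while w and the
  flux a w' are absolutely continuous and satisfy exact integral equations. Since the values of two
  waves and of their fluxes span the plane at every point, the expansion of (w, \<epsilon> a w') has
  no remainder. At the start no pointwise bound is available; normalization and energy identity give
  only L2 bounds. These control the means of the Wronskians, whose variation is bounded as well,
  hence their maxima. Only then is w bounded, which makes the Wronskians equi-Lipschitz. In the
  averaging, products of waves with different quasi-momenta drop out because their phase over a
  period is not 1. This decouples the equations for k and -k, and lets the transform with parameter
  \<sigma> retain the wave \<sigma> only. Passing to a subsequence costs nothing, as the weak limit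
  along the full sequence is given. The factor with l^k at the right end comes from \<alpha> =
  \<epsilon> N: the wave has turned by exp(2 i pi k N), and k N differs from the fractional part of
  \<alpha> k / \<epsilon> by an integer.\<close>

text \<open>Borel rather than Lebesgue measurability, because the functions get composed with
  rescalings, the integer part and coordinate projections, which Lebesgue measurability need not
  survive. With boundedness on compacts, all products that occur are integrable on bounded
  intervals.\<close>

definition loc_bounded :: "(real \<Rightarrow> 'b::euclidean_space) \<Rightarrow> bool" where
  "loc_bounded f \<longleftrightarrow> f \<in> borel_measurable borel \<and> (\<forall>d. \<exists>M. \<forall>x\<in>{-d..d}. norm (f x) \<le> M)"

lemma loc_bounded_measurable [measurable_dest]: "loc_bounded f \<Longrightarrow> f \<in> borel_measurable borel"
  by (simp add: loc_bounded_def)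

lemma loc_boundedE:
  assumes "loc_bounded f"
  obtains M where "0 < M" "\<And>x. c \<le> x \<Longrightarrow> x \<le> d \<Longrightarrow> norm (f x) \<le> M"
proof -
  obtain M where M: "\<forall>x\<in>{-(\<bar>c\<bar> + \<bar>d\<bar>)..\<bar>c\<bar> + \<bar>d\<bar>}. norm (f x) \<le> M"
    using assms unfolding loc_bounded_def by blast
  show ?thesis
  proof (rule that[of "max 1 M"])
    show "norm (f x) \<le> max 1 M" if "c \<le> x" "x \<le> d" for x
    proof -
      have "x \<in> {-(\<bar>c\<bar> + \<bar>d\<bar>)..\<bar>c\<bar> + \<bar>d\<bar>}" using that by auto
      then show ?thesis using M by fastforce
    qed
  qed simp
qed

lemma loc_boundedI:
  assumes "f \<in> borel_measurable borel" and "\<And>x. norm (f x) \<le> M"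
  shows "loc_bounded f"
  using assms unfolding loc_bounded_def by auto

lemma loc_bounded_continuous:
  assumes "continuous_on UNIV f" shows "loc_bounded f"
  unfolding loc_bounded_def
proof (intro conjI allI)
  show "f \<in> borel_measurable borel"
    using assms by (rule borel_measurable_continuous_onI)
  fix d
  have "compact (f ` {-d..d})"
    by (intro compact_continuous_image continuous_on_subset[OF assms]) auto
  then have "bounded (f ` {-d..d})" by (rule compact_imp_bounded)
  then show "\<exists>M. \<forall>x\<in>{-d..d}. norm (f x) \<le> M"
    unfolding bounded_iff by auto
qed

lemma loc_bounded_const: "loc_bounded (\<lambda>x. c)"
  by (rule loc_boundedI[of _ "norm c"]) auto

lemma loc_bounded_add:
  assumes "loc_bounded f" "loc_bounded g" shows "loc_bounded (\<lambda>x. f x + g x)"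
  unfolding loc_bounded_def
proof (intro conjI allI)
  show "(\<lambda>x. f x + g x) \<in> borel_measurable borel" using assms by measurable
  fix d
  obtain M N where "\<forall>x\<in>{-d..d}. norm (f x) \<le> M" "\<forall>x\<in>{-d..d}. norm (g x) \<le> N"
    using assms unfolding loc_bounded_def by blast
  then have "\<forall>x\<in>{-d..d}. norm (f x + g x) \<le> M + N"
    by (meson add_mono norm_triangle_le)
  then show "\<exists>M. \<forall>x\<in>{-d..d}. norm (f x + g x) \<le> M" by blast
qed

lemma loc_bounded_mult:
  fixes f g :: "real \<Rightarrow> 'b::{euclidean_space, real_normed_algebra}"
  assumes "loc_bounded f" "loc_bounded g" shows "loc_bounded (\<lambda>x. f x * g x)"
  unfolding loc_bounded_def
proof (intro conjI allI)
  show "(\<lambda>x. f x * g x) \<in> borel_measurable borel" using assms by measurable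
  fix d
  obtain M N where MN: "\<forall>x\<in>{-d..d}. norm (f x) \<le> M" "\<forall>x\<in>{-d..d}. norm (g x) \<le> N"
    using assms unfolding loc_bounded_def by blast
  have "norm (f x * g x) \<le> M * N" if "x \<in> {-d..d}" for x
  proof -
    have "norm (f x) \<le> M" "norm (g x) \<le> N" using MN that by auto
    then have "norm (f x) * norm (g x) \<le> M * N"
      by (intro mult_mono order_trans[OF norm_ge_zero]) auto
    then show ?thesis using norm_mult_ineq order_trans by blast
  qed
  then show "\<exists>M. \<forall>x\<in>{-d..d}. norm (f x * g x) \<le> M" by blast
qed

lemma loc_bounded_minus: "loc_bounded f \<Longrightarrow> loc_bounded (\<lambda>x. - f x)"
  unfolding loc_bounded_def by simp

lemma loc_bounded_diff:
  assumes "loc_bounded f" "loc_bounded g" shows "loc_bounded (\<lambda>x. f x - g x)"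
  using loc_bounded_add[OF assms(1) loc_bounded_minus[OF assms(2)]] by simp

lemma loc_bounded_of_real: "loc_bounded f \<Longrightarrow> loc_bounded (\<lambda>x. complex_of_real (f x))"
  unfolding loc_bounded_def by (auto intro: borel_measurable_of_real)

lemma loc_bounded_cnj: "loc_bounded f \<Longrightarrow> loc_bounded (\<lambda>x. cnj (f x))"
  unfolding loc_bounded_def by (simp add: borel_measurable_continuous_on[OF continuous_on_cnj[OF continuous_on_id]])

lemma loc_bounded_norm: "loc_bounded f \<Longrightarrow> loc_bounded (\<lambda>x. norm (f x))"
  unfolding loc_bounded_def by (auto intro: borel_measurable_norm)

lemma loc_bounded_power2: "loc_bounded f \<Longrightarrow> loc_bounded (\<lambda>x. (f x :: real)\<^sup>2)"
  using loc_bounded_mult[of f f] by (simp add: power2_eq_square)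

lemma loc_bounded_sum: "(\<And>i. i \<in> I \<Longrightarrow> loc_bounded (f i)) \<Longrightarrow> loc_bounded (\<lambda>x. \<Sum>i\<in>I. f i x)"
proof (induction I rule: infinite_finite_induct)
  case (insert i I) then show ?case by (simp add: loc_bounded_add)
qed (simp_all add: loc_bounded_const)

lemma loc_bounded_affine:
  assumes "loc_bounded f" shows "loc_bounded (\<lambda>x. f (s * x + t))"
  unfolding loc_bounded_def
proof (intro conjI allI)
  have "f \<in> borel_measurable borel" using assms by (rule loc_bounded_measurable)
  then show "(\<lambda>x. f (s * x + t)) \<in> borel_measurable borel" by measurable
  fix d
  obtain M where M: "\<And>x. -(\<bar>s\<bar> * \<bar>d\<bar> + \<bar>t\<bar>) \<le> x \<Longrightarrow> x \<le> \<bar>s\<bar> * \<bar>d\<bar> + \<bar>t\<bar> \<Longrightarrow> norm (f x) \<le> M"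
    using loc_boundedE[OF assms, of "-(\<bar>s\<bar> * \<bar>d\<bar> + \<bar>t\<bar>)" "\<bar>s\<bar> * \<bar>d\<bar> + \<bar>t\<bar>"] by blast
  have "norm (f (s * x + t)) \<le> M" if "x \<in> {-d..d}" for x
  proof -
    have "\<bar>s * x\<bar> \<le> \<bar>s\<bar> * \<bar>d\<bar>" using that by (auto simp: abs_mult intro!: mult_left_mono)
    then show ?thesis by (intro M) linarith+
  qed
  then show "\<exists>M. \<forall>x\<in>{-d..d}. norm (f (s * x + t)) \<le> M" by blast
qed

lemma loc_bounded_scale: "loc_bounded f \<Longrightarrow> loc_bounded (\<lambda>x. f (x / \<epsilon>))"
  using loc_bounded_affine[of f "1 / \<epsilon>" 0] by simp

lemmas loc_bounded_intros = loc_bounded_const loc_bounded_add loc_bounded_mult loc_bounded_minus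
  loc_bounded_diff loc_bounded_of_real loc_bounded_cnj loc_bounded_norm loc_bounded_power2
  loc_bounded_sum

lemma loc_bounded_absolutely_integrable:
  assumes "loc_bounded f" shows "f absolutely_integrable_on {c..d}"
proof -
  obtain M where M: "\<And>x. c \<le> x \<Longrightarrow> x \<le> d \<Longrightarrow> norm (f x) \<le> M"
    using loc_boundedE[OF assms] by blast
  show ?thesis
  proof (rule measurable_bounded_by_integrable_imp_absolutely_integrable[where g = "\<lambda>_. M"])
    show "f \<in> borel_measurable (lebesgue_on {c..d})"
      using loc_bounded_measurable[OF assms]
      by (simp add: measurable_completion measurable_restrict_space1)
    show "(\<lambda>_. M) integrable_on {c..d}" by (metis integrable_const_ivl)
  qed (use M in auto)
qed

lemma loc_bounded_integrable: "loc_bounded f \<Longrightarrow> f integrable_on {c..d}"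
  using loc_bounded_absolutely_integrable set_lebesgue_integral_eq_integral(1) by blast

lemma loc_bounded_integral_combine:
  "loc_bounded f \<Longrightarrow> a \<le> b \<Longrightarrow> b \<le> c \<Longrightarrow> integral {a..b} f + integral {b..c} f = integral {a..c} f"
  by (intro Henstock_Kurzweil_Integration.integral_combine loc_bounded_integrable)

lemma loc_bounded_integral_bound:
  assumes "loc_bounded f" "\<And>x. c \<le> x \<Longrightarrow> x \<le> d \<Longrightarrow> norm (f x) \<le> M" "c \<le> d"
  shows "norm (integral {c..d} f) \<le> M * (d - c)"
proof -
  have "norm (integral {c..d} f) \<le> integral {c..d} (\<lambda>_. M)"
    using assms by (intro integral_norm_bound_integral loc_bounded_integrable loc_bounded_const) auto
  then show ?thesis using assms(3) by (simp add: algebra_simps)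
qed

text \<open>One change of variables for two purposes: \<open>t = 0\<close> rescales to the fast
  variable, \<open>\<epsilon> = 1\<close> translates by periods.\<close>

lemma integral_affine:
  fixes f :: "real \<Rightarrow> 'b::euclidean_space"
  assumes "loc_bounded f" "0 < \<epsilon>"
  shows "integral {c..d} (\<lambda>x. f (x / \<epsilon> + t)) = \<epsilon> *\<^sub>R integral {c / \<epsilon> + t..d / \<epsilon> + t} f"
proof -
  have "(f has_integral integral {c / \<epsilon> + t..d / \<epsilon> + t} f) {c / \<epsilon> + t..d / \<epsilon> + t}"
    using assms loc_bounded_integrable by blast
  then have "(f has_integral integral {c / \<epsilon> + t..d / \<epsilon> + t} f) (cbox (c / \<epsilon> + t) (d / \<epsilon> + t))"
    by simp
  from has_integral_affinity'[OF this, of "1/\<epsilon>" t] assms(2)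
  have "((\<lambda>x. f (x / \<epsilon> + t)) has_integral (\<epsilon> *\<^sub>R integral {c / \<epsilon> + t..d / \<epsilon> + t} f)) {c..d}"
    by (simp add: field_simps)
  then show ?thesis by (rule integral_unique)
qed

text \<open>The factors are only Lipschitz, so the product need not be differentiable everywhere.
  Instead \<open>D\<close>, the product minus its would-be primitive, changes by at most a constant
  times \<open>(y - x)\<^sup>2\<close> between \<open>x\<close> and \<open>y\<close>; its derivative
  is therefore 0 everywhere and \<open>D\<close> is constant.\<close>

lemma product_rule:
  fixes f g F G :: "real \<Rightarrow> complex"
  assumes f: "loc_bounded f" and g: "loc_bounded g" and cF: "loc_bounded F" and cG: "loc_bounded G"
    and F: "\<And>x. 0 \<le> x \<Longrightarrow> x \<le> d \<Longrightarrow> F x = F 0 + integral {0..x} f"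
    and G: "\<And>x. 0 \<le> x \<Longrightarrow> x \<le> d \<Longrightarrow> G x = G 0 + integral {0..x} g"
    and x: "0 \<le> x" "x \<le> d"
  shows "F x * G x = F 0 * G 0 + integral {0..x} (\<lambda>t. f t * G t + F t * g t)"
proof -
  let ?h = "\<lambda>t. f t * G t + F t * g t"
  define D where "D x = F x * G x - integral {0..x} ?h" for x
  obtain M where M: "0 < M" "\<And>x. 0 \<le> x \<Longrightarrow> x \<le> d \<Longrightarrow> norm (f x) \<le> M" using loc_boundedE[OF f] by blast
  obtain N where N: "0 < N" "\<And>x. 0 \<le> x \<Longrightarrow> x \<le> d \<Longrightarrow> norm (g x) \<le> N" using loc_boundedE[OF g] by blast
  have h: "loc_bounded ?h" using assms by (intro loc_bounded_intros)
  have dF: "F y - F x = integral {x..y} f" if "0 \<le> x" "x \<le> y" "y \<le> d" for x y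
    using F[of x] F[of y] that loc_bounded_integral_combine[OF f, of 0 x y]
    by (simp add: algebra_simps)
  have dG: "G y - G x = integral {x..y} g" if "0 \<le> x" "x \<le> y" "y \<le> d" for x y
    using G[of x] G[of y] that loc_bounded_integral_combine[OF g, of 0 x y]
    by (simp add: algebra_simps)
  \<comment> \<open>With the end values \<open>G y\<close> and \<open>F x\<close> frozen the main
    terms cancel, and the remaining integrand carries the factors \<open>G y - G t\<close> and
    \<open>F x - F t\<close>, each of order \<open>y - x\<close>.\<close>
  have quad: "norm (D y - D x) \<le> 2 * M * N * (y - x)\<^sup>2" if xy: "0 \<le> x" "x \<le> y" "y \<le> d" for x y
  proof -
    have 1: "loc_bounded (\<lambda>t. f t * (G y - G t))" "loc_bounded (\<lambda>t. (F x - F t) * g t)"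
      using f g cF cG by (auto intro!: loc_bounded_intros)
    have 2: "loc_bounded (\<lambda>t. f t * G y)" "loc_bounded (\<lambda>t. F x * g t)"
      using f g cF cG by (auto intro!: loc_bounded_intros)
    have "D y - D x = F y * G y - F x * G x - integral {x..y} ?h"
      unfolding D_def using loc_bounded_integral_combine[OF h, of 0 x y] xy by (simp add: algebra_simps)
    also have "F y * G y - F x * G x = (F y - F x) * G y + F x * (G y - G x)"
      by (simp add: algebra_simps)
    also have "\<dots> = integral {x..y} (\<lambda>t. f t * G y) + integral {x..y} (\<lambda>t. F x * g t)"
      using dF[OF xy] dG[OF xy] by simp
    also have "\<dots> - integral {x..y} ?h = integral {x..y} (\<lambda>t. f t * G y + F x * g t - ?h t)"
      using 2 h by (simp add: integral_add integral_diff loc_bounded_integrable loc_bounded_add)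
    also have "\<dots> = integral {x..y} (\<lambda>t. f t * (G y - G t) + (F x - F t) * g t)"
      by (simp add: algebra_simps)
    finally have e: "D y - D x = integral {x..y} (\<lambda>t. f t * (G y - G t) + (F x - F t) * g t)" .
    have "norm (integral {x..y} (\<lambda>t. f t * (G y - G t) + (F x - F t) * g t)) \<le> 2 * M * N * (y - x) * (y - x)"
    proof (rule loc_bounded_integral_bound)
      fix t assume t: "x \<le> t" "t \<le> y"
      have "norm (G y - G t) \<le> N * (y - t)"
        using dG[of t y] loc_bounded_integral_bound[OF g, of t y N] N t xy by auto
      also have "\<dots> \<le> N * (y - x)" using N t by (intro mult_left_mono) auto
      finally have a: "norm (G y - G t) \<le> N * (y - x)" .
      have "norm (F x - F t) = norm (F t - F x)" by (rule norm_minus_commute)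
      also have "\<dots> \<le> M * (t - x)"
        using dF[of x t] loc_bounded_integral_bound[OF f, of x t M] M t xy by auto
      also have "\<dots> \<le> M * (y - x)" using M t by (intro mult_left_mono) auto
      finally have b: "norm (F x - F t) \<le> M * (y - x)" .
      have "norm (f t * (G y - G t) + (F x - F t) * g t) \<le> norm (f t) * norm (G y - G t) + norm (F x - F t) * norm (g t)"
        by (simp add: norm_triangle_ineq flip: norm_mult)
      also have "\<dots> \<le> M * (N * (y - x)) + (M * (y - x)) * N"
        using a b M N t xy by (intro add_mono mult_mono) auto
      finally show "norm (f t * (G y - G t) + (F x - F t) * g t) \<le> 2 * M * N * (y - x)"
        by (simp add: algebra_simps)
    qed (use 1 xy in \<open>auto intro: loc_bounded_add\<close>)
    then show ?thesis using e by (simp add: power2_eq_square mult.assoc)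
  qed
  have "(D has_derivative (\<lambda>h. 0)) (at z within {0..d})" if z: "z \<in> {0..d}" for z
  proof -
    have q: "norm (D y - D z) \<le> 2 * M * N * (y - z)\<^sup>2" if "y \<in> {0..d}" for y
    proof (cases "y \<le> z")
      case True
      have "norm (D y - D z) = norm (D z - D y)" by (rule norm_minus_commute)
      also have "\<dots> \<le> 2 * M * N * (z - y)\<^sup>2" using quad[of y z] True that z by auto
      finally show ?thesis by (simp add: power2_commute)
    qed (use quad[of z y] that z in auto)
    have "((\<lambda>y. 2 * M * N * \<bar>y - z\<bar>) \<longlongrightarrow> 2 * M * N * \<bar>z - z\<bar>) (at z within {0..d})"
      by (intro tendsto_intros)
    then have lim: "((\<lambda>y. 2 * M * N * \<bar>y - z\<bar>) \<longlongrightarrow> 0) (at z within {0..d})" by simp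
    have "((\<lambda>y. (1 / norm (y - z)) *\<^sub>R (D y - (D z + 0))) \<longlongrightarrow> 0) (at z within {0..d})"
    proof (rule Lim_null_comparison[OF _ lim])
      show "\<forall>\<^sub>F y in at z within {0..d}. norm ((1 / norm (y - z)) *\<^sub>R (D y - (D z + 0))) \<le> 2 * M * N * \<bar>y - z\<bar>"
        unfolding eventually_at_filter
      proof (rule always_eventually, intro allI impI)
        fix y assume "y \<noteq> z" "y \<in> {0..d}"
        then show "norm ((1 / norm (y - z)) *\<^sub>R (D y - (D z + 0))) \<le> 2 * M * N * \<bar>y - z\<bar>"
          using q[of y] by (simp add: divide_simps power2_eq_square abs_mult_self_eq flip: abs_mult)
      qed
    qed
    then show ?thesis by (simp add: has_derivative_within)
  qed
  then have "\<exists>c. \<forall>z\<in>{0..d}. D z = c"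
    by (intro has_derivative_zero_constant) auto
  then have "D x = D 0" using x by force
  then show ?thesis by (simp add: D_def algebra_simps)
qed

text \<open>Lebesgue differentiation: at almost every point \<open>f\<close> is the limit of its
  means over cubes with lower corner there, and these means vanish once the cube fits into
  \<open>S\<close>.\<close>

lemma AE_zero_if_box_integrals_zero:
  fixes f :: "'a::euclidean_space \<Rightarrow> 'b::euclidean_space"
  assumes "open S" and int: "\<And>c d. cbox c d \<subseteq> S \<Longrightarrow> integral (cbox c d) f = 0"
    and f: "f absolutely_integrable_on S"
  shows "AE x in lebesgue_on S. f x = 0"
proof -
  let ?f = "\<lambda>x. if x \<in> S then f x else 0"
  have "?f absolutely_integrable_on UNIV" using f by (simp add: absolutely_integrable_restrict_UNIV)
  then have "?f integrable_on cbox c d" for c d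
    using absolutely_integrable_on_subcbox[where f = ?f and S = UNIV] set_lebesgue_integral_eq_integral(1) by blast
  then obtain N where N: "negligible N" and
    d: "\<And>x e. \<lbrakk>x \<notin> N; 0 < e\<rbrakk> \<Longrightarrow>
               \<exists>d>0. \<forall>h. 0 < h \<and> h < d \<longrightarrow>
                         norm(integral (cbox x (x + h *\<^sub>R One)) ?f /\<^sub>R h ^ DIM('a) - ?f x) < e"
    using integrable_ccontinuous_explicit[of ?f] by blast
  have z: "f x = 0" if x: "x \<in> S" "x \<notin> N" for x
  proof (rule ccontr)
    assume "f x \<noteq> 0"
    then obtain d where d: "d > 0" "\<forall>h. 0 < h \<and> h < d \<longrightarrow>
                         norm(integral (cbox x (x + h *\<^sub>R One)) ?f /\<^sub>R h ^ DIM('a) - ?f x) < norm (f x)"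
      using d[of x "norm (f x)"] x by auto
    obtain \<epsilon> where e: "\<epsilon> > 0" "cball x \<epsilon> \<subseteq> S" using \<open>open S\<close> x open_contains_cball by blast
    \<comment> \<open>The first entry keeps the mean close to its limit; the second keeps the cube
      in the ball, because its points are within \<open>h * DIM('a)\<close> of the corner in the l1
      norm.\<close>
    define h where "h = min (d/2) (\<epsilon> / (1 + real DIM('a)))"
    have h: "0 < h" "h < d" "h * DIM('a) \<le> \<epsilon>"
    proof -
      show "0 < h" "h < d" using d e by (auto simp: h_def)
      have "h * DIM('a) \<le> \<epsilon> / (1 + real DIM('a)) * DIM('a)" by (intro mult_right_mono) (auto simp: h_def)
      also have "\<dots> \<le> \<epsilon>" using e by (simp add: field_simps)
      finally show "h * DIM('a) \<le> \<epsilon>" .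
    qed
    have sub: "cbox x (x + h *\<^sub>R One) \<subseteq> S"
    proof
      fix y assume y: "y \<in> cbox x (x + h *\<^sub>R One)"
      have "norm (y - x) \<le> (\<Sum>b\<in>Basis. \<bar>(y - x) \<bullet> b\<bar>)" by (rule norm_le_l1)
      also have "\<dots> \<le> (\<Sum>b\<in>(Basis::'a set). h)"
        using y by (intro sum_mono) (auto simp: mem_box algebra_simps)
      also have "\<dots> \<le> \<epsilon>" using h by (simp add: mult.commute)
      finally show "y \<in> S" using e by (auto simp: dist_norm norm_minus_commute)
    qed
    have "integral (cbox x (x + h *\<^sub>R One)) ?f = integral (cbox x (x + h *\<^sub>R One)) f"
      by (rule integral_cong) (use sub in auto)
    then have "integral (cbox x (x + h *\<^sub>R One)) ?f = 0" using int[OF sub] by simp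
    then show False using d(2) h x by force
  qed
  have "AE x in lebesgue. x \<notin> N" using N by (simp add: AE_not_in negligible_iff_null_sets)
  then have "AE x in lebesgue. x \<in> S \<longrightarrow> f x = 0" using z by auto
  then show ?thesis
    using \<open>open S\<close> by (subst AE_restrict_space_iff) (auto simp: borel_open)
qed

text \<open>A Riemann sum argument: on cells fixed independently of \<open>j\<close> the factor
  \<open>f\<close> is nearly constant, and the integrals of \<open>g j\<close> over them are at most
  \<open>\<delta> j\<close>. Since only small integrals over intervals are asked for, periodic
  functions of mean zero and non-resonant quasi-periodic ones are treated alike.\<close>

lemma averaging:
  fixes f :: "real \<Rightarrow> complex" and g :: "nat \<Rightarrow> real \<Rightarrow> complex"
  assumes f: "continuous_on UNIV f" and g: "\<And>j. loc_bounded (g j)"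
    and C: "\<And>j x. norm (g j x) \<le> C"
    and \<delta>: "\<delta> \<longlonglongrightarrow> 0"
    and osc: "\<And>j c d. x1 \<le> c \<Longrightarrow> c \<le> d \<Longrightarrow> d \<le> x2 \<Longrightarrow> norm (integral {c..d} (g j)) \<le> \<delta> j"
    and x: "x1 \<le> x2"
  shows "(\<lambda>j. integral {x1..x2} (\<lambda>t. f t * g j t)) \<longlonglongrightarrow> 0"
proof (rule LIMSEQ_I)
  fix e :: real assume e: "0 < e"
  have C0: "0 \<le> C" using C[of 0 0] norm_ge_zero order_trans by blast
  have lf: "loc_bounded f" using f by (rule loc_bounded_continuous)
  then obtain S where S: "0 < S" "\<And>x. x1 \<le> x \<Longrightarrow> x \<le> x2 \<Longrightarrow> norm (f x) \<le> S" using loc_boundedE by blast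
  \<comment> \<open>Chosen so that replacing \<open>f\<close> by constants on the cells costs at
    most \<open>e / 2\<close> in total; the added ones keep the denominator positive for
    \<open>C = 0\<close> or \<open>x1 = x2\<close>.\<close>
  define \<eta> where "\<eta> = e / (2 * (C + 1) * (x2 - x1 + 1))"
  have \<eta>: "0 < \<eta>" using e C0 x by (simp add: \<eta>_def)
  have "uniformly_continuous_on {x1..x2} f"
    using f by (intro compact_uniformly_continuous continuous_on_subset[OF f]) auto
  then obtain d where d: "0 < d" "\<And>x y. x \<in> {x1..x2} \<Longrightarrow> y \<in> {x1..x2} \<Longrightarrow> dist y x < d \<Longrightarrow> dist (f y) (f x) < \<eta>"
    using \<eta> unfolding uniformly_continuous_on_def by metis
  obtain n :: nat where n: "(x2 - x1) / d < real n" "0 < n"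
    using reals_Archimedean2[of "(x2 - x1)/d"] by (metis gr0I less_le_trans linorder_not_less of_nat_0 of_nat_0_less_iff x divide_nonneg_pos d(1) diff_ge_0_iff_ge)
  define h where "h = (x2 - x1) / real n"
  have h: "0 \<le> h" "h < d" using n x d by (auto simp: h_def field_simps)
  have nh: "x1 + real n * h = x2" using n by (simp add: h_def)
  \<comment> \<open>Per cell: \<open>\<eta> * C * h\<close> for replacing \<open>f\<close> by its
    left end value, and \<open>S * \<delta> j\<close> for that value times the integral of
    \<open>g j\<close>.\<close>
  have step: "norm (integral {x1..x1 + real i * h} (\<lambda>t. f t * g j t)) \<le> real i * (\<eta> * C * h + S * \<delta> j)" if "i \<le> n" for i j
    using that
  proof (induction i)
    case 0 then show ?case by simp
  next
    case (Suc i)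
    let ?c = "x1 + real i * h" and ?d = "x1 + real (Suc i) * h"
    have "real (Suc i) * h \<le> real n * h" using Suc.prems h by (intro mult_right_mono) auto
    then have cd: "x1 \<le> ?c" "?c \<le> ?d" "?d \<le> x2" using h nh by (auto simp: algebra_simps)
    have l1: "loc_bounded (\<lambda>t. (f t - f ?c) * g j t)" "loc_bounded (\<lambda>t. f ?c * g j t)" "loc_bounded (\<lambda>t. f t * g j t)"
      using lf g by (auto intro!: loc_bounded_intros)
    have "integral {?c..?d} (\<lambda>t. f t * g j t) = integral {?c..?d} (\<lambda>t. (f t - f ?c) * g j t + f ?c * g j t)"
      by (simp add: algebra_simps)
    also have "\<dots> = integral {?c..?d} (\<lambda>t. (f t - f ?c) * g j t) + f ?c * integral {?c..?d} (g j)"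
      using l1 by (simp add: integral_add loc_bounded_integrable)
    finally have "norm (integral {?c..?d} (\<lambda>t. f t * g j t)) \<le> norm (integral {?c..?d} (\<lambda>t. (f t - f ?c) * g j t)) + norm (f ?c) * norm (integral {?c..?d} (g j))"
      by (simp add: norm_triangle_ineq flip: norm_mult)
    also have "\<dots> \<le> \<eta> * C * (?d - ?c) + S * \<delta> j"
    proof (intro add_mono mult_mono)
      show "norm (integral {?c..?d} (\<lambda>t. (f t - f ?c) * g j t)) \<le> \<eta> * C * (?d - ?c)"
      proof (rule loc_bounded_integral_bound[OF l1(1) _ cd(2)])
        fix t assume t: "?c \<le> t" "t \<le> ?d"
        have "dist t ?c < d" using t h by (auto simp: dist_real_def algebra_simps)
        then have "norm (f t - f ?c) \<le> \<eta>" using d(2)[of ?c t] t cd by (auto simp: dist_norm)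
        then show "norm ((f t - f ?c) * g j t) \<le> \<eta> * C"
          using C[of j t] \<eta> by (simp add: norm_mult mult_mono)
      qed
    qed (use S cd osc in auto)
    finally have a: "norm (integral {?c..?d} (\<lambda>t. f t * g j t)) \<le> \<eta> * C * h + S * \<delta> j"
      by (simp add: algebra_simps)
    have "integral {x1..?d} (\<lambda>t. f t * g j t) = integral {x1..?c} (\<lambda>t. f t * g j t) + integral {?c..?d} (\<lambda>t. f t * g j t)"
      using loc_bounded_integral_combine[OF l1(3) cd(1,2)] by simp
    then have "norm (integral {x1..?d} (\<lambda>t. f t * g j t)) \<le> real i * (\<eta> * C * h + S * \<delta> j) + (\<eta> * C * h + S * \<delta> j)"
      using a Suc by (metis (no_types, lifting) Suc_leD add_mono norm_triangle_le)
    then show ?case by (simp add: algebra_simps)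
  qed
  have bound: "norm (integral {x1..x2} (\<lambda>t. f t * g j t)) \<le> \<eta> * C * (x2 - x1) + real n * S * \<delta> j" for j
  proof -
    have "real n * (\<eta> * C * h + S * \<delta> j) = \<eta> * C * (x2 - x1) + real n * S * \<delta> j"
      using nh by (simp add: distrib_left mult.left_commute flip: nh)
    then show ?thesis using step[of n j] nh by simp
  qed
  have "\<eta> * C * (x2 - x1) \<le> \<eta> * ((C + 1) * (x2 - x1 + 1))"
    using \<eta> C0 x by (simp add: mult.assoc) (intro mult_mono, auto)
  also have "\<dots> = e / 2"
  proof -
    define P where "P = (C + 1) * (x2 - x1 + 1)"
    have "P > 0" unfolding P_def using C0 x by (intro mult_pos_pos) auto
    moreover have "\<eta> = e / (2 * P)" by (simp add: \<eta>_def P_def mult.assoc)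
    ultimately have "\<eta> * P = e / 2" by simp
    then show ?thesis by (simp add: P_def)
  qed
  finally have half: "\<eta> * C * (x2 - x1) \<le> e / 2" .
  have "(\<lambda>j. real n * S * \<delta> j) \<longlonglongrightarrow> real n * S * 0" by (intro tendsto_intros \<delta>)
  then have "\<forall>\<^sub>F j in sequentially. real n * S * \<delta> j < e / 2"
    by (rule order_tendstoD) (use e in auto)
  then obtain no where no: "\<forall>j\<ge>no. real n * S * \<delta> j < e / 2" unfolding eventually_sequentially by blast
  have "norm (integral {x1..x2} (\<lambda>t. f t * g j t) - 0) < e" if "j \<ge> no" for j
    using bound[of j] half no that by fastforce
  then show "\<exists>no. \<forall>j\<ge>no. norm (integral {x1..x2} (\<lambda>t. f t * g j t) - 0) < e" by blast
qed

lemma absolutely_integrable_norm_diff: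
  fixes f :: "real \<Rightarrow> 'b::euclidean_space"
  assumes "f absolutely_integrable_on {c..d}"
  shows "(\<lambda>t. norm (f t - q)) absolutely_integrable_on {c..d}"
proof -
  have "(\<lambda>t. q) absolutely_integrable_on {c..d}" by (intro absolutely_integrable_on_const) simp
  then have "(\<lambda>t. f t - q) absolutely_integrable_on {c..d}" by (intro set_integral_diff(1) assms)
  then show ?thesis using absolutely_integrable_norm by (auto simp: o_def)
qed

text \<open>The differentiation theorem concerns the means of one function, whereas
  \<open>norm (f t - f x)\<close> changes with \<open>x\<close>. It is applied to
  \<open>norm (f t - q)\<close> for \<open>q\<close> in a countable dense set, on compact intervals
  exhausting the open one, and the null sets are united. Means to the right of \<open>x\<close>
  suffice for the one-sided kernels below.\<close>

lemma lebesgue_points: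
  fixes f :: "real \<Rightarrow> 'b::euclidean_space"
  assumes int: "\<And>c d. A < c \<Longrightarrow> d < B \<Longrightarrow> f absolutely_integrable_on {c..d}"
  obtains N where "negligible N"
    "\<And>x. \<lbrakk>A < x; x < B; x \<notin> N\<rbrakk> \<Longrightarrow>
      ((\<lambda>h. integral {x..x + h} (\<lambda>t. norm (f t - f x)) / h) \<longlongrightarrow> 0) (at_right 0)"
proof -
  obtain D :: "'b set" where D: "countable D" "\<And>X. open X \<Longrightarrow> X \<noteq> {} \<Longrightarrow> \<exists>d\<in>D. d \<in> X"
    by (rule countable_dense_setE) blast
  define I where "I k = {A + 1 / (1 + real k)..B - 1 / (1 + real k)}" for k
  define G where "G q k = (\<lambda>t. if t \<in> I k then norm (f t - q) else 0)" for q k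
  have fI: "f absolutely_integrable_on I k" for k unfolding I_def by (rule int) auto
  have 1: "(\<lambda>t. norm (f t - q)) absolutely_integrable_on I k" for q k
    using fI unfolding I_def by (rule absolutely_integrable_norm_diff)
  then have "G q k absolutely_integrable_on UNIV" for q k
    unfolding G_def by (simp add: absolutely_integrable_restrict_UNIV)
  then have "G q k integrable_on cbox c d" for q k c d
    using absolutely_integrable_on_subcbox[where S = UNIV] set_lebesgue_integral_eq_integral(1) by blast
  then have "\<exists>N. negligible N \<and> (\<forall>x e. x \<notin> N \<longrightarrow> 0 < e \<longrightarrow>
               (\<exists>d>0. \<forall>h. 0 < h \<and> h < d \<longrightarrow>
                         norm(integral (cbox x (x + h *\<^sub>R One)) (G q k) /\<^sub>R h ^ DIM(real) - G q k x) < e))" for q k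
    using integrable_ccontinuous_explicit[of "G q k"] by metis
  then obtain N where N: "\<And>q k. negligible (N q k)" and
    NG: "\<And>q k x e. x \<notin> N q k \<Longrightarrow> 0 < e \<Longrightarrow>
               (\<exists>d>0. \<forall>h. 0 < h \<and> h < d \<longrightarrow>
                         norm(integral (cbox x (x + h *\<^sub>R One)) (G q k) /\<^sub>R h ^ DIM(real) - G q k x) < e)"
    by metis
  have neg: "negligible (\<Union>q\<in>D. \<Union>k. N q k)"
    using N D(1) by (intro negligible_countable_Union) (auto intro!: negligible_countable_Union)
  show ?thesis
  proof (rule that[OF neg])
    fix x assume x: "A < x" "x < B" "x \<notin> (\<Union>q\<in>D. \<Union>k. N q k)"
    obtain k :: nat where k: "inverse (real (Suc k)) < min (x - A) (B - x)"
      using reals_Archimedean[of "min (x - A) (B - x)"] x by auto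
    define s where "s = B - 1 / (1 + real k) - x"
    have xk: "A + 1 / (1 + real k) < x" "0 < s" using k by (auto simp: inverse_eq_divide s_def)
    show "((\<lambda>h. integral {x..x + h} (\<lambda>t. norm (f t - f x)) / h) \<longlongrightarrow> 0) (at_right 0)"
    proof (rule tendstoI)
      fix e :: real assume e: "0 < e"
      \<comment> \<open>With \<open>q\<close> this close, the mean of \<open>norm (f t - q)\<close>
        ends up below two thirds of \<open>e\<close>, and \<open>norm (f x - q)\<close> takes the
        last third.\<close>
      obtain q where q: "q \<in> D" "norm (f x - q) < e / 3"
        using D(2)[of "ball (f x) (e / 3)"] e by (auto simp: dist_norm)
      obtain d where d: "d > 0" "\<And>h. 0 < h \<Longrightarrow> h < d \<Longrightarrow>
          norm(integral (cbox x (x + h *\<^sub>R One)) (G q k) /\<^sub>R h ^ DIM(real) - G q k x) < e / 3"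
        using NG[of x q k "e / 3"] x(3) q(1) e by auto
      have "dist (integral {x..x + h} (\<lambda>t. norm (f t - f x)) / h) 0 < e" if h: "0 < h" "h < min d s" for h
      proof -
        have sub: "{x..x + h} \<subseteq> I k" using h xk by (auto simp: I_def s_def)
        have xI: "x \<in> I k" using xk by (auto simp: I_def s_def)
        have eq: "integral {x..x + h} (G q k) = integral {x..x + h} (\<lambda>t. norm (f t - q))"
          by (rule integral_cong) (use sub in \<open>auto simp: G_def\<close>)
        have ii: "(\<lambda>t. norm (f t - p)) integrable_on {x..x + h}" for p
        proof -
          have "(\<lambda>t. norm (f t - p)) absolutely_integrable_on cbox x (x + h)"
            using 1 sub by (intro absolutely_integrable_on_subcbox[where S = "I k"]) auto
          then show ?thesis using set_lebesgue_integral_eq_integral(1) by auto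
        qed
        have "\<bar>integral {x..x + h} (\<lambda>t. norm (f t - q)) / h - norm (f x - q)\<bar> < e / 3"
        proof -
          have "norm (integral {x..x + h} (G q k) /\<^sub>R h - G q k x) < e / 3" using d(2)[of h] h by simp
          moreover have "G q k x = norm (f x - q)" using xI by (simp add: G_def)
          ultimately show ?thesis unfolding eq by (simp only: real_scaleR_def real_norm_def divide_inverse mult.commute)
        qed
        then have a: "integral {x..x + h} (\<lambda>t. norm (f t - q)) / h < 2 * (e / 3)" using q(2) by linarith
        have "integral {x..x + h} (\<lambda>t. norm (f t - f x)) \<le> integral {x..x + h} (\<lambda>t. norm (f t - q) + norm (f x - q))"
        proof (rule integral_le[OF ii])
          show "(\<lambda>t. norm (f t - q) + norm (f x - q)) integrable_on {x..x + h}"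
            by (intro integrable_add ii) (metis integrable_const_ivl)
          show "norm (f t - f x) \<le> norm (f t - q) + norm (f x - q)" for t
            using norm_triangle_ineq4[of "f t - q" "f x - q"] by simp
        qed
        also have "\<dots> = integral {x..x + h} (\<lambda>t. norm (f t - q)) + h * norm (f x - q)"
        proof -
          have "(\<lambda>t. norm (f x - q)) integrable_on {x..x + h}" by (metis integrable_const_ivl)
          from integral_add[OF ii this] show ?thesis using h by simp
        qed
        finally have "integral {x..x + h} (\<lambda>t. norm (f t - f x)) / h \<le> integral {x..x + h} (\<lambda>t. norm (f t - q)) / h + norm (f x - q)"
          using h by (simp add: field_simps)
        then have "integral {x..x + h} (\<lambda>t. norm (f t - f x)) / h < e" using a q(2) by linarith
        moreover have "0 \<le> integral {x..x + h} (\<lambda>t. norm (f t - f x))" by (rule integral_nonneg[OF ii]) simp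
        ultimately show ?thesis using h by (simp add: dist_real_def)
      qed
      then show "\<forall>\<^sub>F h in at_right 0. dist (integral {x..x + h} (\<lambda>t. norm (f t - f x)) / h) 0 < e"
        unfolding eventually_at_right_field using d(1) xk(2) by (metis min_less_iff_conj)
    qed
  qed
qed

section \<open>Weak derivatives on an interval\<close>

text \<open>Test functions need only be C1, so cutoffs can be piecewise quadratic; the square of the
  positive part is their building block.\<close>

definition sqpos :: "real \<Rightarrow> real" where "sqpos s = (max 0 s)\<^sup>2"

lemma DERIV_sqpos: "(sqpos has_real_derivative 2 * max 0 s) (at s)"
proof -
  consider "s < 0" | "s > 0" | "s = 0" by linarith
  then show ?thesis
  proof cases
    case 1
    have "((\<lambda>_. 0) has_real_derivative 0) (at s)" by simp
    then have "(sqpos has_real_derivative 0) (at s)"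
      by (rule has_field_derivative_transform_within_open[where S = "{..<0}"]) (use 1 in \<open>auto simp: sqpos_def\<close>)
    then show ?thesis using 1 by simp
  next
    case 2
    have "((\<lambda>s. s\<^sup>2) has_real_derivative 2 * s) (at s)" by (auto intro!: derivative_eq_intros)
    then have "(sqpos has_real_derivative 2 * s) (at s)"
      by (rule has_field_derivative_transform_within_open[where S = "{0<..}"]) (use 2 in \<open>auto simp: sqpos_def\<close>)
    then show ?thesis using 2 by simp
  next
    case 3
    have "(\<lambda>h. (sqpos (0 + h) - sqpos 0) / h) \<midarrow>0\<rightarrow> 0"
    proof (rule Lim_null_comparison[where g = "\<lambda>h. \<bar>h\<bar>"])
      show "\<forall>\<^sub>F h in at 0. norm ((sqpos (0 + h) - sqpos 0) / h) \<le> \<bar>h\<bar>"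
        unfolding eventually_at_filter
        by (rule always_eventually) (auto simp: sqpos_def power2_eq_square max_def)
      show "((\<lambda>h. \<bar>h\<bar>) \<longlongrightarrow> 0) (at (0::real))" by (rule tendsto_rabs_zero) simp
    qed
    then show ?thesis using 3 by (simp add: DERIV_def)
  qed
qed

text \<open>The hat function on \<open>[0, 1]\<close> with peak 2 at 1/2, hence of integral 1.
  Written with hinges it has a primitive in closed form, \<open>smooth_step\<close>, which rises
  from 0 to 1 over the same interval.\<close>

definition tent :: "real \<Rightarrow> real" where
  "tent s = 4 * (max 0 s - 2 * max 0 (s - 1/2) + max 0 (s - 1))"

definition smooth_step :: "real \<Rightarrow> real" where
  "smooth_step s = 2 * (sqpos s - 2 * sqpos (s - 1/2) + sqpos (s - 1))"

lemma DERIV_smooth_step: "(smooth_step has_real_derivative tent s) (at s)"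
  unfolding smooth_step_def[abs_def] tent_def
  by (auto intro!: derivative_eq_intros DERIV_chain'[OF _ DERIV_sqpos])

lemma DERIV_smooth_step_scaled:
  assumes "h > 0"
  shows "((\<lambda>t. smooth_step ((t - x) / h)) has_real_derivative tent ((t - x) / h) / h) (at t)"
proof -
  have "((\<lambda>t. (t - x) / h) has_real_derivative 1 / h) (at t)"
    using assms by (auto intro!: derivative_eq_intros)
  from DERIV_chain'[OF this DERIV_smooth_step] show ?thesis by simp
qed

lemma continuous_tent: "continuous_on S tent"
  unfolding tent_def[abs_def] by (intro continuous_intros)

lemma tent_bounds: "0 \<le> tent s" "tent s \<le> 2"
  by (auto simp: tent_def max_def)

lemma tent_outside: "s \<le> 0 \<or> 1 \<le> s \<Longrightarrow> tent s = 0"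
  by (auto simp: tent_def max_def)

lemma smooth_step_left: "s \<le> 0 \<Longrightarrow> smooth_step s = 0"
  by (auto simp: smooth_step_def sqpos_def max_def)

lemma smooth_step_right: "1 \<le> s \<Longrightarrow> smooth_step s = 1"
proof -
  assume "1 \<le> s"
  then have "max 0 s = s" "max 0 (s - 1/2) = s - 1/2" "max 0 (s - 1) = s - 1" by auto
  then show ?thesis unfolding smooth_step_def sqpos_def by (simp add: power2_eq_square field_simps)
qed

lemma smooth_step_bounds: "\<bar>smooth_step s\<bar> \<le> 1"
proof -
  have mono: "smooth_step x \<le> smooth_step y" if "x \<le> y" for x y
    using that by (rule DERIV_nonneg_imp_nondecreasing) (use DERIV_smooth_step tent_bounds in blast)
  show ?thesis
    using mono[of "min 0 s" s] mono[of s "max 1 s"] smooth_step_left[of "min 0 s"] smooth_step_right[of "max 1 s"]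
    by auto
qed

lemma integral_tent:
  assumes "0 < h" "c \<le> x" "x + h \<le> d"
  shows "((\<lambda>t. tent ((t - x) / h) / h) has_integral 1) {c..d}"
proof -
  have "((\<lambda>t. tent ((t - x) / h) / h) has_integral (smooth_step ((d - x) / h) - smooth_step ((c - x) / h))) {c..d}"
  proof (rule fundamental_theorem_of_calculus)
    show "((\<lambda>t. smooth_step ((t - x) / h)) has_vector_derivative tent ((t - x) / h) / h) (at t within {c..d})" for t
      unfolding has_real_derivative_iff_has_vector_derivative[symmetric]
      using DERIV_smooth_step_scaled[OF assms(1)] has_field_derivative_at_within by blast
  qed (use assms in auto)
  moreover have "smooth_step ((d - x) / h) = 1" using assms by (intro smooth_step_right) (auto simp: field_simps)
  moreover have "smooth_step ((c - x) / h) = 0" using assms by (intro smooth_step_left) (auto simp: field_simps)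
  ultimately show ?thesis by simp
qed

text \<open>Weak derivatives are tested with Bochner integrals over an open interval, while limits
  and the fundamental theorem are handled with gauge integrals on compact ones; this passes between
  the two.\<close>

lemma integral_lebesgue_on_supported:
  fixes f :: "real \<Rightarrow> 'b::euclidean_space"
  assumes "f absolutely_integrable_on K" "K \<subseteq> S" "S \<in> sets lebesgue" "K \<in> sets lebesgue"
    and "\<And>x. x \<in> S \<Longrightarrow> x \<notin> K \<Longrightarrow> f x = 0"
  shows "integral\<^sup>L (lebesgue_on S) f = integral K f"
proof -
  have "integral\<^sup>L (lebesgue_on S) f = integral\<^sup>L lebesgue (\<lambda>x. indicator S x *\<^sub>R f x)"
    using assms by (subst integral_restrict_space) auto
  also have "(\<lambda>x. indicator S x *\<^sub>R f x) = (\<lambda>x. indicator K x *\<^sub>R f x)"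
    using assms by (auto simp: indicator_def fun_eq_iff)
  also have "integral\<^sup>L lebesgue (\<lambda>x. indicator K x *\<^sub>R f x) = integral K f"
    using set_lebesgue_integral_eq_integral(2)[OF assms(1)] by (simp add: set_lebesgue_integral_def)
  finally show ?thesis .
qed

lemma loc_integrable_absolutely_integrable:
  assumes "loc_integrable {A<..<B} f" "A < c" "d < B"
  shows "f absolutely_integrable_on {c..d}"
proof -
  have "compact {c..d}" "{c..d} \<subseteq> {A<..<B}" using assms by auto
  then have "integrable (lebesgue_on {c..d}) f" using assms(1) unfolding loc_integrable_def by blast
  then show ?thesis
    unfolding set_integrable_def by (subst (asm) integrable_restrict_space) auto
qed

lemma bilinear_scaleR: "bilinear (\<lambda>s (v::'b::euclidean_space). s *\<^sub>R v)"
  by (simp add: bilinear_conv_bounded_bilinear bounded_bilinear_scaleR)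

text \<open>The kernel lives on \<open>[x, x + h]\<close>, has integral 1 and is at most
  \<open>2 / h\<close>, so the error is at most twice the mean of \<open>norm (f t - f x)\<close>,
  which vanishes at a Lebesgue point.\<close>

lemma mollifier_tendsto:
  fixes f :: "real \<Rightarrow> 'b::euclidean_space"
  assumes f: "f absolutely_integrable_on {c..d}" and x: "c \<le> x" "x < d"
    and leb: "((\<lambda>h. integral {x..x + h} (\<lambda>t. norm (f t - f x)) / h) \<longlongrightarrow> 0) (at_right 0)"
  shows "((\<lambda>h. integral {c..d} (\<lambda>t. (tent ((t - x) / h) / h) *\<^sub>R f t)) \<longlongrightarrow> f x) (at_right 0)"
proof (rule Lim_transform2[where f = "\<lambda>h. f x"])
  have "((\<lambda>h. 2 * (integral {x..x + h} (\<lambda>t. norm (f t - f x)) / h)) \<longlongrightarrow> 2 * 0) (at_right 0)"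
    by (intro tendsto_intros leb)
  then have lim: "((\<lambda>h. 2 * (integral {x..x + h} (\<lambda>t. norm (f t - f x)) / h)) \<longlongrightarrow> 0) (at_right 0)" by simp
  show "((\<lambda>h. f x - integral {c..d} (\<lambda>t. (tent ((t - x) / h) / h) *\<^sub>R f t)) \<longlongrightarrow> 0) (at_right 0)"
  proof (rule Lim_null_comparison[OF _ lim])
    have "norm (f x - integral {c..d} (\<lambda>t. (tent ((t - x) / h) / h) *\<^sub>R f t)) \<le> 2 * (integral {x..x + h} (\<lambda>t. norm (f t - f x)) / h)"
      if h: "0 < h" "h < d - x" for h
    proof -
      define \<eta> where "\<eta> t = tent ((t - x) / h) / h" for t
      have \<eta>b: "\<bar>\<eta> t\<bar> \<le> 2 / h" for t
        using h tent_bounds[of "(t - x) / h"] by (auto simp: \<eta>_def divide_right_mono)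
      have \<eta>c: "continuous_on UNIV \<eta>" unfolding \<eta>_def[abs_def]
        using h by (intro continuous_intros continuous_on_compose2[OF continuous_tent[of UNIV]]) auto
      have p: "(\<lambda>t. \<eta> t *\<^sub>R g t) absolutely_integrable_on {a..b}"
        if "g absolutely_integrable_on {a..b}" for g :: "real \<Rightarrow> 'c::euclidean_space" and a b
      proof (rule absolutely_integrable_bounded_measurable_product[OF bilinear_scaleR _ _ _ that])
        show "\<eta> \<in> borel_measurable (lebesgue_on {a..b})"
          using \<eta>c by (intro continuous_imp_measurable_on_sets_lebesgue continuous_on_subset[OF \<eta>c]) auto
        show "bounded (\<eta> ` {a..b})" using \<eta>b by (auto simp: bounded_iff)
      qed auto
      have fx: "(\<lambda>t. f t - f x) absolutely_integrable_on {c..d}"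
        using f by (intro set_integral_diff(1) absolutely_integrable_on_const) auto
      have nx: "(\<lambda>t. norm (f t - f x)) absolutely_integrable_on {c..d}" by (rule absolutely_integrable_norm_diff[OF f])
      have one: "(\<eta> has_integral 1) {c..d}" unfolding \<eta>_def using h x by (intro integral_tent) auto
      have "((\<lambda>t. \<eta> t *\<^sub>R f t) has_integral integral {c..d} (\<lambda>t. \<eta> t *\<^sub>R f t)) {c..d}"
        using p[OF f] set_lebesgue_integral_eq_integral(1) by blast
      from has_integral_diff[OF this has_integral_scaleR_left[OF one, of "f x"]]
      have "integral {c..d} (\<lambda>t. \<eta> t *\<^sub>R (f t - f x)) = integral {c..d} (\<lambda>t. \<eta> t *\<^sub>R f t) - f x"
        by (intro integral_unique) (simp add: algebra_simps)
      then have "norm (f x - integral {c..d} (\<lambda>t. \<eta> t *\<^sub>R f t)) = norm (integral {c..d} (\<lambda>t. \<eta> t *\<^sub>R (f t - f x)))"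
        by (simp add: norm_minus_commute)
      also have "\<dots> \<le> integral {c..d} (\<lambda>t. if t \<in> {x..x+h} then (2 / h) * norm (f t - f x) else 0)"
      proof (rule integral_norm_bound_integral)
        show "(\<lambda>t. \<eta> t *\<^sub>R (f t - f x)) integrable_on {c..d}"
          using p[OF fx] set_lebesgue_integral_eq_integral(1) by blast
        have "(\<lambda>t. norm (f t - f x)) integrable_on {x..x+h}"
          using set_lebesgue_integral_eq_integral(1)[OF nx] by (rule integrable_subinterval_real) (use x h in auto)
        then have "(\<lambda>t. (2 / h) * norm (f t - f x)) integrable_on {x..x+h}" by (rule integrable_on_mult_right)
        moreover have "{x..x+h} \<inter> {c..d} = {x..x+h}" using x h by auto
        ultimately show "(\<lambda>t. if t \<in> {x..x+h} then (2 / h) * norm (f t - f x) else 0) integrable_on {c..d}"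
          by (simp only: integrable_restrict_Int)
        fix t
        show "norm (\<eta> t *\<^sub>R (f t - f x)) \<le> (if t \<in> {x..x+h} then (2 / h) * norm (f t - f x) else 0)"
        proof (cases "t \<in> {x..x+h}")
          case True then show ?thesis
            using mult_right_mono[OF \<eta>b[of t], of "norm (f t - f x)"] by simp
        next
          case False
          then have "(t - x) / h \<le> 0 \<or> 1 \<le> (t - x) / h" using h by (auto simp: field_simps)
          then show ?thesis using False by (simp add: \<eta>_def tent_outside)
        qed
      qed
      also have "\<dots> = integral {x..x+h} (\<lambda>t. (2 / h) * norm (f t - f x))"
      proof -
        have "{x..x+h} \<inter> {c..d} = {x..x+h}" using x h by auto
        then show ?thesis by (simp only: integral_restrict_Int)
      qed
      finally show ?thesis by (simp add: \<eta>_def)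
    qed
    then show "\<forall>\<^sub>F h in at_right 0. norm (f x - integral {c..d} (\<lambda>t. (tent ((t - x) / h) / h) *\<^sub>R f t))
       \<le> 2 * (integral {x..x + h} (\<lambda>t. norm (f t - f x)) / h)"
      unfolding eventually_at_right_field using x by (intro exI[of _ "d - x"]) auto
  qed
qed simp

text \<open>Test with a plateau that rises on \<open>[x, x + h]\<close> and falls on
  \<open>[y, y + h]\<close>. Its derivative is a difference of two mollifiers, so for
  \<open>h\<close> tending to 0 one side tends to \<open>f x - f y\<close> and the other to minus
  the integral of \<open>g\<close>. The exceptional set depends on the Lebesgue points of
  \<open>f\<close> only, hence serves all pairs.\<close>

theorem weak_deriv_integral:
  fixes f g :: "real \<Rightarrow> 'b::euclidean_space"
  assumes "weak_deriv {A<..<B} f g"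
  obtains N where "negligible N"
    "\<And>x y. \<lbrakk>A < x; x \<le> y; y < B; x \<notin> N; y \<notin> N\<rbrakk> \<Longrightarrow> f y - f x = integral {x..y} g"
proof -
  have lf: "f absolutely_integrable_on {c..d}" and lg: "g absolutely_integrable_on {c..d}"
    if "A < c" "d < B" for c d
    using assms that by (auto simp: weak_deriv_def intro: loc_integrable_absolutely_integrable)
  obtain N where N: "negligible N"
    "\<And>x. \<lbrakk>A < x; x < B; x \<notin> N\<rbrakk> \<Longrightarrow>
      ((\<lambda>h. integral {x..x + h} (\<lambda>t. norm (f t - f x)) / h) \<longlongrightarrow> 0) (at_right 0)"
    using lebesgue_points[of A B f] lf by blast
  show ?thesis
  proof (rule that[OF N(1)])
    fix x y assume xy: "A < x" "x \<le> y" "y < B" "x \<notin> N" "y \<notin> N"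
    \<comment> \<open>Leaves room to the right of \<open>y\<close> for the falling edge, so that all
      supports lie in \<open>[x, d]\<close>, a compact part of the domain.\<close>
    define d where "d = (y + B) / 2"
    have d: "y < d" "d < B" "x < d" using xy by (auto simp: d_def)
    define \<psi> where "\<psi> h t = smooth_step ((t - x) / h) - smooth_step ((t - y) / h)" for h t
    define \<psi>' where "\<psi>' h t = tent ((t - x) / h) / h - tent ((t - y) / h) / h" for h t
    have \<psi>d: "(\<psi> h has_vector_derivative \<psi>' h t) (at t)" if "h > 0" for h t
      unfolding has_real_derivative_iff_has_vector_derivative[symmetric] \<psi>_def[abs_def] \<psi>'_def
      using DERIV_smooth_step_scaled[OF that] by (intro DERIV_diff)
    have \<psi>'c: "continuous_on UNIV (\<psi>' h)" if "h > 0" for h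
      unfolding \<psi>'_def[abs_def]
      using that by (intro continuous_intros continuous_on_compose2[OF continuous_tent[of UNIV]]) auto
    have \<psi>c: "continuous_on UNIV (\<psi> h)" if "h > 0" for h
      using \<psi>d[OF that] by (meson continuous_at_imp_continuous_on has_vector_derivative_continuous)
    have zero: "\<psi> h t = 0" "\<psi>' h t = 0" if "h > 0" "h < d - y" "t \<notin> {x..d}" for h t
    proof -
      have "(t - x) / h \<le> 0 \<and> (t - y) / h \<le> 0 \<or> 1 \<le> (t - x) / h \<and> 1 \<le> (t - y) / h"
        using that xy by (auto simp: field_simps)
      then show "\<psi> h t = 0" "\<psi>' h t = 0"
        by (auto simp: \<psi>_def \<psi>'_def smooth_step_left smooth_step_right tent_outside)
    qed
    have prod: "(\<lambda>t. F t *\<^sub>R u t) absolutely_integrable_on {a..b}"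
      if "continuous_on UNIV F" "u absolutely_integrable_on {a..b}" for F and u :: "real \<Rightarrow> 'b" and a b
    proof (rule absolutely_integrable_bounded_measurable_product[OF bilinear_scaleR _ _ _ that(2)])
      show "F \<in> borel_measurable (lebesgue_on {a..b})"
        using that by (intro continuous_imp_measurable_on_sets_lebesgue continuous_on_subset[OF that(1)]) auto
      show "bounded (F ` {a..b})"
        by (intro compact_imp_bounded compact_continuous_image continuous_on_subset[OF that(1)]) auto
    qed auto
    have id: "integral {x..d} (\<lambda>t. (tent ((t - x) / h) / h) *\<^sub>R f t) - integral {x..d} (\<lambda>t. (tent ((t - y) / h) / h) *\<^sub>R f t)
        = - integral {x..d} (\<lambda>t. \<psi> h t *\<^sub>R g t)" if h: "h > 0" "h < d - y" for h
    proof -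
      have "test_fun {A<..<B} (\<psi> h) (\<psi>' h)"
        unfolding test_fun_def using \<psi>d[OF h(1)] \<psi>'c[OF h(1)] zero[OF h] xy d
        by (auto intro!: exI[of _ "{x..d}"])
      then have "integral\<^sup>L (lebesgue_on {A<..<B}) (\<lambda>t. \<psi>' h t *\<^sub>R f t) = - integral\<^sup>L (lebesgue_on {A<..<B}) (\<lambda>t. \<psi> h t *\<^sub>R g t)"
        using assms by (auto simp: weak_deriv_def)
      also have "integral\<^sup>L (lebesgue_on {A<..<B}) (\<lambda>t. \<psi>' h t *\<^sub>R f t) = integral {x..d} (\<lambda>t. \<psi>' h t *\<^sub>R f t)"
        using prod[OF \<psi>'c[OF h(1)] lf[OF xy(1) d(2)]] zero[OF h] xy d by (intro integral_lebesgue_on_supported) auto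
      also have "integral\<^sup>L (lebesgue_on {A<..<B}) (\<lambda>t. \<psi> h t *\<^sub>R g t) = integral {x..d} (\<lambda>t. \<psi> h t *\<^sub>R g t)"
        using prod[OF \<psi>c[OF h(1)] lg[OF xy(1) d(2)]] zero[OF h] xy d by (intro integral_lebesgue_on_supported) auto
      also have "integral {x..d} (\<lambda>t. \<psi>' h t *\<^sub>R f t) =
        integral {x..d} (\<lambda>t. (tent ((t - x) / h) / h) *\<^sub>R f t) - integral {x..d} (\<lambda>t. (tent ((t - y) / h) / h) *\<^sub>R f t)"
      proof -
        have "(\<lambda>t. (tent ((t - z) / h) / h) *\<^sub>R f t) integrable_on {x..d}" for z
        proof -
          have "continuous_on UNIV (\<lambda>t. tent ((t - z) / h) / h)"
            using h by (intro continuous_intros continuous_on_compose2[OF continuous_tent[of UNIV]]) auto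
          from prod[OF this lf[OF xy(1) d(2)]] show ?thesis using set_lebesgue_integral_eq_integral(1) by blast
        qed
        then show ?thesis by (simp add: \<psi>'_def scaleR_diff_left integral_diff)
      qed
      finally show ?thesis .
    qed
    have L1: "((\<lambda>h. integral {x..d} (\<lambda>t. (tent ((t - x) / h) / h) *\<^sub>R f t) - integral {x..d} (\<lambda>t. (tent ((t - y) / h) / h) *\<^sub>R f t)) \<longlongrightarrow> f x - f y) (at_right 0)"
      using xy d lf[OF xy(1) d(2)] N(2) by (intro tendsto_diff mollifier_tendsto) auto
    \<comment> \<open>Dominated convergence needs a sequence; the 2 in the denominator makes already
      \<open>H 0\<close> smaller than \<open>d - y\<close>.\<close>
    define H where "H n = (d - y) / (2 + real n)" for n
    have H: "0 < H n" "H n < d - y" for n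
    proof -
      show "0 < H n" using d by (simp add: H_def)
      have "(d - y) * 1 < (d - y) * (2 + real n)" using d by (intro mult_strict_left_mono) auto
      then show "H n < d - y" by (simp add: H_def pos_divide_less_eq add_pos_nonneg)
    qed
    have Hl: "H \<longlonglongrightarrow> 0" unfolding H_def by real_asymp
    then have Hr: "filterlim H (at_right 0) sequentially"
      using H(1) by (auto simp: filterlim_at less_imp_neq[OF H(1), symmetric])
    \<comment> \<open>The edges start at \<open>x\<close> and at \<open>y\<close>, so in the limit
      the left end is excluded and the right end included.\<close>
    have L2: "(\<lambda>n. integral {x..d} (\<lambda>t. \<psi> (H n) t *\<^sub>R g t)) \<longlonglongrightarrow> integral {x..d} (\<lambda>t. if t \<in> {x<..y} then g t else 0)"
    proof (rule dominated_convergence(2)[where h = "\<lambda>t. 2 * norm (g t)"])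
      show "(\<lambda>t. \<psi> (H n) t *\<^sub>R g t) integrable_on {x..d}" for n
        using prod[OF \<psi>c[OF H(1)] lg[OF xy(1) d(2)]] set_lebesgue_integral_eq_integral(1) by blast
      show "(\<lambda>t. 2 * norm (g t)) integrable_on {x..d}"
        using lg[OF xy(1) d(2)] by (intro integrable_on_mult_right) (simp add: absolutely_integrable_on_def)
      show "norm (\<psi> (H n) t *\<^sub>R g t) \<le> 2 * norm (g t)" for n t
        using smooth_step_bounds[of "(t - x) / H n"] smooth_step_bounds[of "(t - y) / H n"]
        by (simp add: \<psi>_def mult_right_mono)
      have st: "(\<lambda>n. smooth_step ((t - z) / H n)) \<longlonglongrightarrow> (if z < t then 1 else 0)" for t z
      proof (cases "z < t")
        case True
        have "\<forall>\<^sub>F n in sequentially. H n < t - z" using Hl True by (intro order_tendstoD) auto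
        then have "\<forall>\<^sub>F n in sequentially. smooth_step ((t - z) / H n) = 1"
          by eventually_elim (use H in \<open>auto intro!: smooth_step_right simp: field_simps\<close>)
        then show ?thesis using True by (simp add: tendsto_eventually)
      next
        case False
        then have "smooth_step ((t - z) / H n) = 0" for n
          using H[of n] by (intro smooth_step_left) (auto simp: field_simps)
        then show ?thesis using False by simp
      qed
      show "(\<lambda>n. \<psi> (H n) t *\<^sub>R g t) \<longlonglongrightarrow> (if t \<in> {x<..y} then g t else 0)" for t
        using tendsto_scaleR[OF tendsto_diff[OF st[of t x] st[of t y]] tendsto_const[of "g t"]] xy
        unfolding \<psi>_def by (auto split: if_splits)
    qed
    have "integral {x..d} (\<lambda>t. if t \<in> {x<..y} then g t else 0) = integral ({x<..y} \<inter> {x..d}) g"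
      by (rule integral_restrict_Int)
    also have "{x<..y} \<inter> {x..d} = {x<..y}" using d by auto
    also have "integral {x<..y} g = integral {x..y} g"
    proof (rule integral_spike_set)
      show "negligible {t \<in> {x<..y} - {x..y}. g t \<noteq> 0}" by (rule negligible_subset[of "{}"]) auto
      show "negligible {t \<in> {x..y} - {x<..y}. g t \<noteq> 0}" by (rule negligible_subset[of "{x}"]) auto
    qed
    finally have L3: "(\<lambda>n. integral {x..d} (\<lambda>t. \<psi> (H n) t *\<^sub>R g t)) \<longlonglongrightarrow> integral {x..y} g" using L2 by simp
    have "(\<lambda>n. - integral {x..d} (\<lambda>t. \<psi> (H n) t *\<^sub>R g t)) \<longlonglongrightarrow> f x - f y"
      using filterlim_compose[OF L1 Hr] id[OF H] by simp
    from LIMSEQ_unique[OF this tendsto_minus[OF L3]]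
    show "f y - f x = integral {x..y} g" by (simp add: algebra_simps)
  qed
qed

section \<open>Null sets, uniqueness of weak derivatives, and the classical case\<close>

lemma AE_lebesgue_on_negligible:
  assumes "negligible N" "S \<in> sets lebesgue" "\<And>x. x \<in> S \<Longrightarrow> x \<notin> N \<Longrightarrow> P x"
  shows "AE x in lebesgue_on S. P x"
proof -
  have "AE x in lebesgue. x \<notin> N" using assms by (simp add: AE_not_in negligible_iff_null_sets)
  then have "AE x in lebesgue. x \<in> S \<longrightarrow> P x" using assms(3) by auto
  then show ?thesis using assms(2) by (subst AE_restrict_space_iff) auto
qed

lemma AE_lebesgue_on_open_intervalE:
  assumes "AE x in lebesgue_on S. P x" "S \<in> sets lebesgue"
  obtains N where "negligible N" "\<And>x. x \<in> S \<Longrightarrow> x \<notin> N \<Longrightarrow> P x"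
proof -
  have "AE x in lebesgue. x \<in> S \<longrightarrow> P x" using assms by (subst (asm) AE_restrict_space_iff) auto
  then obtain N where "N \<in> null_sets lebesgue" "{x. \<not> (x \<in> S \<longrightarrow> P x)} \<subseteq> N"
    by (auto simp: eventually_ae_filter)
  then show ?thesis using that[of N] by (auto simp: negligible_iff_null_sets)
qed

lemma not_negligible_interval: "c < d \<Longrightarrow> \<not> negligible {c<..<d::real}"
  by (rule open_not_negligible) auto

lemma continuous_eq_off_negligible:
  fixes f g :: "real \<Rightarrow> 'b::real_normed_vector"
  assumes "continuous_on {c..d} f" "continuous_on {c..d} g" "negligible N" "c < d"
    "\<And>x. c < x \<Longrightarrow> x < d \<Longrightarrow> x \<notin> N \<Longrightarrow> f x = g x" and x: "x \<in> {c..d}"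
  shows "f x = g x"
proof -
  have cl: "closure ({c<..<d} - N) = {c..d}"
  proof -
    have "{c<..<d} \<subseteq> closure ({c<..<d} - N)"
    proof (rule ccontr)
      assume "\<not> ?thesis"
      then obtain z where z: "z \<in> {c<..<d}" "z \<notin> closure ({c<..<d} - N)" by blast
      then obtain e where e: "e > 0" "ball z e \<inter> ({c<..<d} - N) = {}"
      proof -
        have "open (- closure ({c<..<d} - N))" by (simp add: open_Compl)
        then obtain e where "e > 0" "ball z e \<subseteq> - closure ({c<..<d} - N)"
          using z(2) by (metis ComplI open_contains_ball)
        moreover have "{c<..<d} - N \<subseteq> closure ({c<..<d} - N)" by (rule closure_subset)
        ultimately have "ball z e \<inter> ({c<..<d} - N) = {}" by blast
        then show ?thesis using that \<open>e > 0\<close> by simp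
      qed
      then have "ball z e \<inter> {c<..<d} \<subseteq> N" by auto
      then have "negligible (ball z e \<inter> {c<..<d})" using assms(3) negligible_subset by blast
      moreover have "open (ball z e \<inter> {c<..<d})" "z \<in> ball z e \<inter> {c<..<d}" using e z by auto
      ultimately show False using open_not_negligible by blast
    qed
    then have "closure {c<..<d} \<subseteq> closure ({c<..<d} - N)" by (simp add: closure_minimal)
    moreover have "closure ({c<..<d} - N) \<subseteq> closure {c<..<d}" by (intro closure_mono) auto
    ultimately show ?thesis using assms(4) by (simp add: closure_greaterThanLessThan)
  qed
  have "f x - g x = 0"
  proof (rule continuous_constant_on_closure[where S = "{c<..<d} - N" and f = "\<lambda>x. f x - g x"])
    show "continuous_on (closure ({c<..<d} - N)) (\<lambda>x. f x - g x)"
      unfolding cl by (intro continuous_intros assms)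
  qed (use assms x cl in auto)
  then show ?thesis by simp
qed

text \<open>Both candidates integrate to increments of \<open>f\<close>, so the integral of
  \<open>g1 - g2\<close> vanishes between points off a null set, and by continuity of the indefinite
  integral between any two points. Local integrability gives this on compactly contained intervals
  only; countably many rational ones cover the domain.\<close>

lemma weak_deriv_unique:
  fixes f :: "real \<Rightarrow> 'b::euclidean_space"
  assumes "weak_deriv {A<..<B} f g1" "weak_deriv {A<..<B} f g2"
  shows "AE x in lebesgue_on {A<..<B}. g1 x = g2 x"
proof -
  have l: "g1 absolutely_integrable_on {c..d}" "g2 absolutely_integrable_on {c..d}" if "A < c" "d < B" for c d
    using assms that by (auto simp: weak_deriv_def intro: loc_integrable_absolutely_integrable)
  obtain N1 where N1: "negligible N1" "\<And>x y. \<lbrakk>A < x; x \<le> y; y < B; x \<notin> N1; y \<notin> N1\<rbrakk> \<Longrightarrow> f y - f x = integral {x..y} g1"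
    using weak_deriv_integral[OF assms(1)] by blast
  obtain N2 where N2: "negligible N2" "\<And>x y. \<lbrakk>A < x; x \<le> y; y < B; x \<notin> N2; y \<notin> N2\<rbrakk> \<Longrightarrow> f y - f x = integral {x..y} g2"
    using weak_deriv_integral[OF assms(2)] by blast
  have *: "AE t in lebesgue_on {c<..<d}. g1 t - g2 t = 0" if cd: "A < c" "c < d" "d < B" for c d
  proof (rule AE_zero_if_box_integrals_zero)
    have l12: "(\<lambda>t. g1 t - g2 t) absolutely_integrable_on {c..d}"
      using l[OF cd(1,3)] by (intro set_integral_diff(1))
    then show "(\<lambda>t. g1 t - g2 t) absolutely_integrable_on {c<..<d}"
      by (simp add: absolutely_integrable_on_Icc_iff_Ioo)
    define I where "I x = integral {c..x} (\<lambda>t. g1 t - g2 t)" for x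
    have ii: "(\<lambda>t. g1 t - g2 t) integrable_on {c..d}" using l12 set_lebesgue_integral_eq_integral(1) by blast
    have cI: "continuous_on {c..d} I" unfolding I_def by (rule indefinite_integral_continuous_1[OF ii])
    have diff: "I y - I x = integral {x..y} (\<lambda>t. g1 t - g2 t)" if "c \<le> x" "x \<le> y" "y \<le> d" for x y
      using Henstock_Kurzweil_Integration.integral_combine[of c x y "\<lambda>t. g1 t - g2 t"] that
        integrable_subinterval_real[OF ii, of c y] by (simp add: I_def algebra_simps)
    obtain x0 where x0: "x0 \<in> {c<..<d}" "x0 \<notin> N1 \<union> N2"
      using not_negligible_interval[OF cd(2)] negligible_Un[OF N1(1) N2(1)] negligible_subset by blast
    have "I x = I x0" if "x \<in> {c..d}" for x
    proof (rule continuous_eq_off_negligible[OF cI _ negligible_Un[OF N1(1) N2(1)] cd(2) _ that])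
      fix x assume x: "c < x" "x < d" "x \<notin> N1 \<union> N2"
      have z: "I y - I x = 0" if "x \<le> y" "x \<in> {c<..<d} - (N1 \<union> N2)" "y \<in> {c<..<d} - (N1 \<union> N2)" for x y
      proof -
        have "g1 integrable_on {x..y}" "g2 integrable_on {x..y}"
          using that cd l[of x y] by (auto intro: set_lebesgue_integral_eq_integral(1))
        from Henstock_Kurzweil_Integration.integral_diff[OF this]
        have "I y - I x = integral {x..y} g1 - integral {x..y} g2" using that diff[of x y] by simp
        also have "\<dots> = 0" using N1(2)[of x y] N2(2)[of x y] that cd by auto
        finally show ?thesis .
      qed
      show "I x = I x0" using z[of x x0] z[of x0 x] x x0 by (cases "x \<le> x0") auto
    qed simp
    then show "integral (cbox u v) (\<lambda>t. g1 t - g2 t) = 0" if "cbox u v \<subseteq> {c<..<d}" for u v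
    proof (cases "u \<le> v")
      case True
      then have "u \<in> cbox u v" "v \<in> cbox u v" by auto
      then have "u \<in> {c<..<d}" "v \<in> {c<..<d}" using that by blast+
      then have "I u = I x0" "I v = I x0" "I v - I u = integral {u..v} (\<lambda>t. g1 t - g2 t)"
        using \<open>\<And>x. x \<in> {c..d} \<Longrightarrow> I x = I x0\<close> diff[of u v] True by auto
      then show ?thesis by simp
    qed simp
  qed simp
  then have "\<exists>N. negligible N \<and> (\<forall>t\<in>{c<..<d}. t \<notin> N \<longrightarrow> g1 t = g2 t)" if "A < c" "c < d" "d < B" for c d

  proof -
    have "AE t in lebesgue_on {c<..<d}. g1 t - g2 t = 0" by (rule *) (use that in auto)
    then obtain N where "negligible N" "\<And>t. t \<in> {c<..<d} \<Longrightarrow> t \<notin> N \<Longrightarrow> g1 t - g2 t = 0"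
      by (rule AE_lebesgue_on_open_intervalE) auto
    then show ?thesis by auto
  qed
  then obtain M where M: "\<And>c d. A < c \<Longrightarrow> c < d \<Longrightarrow> d < B \<Longrightarrow> negligible (M c d)"
     "\<And>c d t. A < c \<Longrightarrow> c < d \<Longrightarrow> d < B \<Longrightarrow> t \<in> {c<..<d} \<Longrightarrow> t \<notin> M c d \<Longrightarrow> g1 t = g2 t"
    by metis
  define D where "D = {(c, d) \<in> \<rat> \<times> \<rat>. A < c \<and> c < d \<and> d < B}"
  have "countable D" unfolding D_def by (rule countable_subset[of _ "\<rat> \<times> \<rat>"]) (auto intro: countable_rat)
  then have neg: "negligible (\<Union>(c, d)\<in>D. M c d)"
    by (intro negligible_countable_Union) (auto simp: D_def intro: M(1))
  show ?thesis
  proof (rule AE_lebesgue_on_negligible[OF neg])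
    fix t assume t: "t \<in> {A<..<B}" "t \<notin> (\<Union>(c, d)\<in>D. M c d)"
    obtain c where c: "c \<in> \<rat>" "A < c" "c < t" using t Rats_dense_in_real[of A t] by auto
    obtain d where d: "d \<in> \<rat>" "t < d" "d < B" using t Rats_dense_in_real[of t B] by auto
    have "(c, d) \<in> D" using c d by (auto simp: D_def)
    then show "g1 t = g2 t" using M(2)[of c d t] c d t by auto
  qed simp
qed

text \<open>Makes the choice operator in \<open>wderiv\<close> harmless: any exhibited weak
  derivative may replace it almost everywhere.\<close>

lemma wderiv_unique:
  fixes f :: "real \<Rightarrow> 'b::euclidean_space"
  assumes "weak_deriv {A<..<B} f g"
  shows "AE x in lebesgue_on {A<..<B}. wderiv {A<..<B} f x = g x"
proof -
  have "weak_deriv {A<..<B} f (wderiv {A<..<B} f)"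
    unfolding wderiv_def by (rule someI[of "\<lambda>g. weak_deriv {A<..<B} f g", OF assms])
  then show ?thesis using assms by (rule weak_deriv_unique)
qed

lemma weak_deriv_C1:
  fixes f f' :: "real \<Rightarrow> complex"
  assumes c': "continuous_on {A<..<B} f'"
    and d: "\<And>x. A < x \<Longrightarrow> x < B \<Longrightarrow> (f has_vector_derivative f' x) (at x)"
  shows "weak_deriv {A<..<B} f f'"
proof -
  have c: "continuous_on {A<..<B} f"
    using d by (meson continuous_at_imp_continuous_on greaterThanLessThan_iff has_vector_derivative_continuous)
  have li: "loc_integrable {A<..<B} g" if "continuous_on {A<..<B} g" for g :: "real \<Rightarrow> complex"
    unfolding loc_integrable_def
  proof (intro allI impI)
    fix K assume K: "compact K \<and> K \<subseteq> {A<..<B}"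
    then have "continuous_on K g" using that continuous_on_subset by blast
    then have "bounded (g ` K)" using K by (intro compact_imp_bounded compact_continuous_image) auto
    then obtain M where M: "\<And>x. x \<in> K \<Longrightarrow> norm (g x) \<le> M" by (auto simp: bounded_iff)
    have Kl: "K \<in> lmeasurable" using K by (simp add: lmeasurable_compact)
    have "g absolutely_integrable_on K"
      using \<open>continuous_on K g\<close> Kl M
      by (intro measurable_bounded_by_integrable_imp_absolutely_integrable[where g = "\<lambda>_. M"]
          continuous_imp_measurable_on_sets_lebesgue integrable_on_const) auto
    then show "integrable (lebesgue_on K) g"
      using K by (simp add: set_integrable_def integrable_restrict_space fmeasurableD lmeasurable_compact)
  qed
  show ?thesis unfolding weak_deriv_def
  proof (intro conjI li c c' allI impI)
    fix \<psi> \<psi>' :: "real \<Rightarrow> real" assume t: "test_fun {A<..<B} \<psi> \<psi>'"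
    then have \<psi>: "\<And>t. (\<psi> has_vector_derivative \<psi>' t) (at t)" and c\<psi>': "continuous_on UNIV \<psi>'"
      by (auto simp: test_fun_def)
    obtain K where K: "compact K" "K \<subseteq> {A<..<B}" "\<And>t. t \<notin> K \<Longrightarrow> \<psi> t = 0" using t unfolding test_fun_def by auto
    have c\<psi>: "continuous_on UNIV \<psi>" using \<psi> by (meson continuous_at_imp_continuous_on has_vector_derivative_continuous)
    have \<psi>'0: "\<psi>' t = 0" if "t \<notin> K" for t
    proof -
      have "((\<lambda>_. 0) has_vector_derivative 0) (at t)" by simp
      then have "(\<psi> has_vector_derivative 0) (at t)"
        by (rule has_vector_derivative_transform_within_open[where S = "- K"]) (use K that compact_imp_closed in auto)
      then show ?thesis using \<psi> vector_derivative_unique_at by blast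
    qed
    show "integral\<^sup>L (lebesgue_on {A<..<B}) (\<lambda>t. \<psi>' t *\<^sub>R f t) = - integral\<^sup>L (lebesgue_on {A<..<B}) (\<lambda>t. \<psi> t *\<^sub>R f' t)"
    proof (cases "K = {}")
      case True then show ?thesis using K(3) \<psi>'0 by simp
    next
      case False
      obtain p q where pq: "p \<in> K" "q \<in> K" "\<And>t. t \<in> K \<Longrightarrow> p \<le> t \<and> t \<le> q"
        using compact_attains_inf[OF K(1) False] compact_attains_sup[OF K(1) False] by metis
      \<comment> \<open>Strictly between the support and the ends of the domain, so that the
        boundary terms of the integration by parts vanish while \<open>f\<close> is C1 on
        \<open>[c, d]\<close>.\<close>
      define c d where "c = (A + p) / 2" and "d = (q + B) / 2"
      have cd: "A < c" "c < p" "p \<le> q" "q < d" "d < B" using pq K(2) by (auto simp: c_def d_def)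
      have out: "\<psi> t = 0" "\<psi>' t = 0" if "t \<le> c \<or> d \<le> t" for t
        using that cd pq(3)[of t] K(3)[of t] \<psi>'0[of t] by force+
      have sub: "{c..d} \<subseteq> {A<..<B}" using cd by auto
      have cc: "continuous_on {c..d} f" "continuous_on {c..d} f'" "continuous_on {c..d} \<psi>" "continuous_on {c..d} \<psi>'"
        using c c' sub c\<psi> c\<psi>' continuous_on_subset by blast+
      have "((\<lambda>t. \<psi> t *\<^sub>R f' t + \<psi>' t *\<^sub>R f t) has_integral (\<psi> d *\<^sub>R f d - \<psi> c *\<^sub>R f c)) {c..d}"
      proof (rule fundamental_theorem_of_calculus)
        fix t assume "t \<in> {c..d}"
        then have "(f has_vector_derivative f' t) (at t)" using d sub by auto
        moreover have "(\<psi> has_real_derivative \<psi>' t) (at t)" using \<psi> by (simp add: has_real_derivative_iff_has_vector_derivative)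
        ultimately show "((\<lambda>t. \<psi> t *\<^sub>R f t) has_vector_derivative \<psi> t *\<^sub>R f' t + \<psi>' t *\<^sub>R f t) (at t within {c..d})"
          by (rule has_vector_derivative_at_within[OF has_vector_derivative_scaleR, rotated])
      qed (use cd in auto)
      then have e: "integral {c..d} (\<lambda>t. \<psi> t *\<^sub>R f' t + \<psi>' t *\<^sub>R f t) = 0" using out by (simp add: integral_unique)
      have a: "(\<lambda>t. \<psi> t *\<^sub>R f' t) absolutely_integrable_on {c..d}" "(\<lambda>t. \<psi>' t *\<^sub>R f t) absolutely_integrable_on {c..d}"
        using cc by (auto intro!: absolutely_integrable_continuous_real continuous_intros)
      have "integral {c..d} (\<lambda>t. \<psi>' t *\<^sub>R f t) = - integral {c..d} (\<lambda>t. \<psi> t *\<^sub>R f' t)"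
        using e a[THEN set_lebesgue_integral_eq_integral(1)] by (simp add: integral_add add_eq_0_iff)
      then show ?thesis
      proof -
        have 1: "integral\<^sup>L (lebesgue_on {A<..<B}) (\<lambda>t. \<psi> t *\<^sub>R f' t) = integral {c..d} (\<lambda>t. \<psi> t *\<^sub>R f' t)"
          by (rule integral_lebesgue_on_supported[OF a(1) sub]) (use out in force)+
        have 2: "integral\<^sup>L (lebesgue_on {A<..<B}) (\<lambda>t. \<psi>' t *\<^sub>R f t) = integral {c..d} (\<lambda>t. \<psi>' t *\<^sub>R f t)"
          by (rule integral_lebesgue_on_supported[OF a(2) sub]) (use out in force)+
        show ?thesis unfolding 1 2 by fact
      qed
    qed
  qed
qed

lemma AE_lebesgueE:
  assumes "AE x in lebesgue. P (x::real)"
  obtains N where "negligible N" "\<And>x. x \<notin> N \<Longrightarrow> P x"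
  using assms that by (auto simp: eventually_ae_filter negligible_iff_null_sets)

lemma AE_lebesgueI:
  assumes "negligible N" "\<And>x. x \<notin> N \<Longrightarrow> P (x::real)"
  shows "AE x in lebesgue. P x"
  using assms by (auto simp: eventually_ae_filter negligible_iff_null_sets)

lemma continuous_eq_off_negligible_UNIV:
  fixes f g :: "real \<Rightarrow> 'b::real_normed_vector"
  assumes "continuous_on UNIV f" "continuous_on UNIV g" "negligible N" "\<And>x. x \<notin> N \<Longrightarrow> f x = g x"
  shows "f x = g x"
proof (rule continuous_eq_off_negligible[where c = "x - 1" and d = "x + 1" and N = N])
  show "continuous_on {x - 1..x + 1} f" "continuous_on {x - 1..x + 1} g"
    using assms continuous_on_subset by blast+
qed (use assms in auto)

text \<open>Applied with \<open>P\<close> a function minus the primitive it should have: an integral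
  equation known between points off a null set then holds on the whole closed interval.\<close>

lemma constant_off_negligible:
  fixes P :: "real \<Rightarrow> 'b::real_normed_vector"
  assumes P: "continuous_on {c..d} P" "c < d" and N: "negligible N"
    and eq: "\<And>x y. \<lbrakk>c < x; x \<le> y; y < d; x \<notin> N; y \<notin> N\<rbrakk> \<Longrightarrow> P x = P y" and x: "x \<in> {c..d}"
  shows "P x = P c"
proof -
  obtain x0 where x0: "x0 \<in> {c<..<d}" "x0 \<notin> N"
    using not_negligible_interval[OF P(2)] N negligible_subset by blast
  have "P x = P x0" if "x \<in> {c..d}" for x
  proof (rule continuous_eq_off_negligible[OF P(1) _ N P(2) _ that])
    show "P z = P x0" if z: "c < z" "z < d" "z \<notin> N" for z
    proof (cases "z \<le> x0")
      case True then show ?thesis using z x0 by (intro eq) auto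
    next
      case False then show ?thesis using z x0 by (intro eq[symmetric]) auto
    qed
  qed simp
  from this[of x] this[of c] x P(2) show ?thesis by simp
qed

text \<open>This union is invariant under integer translations, so off it a periodicity known almost
  everywhere can be iterated.\<close>

lemma negligible_int_translates:
  assumes "negligible N" shows "negligible (\<Union>l::int. (+) (of_int l :: real) ` N)"
  using assms by (intro negligible_countable_Union) (auto intro: negligible_translation)

section \<open>Regular representatives and the first-order system\<close>

text \<open>Composition with the fractional part makes a Borel version exactly periodic, and
  clipping makes the bounds exact. Agreement with \<open>r\<close> survives because the exceptional
  set is enlarged to a translation invariant null set.\<close>

lemma ex_regular_density:
  assumes r: "Linf_real r" and p: "periodic_coeff r0 r1 r"
  obtains rh where "rh \<in> borel_measurable borel" "\<And>x. r0 \<le> rh x" "\<And>x. rh x \<le> r1" "\<And>x. rh (x + 1) = rh x"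
    "AE x in lebesgue. r x = rh x"
proof -
  have p1: "AE x in lebesgue. r0 \<le> r x \<and> r x \<le> r1" and p2: "AE x in lebesgue. r (x + 1) = r x"
    using p by (simp_all only: periodic_coeff_def)
  have "r \<in> borel_measurable lebesgue" using r by (simp add: Linf_real_def)
  from completion_ex_borel_measurable_real[OF this]
  obtain g where g: "g \<in> borel_measurable lborel" "AE x in lborel. r x = g x" by auto
  have "AE x in lebesgue. r x = g x" using g(2) by (rule AE_completion)
  then obtain N1 where N1: "negligible N1" "\<And>x. x \<notin> N1 \<Longrightarrow> r x = g x" by (rule AE_lebesgueE) blast
  obtain N2 where N2: "negligible N2" "\<And>x. x \<notin> N2 \<Longrightarrow> r0 \<le> r x \<and> r x \<le> r1"
    using p1 by (rule AE_lebesgueE) blast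
  obtain N3 where N3: "negligible N3" "\<And>x. x \<notin> N3 \<Longrightarrow> r (x + 1) = r x"
    using p2 by (rule AE_lebesgueE) blast
  define N where "N = (\<Union>l::int. (+) (of_int l :: real) ` (N1 \<union> N2 \<union> N3))"
  have N: "negligible N" unfolding N_def by (intro negligible_int_translates negligible_Un N1 N2 N3)
  have notN: "x + of_int l \<notin> N1 \<union> N2 \<union> N3" if "x \<notin> N" for x and l :: int
  proof
    assume "x + of_int l \<in> N1 \<union> N2 \<union> N3"
    then have "x \<in> (+) (of_int (-l)) ` (N1 \<union> N2 \<union> N3)" by (auto intro!: image_eqI[where x = "x + of_int l"])
    then show False using that unfolding N_def by blast
  qed
  have per: "r (x + of_int l) = r x" if x: "x \<notin> N" for x and l :: int
  proof (induction l rule: int_induct[where k = 0])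
    case (step1 i)
    have "r (x + of_int i + 1) = r (x + of_int i)" using notN[OF x, of i] N3(2) by auto
    then show ?case using step1 by (simp add: add.assoc)
  next
    case (step2 i)
    have e: "x + of_int (i - 1) + 1 = x + of_int i" by simp
    have "r (x + of_int i) = r (x + of_int (i - 1))"
      using notN[OF x, of "i - 1"] N3(2)[of "x + of_int (i - 1)"] unfolding e by blast
    then show ?case using step2 by simp
  qed simp
  have "N \<noteq> UNIV" using N by force
  then obtain z where "z \<notin> N" by auto
  \<comment> \<open>One good point shows \<open>r0 \<le> r1\<close>, without which the clipping
    would not respect the lower bound.\<close>
  from notN[OF this, of 0] have r01: "r0 \<le> r1" using N2(2)[of z] by auto
  define rh where "rh x = min r1 (max r0 (g (frac x)))" for x
  show ?thesis
  proof (rule that)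
    have [measurable]: "(frac :: real \<Rightarrow> real) \<in> borel_measurable borel" by (simp add: frac_def[abs_def])
    have [measurable]: "g \<in> borel_measurable borel" using g(1) by simp
    show "rh \<in> borel_measurable borel" unfolding rh_def[abs_def] by measurable
    show "r0 \<le> rh x" "rh x \<le> r1" for x using r01 by (auto simp: rh_def)
    show "rh (x + 1) = rh x" for x by (simp add: rh_def frac_1_eq)
    show "AE x in lebesgue. r x = rh x"
    proof (rule AE_lebesgueI[OF N])
      fix x assume x: "x \<notin> N"
      have f: "frac x = x + of_int (- \<lfloor>x\<rfloor>)" by (simp add: frac_def)
      have "g (frac x) = r (frac x)" using notN[OF x, of "- \<lfloor>x\<rfloor>"] N1(2) f by auto
      also have "\<dots> = r x" using per[OF x] f by metis
      finally have "g (frac x) = r x" .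
      then show "r x = rh x" using notN[OF x, of 0] N2(2)[of x] by (auto simp: rh_def)
    qed
  qed
qed

lemma test_fun_deriv_zero:
  assumes "test_fun I \<psi> \<psi>'"
  obtains K where "compact K" "K \<subseteq> I" "\<And>t. t \<notin> K \<Longrightarrow> \<psi> t = 0" "\<And>t. t \<notin> K \<Longrightarrow> \<psi>' t = 0"
proof -
  obtain K where K: "compact K" "K \<subseteq> I" "\<And>t. t \<notin> K \<Longrightarrow> \<psi> t = 0" using assms unfolding test_fun_def by auto
  show ?thesis
  proof (rule that[OF K])
    fix t assume "t \<notin> K"
    have "((\<lambda>_. 0) has_vector_derivative 0) (at t)" by simp
    then have "(\<psi> has_vector_derivative 0) (at t)"
      by (rule has_vector_derivative_transform_within_open[where S = "- K"])
        (use K \<open>t \<notin> K\<close> compact_imp_closed in auto)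
    moreover have "(\<psi> has_vector_derivative \<psi>' t) (at t)" using assms by (auto simp: test_fun_def)
    ultimately show "\<psi>' t = 0" using vector_derivative_unique_at by blast
  qed
qed

text \<open>A test function on the smaller set is one on the larger set, with unchanged integrals;
  this brings a weak derivative on the whole line to bounded intervals.\<close>

lemma weak_deriv_subset:
  fixes f g :: "real \<Rightarrow> 'b::euclidean_space"
  assumes w: "weak_deriv I f g" and J: "J \<subseteq> I" "I \<in> sets lebesgue" "J \<in> sets lebesgue"
  shows "weak_deriv J f g"
  unfolding weak_deriv_def
proof (intro conjI allI impI)
  show "loc_integrable J f" "loc_integrable J g"
    using w J by (auto simp: weak_deriv_def loc_integrable_def)
  fix \<psi> \<psi>' :: "real \<Rightarrow> real" assume t: "test_fun J \<psi> \<psi>'"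
  then have tI: "test_fun I \<psi> \<psi>'" using J unfolding test_fun_def by blast
  obtain K where K: "K \<subseteq> J" "\<And>t. t \<notin> K \<Longrightarrow> \<psi> t = 0" "\<And>t. t \<notin> K \<Longrightarrow> \<psi>' t = 0"
    using test_fun_deriv_zero[OF t] by metis
  have e: "integral\<^sup>L (lebesgue_on I) (\<lambda>t. \<eta> t *\<^sub>R h t) = integral\<^sup>L (lebesgue_on J) (\<lambda>t. \<eta> t *\<^sub>R h t)"
    if "\<And>t. t \<notin> K \<Longrightarrow> \<eta> t = 0" for \<eta> :: "real \<Rightarrow> real" and h :: "real \<Rightarrow> 'b"
  proof -
    have "(\<lambda>x. indicator I x *\<^sub>R \<eta> x *\<^sub>R h x) = (\<lambda>x. indicator J x *\<^sub>R \<eta> x *\<^sub>R h x)"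
      using K(1) J(1) that by (fastforce simp: indicator_def fun_eq_iff)
    then show ?thesis using J by (simp add: integral_restrict_space)
  qed
  show "integral\<^sup>L (lebesgue_on J) (\<lambda>t. \<psi>' t *\<^sub>R f t) = - integral\<^sup>L (lebesgue_on J) (\<lambda>t. \<psi> t *\<^sub>R g t)"
    using w tI e[where \<eta> = \<psi> and h = g, OF K(2)] e[where \<eta> = \<psi>' and h = f, OF K(3)] by (simp add: weak_deriv_def)
qed

lemma dense_off_negligible:
  assumes "negligible (N::real set)" shows "closure (- N) = UNIV"
proof (rule ccontr)
  assume "closure (- N) \<noteq> UNIV"
  then have "- closure (- N) \<noteq> {}" by auto
  moreover have "open (- closure (- N))" by (simp add: open_Compl)
  moreover have "- N \<subseteq> closure (- N)" by (rule closure_subset)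
  then have "negligible (- closure (- N))" by (intro negligible_subset[OF assms]) auto
  ultimately show False using open_not_negligible by metis
qed

text \<open>A bounded weak derivative makes \<open>a\<close> Lipschitz off a null set. The
  complement of that set is dense, so \<open>a\<close> extends continuously from it, and bounds and
  periodicity pass to the extension.\<close>

lemma ex_regular_stiffness:
  assumes a: "W1inf_real a" and p: "periodic_coeff a0 a1 a"
  obtains ah where "continuous_on UNIV ah" "\<And>x. a0 \<le> ah x" "\<And>x. ah x \<le> a1" "\<And>x. ah (x + 1) = ah x"
    "AE x in lebesgue. a x = ah x"
proof -
  have p1: "AE x in lebesgue. a0 \<le> a x \<and> a x \<le> a1" and p2: "AE x in lebesgue. a (x + 1) = a x"
    using p by (simp_all only: periodic_coeff_def)
  obtain g where g: "weak_deriv UNIV a g" "Linf_real g" using a by (auto simp: W1inf_real_def)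
  obtain C where C: "AE x in lebesgue. \<bar>g x\<bar> \<le> C" using g(2) by (auto simp: Linf_real_def)
  then obtain N0 where N0: "negligible N0" "\<And>x. x \<notin> N0 \<Longrightarrow> \<bar>g x\<bar> \<le> C" by (rule AE_lebesgueE) blast
  have "weak_deriv {- real n<..<real n} a g" for n by (rule weak_deriv_subset[OF g(1)]) auto
  then have "\<exists>N. negligible N \<and> (\<forall>x y. - real n < x \<longrightarrow> x \<le> y \<longrightarrow> y < real n \<longrightarrow> x \<notin> N \<longrightarrow> y \<notin> N \<longrightarrow> a y - a x = integral {x..y} g)" for n
    using weak_deriv_integral by metis
  then obtain M where M: "\<And>n. negligible (M n)"
     "\<And>n x y. \<lbrakk>- real n < x; x \<le> y; y < real n; x \<notin> M n; y \<notin> M n\<rbrakk> \<Longrightarrow> a y - a x = integral {x..y} g" by metis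
  define N where "N = (\<Union>n. M n)"
  have N: "negligible N" unfolding N_def by (intro negligible_countable_Union) (auto intro: M)
  have C0: "0 \<le> C"
  proof -
    have "N0 \<noteq> UNIV" using N0 by force
    then show ?thesis using N0(2) by (metis UNIV_eq_I abs_ge_zero order_trans)
  qed
  have lip: "\<bar>a y - a x\<bar> \<le> C * (y - x)" if "x \<le> y" "x \<notin> N" "y \<notin> N" for x y
  proof -
    obtain n :: nat where n: "max \<bar>x\<bar> \<bar>y\<bar> < real n" using reals_Archimedean2 by blast
    have e: "a y - a x = integral {x..y} g"
      by (rule M(2)[of n]) (use n that in \<open>auto simp: N_def\<close>)
    \<comment> \<open>Changed on the null set where the bound fails, so that it holds pointwise. If
      \<open>g'\<close> were not integrable, its gauge integral would be 0 and the estimate would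
      hold all the same.\<close>
    define g' where "g' t = (if t \<in> N0 then 0 else g t)" for t
    have "integral {x..y} g = integral {x..y} g'" by (rule integral_spike[OF N0(1)]) (auto simp: g'_def)
    moreover have "norm (integral {x..y} g') \<le> C * (y - x)"
    proof (cases "g' integrable_on {x..y}")
      case True
      have "norm (integral {x..y} g') \<le> integral {x..y} (\<lambda>_. C)"
        by (rule integral_norm_bound_integral[OF True]) (use N0(2) C0 in \<open>auto simp: g'_def integrable_const_ivl\<close>)
      then show ?thesis using that by (simp add: mult.commute)
    next
      case False then show ?thesis using C0 that by (simp add: not_integrable_integral)
    qed
    ultimately show ?thesis using e by simp
  qed
  have "uniformly_continuous_on (- N) a"
  proof (rule lipschitz_on_uniformly_continuous[of C])
    show "C-lipschitz_on (- N) a"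
    proof (rule lipschitz_onI[OF _ C0])
      fix x y assume "x \<in> - N" "y \<in> - N"
      then show "dist (a x) (a y) \<le> C * dist x y"
        using lip[of x y] lip[of y x] by (cases "x \<le> y") (auto simp: dist_real_def)
    qed
  qed
  then obtain ah where ah: "uniformly_continuous_on (closure (- N)) ah" "\<And>x. x \<in> - N \<Longrightarrow> a x = ah x"
    by (rule uniformly_continuous_on_extension_on_closure) blast
  have c: "continuous_on UNIV ah"
    using uniformly_continuous_imp_continuous[OF ah(1)] by (simp add: dense_off_negligible[OF N])
  obtain N2 where N2: "negligible N2" "\<And>x. x \<notin> N2 \<Longrightarrow> a0 \<le> a x \<and> a x \<le> a1"
    using p1 by (rule AE_lebesgueE) blast
  obtain N3 where N3: "negligible N3" "\<And>x. x \<notin> N3 \<Longrightarrow> a (x + 1) = a x"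
    using p2 by (rule AE_lebesgueE) blast
  show ?thesis
  proof (rule that[OF c])
    \<comment> \<open>As an equation between continuous functions the inequality extends from a
      dense set.\<close>
    have "max a0 (ah x) = ah x" for x
      by (rule continuous_eq_off_negligible_UNIV[OF _ c negligible_Un[OF N N2(1)]])
        (use ah N2 in \<open>force intro!: continuous_intros c\<close>)+
    then show "a0 \<le> ah x" for x by (metis max.cobounded1)
    have "min a1 (ah x) = ah x" for x
      by (rule continuous_eq_off_negligible_UNIV[OF _ c negligible_Un[OF N N2(1)]])
        (use ah N2 in \<open>force intro!: continuous_intros c\<close>)+
    then show "ah x \<le> a1" for x by (metis min.cobounded1)
    show "ah (x + 1) = ah x" for x
    proof (rule continuous_eq_off_negligible_UNIV[OF _ c])
      show "negligible (N \<union> N3 \<union> (+) (-1) ` N)" by (intro negligible_Un N N3 negligible_translation)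
      show "continuous_on UNIV (\<lambda>x. ah (x + 1))"
        by (intro continuous_on_compose2[OF c] continuous_intros) auto
      fix x assume x: "x \<notin> N \<union> N3 \<union> (+) (-1) ` N"
      have "x + 1 \<notin> N"
      proof
        assume "x + 1 \<in> N"
        then have "x \<in> (+) (-1) ` N" by (intro image_eqI[where x = "x + 1"]) auto
        then show False using x by auto
      qed
      then show "ah (x + 1) = ah x" using ah(2)[of x] ah(2)[of "x + 1"] N3(2)[of x] x by auto
    qed
    show "AE x in lebesgue. a x = ah x" by (rule AE_lebesgueI[OF N]) (use ah in auto)
  qed
qed

text \<open>\<open>Q\<close> stands for the flux \<open>a W'\<close>; the system is imposed on \<open>[0, d]\<close> only.\<close>

definition int_sol :: "(real \<Rightarrow> real) \<Rightarrow> (real \<Rightarrow> real) \<Rightarrow> real \<Rightarrow> real \<Rightarrow> (real \<Rightarrow> complex) \<Rightarrow> (real \<Rightarrow> complex) \<Rightarrow> bool" where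
  "int_sol a r \<Lambda> d W Q \<longleftrightarrow> continuous_on UNIV W \<and> continuous_on UNIV Q \<and>
     (\<forall>x. 0 \<le> x \<and> x \<le> d \<longrightarrow>
        W x = W 0 + integral {0..x} (\<lambda>t. of_real (inverse (a t)) * Q t) \<and>
        Q x = Q 0 + integral {0..x} (\<lambda>t. of_real (- \<Lambda> * r t) * W t))"

lemma int_solD:
  assumes "int_sol a r \<Lambda> d W Q"
  shows "continuous_on UNIV W" "continuous_on UNIV Q" "loc_bounded W" "loc_bounded Q"
    and "\<And>x. 0 \<le> x \<Longrightarrow> x \<le> d \<Longrightarrow> W x = W 0 + integral {0..x} (\<lambda>t. of_real (inverse (a t)) * Q t)"
    and "\<And>x. 0 \<le> x \<Longrightarrow> x \<le> d \<Longrightarrow> Q x = Q 0 + integral {0..x} (\<lambda>t. of_real (- \<Lambda> * r t) * W t)"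
proof -
  show "continuous_on UNIV W" "continuous_on UNIV Q" using assms unfolding int_sol_def by blast+
  then show "loc_bounded W" "loc_bounded Q" by (auto intro: loc_bounded_continuous)
qed (use assms int_sol_def in blast)+

text \<open>Periodicity is left to an extension of this locale, because these results are also
  applied to \<open>osc \<epsilon> a\<close> and \<open>osc \<epsilon> r\<close>, which satisfy the
  same bounds but need not have period 1.\<close>

locale coefficients =
  fixes a r :: "real \<Rightarrow> real" and a0 a1 r0 r1 :: real
  assumes a_cont: "continuous_on UNIV a" and a_ge: "a0 \<le> a x" and a_le: "a x \<le> a1" and a0: "0 < a0"
    and r_meas: "r \<in> borel_measurable borel" and r_ge: "r0 \<le> r x" and r_le: "r x \<le> r1" and r0: "0 < r0"
begin

lemma a_pos: "0 < a x" using a_ge[of x] a0 by linarith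
lemma r_pos: "0 < r x" using r_ge[of x] r0 by linarith

lemma loc_bounded_r: "loc_bounded r"
  by (rule loc_boundedI[OF r_meas, of r1]) (use r_le r_pos in \<open>auto simp: less_imp_le\<close>)

lemma continuous_inverse_a: "continuous_on S (\<lambda>t. inverse (a t))"
  using a_pos by (intro continuous_intros continuous_on_subset[OF a_cont]) (auto simp: less_imp_neq[symmetric])

lemma loc_bounded_inverse_a: "loc_bounded (\<lambda>t. inverse (a t))"
  by (intro loc_bounded_continuous continuous_inverse_a)

lemma loc_bounded_rhs1: "loc_bounded Q \<Longrightarrow> loc_bounded (\<lambda>t. complex_of_real (inverse (a t)) * Q t)"
  by (intro loc_bounded_mult loc_bounded_of_real loc_bounded_inverse_a)

lemma loc_bounded_rhs2: "loc_bounded W \<Longrightarrow> loc_bounded (\<lambda>t. complex_of_real (- \<Lambda> * r t) * W t)"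
  by (intro loc_bounded_mult loc_bounded_of_real loc_bounded_r loc_bounded_const)

lemma int_sol_osc:
  assumes "0 < \<epsilon>" shows "coefficients (osc \<epsilon> a) (osc \<epsilon> r) a0 a1 r0 r1"
proof
  show "continuous_on UNIV (osc \<epsilon> a)"
    unfolding osc_def[abs_def] using assms by (intro continuous_on_compose2[OF a_cont] continuous_intros) auto
  show "osc \<epsilon> r \<in> borel_measurable borel"
    using loc_bounded_scale[OF loc_bounded_r] unfolding osc_def[abs_def] by (rule loc_bounded_measurable)
qed (use a_ge a_le a0 r_ge r_le r0 in \<open>auto simp: osc_def\<close>)

text \<open>The chain rule puts a factor \<open>1 / \<epsilon>\<close> on the flux and hence
  \<open>1 / \<epsilon>\<^sup>2\<close> on the eigenvalue.\<close>

lemma int_sol_scale: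
  assumes s: "int_sol a r \<Lambda> d W Q" and e: "0 < \<epsilon>"
  shows "int_sol (osc \<epsilon> a) (osc \<epsilon> r) (\<Lambda> / \<epsilon>\<^sup>2) (\<epsilon> * d) (\<lambda>x. W (x / \<epsilon>)) (\<lambda>x. Q (x / \<epsilon>) / of_real \<epsilon>)"
  unfolding int_sol_def
proof (intro conjI allI impI)
  have c: "continuous_on UNIV W" "continuous_on UNIV Q" using s by (auto simp: int_sol_def)
  show "continuous_on UNIV (\<lambda>x. W (x / \<epsilon>))"
    by (rule continuous_on_compose2[OF c(1)]) (use e in \<open>auto intro: continuous_intros\<close>)
  have "continuous_on UNIV (\<lambda>x. Q (x / \<epsilon>))"
    by (rule continuous_on_compose2[OF c(2)]) (use e in \<open>auto intro: continuous_intros\<close>)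
  then show "continuous_on UNIV (\<lambda>x. Q (x / \<epsilon>) / of_real \<epsilon>)"
    using e by (intro continuous_on_divide continuous_on_const) auto
  fix x assume x: "0 \<le> x \<and> x \<le> \<epsilon> * d"
  then have x': "0 \<le> x / \<epsilon>" "x / \<epsilon> \<le> d" using e by (auto simp: field_simps)
  have l: "loc_bounded W" "loc_bounded Q" using c by (auto intro: loc_bounded_continuous)
  have "integral {0..x} (\<lambda>t. of_real (inverse (osc \<epsilon> a t)) * (Q (t / \<epsilon>) / of_real \<epsilon>))
    = integral {0..x} (\<lambda>t. (of_real (inverse (a (t / \<epsilon> + 0))) * Q (t / \<epsilon> + 0))) * inverse (of_real \<epsilon>)"
    by (subst integral_mult_left[symmetric], rule integral_cong) (simp add: osc_def divide_inverse)
  also have "\<dots> = integral {0..x / \<epsilon>} (\<lambda>t. of_real (inverse (a t)) * Q t)"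
    using integral_affine[OF loc_bounded_rhs1[OF l(2)] e, of 0 x 0] e by (simp add: scaleR_conv_of_real)
  finally show "W (x / \<epsilon>) = W (0 / \<epsilon>) + integral {0..x} (\<lambda>t. of_real (inverse (osc \<epsilon> a t)) * (Q (t / \<epsilon>) / of_real \<epsilon>))"
    using int_solD(5)[OF s x'] by simp
  have "integral {0..x} (\<lambda>t. of_real (- (\<Lambda> / \<epsilon>\<^sup>2) * osc \<epsilon> r t) * W (t / \<epsilon>))
    = integral {0..x} (\<lambda>t. (of_real (- \<Lambda> * r (t / \<epsilon> + 0)) * W (t / \<epsilon> + 0))) * inverse (of_real (\<epsilon>\<^sup>2))"
    by (subst integral_mult_left[symmetric], rule integral_cong) (simp add: osc_def divide_inverse)
  also have "\<dots> = integral {0..x / \<epsilon>} (\<lambda>t. of_real (- \<Lambda> * r t) * W t) / of_real \<epsilon>"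
    unfolding integral_affine[OF loc_bounded_rhs2[OF l(1)] e]
    using e by (simp add: scaleR_conv_of_real power2_eq_square divide_inverse)
  finally show "Q (x / \<epsilon>) / of_real \<epsilon> = Q (0 / \<epsilon>) / of_real \<epsilon> + integral {0..x} (\<lambda>t. of_real (- (\<Lambda> / \<epsilon>\<^sup>2) * osc \<epsilon> r t) * W (t / \<epsilon>))"
    using int_solD(6)[OF s x'] by (simp add: add_divide_distrib diff_divide_distrib)
qed

end

locale periodic_coefficients = coefficients +
  assumes a_periodic: "a (x + 1) = a x" and r_periodic: "r (x + 1) = r x"

section \<open>Continuous representatives of Bloch waves and of physical eigenfunctions\<close>

lemma weak_deriv_representative:
  fixes f g :: "real \<Rightarrow> complex"
  assumes w: "weak_deriv {A<..<B} f g" and cd: "A < c" "c < d" "d < B"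
  obtains F N where "continuous_on {c..d} F" "negligible N" "\<And>x. x \<in> {c..d} \<Longrightarrow> x \<notin> N \<Longrightarrow> F x = f x"
proof -
  obtain N where N: "negligible N" "\<And>x y. \<lbrakk>A < x; x \<le> y; y < B; x \<notin> N; y \<notin> N\<rbrakk> \<Longrightarrow> f y - f x = integral {x..y} g"
    using weak_deriv_integral[OF w] by blast
  have "g absolutely_integrable_on {c..d}"
    using w cd by (auto simp: weak_deriv_def intro: loc_integrable_absolutely_integrable)
  then have gi: "g integrable_on {c..d}" using set_lebesgue_integral_eq_integral(1) by blast
  obtain x0 where x0: "x0 \<in> {c<..<d}" "x0 \<notin> N"
    using not_negligible_interval[OF cd(2)] N(1) negligible_subset by blast
  define F where "F x = f x0 + (integral {c..x} g - integral {c..x0} g)" for x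
  have diff: "integral {c..y} g - integral {c..x} g = integral {x..y} g" if "c \<le> x" "x \<le> y" "y \<le> d" for x y
    using Henstock_Kurzweil_Integration.integral_combine[OF that(1,2) integrable_subinterval_real[OF gi]] that
    by (simp add: algebra_simps)
  show ?thesis
  proof (rule that[of F N])
    show "continuous_on {c..d} F"
      unfolding F_def[abs_def] by (intro continuous_intros indefinite_integral_continuous_1 gi)
    fix x assume x: "x \<in> {c..d}" "x \<notin> N"
    show "F x = f x"
    proof (cases "x0 \<le> x")
      case True
      then have "f x - f x0 = integral {c..x} g - integral {c..x0} g"
        using diff[of x0 x] N(2)[of x0 x] x x0 cd by simp
      then show ?thesis by (metis F_def add.commute diff_add_cancel)
    next
      case False
      then have "f x0 - f x = integral {c..x0} g - integral {c..x} g"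
        using diff[of x x0] N(2)[of x x0] x x0 cd by simp
      then show ?thesis by (simp add: F_def algebra_simps)
    qed
  qed (rule N(1))
qed

text \<open>The second weak derivative makes the first one continuous up to a null set;
  \<open>f\<close> minus the primitive of that continuous version is constant off a null set, hence
  constant.\<close>

lemma H2_has_continuous_derivative:
  fixes f g :: "real \<Rightarrow> complex"
  assumes w: "weak_deriv {A<..<B} f g" "weak_deriv {A<..<B} g g'" and cd: "A < c" "c < d" "d < B"
    and cf: "continuous_on UNIV f"
  obtains G where "continuous_on {c..d} G" "\<And>x. c < x \<Longrightarrow> x < d \<Longrightarrow> (f has_vector_derivative G x) (at x)"
proof -
  obtain G N1 where G: "continuous_on {c..d} G" "negligible N1" "\<And>x. x \<in> {c..d} \<Longrightarrow> x \<notin> N1 \<Longrightarrow> G x = g x"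
    using weak_deriv_representative[OF w(2) cd] by blast
  obtain N2 where N2: "negligible N2" "\<And>x y. \<lbrakk>A < x; x \<le> y; y < B; x \<notin> N2; y \<notin> N2\<rbrakk> \<Longrightarrow> f y - f x = integral {x..y} g"
    using weak_deriv_integral[OF w(1)] by blast
  have Gi: "G integrable_on {c..d}" using G(1) by (rule integrable_continuous_real)
  define P where "P x = f x - integral {c..x} G" for x
  have P: "P x = P c" if "x \<in> {c..d}" for x
  proof (rule constant_off_negligible[OF _ cd(2) N2(1) _ that])
    show "continuous_on {c..d} P" unfolding P_def[abs_def]
      by (intro continuous_intros indefinite_integral_continuous_1 Gi continuous_on_subset[OF cf]) auto
    fix x y assume xy: "c < x" "x \<le> y" "y < d" "x \<notin> N2" "y \<notin> N2"
    have "integral {c..x} G + integral {x..y} G = integral {c..y} G"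
      using xy by (intro Henstock_Kurzweil_Integration.integral_combine integrable_subinterval_real[OF Gi]) auto
    moreover have "integral {x..y} G = integral {x..y} g"
      using xy G(3) by (intro integral_spike[OF G(2)]) auto
    moreover have "f y - f x = integral {x..y} g" using N2(2) xy cd by auto
    ultimately show "P x = P y" by (simp add: P_def algebra_simps)
  qed
  have f: "f x = f c + integral {c..x} G" if "x \<in> {c..d}" for x
    using P[OF that] by (simp add: P_def algebra_simps)
  show ?thesis
  proof (rule that[OF G(1)])
    fix x assume x: "c < x" "x < d"
    have "((\<lambda>x. f c + integral {c..x} G) has_vector_derivative 0 + G x) (at x within {c..d})"
      using x by (intro has_vector_derivative_add has_vector_derivative_const integral_has_vector_derivative[OF G(1)]) auto
    then have "((\<lambda>x. f c + integral {c..x} G) has_vector_derivative G x) (at x within {c..d})" by simp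
    then have "(f has_vector_derivative G x) (at x within {c..d})"
    proof (rule has_vector_derivative_transform[rotated 2, where f = "\<lambda>x. f c + integral {c..x} G"])
      show "x \<in> {c..d}" using x by simp
    qed (rule f)
    then show "(f has_vector_derivative G x) (at x)"
      using x by (simp add: at_within_Icc_at)
  qed
qed

context periodic_coefficients
begin

text \<open>The eigenvalue equation is given on one cell only. Since the wave is of class H2 across
  the lattice points, its flux is continuous there, and the integral equation propagates from
  \<open>[0, 1]\<close> to every \<open>[0, n]\<close> by means of the multiplier of a
  period.\<close>

lemma bloch_representation:
  assumes b: "bloch_solution a' r' k \<Lambda> \<phi>"
    and aa: "AE x in lebesgue. a' x = a x" and rr: "AE x in lebesgue. r' x = r x"
  obtains q where "\<And>d. int_sol a r \<Lambda> d \<phi> q"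
    "\<And>y. \<phi> (y + 1) = exp (2 * \<i> * pi * k) * \<phi> y" "\<And>y. q (y + 1) = exp (2 * \<i> * pi * k) * q y"
    "AE y in lebesgue_on Ycell. of_real (a' y) * wderiv Ycell \<phi> y = q y"
    "AE y in lebesgue_on Ycell. wderiv Ycell \<phi> y = of_real (inverse (a y)) * q y"
    "\<And>y. (\<phi> has_vector_derivative of_real (inverse (a y)) * q y) (at y)"
proof -
  let ?\<omega> = "exp (2 * \<i> * pi * k) :: complex"
  obtain Na where Na: "negligible Na" "\<And>x. x \<notin> Na \<Longrightarrow> a' x = a x" using aa by (rule AE_lebesgueE) blast
  obtain Nr where Nr: "negligible Nr" "\<And>x. x \<notin> Nr \<Longrightarrow> r' x = r x" using rr by (rule AE_lebesgueE) blast
  have c\<phi>: "continuous_on UNIV \<phi>" using b by (simp add: bloch_solution_def)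
  have "\<forall>l::int. AE x in lebesgue. \<phi> (x + of_int l) = \<phi> x * exp (2 * \<i> * pi * k * of_int l)"
    using b unfolding bloch_solution_def Sob_bloch_def by blast
  from this[rule_format, of 1] have "AE x in lebesgue. \<phi> (x + 1) = \<phi> x * ?\<omega>" by simp
  then obtain Np where Np: "negligible Np" "\<And>x. x \<notin> Np \<Longrightarrow> \<phi> (x + 1) = \<phi> x * ?\<omega>" by (rule AE_lebesgueE) blast
  have \<phi>per: "\<phi> (y + 1) = ?\<omega> * \<phi> y" for y
  proof (rule continuous_eq_off_negligible_UNIV[OF _ _ Np(1)])
    show "continuous_on UNIV (\<lambda>x. \<phi> (x + 1))" by (intro continuous_on_compose2[OF c\<phi>] continuous_intros) auto
    show "continuous_on UNIV (\<lambda>x. ?\<omega> * \<phi> x)" by (intro continuous_intros c\<phi>)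
  qed (use Np in \<open>simp add: mult.commute\<close>)
  have loc: "\<exists>G. continuous_on {y - 1..y + 1} G \<and> (\<forall>x. y - 1 < x \<longrightarrow> x < y + 1 \<longrightarrow> (\<phi> has_vector_derivative G x) (at x))" for y
  proof -
    have "Sob 2 {y - 2<..<y + 2} \<phi>" using b by (simp add: bloch_solution_def Sob_bloch_def Sob_loc_def)
    then obtain g g' where "weak_deriv {y - 2<..<y + 2} \<phi> g" "weak_deriv {y - 2<..<y + 2} g g'"
      by (auto simp: numeral_2_eq_2)
    then show ?thesis
      by (rule H2_has_continuous_derivative[where c = "y - 1" and d = "y + 1"]) (use c\<phi> in auto)
  qed
  define D where "D y = vector_derivative \<phi> (at y)" for y
  have D: "(\<phi> has_vector_derivative D y) (at y)" for y
  proof -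
    obtain G where "\<forall>x. y - 1 < x \<longrightarrow> x < y + 1 \<longrightarrow> (\<phi> has_vector_derivative G x) (at x)" using loc by metis
    then have "(\<phi> has_vector_derivative G y) (at y)" by auto
    then show ?thesis unfolding D_def by (simp add: vector_derivative_at)
  qed
  have cD: "continuous_on UNIV D"
  proof (rule continuous_at_imp_continuous_on, rule ballI)
    fix y
    obtain G where G: "continuous_on {y - 1..y + 1} G" "\<And>x. y - 1 < x \<Longrightarrow> x < y + 1 \<Longrightarrow> (\<phi> has_vector_derivative G x) (at x)"
      using loc by metis
    have "continuous_on {y - 1<..<y + 1} D"
    proof (rule continuous_on_eq)
      show "continuous_on {y - 1<..<y + 1} G" by (rule continuous_on_subset[OF G(1)]) auto
      show "G x = D x" if "x \<in> {y - 1<..<y + 1}" for x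
        using G(2)[of x] D[of x] that vector_derivative_unique_at by auto
    qed
    then show "isCont D y" by (rule continuous_on_interior) (simp add: interior_open)
  qed
  have Dper: "D (y + 1) = ?\<omega> * D y" for y
  proof -
    have "((\<lambda>x. \<phi> (x + 1)) has_vector_derivative D (y + 1)) (at y)"
    proof -
      have "((\<lambda>x. x + 1) has_vector_derivative 1) (at y)" by (auto intro!: derivative_eq_intros)
      from vector_diff_chain_at[OF this D[of "y + 1"]] show ?thesis by (simp add: o_def)
    qed
    moreover have "((\<lambda>x. \<phi> (x + 1)) has_vector_derivative ?\<omega> * D y) (at y)"
      unfolding \<phi>per by (intro has_vector_derivative_mult_right D)
    ultimately show ?thesis by (rule vector_derivative_unique_at)
  qed
  define q where "q y = of_real (a y) * D y" for y
  have cq: "continuous_on UNIV q" unfolding q_def[abs_def] by (intro continuous_intros a_cont cD)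
  have qper: "q (y + 1) = ?\<omega> * q y" for y using Dper[of y] a_periodic[of y] by (simp add: q_def)
  have Dq: "of_real (inverse (a y)) * q y = D y" for y using a_pos[of y] by (simp add: q_def)
  have wd: "AE y in lebesgue_on Ycell. wderiv Ycell \<phi> y = D y"
    by (intro wderiv_unique weak_deriv_C1) (use D continuous_on_subset[OF cD] in auto)
  then obtain Nw where Nw: "negligible Nw" "\<And>x. x \<in> Ycell \<Longrightarrow> x \<notin> Nw \<Longrightarrow> wderiv Ycell \<phi> x = D x"
    by (rule AE_lebesgue_on_open_intervalE) auto
  let ?h = "\<lambda>t. of_real (- \<Lambda> * r t) * \<phi> t"
  have lh: "loc_bounded ?h" by (intro loc_bounded_rhs2 loc_bounded_continuous c\<phi>)
  obtain N where N: "negligible N" "\<And>x y. \<lbrakk>0 < x; x \<le> y; y < 1; x \<notin> N; y \<notin> N\<rbrakk> \<Longrightarrow>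
      of_real (a' y) * wderiv Ycell \<phi> y - of_real (a' x) * wderiv Ycell \<phi> x = integral {x..y} (\<lambda>y. - (of_real \<Lambda> * of_real (r' y) * \<phi> y))"
    using weak_deriv_integral[of 0 1] b unfolding bloch_solution_def by blast
  define P where "P x = q x - integral {0..x} ?h" for x
  have P: "P x = P 0" if "x \<in> {0..1}" for x
  proof (rule constant_off_negligible[OF _ _ _ _ that])
    show "negligible (N \<union> Na \<union> Nw)" by (intro negligible_Un N Na Nw)
    show "continuous_on {0..1} P" unfolding P_def[abs_def]
      by (intro continuous_intros indefinite_integral_continuous_1 loc_bounded_integrable lh continuous_on_subset[OF cq]) auto
    fix x y :: real assume xy: "0 < x" "x \<le> y" "y < 1" "x \<notin> N \<union> Na \<union> Nw" "y \<notin> N \<union> Na \<union> Nw"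
    have "q y - q x = integral {x..y} (\<lambda>y. - (of_real \<Lambda> * of_real (r' y) * \<phi> y))"
      using N(2)[of x y] Na(2)[of x] Na(2)[of y] Nw(2)[of x] Nw(2)[of y] xy by (simp add: q_def)
    also have "\<dots> = integral {x..y} ?h"
      by (rule integral_spike[OF Nr(1)]) (use Nr(2) in auto)
    finally show "P x = P y"
      using loc_bounded_integral_combine[OF lh, of 0 x y] xy by (simp add: P_def algebra_simps)
  qed auto
  have q01: "q x = q 0 + integral {0..x} ?h" if "0 \<le> x" "x \<le> 1" for x
    using P[of x] that by (simp add: P_def algebra_simps)
  \<comment> \<open>Beyond 1 the equation is pulled back by one period: \<open>q\<close> and the
    integrand both acquire the factor \<open>\<omega>\<close>, and \<open>\<omega> * q 0\<close> is
    \<open>q 1\<close>.\<close>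
  have qn: "\<forall>x. 0 \<le> x \<and> x \<le> real n \<longrightarrow> q x = q 0 + integral {0..x} ?h" for n
  proof (induction n)
    case 0
    then show ?case by auto
  next
    case (Suc n)
    show ?case
    proof (intro allI impI)
      fix x assume x: "0 \<le> x \<and> x \<le> real (Suc n)"
      show "q x = q 0 + integral {0..x} ?h"
      proof (cases "x \<le> 1")
        case True then show ?thesis using q01 x by blast
      next
        case False
        have hper: "?h (t + 1) = ?\<omega> * ?h t" for t by (simp add: r_periodic \<phi>per)
        have "integral {0..x - 1} (\<lambda>t. ?h (t / 1 + 1)) = 1 *\<^sub>R integral {0 / 1 + 1..(x - 1) / 1 + 1} ?h"
          by (rule integral_affine[OF lh]) simp
        then have "integral {1..x} ?h = integral {0..x - 1} (\<lambda>t. ?h (t + 1))" by simp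
        also have "\<dots> = integral {0..x - 1} (\<lambda>t. ?\<omega> * ?h t)" unfolding hper ..
        finally have sh: "integral {1..x} ?h = ?\<omega> * integral {0..x - 1} ?h" unfolding integral_mult_right .
        have "q x = ?\<omega> * q (x - 1)" using qper[of "x - 1"] by simp
        also have "\<dots> = ?\<omega> * q 0 + ?\<omega> * integral {0..x - 1} ?h"
          using Suc.IH[rule_format, of "x - 1"] x False by (simp add: distrib_left right_diff_distrib)
        also have "\<dots> = q 1 + integral {1..x} ?h" using qper[of 0] sh by simp
        also have "\<dots> = q 0 + (integral {0..1} ?h + integral {1..x} ?h)" using q01[of 1] by simp
        also have "\<dots> = q 0 + integral {0..x} ?h" using loc_bounded_integral_combine[OF lh, of 0 1 x] False by simp
        finally show ?thesis .
      qed
    qed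
  qed
  show ?thesis
  proof (rule that[of q])
    show "int_sol a r \<Lambda> d \<phi> q" for d
      unfolding int_sol_def
    proof (intro conjI c\<phi> cq allI impI)
      fix x assume x: "0 \<le> x \<and> x \<le> d"
      have "(D has_integral \<phi> x - \<phi> 0) {0..x}"
        by (rule fundamental_theorem_of_calculus) (use x has_vector_derivative_at_within[OF D] in auto)
      from integral_unique[OF this]
      show "\<phi> x = \<phi> 0 + integral {0..x} (\<lambda>t. of_real (inverse (a t)) * q t)"
        unfolding Dq by simp
      obtain n where "x \<le> real n" using real_arch_simple by blast
      then show "q x = q 0 + integral {0..x} ?h" using qn[rule_format, of x n] x by simp
    qed
    show "AE y in lebesgue_on Ycell. of_real (a' y) * wderiv Ycell \<phi> y = q y"
      by (rule AE_lebesgue_on_negligible[OF negligible_Un[OF Na(1) Nw(1)]]) (use Na Nw in \<open>auto simp: q_def\<close>)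
    show "AE y in lebesgue_on Ycell. wderiv Ycell \<phi> y = of_real (inverse (a y)) * q y"
      unfolding Dq by (rule wd)
    show "(\<phi> has_vector_derivative of_real (inverse (a y)) * q y) (at y)" for y
      unfolding Dq by (rule D)
  qed (rule \<phi>per qper)+
qed

end

context coefficients
begin

text \<open>The flux is built backwards from the equation, as a constant plus the integral of the
  right-hand side. The constant is read off at one good point; the weak equation then gives
  agreement with coefficient times weak derivative almost everywhere.\<close>

lemma physical_representation:
  assumes p: "physical_eigen \<alpha> a' r' \<Lambda> w" and \<alpha>: "0 < \<alpha>"
    and aa: "AE x in lebesgue. a' x = a x" and rr: "AE x in lebesgue. r' x = r x"
  obtains W Q where "int_sol a r \<Lambda> \<alpha> W Q" "\<And>x. 0 \<le> x \<Longrightarrow> x \<le> \<alpha> \<Longrightarrow> W x = w x"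
    "AE x in lebesgue_on (Omega \<alpha>). wderiv (Omega \<alpha>) w x = of_real (inverse (a x)) * Q x"
proof -
  obtain Na where Na: "negligible Na" "\<And>x. x \<notin> Na \<Longrightarrow> a' x = a x" using aa by (rule AE_lebesgueE) blast
  obtain Nr where Nr: "negligible Nr" "\<And>x. x \<notin> Nr \<Longrightarrow> r' x = r x" using rr by (rule AE_lebesgueE) blast
  \<comment> \<open>Clamping to \<open>[0, \<alpha>]\<close> extends functions continuously to the
    line: \<open>int_sol\<close> asks for continuity everywhere but for the equations on the
    interval only.\<close>
  define cl where "cl x = max 0 (min \<alpha> x)" for x :: real
  have ccl: "continuous_on UNIV cl" unfolding cl_def[abs_def] by (intro continuous_intros)
  have cl: "cl x \<in> {0..\<alpha>}" "x \<in> {0..\<alpha>} \<Longrightarrow> cl x = x" for x using \<alpha> by (auto simp: cl_def)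
  define W where "W x = w (cl x)" for x
  have cW: "continuous_on UNIV W"
    unfolding W_def[abs_def] using p cl by (intro continuous_on_compose2[OF _ ccl, of "{0..\<alpha>}" w]) (auto simp: physical_eigen_def)
  have Ww: "W x = w x" if "0 \<le> x" "x \<le> \<alpha>" for x using cl that by (simp add: W_def)
  let ?h = "\<lambda>t. of_real (- \<Lambda> * r t) * W t"
  have lh: "loc_bounded ?h" by (intro loc_bounded_rhs2 loc_bounded_continuous cW)
  obtain N where N: "negligible N" "\<And>x y. \<lbrakk>0 < x; x \<le> y; y < \<alpha>; x \<notin> N; y \<notin> N\<rbrakk> \<Longrightarrow>
      of_real (a' y) * wderiv (Omega \<alpha>) w y - of_real (a' x) * wderiv (Omega \<alpha>) w x
       = integral {x..y} (\<lambda>y. - (of_real \<Lambda> * of_real (r' y) * w y))"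
    using weak_deriv_integral[of 0 \<alpha>] p unfolding physical_eigen_def by blast
  define I where "I x = integral {0..x} ?h" for x
  have Id: "integral {x..y} (\<lambda>y. - (of_real \<Lambda> * of_real (r' y) * w y)) = I y - I x" if "0 \<le> x" "x \<le> y" "y \<le> \<alpha>" for x y
  proof -
    have "integral {x..y} (\<lambda>y. - (of_real \<Lambda> * of_real (r' y) * w y)) = integral {x..y} ?h"
      by (rule integral_spike[OF Nr(1)]) (use Nr(2) Ww that in auto)
    then show ?thesis using loc_bounded_integral_combine[OF lh, of 0 x y] that by (simp add: I_def algebra_simps)
  qed
  obtain x0 where x0: "x0 \<in> Omega \<alpha>" "x0 \<notin> N \<union> Na"
    using not_negligible_interval[OF \<alpha>] negligible_Un[OF N(1) Na(1)] negligible_subset by blast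
  define C where "C = of_real (a' x0) * wderiv (Omega \<alpha>) w x0 - I x0"
  define Q where "Q x = C + I (cl x)" for x
  have cI: "continuous_on {0..\<alpha>} I" unfolding I_def[abs_def]
    by (intro indefinite_integral_continuous_1 loc_bounded_integrable lh)
  have cQ: "continuous_on UNIV Q"
    unfolding Q_def[abs_def] using cl by (intro continuous_intros continuous_on_compose2[OF cI ccl]) auto
  have Qa: "of_real (a' x) * wderiv (Omega \<alpha>) w x = Q x" if x: "x \<in> Omega \<alpha>" "x \<notin> N" for x
  proof (cases "x0 \<le> x")
    case True
    then have "of_real (a' x) * wderiv (Omega \<alpha>) w x - of_real (a' x0) * wderiv (Omega \<alpha>) w x0 = I x - I x0"
      using N(2)[of x0 x] Id[of x0 x] x x0 by simp
    then have "of_real (a' x) * wderiv (Omega \<alpha>) w x = C + I x" by (simp add: C_def algebra_simps)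
    then show ?thesis using cl(2)[of x] x by (simp add: Q_def)
  next
    case False
    then have "of_real (a' x0) * wderiv (Omega \<alpha>) w x0 - of_real (a' x) * wderiv (Omega \<alpha>) w x = I x0 - I x"
      using N(2)[of x x0] Id[of x x0] x x0 by simp
    then have "of_real (a' x) * wderiv (Omega \<alpha>) w x = C + I x" by (simp add: C_def algebra_simps)
    then show ?thesis using cl(2)[of x] x by (simp add: Q_def)
  qed
  have wd: "wderiv (Omega \<alpha>) w x = of_real (inverse (a x)) * Q x" if "x \<in> Omega \<alpha>" "x \<notin> N \<union> Na" for x
    using Qa[of x] Na(2)[of x] that a_pos[of x] by (simp add: field_simps)
  have "\<exists>g. weak_deriv (Omega \<alpha>) w g" using p by (auto simp: physical_eigen_def numeral_2_eq_2)
  then have "weak_deriv (Omega \<alpha>) w (wderiv (Omega \<alpha>) w)"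
    unfolding wderiv_def by (rule someI_ex[of "\<lambda>g. weak_deriv (Omega \<alpha>) w g"])
  from weak_deriv_integral[OF this]
  obtain M where M: "negligible M" "\<And>x y. \<lbrakk>0 < x; x \<le> y; y < \<alpha>; x \<notin> M; y \<notin> M\<rbrakk> \<Longrightarrow>
      w y - w x = integral {x..y} (wderiv (Omega \<alpha>) w)"
    by blast
  let ?g = "\<lambda>t. of_real (inverse (a t)) * Q t"
  have lg: "loc_bounded ?g" by (intro loc_bounded_rhs1 loc_bounded_continuous cQ)
  define P where "P x = W x - integral {0..x} ?g" for x
  have P: "P x = P 0" if "x \<in> {0..\<alpha>}" for x
  proof (rule constant_off_negligible[OF _ \<alpha> M(1) _ that])
    show "continuous_on {0..\<alpha>} P" unfolding P_def[abs_def]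
      by (intro continuous_intros indefinite_integral_continuous_1 loc_bounded_integrable lg continuous_on_subset[OF cW]) auto
    fix x y :: real assume xy: "0 < x" "x \<le> y" "y < \<alpha>" "x \<notin> M" "y \<notin> M"
    have "W y - W x = integral {x..y} (wderiv (Omega \<alpha>) w)" using M(2) xy Ww by auto
    also have "\<dots> = integral {x..y} ?g"
      by (rule integral_spike[OF negligible_Un[OF N(1) Na(1)]]) (use wd xy in auto)
    finally show "P x = P y"
      using loc_bounded_integral_combine[OF lg, of 0 x y] xy by (simp add: P_def algebra_simps)
  qed
  show ?thesis
  proof (rule that[of W Q])
    show "int_sol a r \<Lambda> \<alpha> W Q"
      unfolding int_sol_def
    proof (intro conjI cW cQ allI impI)
      fix x assume x: "0 \<le> x \<and> x \<le> \<alpha>"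
      show "W x = W 0 + integral {0..x} ?g" using P[of x] x by (simp add: P_def algebra_simps)
      show "Q x = Q 0 + integral {0..x} ?h" using cl(2)[of x] cl(2)[of 0] x \<alpha> by (simp add: Q_def I_def)
    qed
    show "AE x in lebesgue_on (Omega \<alpha>). wderiv (Omega \<alpha>) w x = of_real (inverse (a x)) * Q x"
      by (rule AE_lebesgue_on_negligible[OF negligible_Un[OF N(1) Na(1)]]) (use wd in auto)
  qed (use Ww in auto)
qed

end

section \<open>Limits of the Bloch wave amplitudes\<close>

lemma hk_integral_of_real:
  assumes "loc_bounded f"
  shows "integral {c..d} (\<lambda>x. complex_of_real (f x)) = of_real (integral {c..d} f)"
  using has_integral_of_real[OF integrable_integral[OF loc_bounded_integrable[OF assms]]]
  by (rule integral_unique)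

context coefficients
begin

section \<open>Energy and Wronskian identities\<close>

lemma int_sol_cnj:
  assumes "int_sol a r \<Lambda> d W Q" shows "int_sol a r \<Lambda> d (\<lambda>x. cnj (W x)) (\<lambda>x. cnj (Q x))"
  unfolding int_sol_def
proof (intro conjI allI impI)
  note s = int_solD[OF assms]
  show "continuous_on UNIV (\<lambda>x. cnj (W x))" "continuous_on UNIV (\<lambda>x. cnj (Q x))"
    by (intro continuous_intros s)+
  fix x assume x: "0 \<le> x \<and> x \<le> d"
  have "cnj (W x) = cnj (W 0 + integral {0..x} (\<lambda>t. of_real (inverse (a t)) * Q t))" using s(5)[of x] x by metis
  then show "cnj (W x) = cnj (W 0) + integral {0..x} (\<lambda>t. of_real (inverse (a t)) * cnj (Q t))"
    by (simp add: Henstock_Kurzweil_Integration.integral_cnj)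
  have "cnj (Q x) = cnj (Q 0 + integral {0..x} (\<lambda>t. of_real (- \<Lambda> * r t) * W t))" using s(6)[of x] x by metis
  then show "cnj (Q x) = cnj (Q 0) + integral {0..x} (\<lambda>t. of_real (- \<Lambda> * r t) * cnj (W t))"
    by (simp add: Henstock_Kurzweil_Integration.integral_cnj del: of_real_minus of_real_mult mult_minus_left)
qed

text \<open>Common source of two identities: \<open>V = W\<close> gives the energy balance, and
  subtracting the conjugate of the version with the two solutions exchanged gives the
  Wronskian.\<close>

lemma flux_product:
  assumes s: "int_sol a r \<Lambda> d W Q" and t: "int_sol a r \<Lambda>' d V P" and x: "0 \<le> x" "x \<le> d"
  shows "Q x * cnj (V x) = Q 0 * cnj (V 0) + integral {0..x} (\<lambda>t. (of_real (- \<Lambda> * r t) * W t) * cnj (V t)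
    + Q t * (of_real (inverse (a t)) * cnj (P t)))"
proof -
  note s' = int_solD[OF s] and t' = int_solD[OF int_sol_cnj[OF t]]
  show ?thesis
    by (rule product_rule[OF loc_bounded_rhs2[OF s'(3)] loc_bounded_rhs1[OF t'(4)] s'(4) t'(3) s'(6) t'(5) x])
qed

text \<open>The condition \<open>bc\<close> makes the boundary terms cancel; it holds for Dirichlet
  data and for quasi-periodic solutions over a period alike.\<close>

lemma energy_identity:
  assumes s: "int_sol a r \<Lambda> d W Q" and d: "0 \<le> d" and bc: "Q d * cnj (W d) = Q 0 * cnj (W 0)"
  shows "integral {0..d} (\<lambda>t. inverse (a t) * (cmod (Q t))\<^sup>2) = \<Lambda> * integral {0..d} (\<lambda>t. r t * (cmod (W t))\<^sup>2)"
proof -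
  note s' = int_solD[OF s]
  have l: "loc_bounded (\<lambda>t. inverse (a t) * (cmod (Q t))\<^sup>2)" "loc_bounded (\<lambda>t. r t * (cmod (W t))\<^sup>2)"
    using s'(3,4) by (auto intro!: loc_bounded_intros loc_bounded_inverse_a loc_bounded_r)
  have l': "loc_bounded (\<lambda>t. - \<Lambda> * (r t * (cmod (W t))\<^sup>2))" by (rule loc_bounded_mult[OF loc_bounded_const l(2)])
  have "(of_real (- \<Lambda> * r t) * W t) * cnj (W t) + Q t * (of_real (inverse (a t)) * cnj (Q t))
    = of_real (- \<Lambda> * (r t * (cmod (W t))\<^sup>2) + inverse (a t) * (cmod (Q t))\<^sup>2)" for t
    using complex_norm_square[of "W t"] complex_norm_square[of "Q t"] by (simp add: algebra_simps)
  then have "integral {0..d} (\<lambda>t. complex_of_real (- \<Lambda> * (r t * (cmod (W t))\<^sup>2) + inverse (a t) * (cmod (Q t))\<^sup>2)) = 0"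
    using flux_product[OF s s d order_refl] bc by simp
  then have "integral {0..d} (\<lambda>t. - \<Lambda> * (r t * (cmod (W t))\<^sup>2) + inverse (a t) * (cmod (Q t))\<^sup>2) = 0"
    by (subst (asm) hk_integral_of_real[OF loc_bounded_add[OF l' l(1)]]) (simp only: of_real_eq_0_iff)
  then have "integral {0..d} (\<lambda>t. - \<Lambda> * (r t * (cmod (W t))\<^sup>2)) + integral {0..d} (\<lambda>t. inverse (a t) * (cmod (Q t))\<^sup>2) = 0"
    by (subst (asm) Henstock_Kurzweil_Integration.integral_add[OF loc_bounded_integrable[OF l'] loc_bounded_integrable[OF l(1)]])
  then show ?thesis by simp
qed

text \<open>Lagrange's identity. The products of the two fluxes occur in both flux products and
  cancel, so only the difference of the eigenvalues drives the Wronskian.\<close>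

lemma wronskian_identity:
  assumes s: "int_sol a r \<Lambda> d W Q" and t: "int_sol a r \<Lambda>' d V P" and x: "0 \<le> x" "x \<le> d"
  shows "Q x * cnj (V x) - W x * cnj (P x) = Q 0 * cnj (V 0) - W 0 * cnj (P 0)
     - of_real (\<Lambda> - \<Lambda>') * integral {0..x} (\<lambda>t. of_real (r t) * W t * cnj (V t))"
proof -
  note s' = int_solD[OF s] and t' = int_solD[OF t]
  let ?f = "\<lambda>t. (of_real (- \<Lambda> * r t) * W t) * cnj (V t) + Q t * (of_real (inverse (a t)) * cnj (P t))"
  let ?g = "\<lambda>t. cnj ((of_real (- \<Lambda>' * r t) * V t) * cnj (W t) + P t * (of_real (inverse (a t)) * cnj (Q t)))"
  have l: "loc_bounded ?f" "loc_bounded ?g"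
    by (intro loc_bounded_intros loc_bounded_inverse_a loc_bounded_r s'(3,4) t'(3,4))+
  have 1: "Q x * cnj (V x) = Q 0 * cnj (V 0) + integral {0..x} ?f" by (rule flux_product[OF s t x])
  have "P x * cnj (W x) = P 0 * cnj (W 0) + integral {0..x} (\<lambda>t. (of_real (- \<Lambda>' * r t) * V t) * cnj (W t)
    + P t * (of_real (inverse (a t)) * cnj (Q t)))" by (rule flux_product[OF t s x])
  from arg_cong[OF this, of cnj] have 2: "W x * cnj (P x) = W 0 * cnj (P 0) + integral {0..x} ?g"
    by (simp add: Henstock_Kurzweil_Integration.integral_cnj mult.commute)
  have "integral {0..x} ?f - integral {0..x} ?g = integral {0..x} (\<lambda>t. ?f t - ?g t)"
    by (rule Henstock_Kurzweil_Integration.integral_diff[symmetric]) (intro loc_bounded_integrable l)+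
  also have "(\<lambda>t. ?f t - ?g t) = (\<lambda>t. - of_real (\<Lambda> - \<Lambda>') * (of_real (r t) * W t * cnj (V t)))"
    by (simp add: fun_eq_iff algebra_simps)
  also have "integral {0..x} \<dots> = - of_real (\<Lambda> - \<Lambda>') * integral {0..x} (\<lambda>t. of_real (r t) * W t * cnj (V t))"
    by (rule integral_mult_right)
  finally show ?thesis unfolding 1 2 by (simp add: algebra_simps)
qed

end

section \<open>Quasi-periodic functions: bounds, primitives, averages\<close>

lemma norm_exp_i_real: "norm (exp (2 * \<i> * of_real pi * of_real s)) = 1"
proof -
  have "2 * \<i> * of_real pi * of_real s = \<i> * of_real (2 * pi * s)" by simp
  then show ?thesis by (metis norm_exp_i_times)
qed

lemma norm_quasi_periodic_int:
  fixes f :: "real \<Rightarrow> complex"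
  assumes "\<And>y. f (y + 1) = \<omega> * f y" "norm \<omega> = 1"
  shows "norm (f (y + of_int l)) = norm (f y)"
proof (induction l rule: int_induct[where k = 0])
  case (step1 i)
  have "norm (f (y + of_int i + 1)) = norm (f (y + of_int i))" unfolding assms(1) by (simp add: norm_mult assms)
  then show ?case using step1 by (simp add: add.assoc)
next
  case (step2 i)
  have e: "y + of_int (i - 1) + 1 = y + of_int i" by simp
  have "norm (f (y + of_int (i - 1) + 1)) = norm (f (y + of_int (i - 1)))" unfolding assms(1) by (simp add: norm_mult assms)
  then show ?case using step2 unfolding e by simp
qed simp

lemma quasi_periodic_bounded:
  fixes f :: "real \<Rightarrow> complex"
  assumes "loc_bounded f" "\<And>y. f (y + 1) = \<omega> * f y" "norm \<omega> = 1"
  obtains C where "0 < C" "\<And>y. norm (f y) \<le> C"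
proof -
  obtain C where C: "0 < C" "\<And>y. 0 \<le> y \<Longrightarrow> y \<le> 1 \<Longrightarrow> norm (f y) \<le> C" using loc_boundedE[OF assms(1)] by blast
  have "norm (f y) \<le> C" for y
  proof -
    have "norm (f y) = norm (f (frac y))"
      using norm_quasi_periodic_int[of f \<omega> "frac y" "\<lfloor>y\<rfloor>"] assms by (simp add: frac_def)
    then show ?thesis using C(2)[of "frac y"] frac_lt_1[of y] by (simp add: less_imp_le)
  qed
  then show ?thesis using that C(1) by blast
qed

lemma quasi_periodic_nat:
  fixes f :: "real \<Rightarrow> complex"
  assumes "\<And>y. f (y + 1) = \<omega> * f y" shows "f (y + of_nat n) = \<omega> ^ n * f y"
proof (induction n)
  case (Suc n)
  have "f (y + of_nat (Suc n)) = f ((y + of_nat n) + 1)" by (simp add: algebra_simps)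
  then show ?case using Suc assms by simp
qed simp

text \<open>Integrals over successive periods form a geometric sequence with ratio
  \<open>\<omega>\<close>, whose partial sums stay bounded unless \<open>\<omega> = 1\<close>; in
  that case the mean has to vanish.\<close>

lemma quasi_periodic_primitive_bounded:
  fixes f :: "real \<Rightarrow> complex"
  assumes f: "loc_bounded f" and per: "\<And>y. f (y + 1) = \<omega> * f y" and \<omega>: "norm \<omega> = 1"
    and mean: "\<omega> = 1 \<Longrightarrow> integral {0..1} f = 0"
  obtains M where "\<And>x y. 0 \<le> x \<Longrightarrow> x \<le> y \<Longrightarrow> norm (integral {x..y} f) \<le> M"
proof -
  obtain C where C: "0 < C" "\<And>y. norm (f y) \<le> C" using quasi_periodic_bounded[OF f per \<omega>] by blast
  define c where "c = integral {0..1} f"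
  have step: "integral {real n..real n + 1} f = \<omega> ^ n * c" for n
  proof -
    have "integral {0..1} (\<lambda>t. f (t / 1 + real n)) = 1 *\<^sub>R integral {0 / 1 + real n..1 / 1 + real n} f"
      by (rule integral_affine[OF f]) simp
    then show ?thesis using quasi_periodic_nat[of f \<omega>, OF per] by (simp add: c_def add.commute)
  qed
  have sum: "integral {0..real n} f = (\<Sum>k<n. \<omega> ^ k) * c" for n
  proof (induction n)
    case (Suc n)
    have "integral {0..real n} f + integral {real n..real n + 1} f = integral {0..real n + 1} f"
      by (rule loc_bounded_integral_combine[OF f]) auto
    then show ?case using Suc step[of n] by (simp add: algebra_simps)
  qed simp
  \<comment> \<open>Bounds the geometric sum, as \<open>norm (\<omega> ^ n - 1) \<le> 2\<close>. For
    \<open>\<omega> = 1\<close> the quotient is 0 by convention, which is right because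
    \<open>c\<close> is then 0.\<close>
  define B where "B = 2 * norm c / norm (\<omega> - 1)"
  have nb: "norm (integral {0..real n} f) \<le> B" for n
  proof (cases "\<omega> = 1")
    case True then show ?thesis using mean unfolding sum by (simp add: c_def B_def)
  next
    case False
    then have "(\<Sum>k<n. \<omega> ^ k) = (\<omega> ^ n - 1) / (\<omega> - 1)" by (rule geometric_sum)
    then have "norm (integral {0..real n} f) = norm (\<omega> ^ n - 1) * norm c / norm (\<omega> - 1)"
      unfolding sum by (simp add: norm_mult norm_divide)
    also have "\<dots> \<le> 2 * norm c / norm (\<omega> - 1)"
    proof (intro divide_right_mono mult_right_mono)
      show "norm (\<omega> ^ n - 1) \<le> 2" using norm_triangle_ineq4[of "\<omega> ^ n" 1] \<omega> by (simp add: norm_power)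
    qed auto
    finally show ?thesis by (simp add: B_def)
  qed
  have yb: "norm (integral {0..y} f) \<le> B + C" if "0 \<le> y" for y
  proof -
    define n where "n = nat \<lfloor>y\<rfloor>"
    have n: "real n \<le> y" "y \<le> real n + 1" using that by (auto simp: n_def)
    have "integral {0..y} f = integral {0..real n} f + integral {real n..y} f"
      using loc_bounded_integral_combine[OF f, of 0 "real n" y] n by simp
    moreover have "norm (integral {real n..y} f) \<le> C * (y - real n)"
      using loc_bounded_integral_bound[OF f _ n(1)] C(2) by blast
    moreover have "C * (y - real n) \<le> C * 1" using n C by (intro mult_left_mono) auto
    ultimately show ?thesis using nb[of n] norm_triangle_ineq[of "integral {0..real n} f" "integral {real n..y} f"] by simp
  qed
  show ?thesis
  proof (rule that[of "2 * (B + C)"])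
    fix x y :: real assume xy: "0 \<le> x" "x \<le> y"
    have "integral {x..y} f = integral {0..y} f - integral {0..x} f"
      using loc_bounded_integral_combine[OF f, of 0 x y] xy by (simp add: algebra_simps)
    then show "norm (integral {x..y} f) \<le> 2 * (B + C)"
      using yb[of x] yb[of y] xy norm_triangle_ineq4[of "integral {0..y} f" "integral {0..x} f"] by simp
  qed
qed

text \<open>Only for multiplier 1 does the fast factor have a mean that survives. Subtracting it
  leaves a function with bounded primitive, whose rescaled integrals are of order
  \<open>\<epsilon> j\<close>.\<close>

lemma averaging_quasi_periodic:
  fixes f \<beta> :: "real \<Rightarrow> complex" and \<epsilon> :: "nat \<Rightarrow> real"
  assumes f: "continuous_on UNIV f" and \<beta>: "loc_bounded \<beta>" and per: "\<And>y. \<beta> (y + 1) = \<omega> * \<beta> y" and \<omega>: "norm \<omega> = 1"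
    and \<epsilon>: "\<epsilon> \<longlonglongrightarrow> 0" "\<And>j. 0 < \<epsilon> j" and x: "0 \<le> x1" "x1 \<le> x2"
  shows "(\<lambda>j. integral {x1..x2} (\<lambda>t. f t * \<beta> (t / \<epsilon> j)))
    \<longlonglongrightarrow> (if \<omega> = 1 then integral {0..1} \<beta> else 0) * integral {x1..x2} f"
proof -
  define m where "m = (if \<omega> = 1 then integral {0..1} \<beta> else 0)"
  define \<gamma> where "\<gamma> y = \<beta> y - m" for y
  have lf: "loc_bounded f" by (rule loc_bounded_continuous[OF f])
  have \<gamma>: "loc_bounded \<gamma>" unfolding \<gamma>_def[abs_def] by (intro loc_bounded_diff \<beta> loc_bounded_const)
  \<comment> \<open>A nonzero constant is subtracted only for \<open>\<omega> = 1\<close>, where it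
    has the same multiplier.\<close>
  have \<gamma>per: "\<gamma> (y + 1) = \<omega> * \<gamma> y" for y by (simp add: \<gamma>_def per m_def right_diff_distrib)
  have mean: "integral {0..1} \<gamma> = 0" if "\<omega> = 1"
  proof -
    have "integral {0..1} \<gamma> = integral {0..1} \<beta> - integral {0..1} (\<lambda>_::real. m)"
      unfolding \<gamma>_def[abs_def] by (rule Henstock_Kurzweil_Integration.integral_diff) (intro loc_bounded_integrable \<beta> loc_bounded_const)+
    then show ?thesis using that by (simp add: m_def)
  qed
  obtain M where M: "\<And>x y. 0 \<le> x \<Longrightarrow> x \<le> y \<Longrightarrow> norm (integral {x..y} \<gamma>) \<le> M"
    using quasi_periodic_primitive_bounded[OF \<gamma> \<gamma>per \<omega> mean] by blast
  obtain C where C: "\<And>y. norm (\<gamma> y) \<le> C" using quasi_periodic_bounded[OF \<gamma> \<gamma>per \<omega>] by blast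
  have "(\<lambda>j. integral {x1..x2} (\<lambda>t. f t * \<gamma> (t / \<epsilon> j))) \<longlonglongrightarrow> 0"
  proof (rule averaging[OF f _ C _ _ x(2), where \<delta> = "\<lambda>j. \<epsilon> j * M"])
    show "loc_bounded (\<lambda>t. \<gamma> (t / \<epsilon> j))" for j by (rule loc_bounded_scale[OF \<gamma>])
    show "(\<lambda>j. \<epsilon> j * M) \<longlonglongrightarrow> 0" using tendsto_mult[OF \<epsilon>(1) tendsto_const[of M]] by simp
    fix j c d assume cd: "x1 \<le> c" "c \<le> d" "d \<le> x2"
    have "integral {c..d} (\<lambda>t. \<gamma> (t / \<epsilon> j)) = \<epsilon> j *\<^sub>R integral {c / \<epsilon> j..d / \<epsilon> j} \<gamma>"
      using integral_affine[OF \<gamma> \<epsilon>(2), of c d j 0] by simp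
    moreover have "norm (integral {c / \<epsilon> j..d / \<epsilon> j} \<gamma>) \<le> M"
      using M cd x \<epsilon>(2)[of j] by (auto simp: divide_right_mono)
    ultimately show "norm (integral {c..d} (\<lambda>t. \<gamma> (t / \<epsilon> j))) \<le> \<epsilon> j * M"
      using \<epsilon>(2)[of j] by simp
  qed
  then have "(\<lambda>j. integral {x1..x2} (\<lambda>t. f t * \<gamma> (t / \<epsilon> j)) + m * integral {x1..x2} f) \<longlonglongrightarrow> 0 + m * integral {x1..x2} f"
    by (intro tendsto_add tendsto_const)
  moreover have "integral {x1..x2} (\<lambda>t. f t * \<gamma> (t / \<epsilon> j)) + m * integral {x1..x2} f = integral {x1..x2} (\<lambda>t. f t * \<beta> (t / \<epsilon> j))" for j
  proof -
    have "integral {x1..x2} (\<lambda>t. f t * \<gamma> (t / \<epsilon> j)) + integral {x1..x2} (\<lambda>t. m * f t)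
      = integral {x1..x2} (\<lambda>t. f t * \<gamma> (t / \<epsilon> j) + m * f t)"
      by (rule Henstock_Kurzweil_Integration.integral_add[symmetric])
        (rule loc_bounded_integrable, rule loc_bounded_mult, rule lf loc_bounded_const, rule loc_bounded_scale[OF \<gamma>] lf)+
    also have "\<dots> = integral {x1..x2} (\<lambda>t. f t * \<beta> (t / \<epsilon> j))"
      by (intro integral_cong) (simp add: \<gamma>_def algebra_simps)
    finally show ?thesis by (simp add: integral_mult_right)
  qed
  ultimately show ?thesis unfolding m_def by simp
qed

text \<open>Induction over the family, refining the subsequence each time, since the limit equations
  may couple the members and so need a common subsequence.\<close>

lemma Arzela_Ascoli_finite_family:
  fixes F :: "'i \<Rightarrow> nat \<Rightarrow> real \<Rightarrow> complex"
  assumes "finite I" and "compact S"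
    and "\<And>i n x. i \<in> I \<Longrightarrow> x \<in> S \<Longrightarrow> norm (F i n x) \<le> M"
    and "\<And>i n x y. i \<in> I \<Longrightarrow> x \<in> S \<Longrightarrow> y \<in> S \<Longrightarrow> norm (F i n x - F i n y) \<le> L * \<bar>x - y\<bar>"
  obtains G :: "'i \<Rightarrow> real \<Rightarrow> complex" and k :: "nat \<Rightarrow> nat" where "strict_mono k" "\<And>i. i \<in> I \<Longrightarrow> continuous_on S (G i)"
    "\<And>i. i \<in> I \<Longrightarrow> uniform_limit S (\<lambda>n. F i (k n)) (G i) sequentially"
proof -
  have "\<exists>G k. strict_mono (k :: nat \<Rightarrow> nat) \<and> (\<forall>i\<in>I. continuous_on S (G i) \<and> uniform_limit S (\<lambda>n. F i (k n)) (G i) sequentially)"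
    using assms(1,3,4)
  proof (induction I rule: finite_induct)
    case empty
    show ?case by (intro exI[of _ "\<lambda>n. n"] exI) (simp add: strict_mono_def)
  next
    case (insert i I)
    then obtain G k where Gk: "strict_mono (k :: nat \<Rightarrow> nat)"
      "\<And>l. l \<in> I \<Longrightarrow> continuous_on S (G l) \<and> uniform_limit S (\<lambda>n. F l (k n)) (G l) sequentially" by blast
    have eq: "\<exists>d>0. \<forall>n y. y \<in> S \<and> norm (x - y) < d \<longrightarrow> norm (F i (k n) x - F i (k n) y) < e"
      if "x \<in> S" "0 < e" for x e
    proof (intro exI conjI allI impI)
      show "0 < e / (\<bar>L\<bar> + 1)" using that by simp
      fix n y assume y: "y \<in> S \<and> norm (x - y) < e / (\<bar>L\<bar> + 1)"
      have "norm (F i (k n) x - F i (k n) y) \<le> L * \<bar>x - y\<bar>" using insert.prems(2)[of i] that y by auto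
      also have "\<dots> \<le> (\<bar>L\<bar> + 1) * \<bar>x - y\<bar>" by (intro mult_right_mono) auto
      also have "\<dots> < e" using y by (simp add: pos_less_divide_eq mult.commute)
      finally show "norm (F i (k n) x - F i (k n) y) < e" .
    qed
    obtain g k' where g: "continuous_on S g" "strict_mono (k' :: nat \<Rightarrow> nat)"
        "\<And>e. 0 < e \<Longrightarrow> \<exists>N. \<forall>n x. n \<ge> N \<and> x \<in> S \<longrightarrow> norm ((\<lambda>n. F i (k n)) (k' n) x - g x) < e"
      using Arzela_Ascoli[OF \<open>compact S\<close>, of "\<lambda>n. F i (k n)" M] insert.prems(1) eq by blast
    have ug: "uniform_limit S (\<lambda>n. F i (k (k' n))) g sequentially"
      unfolding uniform_limit_iff eventually_sequentially dist_norm using g(3) by blast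
    show ?case
    proof (intro exI[of _ "G(i := g)"] exI[of _ "k \<circ> k'"] conjI ballI)
      show "strict_mono (k \<circ> k')" using Gk(1) g(2) by (rule strict_mono_o)
      fix l assume "l \<in> insert i I"
      show "continuous_on S ((G(i := g)) l)" using \<open>l \<in> insert i I\<close> Gk g(1) by auto
      show "uniform_limit S (\<lambda>n. F l ((k \<circ> k') n)) ((G(i := g)) l) sequentially"
      proof (cases "l = i")
        case True then show ?thesis using ug by simp
      next
        case False
        then have "uniform_limit S (\<lambda>n. F l (k n)) (G l) sequentially" using Gk \<open>l \<in> insert i I\<close> by auto
        then have "uniform_limit S (\<lambda>n. F l (k (k' n))) (G l) sequentially"
          by (rule filterlim_compose[OF _ filterlim_subseq[OF g(2)]])
        then show ?thesis using False by simp
      qed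
    qed
  qed
  then show ?thesis using that by metis
qed

lemma uniform_limit_finite_sum:
  fixes f :: "'i \<Rightarrow> nat \<Rightarrow> real \<Rightarrow> complex"
  assumes "\<And>i. i \<in> I \<Longrightarrow> uniform_limit S (f i) (g i) F"
  shows "uniform_limit S (\<lambda>n x. \<Sum>i\<in>I. f i n x) (\<lambda>x. \<Sum>i\<in>I. g i x) F"
  using assms
proof (induction I rule: infinite_finite_induct)
  case (insert i I)
  have "uniform_limit S (\<lambda>n x. f i n x + (\<Sum>i\<in>I. f i n x)) (\<lambda>x. g i x + (\<Sum>i\<in>I. g i x)) F"
    using insert by (intro uniform_limit_add) auto
  then show ?case using insert.hyps by simp
qed (auto intro: uniform_limit_const)

section \<open>Compactness of the amplitudes and their limit equation\<close>

text \<open>An abstract index set covers both cases: quasi-momenta k and -k with distinct phases, or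
  two indices with quasi-momentum 0. In \<open>recW\<close> and \<open>recQ\<close> the numbers
  \<open>u\<close> and \<open>v\<close> stand for the values of \<open>W\<close> and of \<epsilon>
  times \<open>Q\<close>; the two together say that the pairs of wave and flux values span the plane
  at each point.\<close>

locale homogenization = periodic_coefficients +
  fixes \<alpha> :: real and I :: "'i set" and \<sigma> :: "'i \<Rightarrow> real" and \<phi> q :: "'i \<Rightarrow> real \<Rightarrow> complex"
    and D :: "'i \<Rightarrow> 'i \<Rightarrow> complex" and \<mu>0 \<mu>1 :: real
    and \<epsilon> \<Lambda> :: "nat \<Rightarrow> real" and W Q :: "nat \<Rightarrow> real \<Rightarrow> complex"
  assumes \<alpha>: "0 < \<alpha>" and fin: "finite I" and \<mu>0: "0 < \<mu>0"
    and bloch: "\<And>i d. i \<in> I \<Longrightarrow> int_sol a r (\<mu>0\<^sup>2) d (\<phi> i) (q i)"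
    and \<phi>_per: "\<And>i y. i \<in> I \<Longrightarrow> \<phi> i (y + 1) = exp (2 * \<i> * pi * \<sigma> i) * \<phi> i y"
    and q_per: "\<And>i y. i \<in> I \<Longrightarrow> q i (y + 1) = exp (2 * \<i> * pi * \<sigma> i) * q i y"
    \<comment> \<open>\<open>D\<close> is the inverse of the matrix of Wronskians of the Bloch waves\<close>
    and recW: "\<And>y u v. u = (\<Sum>i\<in>I. \<phi> i y * (\<Sum>l\<in>I. D i l * (v * cnj (\<phi> l y) - u * cnj (q l y))))"
    and recQ: "\<And>y u v. v = (\<Sum>i\<in>I. q i y * (\<Sum>l\<in>I. D i l * (v * cnj (\<phi> l y) - u * cnj (q l y))))"
    and \<epsilon>_pos: "\<And>j. 0 < \<epsilon> j" and \<epsilon>_lim: "\<epsilon> \<longlonglongrightarrow> 0"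
    and sol: "\<And>j. int_sol (osc (\<epsilon> j) a) (osc (\<epsilon> j) r) (\<Lambda> j) \<alpha> (W j) (Q j)"
    and bc: "\<And>j. W j 0 = 0" "\<And>j. W j \<alpha> = 0"
    and norm1: "\<And>j. integral {0..\<alpha>} (\<lambda>x. (cmod (W j x))\<^sup>2) = 1"
    and \<Lambda>_nonneg: "\<And>j. 0 \<le> \<Lambda> j"
    and \<mu>_lim: "(\<lambda>j. sqrt (\<Lambda> j) - \<mu>0 / \<epsilon> j) \<longlonglongrightarrow> \<mu>1"
begin

text \<open>\<open>p l j\<close> is the Wronskian of the physical solution with a Bloch wave; unlike both of them it does not
  oscillate at order one, since its derivative only contains the difference of the two eigenvalues.\<close>

definition p :: "'i \<Rightarrow> nat \<Rightarrow> real \<Rightarrow> complex" where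
  "p l j x = (\<epsilon> j * Q j x) * cnj (\<phi> l (x / \<epsilon> j)) - W j x * cnj (q l (x / \<epsilon> j))"

definition A :: "'i \<Rightarrow> nat \<Rightarrow> real \<Rightarrow> complex" where
  "A i j x = (\<Sum>l\<in>I. D i l * p l j x)"

text \<open>The rate at which the Wronskians change: the difference of the eigenvalues, times the
  factor \<epsilon> that \<open>p\<close> puts on the flux. Its limit is the \<lambda>^1 of the
  macroscopic problem.\<close>

definition \<kappa> :: "nat \<Rightarrow> real" where "\<kappa> j = \<epsilon> j * (\<Lambda> j - \<mu>0\<^sup>2 / (\<epsilon> j)\<^sup>2)"

lemma W_expand: "W j x = (\<Sum>i\<in>I. \<phi> i (x / \<epsilon> j) * A i j x)"
  unfolding A_def p_def by (rule recW)

lemma Q_expand: "\<epsilon> j * Q j x = (\<Sum>i\<in>I. q i (x / \<epsilon> j) * A i j x)"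
  unfolding A_def p_def by (rule recQ)

lemma osc_coefficients: "coefficients (osc (\<epsilon> j) a) (osc (\<epsilon> j) r) a0 a1 r0 r1"
  by (rule int_sol_osc[OF \<epsilon>_pos])

lemma loc_bounded_osc_r: "loc_bounded (osc \<epsilon>' r)"
  unfolding osc_def[abs_def] by (rule loc_bounded_scale[OF loc_bounded_r])

lemma loc_bounded_sols: "loc_bounded (W j)" "loc_bounded (Q j)"
  using int_solD[OF sol] by blast+

lemma loc_bounded_bloch: "i \<in> I \<Longrightarrow> loc_bounded (\<phi> i)" "i \<in> I \<Longrightarrow> loc_bounded (q i)"
  using int_solD[OF bloch] by blast+

text \<open>The Wronskian identity for the physical solution and the rescaled wave, whose flux is
  \<open>q l (x / \<epsilon> j) / \<epsilon> j\<close>; multiplication by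
  \<open>\<epsilon> j\<close> turns that Wronskian into \<open>p\<close>.\<close>

lemma p_increment:
  assumes l: "l \<in> I" and x: "0 \<le> x" "x \<le> \<alpha>"
  shows "p l j x = p l j 0 - \<kappa> j * integral {0..x} (\<lambda>t. of_real (osc (\<epsilon> j) r t) * W j t * cnj (\<phi> l (t / \<epsilon> j)))"
proof -
  interpret o: coefficients "osc (\<epsilon> j) a" "osc (\<epsilon> j) r" a0 a1 r0 r1 by (rule osc_coefficients)
  have "int_sol (osc (\<epsilon> j) a) (osc (\<epsilon> j) r) (\<mu>0\<^sup>2 / (\<epsilon> j)\<^sup>2) (\<epsilon> j * (\<alpha> / \<epsilon> j)) (\<lambda>x. \<phi> l (x / \<epsilon> j)) (\<lambda>x. q l (x / \<epsilon> j) / of_real (\<epsilon> j))"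
    by (rule int_sol_scale[OF bloch[OF l] \<epsilon>_pos])
  moreover have "\<epsilon> j * (\<alpha> / \<epsilon> j) = \<alpha>" using \<epsilon>_pos[of j] by simp
  ultimately have "int_sol (osc (\<epsilon> j) a) (osc (\<epsilon> j) r) (\<mu>0\<^sup>2 / (\<epsilon> j)\<^sup>2) \<alpha> (\<lambda>x. \<phi> l (x / \<epsilon> j)) (\<lambda>x. q l (x / \<epsilon> j) / of_real (\<epsilon> j))"
    by simp
  note w = o.wronskian_identity[OF sol this x]
  have pe: "p l j x = of_real (\<epsilon> j) * (Q j x * cnj (\<phi> l (x / \<epsilon> j)) - W j x * cnj (q l (x / \<epsilon> j) / of_real (\<epsilon> j)))" for x
    using \<epsilon>_pos[of j] by (simp add: p_def right_diff_distrib)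
  show ?thesis unfolding pe w \<kappa>_def by (simp add: algebra_simps)
qed

lemma nu_lim: "(\<lambda>j. \<epsilon> j * sqrt (\<Lambda> j)) \<longlonglongrightarrow> \<mu>0"
proof -
  have "(\<lambda>j. \<epsilon> j * (sqrt (\<Lambda> j) - \<mu>0 / \<epsilon> j) + \<mu>0) \<longlonglongrightarrow> 0 * \<mu>1 + \<mu>0"
    by (intro tendsto_intros \<epsilon>_lim \<mu>_lim)
  moreover have "\<epsilon> j * (sqrt (\<Lambda> j) - \<mu>0 / \<epsilon> j) + \<mu>0 = \<epsilon> j * sqrt (\<Lambda> j)" for j
    using \<epsilon>_pos[of j] by (simp add: right_diff_distrib)
  ultimately show ?thesis by simp
qed

text \<open>The difference of squares factors into
  \<open>sqrt (\<Lambda> j) - \<mu>0 / \<epsilon> j\<close>, which tends to \<open>\<mu>1\<close>,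
  and a sum which after multiplication by \<open>\<epsilon> j\<close> tends to
  \<open>2 * \<mu>0\<close>.\<close>

lemma kappa_lim: "\<kappa> \<longlonglongrightarrow> 2 * \<mu>0 * \<mu>1"
proof -
  have "(\<lambda>j. (sqrt (\<Lambda> j) - \<mu>0 / \<epsilon> j) * (\<epsilon> j * sqrt (\<Lambda> j) + \<mu>0)) \<longlonglongrightarrow> \<mu>1 * (\<mu>0 + \<mu>0)"
    by (intro tendsto_intros nu_lim \<mu>_lim)
  moreover have "(sqrt (\<Lambda> j) - \<mu>0 / \<epsilon> j) * (\<epsilon> j * sqrt (\<Lambda> j) + \<mu>0) = \<kappa> j" for j
  proof -
    have "\<Lambda> j = sqrt (\<Lambda> j) * sqrt (\<Lambda> j)" using \<Lambda>_nonneg[of j] by simp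
    then show ?thesis using \<epsilon>_pos[of j] unfolding \<kappa>_def
      by (simp add: field_simps power2_eq_square)
  qed
  ultimately show ?thesis by (simp add: mult_ac)
qed

lemma bloch_bounded:
  obtains C where "0 < C" "\<And>i y. i \<in> I \<Longrightarrow> cmod (\<phi> i y) \<le> C" "\<And>i y. i \<in> I \<Longrightarrow> cmod (q i y) \<le> C"
proof -
  have "\<exists>C>0. \<forall>y. cmod (\<phi> i y) \<le> C \<and> cmod (q i y) \<le> C" if i: "i \<in> I" for i
  proof -
    obtain C1 where C1: "0 < C1" "\<And>y. cmod (\<phi> i y) \<le> C1"
      using quasi_periodic_bounded[OF loc_bounded_bloch(1)[OF i] \<phi>_per[OF i] norm_exp_i_real] by blast
    obtain C2 where C2: "0 < C2" "\<And>y. cmod (q i y) \<le> C2"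
      using quasi_periodic_bounded[OF loc_bounded_bloch(2)[OF i] q_per[OF i] norm_exp_i_real] by blast
    show ?thesis using C1 C2 by (intro exI[of _ "C1 + C2"]) (auto intro: add_increasing2 add_increasing less_imp_le)
  qed
  then obtain C where C: "\<And>i. i \<in> I \<Longrightarrow> 0 < C i" "\<And>i y. i \<in> I \<Longrightarrow> cmod (\<phi> i y) \<le> C i \<and> cmod (q i y) \<le> C i"
    by metis
  have le: "C i \<le> 1 + sum C I" if "i \<in> I" for i
    using member_le_sum[OF that _ fin, of C] C(1) by (force intro: less_imp_le)
  show ?thesis
  proof (rule that[of "1 + sum C I"])
    show "0 < 1 + sum C I" using C(1) by (intro add_pos_nonneg sum_nonneg) (auto intro: less_imp_le)
  qed (use le C(2) order_trans in blast)+
qed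

text \<open>Dirichlet data remove the boundary terms from the energy identity, which bounds the flux
  in terms of \<open>\<Lambda> j\<close>; the factor \<open>(\<epsilon> j)\<^sup>2\<close>
  compensates, as \<open>\<epsilon> j * sqrt (\<Lambda> j)\<close> converges.\<close>

lemma energy_bound:
  obtains B where "\<And>j. integral {0..\<alpha>} (\<lambda>x. (cmod (\<epsilon> j * Q j x))\<^sup>2) \<le> B"
proof -
  have "Bseq (\<lambda>j. \<epsilon> j * sqrt (\<Lambda> j))" using nu_lim convergent_imp_Bseq convergentI by blast
  then obtain K where K: "\<And>j. \<bar>\<epsilon> j * sqrt (\<Lambda> j)\<bar> \<le> K" by (auto simp: Bseq_def)
  show ?thesis
  proof (rule that[of "K\<^sup>2 * (a1 * r1)"])
    fix j
    interpret o: coefficients "osc (\<epsilon> j) a" "osc (\<epsilon> j) r" a0 a1 r0 r1 by (rule osc_coefficients)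
    have lb: "loc_bounded (\<lambda>x. (cmod (Q j x))\<^sup>2)" "loc_bounded (\<lambda>x. (cmod (W j x))\<^sup>2)"
      by (intro loc_bounded_intros loc_bounded_sols)+
    have "integral {0..\<alpha>} (\<lambda>x. (cmod (Q j x))\<^sup>2) \<le> integral {0..\<alpha>} (\<lambda>x. a1 * (inverse (osc (\<epsilon> j) a x) * (cmod (Q j x))\<^sup>2))"
    proof (rule integral_le)
      fix x
      have "1 \<le> a1 * inverse (osc (\<epsilon> j) a x)" using o.a_le[of x] o.a_pos[of x] by (simp add: field_simps)
      from mult_right_mono[OF this, of "(cmod (Q j x))\<^sup>2"]
      show "(cmod (Q j x))\<^sup>2 \<le> a1 * (inverse (osc (\<epsilon> j) a x) * (cmod (Q j x))\<^sup>2)" by (simp add: mult.assoc)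
    qed (intro loc_bounded_integrable loc_bounded_mult loc_bounded_const lb o.loc_bounded_inverse_a)+
    also have "\<dots> = a1 * (\<Lambda> j * integral {0..\<alpha>} (\<lambda>t. osc (\<epsilon> j) r t * (cmod (W j t))\<^sup>2))"
      unfolding integral_mult_right
      by (subst o.energy_identity[OF sol]) (use \<alpha> bc in auto)
    also have "\<dots> \<le> a1 * (\<Lambda> j * integral {0..\<alpha>} (\<lambda>t. r1 * (cmod (W j t))\<^sup>2))"
    proof (intro mult_left_mono integral_le \<Lambda>_nonneg)
      show "0 \<le> a1" using a_le[of 0] a_pos[of 0] by linarith
    qed (auto intro!: loc_bounded_integrable loc_bounded_mult loc_bounded_const lb o.loc_bounded_r mult_right_mono o.r_le)
    also have "\<dots> = a1 * (\<Lambda> j * r1)" unfolding integral_mult_right norm1 by simp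
    finally have Q: "integral {0..\<alpha>} (\<lambda>x. (cmod (Q j x))\<^sup>2) \<le> a1 * (\<Lambda> j * r1)" .
    have "integral {0..\<alpha>} (\<lambda>x. (cmod (\<epsilon> j * Q j x))\<^sup>2) = (\<epsilon> j)\<^sup>2 * integral {0..\<alpha>} (\<lambda>x. (cmod (Q j x))\<^sup>2)"
      unfolding integral_mult_right[symmetric] by (simp add: norm_mult power_mult_distrib)
    also have "\<dots> \<le> (\<epsilon> j)\<^sup>2 * (a1 * (\<Lambda> j * r1))" using Q by (intro mult_left_mono) auto
    also have "\<dots> = (\<epsilon> j * sqrt (\<Lambda> j))\<^sup>2 * (a1 * r1)" using \<Lambda>_nonneg[of j] by (simp add: power_mult_distrib)
    also have "\<dots> \<le> K\<^sup>2 * (a1 * r1)"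
    proof (rule mult_right_mono)
      show "(\<epsilon> j * sqrt (\<Lambda> j))\<^sup>2 \<le> K\<^sup>2" using K[of j] by (metis abs_ge_zero power2_abs power_mono)
      show "0 \<le> a1 * r1" using a_le[of 0] a_pos[of 0] r_le[of 0] r_pos[of 0] by (intro mult_nonneg_nonneg) linarith+
    qed
    finally show "integral {0..\<alpha>} (\<lambda>x. (cmod (\<epsilon> j * Q j x))\<^sup>2) \<le> K\<^sup>2 * (a1 * r1)" .
  qed
qed

text \<open>The inequality \<open>t \<le> 1 + t\<^sup>2\<close> replaces Cauchy-Schwarz, since the
  size of the constant does not matter.\<close>

lemma integral_norm_le:
  fixes f :: "real \<Rightarrow> complex"
  assumes "loc_bounded f" "0 \<le> x" "x \<le> \<alpha>"
  shows "integral {0..x} (\<lambda>t. cmod (f t)) \<le> \<alpha> + integral {0..\<alpha>} (\<lambda>t. (cmod (f t))\<^sup>2)"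
proof -
  have l: "loc_bounded (\<lambda>t. cmod (f t))" "loc_bounded (\<lambda>t. (cmod (f t))\<^sup>2)" by (intro loc_bounded_intros assms)+
  have "0 \<le> integral {x..\<alpha>} (\<lambda>t. cmod (f t))" by (intro integral_nonneg loc_bounded_integrable l) auto
  then have "integral {0..x} (\<lambda>t. cmod (f t)) \<le> integral {0..\<alpha>} (\<lambda>t. cmod (f t))"
    using loc_bounded_integral_combine[OF l(1) assms(2,3)] by linarith
  also have "\<dots> \<le> integral {0..\<alpha>} (\<lambda>t. 1 + (cmod (f t))\<^sup>2)"
  proof (intro integral_le loc_bounded_integrable loc_bounded_add l loc_bounded_const)
    fix t
    have "0 \<le> (cmod (f t) - 1)\<^sup>2" by simp
    then have "2 * cmod (f t) \<le> (cmod (f t))\<^sup>2 + 1" unfolding power2_diff by simp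
    then show "cmod (f t) \<le> 1 + (cmod (f t))\<^sup>2" using norm_ge_zero[of "f t"] by linarith
  qed
  also have "\<dots> = integral {0..\<alpha>} (\<lambda>t. 1) + integral {0..\<alpha>} (\<lambda>t. (cmod (f t))\<^sup>2)"
    by (rule Henstock_Kurzweil_Integration.integral_add) (intro loc_bounded_integrable l loc_bounded_const)+
  also have "integral {0..\<alpha>} (\<lambda>t. 1::real) = \<alpha>" using \<alpha> by simp
  finally show ?thesis .
qed

text \<open>No point is known at which \<open>p\<close> is small. But \<open>p\<close> changes by at
  most \<open>K'\<close> over the interval, because its increments are controlled by the L1 norm of
  \<open>W\<close>, and its mean is controlled by the L2 bounds on \<open>W\<close> and on the
  scaled flux; together this bounds \<open>p l j 0\<close>.\<close>

lemma p_bounded: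
  obtains B where "\<And>l j x. l \<in> I \<Longrightarrow> 0 \<le> x \<Longrightarrow> x \<le> \<alpha> \<Longrightarrow> cmod (p l j x) \<le> B"
proof -
  obtain C where C: "0 < C" "\<And>i y. i \<in> I \<Longrightarrow> cmod (\<phi> i y) \<le> C" "\<And>i y. i \<in> I \<Longrightarrow> cmod (q i y) \<le> C"
    using bloch_bounded by blast
  obtain B where B: "\<And>j. integral {0..\<alpha>} (\<lambda>x. (cmod (\<epsilon> j * Q j x))\<^sup>2) \<le> B" using energy_bound by blast
  have "Bseq \<kappa>" using kappa_lim convergent_imp_Bseq convergentI by blast
  then obtain K where K: "0 < K" "\<And>j. \<bar>\<kappa> j\<bar> \<le> K" by (auto simp: Bseq_def)
  define K' where "K' = K * (r1 * C * (\<alpha> + 1))"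
  have r1: "0 \<le> r1" using r_le[of 0] r_pos[of 0] by linarith
  have inc: "cmod (p l j x - p l j 0) \<le> K'" if l: "l \<in> I" and x: "0 \<le> x" "x \<le> \<alpha>" for l j x
  proof -
    let ?f = "\<lambda>t. of_real (osc (\<epsilon> j) r t) * W j t * cnj (\<phi> l (t / \<epsilon> j))"
    have lf: "loc_bounded ?f"
      by (intro loc_bounded_mult loc_bounded_of_real loc_bounded_osc_r loc_bounded_sols loc_bounded_cnj loc_bounded_scale loc_bounded_bloch l)
    have lW: "loc_bounded (\<lambda>t. cmod (W j t))" by (intro loc_bounded_norm loc_bounded_sols)
    have "cmod (integral {0..x} ?f) \<le> integral {0..x} (\<lambda>t. (r1 * C) * cmod (W j t))"
    proof (rule integral_norm_bound_integral)
      fix t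
      have "cmod (?f t) = osc (\<epsilon> j) r t * cmod (\<phi> l (t / \<epsilon> j)) * cmod (W j t)"
        using r_pos[of "t / \<epsilon> j"] by (simp add: norm_mult osc_def)
      also have "\<dots> \<le> (r1 * C) * cmod (W j t)"
        using C(2)[OF l] r_le r_pos r1 by (intro mult_right_mono mult_mono) (auto simp: osc_def less_imp_le)
      finally show "cmod (?f t) \<le> (r1 * C) * cmod (W j t)" .
    qed (intro loc_bounded_integrable lf loc_bounded_mult loc_bounded_const lW)+
    also have "\<dots> = (r1 * C) * integral {0..x} (\<lambda>t. cmod (W j t))" by (rule integral_mult_right)
    also have "\<dots> \<le> (r1 * C) * (\<alpha> + 1)"
      using integral_norm_le[OF loc_bounded_sols(1)[of j] x] r1 C(1) unfolding norm1 by (intro mult_left_mono) auto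
    finally have 1: "cmod (integral {0..x} ?f) \<le> r1 * C * (\<alpha> + 1)" .
    have "cmod (p l j x - p l j 0) = \<bar>\<kappa> j\<bar> * cmod (integral {0..x} ?f)"
      unfolding p_increment[OF l x] by (simp add: norm_mult)
    also have "\<dots> \<le> K'" unfolding K'_def using K 1 by (intro mult_mono) auto
    finally show ?thesis .
  qed
  \<comment> \<open>The quotient bounds the mean over \<open>[0, \<alpha>]\<close>; one
    \<open>K'\<close> leads from the mean to \<open>p l j 0\<close>, the other from there to any
    point.\<close>
  define B' where "B' = (C * (\<alpha> + B) + C * (\<alpha> + 1)) / \<alpha> + K' + K'"
  show ?thesis
  proof (rule that[of B'])
    fix l j x assume l: "l \<in> I" and x: "0 \<le> x" "x \<le> \<alpha>"
    have lb: "loc_bounded (\<lambda>t. cmod (of_real (\<epsilon> j) * Q j t))" "loc_bounded (\<lambda>t. cmod (W j t))"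
      by (intro loc_bounded_intros loc_bounded_sols)+
    have "integral {0..\<alpha>} (\<lambda>t. cmod (p l j 0) - K') \<le> integral {0..\<alpha>} (\<lambda>t. C * cmod (\<epsilon> j * Q j t) + C * cmod (W j t))"
    proof (intro integral_le)
      fix t assume t: "t \<in> {0..\<alpha>}"
      have "cmod (p l j 0) \<le> cmod (p l j t) + cmod (p l j t - p l j 0)"
        using norm_triangle_ineq4[of "p l j t" "p l j t - p l j 0"] by simp
      moreover have "cmod (p l j t) \<le> cmod (\<epsilon> j * Q j t) * cmod (\<phi> l (t / \<epsilon> j)) + cmod (W j t) * cmod (q l (t / \<epsilon> j))"
        unfolding p_def by (rule order_trans[OF norm_triangle_ineq4]) (simp add: norm_mult)
      moreover have "\<dots> \<le> cmod (\<epsilon> j * Q j t) * C + cmod (W j t) * C"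
        using C l by (intro add_mono mult_left_mono) auto
      ultimately show "cmod (p l j 0) - K' \<le> C * cmod (\<epsilon> j * Q j t) + C * cmod (W j t)"
        using inc[OF l, of t j] t by (simp add: mult.commute)
    qed (intro loc_bounded_integrable loc_bounded_add loc_bounded_mult loc_bounded_const lb)+
    also have "\<dots> = C * integral {0..\<alpha>} (\<lambda>t. cmod (\<epsilon> j * Q j t)) + C * integral {0..\<alpha>} (\<lambda>t. cmod (W j t))"
      by (subst Henstock_Kurzweil_Integration.integral_add)
        (auto intro!: loc_bounded_integrable loc_bounded_mult loc_bounded_const lb)
    also have "\<dots> \<le> C * (\<alpha> + B) + C * (\<alpha> + 1)"
    proof (intro add_mono mult_left_mono)
      have "loc_bounded (\<lambda>t. of_real (\<epsilon> j) * Q j t)" by (intro loc_bounded_intros loc_bounded_sols)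
      from integral_norm_le[OF this, of \<alpha>] B[of j] \<alpha>
      show "integral {0..\<alpha>} (\<lambda>t. cmod (\<epsilon> j * Q j t)) \<le> \<alpha> + B" by simp
      show "integral {0..\<alpha>} (\<lambda>t. cmod (W j t)) \<le> \<alpha> + 1"
        using integral_norm_le[OF loc_bounded_sols(1)[of j], of \<alpha>] \<alpha> unfolding norm1 by simp
    qed (use C in auto)
    finally have "cmod (p l j 0) - K' \<le> (C * (\<alpha> + B) + C * (\<alpha> + 1)) / \<alpha>"
      using \<alpha> by (simp add: pos_le_divide_eq mult.commute)
    moreover have "cmod (p l j x) \<le> cmod (p l j 0) + cmod (p l j x - p l j 0)"
      using norm_triangle_ineq[of "p l j 0" "p l j x - p l j 0"] by simp
    ultimately show "cmod (p l j x) \<le> B'" using inc[OF l x, of j] unfolding B'_def by linarith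
  qed
qed

lemma A_bounded:
  obtains B where "0 < B" "\<And>i j x. i \<in> I \<Longrightarrow> 0 \<le> x \<Longrightarrow> x \<le> \<alpha> \<Longrightarrow> cmod (A i j x) \<le> B"
proof -
  obtain B where B: "\<And>l j x. l \<in> I \<Longrightarrow> 0 \<le> x \<Longrightarrow> x \<le> \<alpha> \<Longrightarrow> cmod (p l j x) \<le> B" using p_bounded by blast
  define B' where "B' = 1 + (\<Sum>i\<in>I. \<Sum>l\<in>I. cmod (D i l) * \<bar>B\<bar>)"
  show ?thesis
  proof (rule that[of B'])
    show "0 < B'" unfolding B'_def by (intro add_pos_nonneg sum_nonneg) auto
    fix i j x assume i: "i \<in> I" and x: "0 \<le> x" "x \<le> \<alpha>"
    have "cmod (A i j x) \<le> (\<Sum>l\<in>I. cmod (D i l * p l j x))" unfolding A_def by (rule norm_sum)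
    also have "\<dots> \<le> (\<Sum>l\<in>I. cmod (D i l) * \<bar>B\<bar>)"
    proof (rule sum_mono)
      fix l assume "l \<in> I"
      then have "cmod (p l j x) \<le> \<bar>B\<bar>" using B[of l x j] x by linarith
      then show "cmod (D i l * p l j x) \<le> cmod (D i l) * \<bar>B\<bar>" by (simp add: norm_mult mult_left_mono)
    qed
    also have "\<dots> \<le> (\<Sum>i\<in>I. \<Sum>l\<in>I. cmod (D i l) * \<bar>B\<bar>)"
      by (rule member_le_sum[OF i _ fin]) (auto intro!: sum_nonneg)
    finally show "cmod (A i j x) \<le> B'" unfolding B'_def by simp
  qed
qed

text \<open>Bootstrap: bounded amplitudes make \<open>W\<close> uniformly bounded through its
  expansion, so that the integrand in \<open>p_increment\<close> is uniformly bounded and not just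
  bounded in L1.\<close>

lemma p_Lipschitz:
  obtains L where "\<And>l j x y. l \<in> I \<Longrightarrow> x \<in> {0..\<alpha>} \<Longrightarrow> y \<in> {0..\<alpha>} \<Longrightarrow> cmod (p l j x - p l j y) \<le> L * \<bar>x - y\<bar>"
proof -
  obtain C where C: "0 < C" "\<And>i y. i \<in> I \<Longrightarrow> cmod (\<phi> i y) \<le> C" "\<And>i y. i \<in> I \<Longrightarrow> cmod (q i y) \<le> C"
    using bloch_bounded by blast
  obtain B where B: "0 < B" "\<And>i j x. i \<in> I \<Longrightarrow> 0 \<le> x \<Longrightarrow> x \<le> \<alpha> \<Longrightarrow> cmod (A i j x) \<le> B" using A_bounded by blast
  have "Bseq \<kappa>" using kappa_lim convergent_imp_Bseq convergentI by blast
  then obtain K where K: "0 < K" "\<And>j. \<bar>\<kappa> j\<bar> \<le> K" by (auto simp: Bseq_def)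
  define W' where "W' = real (card I) * (C * B)"
  have Wb: "cmod (W j x) \<le> W'" if x: "0 \<le> x" "x \<le> \<alpha>" for j x
  proof -
    have "cmod (W j x) \<le> (\<Sum>i\<in>I. cmod (\<phi> i (x / \<epsilon> j) * A i j x))" unfolding W_expand[of j x] by (rule norm_sum)
    also have "\<dots> \<le> (\<Sum>i\<in>I. C * B)"
      unfolding norm_mult using B(2)[OF _ x] C by (intro sum_mono mult_mono) auto
    finally show ?thesis by (simp add: W'_def)
  qed
  have r1: "0 \<le> r1" using r_le[of 0] r_pos[of 0] by linarith
  have le: "cmod (p l j y - p l j x) \<le> K * (r1 * W' * C) * (y - x)" if l: "l \<in> I" and xy: "0 \<le> x" "x \<le> y" "y \<le> \<alpha>" for l j x y
  proof -
    let ?f = "\<lambda>t. of_real (osc (\<epsilon> j) r t) * W j t * cnj (\<phi> l (t / \<epsilon> j))"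
    have lf: "loc_bounded ?f"
      by (intro loc_bounded_mult loc_bounded_of_real loc_bounded_osc_r loc_bounded_sols loc_bounded_cnj loc_bounded_scale loc_bounded_bloch l)
    have "cmod (integral {x..y} ?f) \<le> (r1 * W' * C) * (y - x)"
    proof (rule loc_bounded_integral_bound[OF lf _ xy(2)])
      fix t assume t: "x \<le> t" "t \<le> y"
      have "cmod (?f t) = osc (\<epsilon> j) r t * cmod (W j t) * cmod (\<phi> l (t / \<epsilon> j))"
        using r_pos[of "t / \<epsilon> j"] by (simp add: norm_mult osc_def)
      also have "\<dots> \<le> r1 * W' * C"
        using C(2)[OF l] Wb[of t j] t xy r_le r_pos r1 C(1) order_trans[OF norm_ge_zero Wb[of t j]]
        by (intro mult_mono mult_nonneg_nonneg) (auto simp: osc_def less_imp_le)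
      finally show "cmod (?f t) \<le> r1 * W' * C" .
    qed
    moreover have "p l j y - p l j x = - of_real (\<kappa> j) * integral {x..y} ?f"
    proof -
      have e: "integral {0..y} ?f = integral {0..x} ?f + integral {x..y} ?f"
        using loc_bounded_integral_combine[OF lf xy(1,2)] by simp
      have "p l j x = p l j 0 - \<kappa> j * integral {0..x} ?f" "p l j y = p l j 0 - \<kappa> j * integral {0..y} ?f"
        using xy by (auto intro!: p_increment[OF l])
      then show ?thesis unfolding e by (simp add: distrib_left)
    qed
    ultimately have "cmod (p l j y - p l j x) \<le> K * ((r1 * W' * C) * (y - x))"
      using K by (simp add: norm_mult) (intro mult_mono, auto)
    then show ?thesis by (simp add: mult.assoc)
  qed
  show ?thesis
  proof (rule that[of "K * (r1 * W' * C)"])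
    fix l j x y assume "l \<in> I" "x \<in> {0..\<alpha>}" "y \<in> {0..\<alpha>}"
    then show "cmod (p l j x - p l j y) \<le> K * (r1 * W' * C) * \<bar>x - y\<bar>"
      using le[of l x y j] le[of l y x j] by (cases "x \<le> y") (auto simp: norm_minus_commute)
  qed
qed

text \<open>What averaging leaves of the product of waves \<open>h\<close> and \<open>l\<close>: a
  product whose phase over a period is not 1 averages out. The surviving integrals are later
  identified with the coefficients b.\<close>

definition bloch_mass :: "'i \<Rightarrow> 'i \<Rightarrow> complex" where
  "bloch_mass l h = (if exp (2 * \<i> * pi * \<sigma> h) * cnj (exp (2 * \<i> * pi * \<sigma> l)) = 1
     then integral {0..1} (\<lambda>y. of_real (r y) * \<phi> h y * cnj (\<phi> l y)) else 0)"

lemma loc_bounded_p: "l \<in> I \<Longrightarrow> loc_bounded (p l j)"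
  unfolding p_def[abs_def]
  by (intro loc_bounded_diff loc_bounded_mult loc_bounded_const loc_bounded_cnj loc_bounded_scale loc_bounded_sols loc_bounded_bloch)

lemma loc_bounded_A: "loc_bounded (A i j)"
  unfolding A_def[abs_def] by (intro loc_bounded_sum loc_bounded_mult loc_bounded_const loc_bounded_p)

text \<open>Compactness is applied to the Wronskians; the amplitudes follow through the constant
  matrix \<open>D\<close>. The equation is kept in integral form, so that uniform convergence is all
  the limit passage requires of the amplitudes.\<close>

theorem homogenized_limit:
  obtains k :: "nat \<Rightarrow> nat" and \<A> :: "'i \<Rightarrow> real \<Rightarrow> complex"
  where "strict_mono k" "\<And>i. i \<in> I \<Longrightarrow> continuous_on UNIV (\<A> i)"
    "\<And>i. i \<in> I \<Longrightarrow> uniform_limit {0..\<alpha>} (\<lambda>n. A i (k n)) (\<A> i) sequentially"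
    "\<And>i x. i \<in> I \<Longrightarrow> 0 \<le> x \<Longrightarrow> x \<le> \<alpha> \<Longrightarrow>
      \<A> i x = \<A> i 0 - of_real (2 * \<mu>0 * \<mu>1) * (\<Sum>l\<in>I. D i l * (\<Sum>h\<in>I. bloch_mass l h * integral {0..x} (\<A> h)))"
proof -
  obtain B where B: "\<And>l j x. l \<in> I \<Longrightarrow> 0 \<le> x \<Longrightarrow> x \<le> \<alpha> \<Longrightarrow> cmod (p l j x) \<le> B" using p_bounded by blast
  obtain L where L: "\<And>l j x y. l \<in> I \<Longrightarrow> x \<in> {0..\<alpha>} \<Longrightarrow> y \<in> {0..\<alpha>} \<Longrightarrow> cmod (p l j x - p l j y) \<le> L * \<bar>x - y\<bar>"
    using p_Lipschitz by blast
  obtain G :: "'i \<Rightarrow> real \<Rightarrow> complex" and k :: "nat \<Rightarrow> nat" where k: "strict_mono k"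
    and G: "\<And>i. i \<in> I \<Longrightarrow> continuous_on {0..\<alpha>} (G i)"
      "\<And>i. i \<in> I \<Longrightarrow> uniform_limit {0..\<alpha>} (\<lambda>n. p i (k n)) (G i) sequentially"
  proof (rule Arzela_Ascoli_finite_family[OF fin, of "{0..\<alpha>}" p B L])
    show "cmod (p i n x) \<le> B" if "i \<in> I" "x \<in> {0..\<alpha>}" for i n x using B that by auto
  qed (use L in \<open>blast | simp\<close>)+
  define P where "P i x = G i (max 0 (min \<alpha> x))" for i x
  have cP: "continuous_on UNIV (P i)" if "i \<in> I" for i
    unfolding P_def[abs_def] by (intro continuous_on_compose2[OF G(1)[OF that]] continuous_intros) (use \<alpha> in auto)
  have PG: "P i x = G i x" if "x \<in> {0..\<alpha>}" for i x
  proof -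
    have "max 0 (min \<alpha> x) = x" using that by auto
    then show ?thesis by (simp add: P_def)
  qed
  have uP: "uniform_limit {0..\<alpha>} (\<lambda>n. p i (k n)) (P i) sequentially" if "i \<in> I" for i
    by (rule uniform_limit_cong'[THEN iffD1, OF _ _ G(2)[OF that]]) (use PG in auto)
  define \<A> where "\<A> i x = (\<Sum>l\<in>I. D i l * P l x)" for i x
  have cA: "continuous_on UNIV (\<A> i)" for i
    unfolding \<A>_def[abs_def] by (intro continuous_intros cP)
  have uA: "uniform_limit {0..\<alpha>} (\<lambda>n. A i (k n)) (\<A> i) sequentially" for i
    unfolding A_def[abs_def] \<A>_def[abs_def]
    by (intro uniform_limit_finite_sum bounded_linear.uniform_limit[OF bounded_linear_mult_right] uP)
  show ?thesis
  proof (rule that[OF k cA uA])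
    fix i x assume i: "i \<in> I" and x: "0 \<le> x" "x \<le> \<alpha>"
    have \<epsilon>k: "(\<lambda>n. \<epsilon> (k n)) \<longlonglongrightarrow> 0" using \<epsilon>_lim k LIMSEQ_subseq_LIMSEQ by (fastforce simp: o_def)
    have \<kappa>k: "(\<lambda>n. \<kappa> (k n)) \<longlonglongrightarrow> 2 * \<mu>0 * \<mu>1" using kappa_lim k LIMSEQ_subseq_LIMSEQ by (fastforce simp: o_def)
    \<comment> \<open>After expanding \<open>W\<close>, the integrand is a sum of amplitudes times
      fixed quasi-periodic functions of \<open>t / \<epsilon> (k n)\<close>. The amplitude is first
      replaced by its uniform limit, since averaging needs a fixed continuous factor.\<close>
    have Il: "(\<lambda>n. integral {0..x} (\<lambda>t. of_real (osc (\<epsilon> (k n)) r t) * W (k n) t * cnj (\<phi> l (t / \<epsilon> (k n)))))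
      \<longlonglongrightarrow> (\<Sum>h\<in>I. bloch_mass l h * integral {0..x} (\<A> h))" if l: "l \<in> I" for l
    proof -
      define \<beta> where "\<beta> h y = of_real (r y) * \<phi> h y * cnj (\<phi> l y)" for h y
      have \<beta>: "loc_bounded (\<beta> h)" if "h \<in> I" for h unfolding \<beta>_def[abs_def]
        by (intro loc_bounded_mult loc_bounded_of_real loc_bounded_r loc_bounded_bloch loc_bounded_cnj that l)
      let ?\<omega> = "\<lambda>h. exp (2 * \<i> * pi * \<sigma> h) * cnj (exp (2 * \<i> * pi * \<sigma> l))"
      have \<beta>per: "\<beta> h (y + 1) = ?\<omega> h * \<beta> h y" if "h \<in> I" for h y
        unfolding \<beta>_def \<phi>_per[OF that] \<phi>_per[OF l] r_periodic by simp
      have n\<omega>: "norm (?\<omega> h) = 1" for h unfolding norm_mult complex_mod_cnj norm_exp_i_real by simp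
      have 1: "(\<lambda>n. integral {0..x} (\<lambda>t. A h (k n) t * \<beta> h (t / \<epsilon> (k n)))) \<longlonglongrightarrow> bloch_mass l h * integral {0..x} (\<A> h)"
        if h: "h \<in> I" for h
      proof (rule Lim_transform)
        show "(\<lambda>n. integral {0..x} (\<lambda>t. \<A> h t * \<beta> h (t / \<epsilon> (k n)))) \<longlonglongrightarrow> bloch_mass l h * integral {0..x} (\<A> h)"
          using averaging_quasi_periodic[OF cA \<beta>[OF h] \<beta>per[OF h] n\<omega> \<epsilon>k \<epsilon>_pos order_refl x(1), of h]
          unfolding bloch_mass_def \<beta>_def .
        obtain C where C: "0 < C" "\<And>y. cmod (\<beta> h y) \<le> C" using quasi_periodic_bounded[OF \<beta>[OF h] \<beta>per[OF h] n\<omega>] by blast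
        show "(\<lambda>n. integral {0..x} (\<lambda>t. A h (k n) t * \<beta> h (t / \<epsilon> (k n))) - integral {0..x} (\<lambda>t. \<A> h t * \<beta> h (t / \<epsilon> (k n)))) \<longlonglongrightarrow> 0"
        proof (rule LIMSEQ_I)
          fix e :: real assume e: "0 < e"
          define e' where "e' = e / (2 * C * (x + 1))"
          have e': "0 < e'" using e C x by (simp add: e'_def)
          obtain N where N: "\<And>n t. n \<ge> N \<Longrightarrow> t \<in> {0..\<alpha>} \<Longrightarrow> dist (A h (k n) t) (\<A> h t) < e'"
            using uA[of h] e' unfolding uniform_limit_iff eventually_sequentially by blast
          have "cmod (integral {0..x} (\<lambda>t. A h (k n) t * \<beta> h (t / \<epsilon> (k n))) - integral {0..x} (\<lambda>t. \<A> h t * \<beta> h (t / \<epsilon> (k n))) - 0) < e"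
            if n: "n \<ge> N" for n
          proof -
            have lb: "loc_bounded (\<lambda>t. A h (k n) t * \<beta> h (t / \<epsilon> (k n)))" "loc_bounded (\<lambda>t. \<A> h t * \<beta> h (t / \<epsilon> (k n)))"
              by (intro loc_bounded_mult loc_bounded_A loc_bounded_scale \<beta> h loc_bounded_continuous cA)+
            have "cmod (integral {0..x} (\<lambda>t. A h (k n) t * \<beta> h (t / \<epsilon> (k n)) - \<A> h t * \<beta> h (t / \<epsilon> (k n)))) \<le> (e' * C) * (x - 0)"
            proof (rule loc_bounded_integral_bound[OF loc_bounded_diff[OF lb] _ x(1)])
              fix t assume t: "0 \<le> t" "t \<le> x"
              have "cmod (A h (k n) t * \<beta> h (t / \<epsilon> (k n)) - \<A> h t * \<beta> h (t / \<epsilon> (k n))) = cmod (A h (k n) t - \<A> h t) * cmod (\<beta> h (t / \<epsilon> (k n)))"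
                by (simp add: left_diff_distrib flip: norm_mult)
              also have "\<dots> \<le> e' * C" using N[OF n, of t] C t x e' by (intro mult_mono) (auto simp: dist_norm less_imp_le)
              finally show "cmod (A h (k n) t * \<beta> h (t / \<epsilon> (k n)) - \<A> h t * \<beta> h (t / \<epsilon> (k n))) \<le> e' * C" .
            qed
            also have "\<dots> < e"
            proof -
              have "e' * C * x \<le> e' * C * (x + 1)" using e' C by (intro mult_left_mono) auto
              also have "\<dots> = e / 2"
              proof -
                define z where "z = x + 1"
                have "z > 0" using x by (simp add: z_def)
                then have "e / (2 * C * z) * C * z = e / 2" using C by simp
                then show ?thesis by (simp add: e'_def z_def)
              qed
              finally show ?thesis using e by simp
            qed
            finally show ?thesis
              using Henstock_Kurzweil_Integration.integral_diff[OF loc_bounded_integrable[OF lb(1)] loc_bounded_integrable[OF lb(2)], of 0 x]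
              by simp
          qed
          then show "\<exists>no. \<forall>n\<ge>no. cmod (integral {0..x} (\<lambda>t. A h (k n) t * \<beta> h (t / \<epsilon> (k n))) - integral {0..x} (\<lambda>t. \<A> h t * \<beta> h (t / \<epsilon> (k n))) - 0) < e"
            by blast
        qed
      qed
      have "integral {0..x} (\<lambda>t. of_real (osc (\<epsilon> (k n)) r t) * W (k n) t * cnj (\<phi> l (t / \<epsilon> (k n))))
         = (\<Sum>h\<in>I. integral {0..x} (\<lambda>t. A h (k n) t * \<beta> h (t / \<epsilon> (k n))))" for n
      proof -
        have "of_real (osc (\<epsilon> (k n)) r t) * W (k n) t * cnj (\<phi> l (t / \<epsilon> (k n))) = (\<Sum>h\<in>I. A h (k n) t * \<beta> h (t / \<epsilon> (k n)))" for t
          unfolding W_expand[of "k n" t] \<beta>_def osc_def sum_distrib_left sum_distrib_right by (rule sum.cong) auto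
        then show ?thesis
          by (simp only:) (rule integral_sum[OF fin], intro loc_bounded_integrable loc_bounded_mult loc_bounded_A loc_bounded_scale \<beta>)
      qed
      then show ?thesis using tendsto_sum[of I, OF 1] by simp
    qed
    have pl: "P l x = P l 0 - of_real (2 * \<mu>0 * \<mu>1) * (\<Sum>h\<in>I. bloch_mass l h * integral {0..x} (\<A> h))" if l: "l \<in> I" for l
    proof (rule LIMSEQ_unique)
      have t: "(\<lambda>n. p l (k n) z) \<longlonglongrightarrow> P l z" if "z \<in> {0..\<alpha>}" for z using uP[OF l] that by (rule tendsto_uniform_limitI)
      show "(\<lambda>n. p l (k n) x) \<longlonglongrightarrow> P l x" using t x by auto
      have "(\<lambda>n. p l (k n) 0 - of_real (\<kappa> (k n)) * integral {0..x} (\<lambda>t. of_real (osc (\<epsilon> (k n)) r t) * W (k n) t * cnj (\<phi> l (t / \<epsilon> (k n)))))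
        \<longlonglongrightarrow> P l 0 - of_real (2 * \<mu>0 * \<mu>1) * (\<Sum>h\<in>I. bloch_mass l h * integral {0..x} (\<A> h))"
        using \<alpha> by (intro tendsto_diff tendsto_mult t tendsto_of_real \<kappa>k Il l) auto
      then show "(\<lambda>n. p l (k n) x) \<longlonglongrightarrow> P l 0 - of_real (2 * \<mu>0 * \<mu>1) * (\<Sum>h\<in>I. bloch_mass l h * integral {0..x} (\<A> h))"
        by (subst p_increment[OF l x])
    qed
    have "\<A> i x = (\<Sum>l\<in>I. D i l * P l 0 - D i l * (of_real (2 * \<mu>0 * \<mu>1) * (\<Sum>h\<in>I. bloch_mass l h * integral {0..x} (\<A> h))))"
      unfolding \<A>_def[of i] by (rule sum.cong[OF refl]) (simp only: pl right_diff_distrib)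
    also have "\<dots> = \<A> i 0 - of_real (2 * \<mu>0 * \<mu>1) * (\<Sum>l\<in>I. D i l * (\<Sum>h\<in>I. bloch_mass l h * integral {0..x} (\<A> h)))"
    proof -
      have "(\<Sum>l\<in>I. D i l * (c * S l)) = c * (\<Sum>l\<in>I. D i l * S l)" for c and S :: "'i \<Rightarrow> complex"
        by (simp add: sum_distrib_left mult.left_commute)
      then show ?thesis unfolding sum_subtractf \<A>_def[of i 0] by simp
    qed
    finally show "\<A> i x = \<A> i 0 - of_real (2 * \<mu>0 * \<mu>1) * (\<Sum>l\<in>I. D i l * (\<Sum>h\<in>I. bloch_mass l h * integral {0..x} (\<A> h)))" .
  qed
qed

text \<open>At the right end \<open>\<alpha> / \<epsilon> j\<close> is the integer
  \<open>N j\<close>, so each wave equals its value at 0 times the \<open>N j\<close>-th power of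
  its multiplier; \<open>\<rho>\<close> collects the limits of these powers.\<close>

lemma boundary_limit:
  assumes k: "strict_mono (k :: nat \<Rightarrow> nat)" and u: "\<And>i. i \<in> I \<Longrightarrow> uniform_limit {0..\<alpha>} (\<lambda>n. A i (k n)) (\<A> i) sequentially"
  shows "(\<Sum>i\<in>I. \<phi> i 0 * \<A> i 0) = 0"
    and "\<lbrakk>\<And>i. i \<in> I \<Longrightarrow> (\<lambda>j. exp (2 * \<i> * pi * \<sigma> i) ^ N j) \<longlonglongrightarrow> \<rho> i; \<And>j. \<alpha> / \<epsilon> j = real (N j)\<rbrakk> \<Longrightarrow>
      (\<Sum>i\<in>I. \<rho> i * \<phi> i 0 * \<A> i \<alpha>) = 0"
proof -
  have t: "(\<lambda>n. A i (k n) z) \<longlonglongrightarrow> \<A> i z" if "i \<in> I" "z \<in> {0..\<alpha>}" for i z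
    using u[OF that(1)] that(2) by (rule tendsto_uniform_limitI)
  have "(\<lambda>n. \<Sum>i\<in>I. \<phi> i 0 * A i (k n) 0) \<longlonglongrightarrow> (\<Sum>i\<in>I. \<phi> i 0 * \<A> i 0)"
    using \<alpha> by (intro tendsto_intros t) auto
  moreover have "(\<Sum>i\<in>I. \<phi> i 0 * A i (k n) 0) = 0" for n using W_expand[of "k n" 0] bc(1)[of "k n"] by simp
  ultimately show "(\<Sum>i\<in>I. \<phi> i 0 * \<A> i 0) = 0" by (simp add: LIMSEQ_const_iff)
  assume \<rho>: "\<And>i. i \<in> I \<Longrightarrow> (\<lambda>j. exp (2 * \<i> * pi * \<sigma> i) ^ N j) \<longlonglongrightarrow> \<rho> i" and N: "\<And>j. \<alpha> / \<epsilon> j = real (N j)"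
  have "(\<lambda>n. exp (2 * \<i> * pi * \<sigma> i) ^ N (k n)) \<longlonglongrightarrow> \<rho> i" if "i \<in> I" for i
    using LIMSEQ_subseq_LIMSEQ[OF \<rho>[OF that] k] by (simp add: o_def)
  then have "(\<lambda>n. \<Sum>i\<in>I. exp (2 * \<i> * pi * \<sigma> i) ^ N (k n) * \<phi> i 0 * A i (k n) \<alpha>) \<longlonglongrightarrow> (\<Sum>i\<in>I. \<rho> i * \<phi> i 0 * \<A> i \<alpha>)"
    using \<alpha> by (intro tendsto_intros t) auto
  moreover have "(\<Sum>i\<in>I. exp (2 * \<i> * pi * \<sigma> i) ^ N (k n) * \<phi> i 0 * A i (k n) \<alpha>) = 0" for n
  proof -
    have "\<phi> i (\<alpha> / \<epsilon> (k n)) = exp (2 * \<i> * pi * \<sigma> i) ^ N (k n) * \<phi> i 0" if "i \<in> I" for i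
      using quasi_periodic_nat[of "\<phi> i", OF \<phi>_per[OF that], of 0 "N (k n)"] by (simp add: N)
    then have "(\<Sum>i\<in>I. exp (2 * \<i> * pi * \<sigma> i) ^ N (k n) * \<phi> i 0 * A i (k n) \<alpha>) = W (k n) \<alpha>"
      unfolding W_expand[of "k n" \<alpha>] by (intro sum.cong) auto
    then show ?thesis using bc(2) by simp
  qed
  ultimately show "(\<Sum>i\<in>I. \<rho> i * \<phi> i 0 * \<A> i \<alpha>) = 0" by (simp add: LIMSEQ_const_iff)
qed

end

section \<open>Limits of modulated two-scale transforms\<close>

lemma integrable_lborel_product:
  fixes f g :: "real \<Rightarrow> 'b::{euclidean_space, real_normed_field}"
  assumes f: "integrable lborel f" and g: "integrable lborel g"
  shows "integrable lborel (\<lambda>z. f (fst z) * g (snd z))"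
    and "integral\<^sup>L lborel (\<lambda>z. f (fst z) * g (snd z)) = integral\<^sup>L lborel f * integral\<^sup>L lborel g"
proof -
  have [measurable]: "f \<in> borel_measurable borel" "g \<in> borel_measurable borel" using f g by auto
  have i: "integrable (lborel \<Otimes>\<^sub>M lborel) (\<lambda>z. f (fst z) * g (snd z))"
  proof (rule lborel_pair.Fubini_integrable)
    have "(\<lambda>x. \<integral>y. norm (f (fst (x, y)) * g (snd (x, y))) \<partial>lborel) = (\<lambda>x. norm (f x) * (\<integral>y. norm (g y) \<partial>lborel))"
      by (simp add: norm_mult)
    then show "integrable lborel (\<lambda>x. \<integral>y. norm (f (fst (x, y)) * g (snd (x, y))) \<partial>lborel)" using f by simp
    show "AE x in lborel. integrable lborel (\<lambda>y. f (fst (x, y)) * g (snd (x, y)))" using g by simp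
  qed measurable
  then show "integrable lborel (\<lambda>z. f (fst z) * g (snd z))" by (simp add: lborel_prod)
  have "integral\<^sup>L (lborel \<Otimes>\<^sub>M lborel) (\<lambda>z. f (fst z) * g (snd z)) = (\<integral>x. \<integral>y. f (fst (x, y)) * g (snd (x, y)) \<partial>lborel \<partial>lborel)"
    by (rule lborel_pair.integral_fst'[OF i, symmetric])
  then show "integral\<^sup>L lborel (\<lambda>z. f (fst z) * g (snd z)) = integral\<^sup>L lborel f * integral\<^sup>L lborel g"
    by (simp add: lborel_prod)
qed

lemma loc_bounded_lborel:
  fixes f :: "real \<Rightarrow> 'b::euclidean_space"
  assumes "loc_bounded f"
  shows "integrable lborel (\<lambda>x. indicator {c..d} x *\<^sub>R f x)"
    and "integral\<^sup>L lborel (\<lambda>x. indicator {c..d} x *\<^sub>R f x) = integral {c..d} f"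
proof -
  have [measurable]: "f \<in> borel_measurable borel" by (rule loc_bounded_measurable[OF assms])
  have "integrable lebesgue (\<lambda>x. indicator {c..d} x *\<^sub>R f x)"
    using loc_bounded_absolutely_integrable[OF assms, of c d] by (simp add: set_integrable_def)
  then show i: "integrable lborel (\<lambda>x. indicator {c..d} x *\<^sub>R f x)"
    by (subst (asm) integrable_completion) auto
  then show "integral\<^sup>L lborel (\<lambda>x. indicator {c..d} x *\<^sub>R f x) = integral {c..d} f"
    using set_borel_integral_eq_integral(2)[of "{c..d}" f] by (simp add: set_integrable_def set_lebesgue_integral_def)
qed

lemma rectangle_product_integral:
  fixes f g :: "real \<Rightarrow> 'b::{euclidean_space, real_normed_field}"
  assumes f: "loc_bounded f" and g: "loc_bounded g"
  shows "integrable lborel (\<lambda>z. indicator ({x1..x2} \<times> {y1..y2}) z *\<^sub>R (f (fst z) * g (snd z)))"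
    and "integral\<^sup>L lborel (\<lambda>z. indicator ({x1..x2} \<times> {y1..y2}) z *\<^sub>R (f (fst z) * g (snd z)))
      = integral {x1..x2} f * integral {y1..y2} g"
proof -
  have e: "(\<lambda>z. indicator ({x1..x2} \<times> {y1..y2}) z *\<^sub>R (f (fst z) * g (snd z)))
    = (\<lambda>z. (indicator {x1..x2} (fst z) *\<^sub>R f (fst z)) * (indicator {y1..y2} (snd z) *\<^sub>R g (snd z)))"
    by (auto simp: fun_eq_iff indicator_def)
  show "integrable lborel (\<lambda>z. indicator ({x1..x2} \<times> {y1..y2}) z *\<^sub>R (f (fst z) * g (snd z)))"
    unfolding e by (rule integrable_lborel_product(1)[OF loc_bounded_lborel(1)[OF f] loc_bounded_lborel(1)[OF g]])
  show "integral\<^sup>L lborel (\<lambda>z. indicator ({x1..x2} \<times> {y1..y2}) z *\<^sub>R (f (fst z) * g (snd z)))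
      = integral {x1..x2} f * integral {y1..y2} g"
    unfolding e integrable_lborel_product(2)[OF loc_bounded_lborel(1)[OF f] loc_bounded_lborel(1)[OF g]]
      loc_bounded_lborel(2)[OF f] loc_bounded_lborel(2)[OF g] ..
qed

text \<open>The detour through a Borel null set containing \<open>N\<close> is needed because the
  product sigma-algebra contains products of Borel sets but not of arbitrary null sets.\<close>

lemma negligible_strips:
  fixes N :: "real set"
  assumes "negligible N"
  shows "negligible ((UNIV :: real set) \<times> N)" and "negligible (N \<times> (UNIV :: real set))"
proof -
  have "N \<in> null_sets lebesgue" using assms by (simp add: negligible_iff_null_sets)
  then obtain N' where N': "N' \<in> null_sets lborel" "N \<subseteq> N'" by (auto simp: null_sets_completion_iff2)
  have "UNIV \<times> N' \<in> null_sets (lborel \<Otimes>\<^sub>M lborel)" "N' \<times> UNIV \<in> null_sets (lborel \<Otimes>\<^sub>M lborel)"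
    using N'(1) by (auto intro: lborel.times_in_null_sets2 lborel.times_in_null_sets1)
  then have "UNIV \<times> N' \<in> null_sets lborel" "N' \<times> UNIV \<in> null_sets lborel" by (simp_all add: lborel_prod)
  then have "negligible (UNIV \<times> N')" "negligible (N' \<times> UNIV)"
    by (auto simp: negligible_iff_null_sets intro: null_sets_completionI)
  then show "negligible (UNIV \<times> N)" "negligible (N \<times> UNIV)"
    using N'(2) by (auto elim!: negligible_subset)
qed

text \<open>Off a null set, the sum over cells in the definition of the two-scale transform reduces to the
  one cell which contains \<open>fst z\<close>.\<close>

definition tscale :: "real \<Rightarrow> real \<Rightarrow> (real \<Rightarrow> complex) \<Rightarrow> real \<times> real \<Rightarrow> complex" where
  "tscale \<epsilon> s V z = exp (- 2 * \<i> * pi * s * of_real (of_int \<lfloor>fst z / \<epsilon>\<rfloor>)) *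
     V (\<epsilon> * of_int \<lfloor>fst z / \<epsilon>\<rfloor> + \<epsilon> * snd z)"

lemma tscale_measurable [measurable]:
  assumes [measurable]: "V \<in> borel_measurable borel"
  shows "tscale \<epsilon> s V \<in> borel_measurable borel"
proof -
  have [measurable]: "(\<lambda>x::real. complex_of_real (of_int \<lfloor>x\<rfloor>)) \<in> borel_measurable borel" by measurable
  have "(\<lambda>z::real\<times>real. exp (- 2 * \<i> * pi * s * of_real (of_int \<lfloor>fst z / \<epsilon>\<rfloor>)) *
     V (\<epsilon> * of_int \<lfloor>fst z / \<epsilon>\<rfloor> + \<epsilon> * snd z)) \<in> borel_measurable (borel \<Otimes>\<^sub>M borel)"
    by measurable
  then show ?thesis unfolding tscale_def[abs_def] by (simp add: borel_prod)
qed

lemma norm_exp_minus_i_real: "norm (exp (- 2 * \<i> * of_real pi * of_real s * of_real t)) = 1"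
proof -
  have "- 2 * \<i> * of_real pi * of_real s * of_real t = \<i> * of_real (- 2 * pi * s * t)" by simp
  then show ?thesis by (metis norm_exp_i_times)
qed

lemma norm_tscale: "norm (tscale \<epsilon> s V z) = norm (V (\<epsilon> * of_int \<lfloor>fst z / \<epsilon>\<rfloor> + \<epsilon> * snd z))"
  unfolding tscale_def norm_mult norm_exp_minus_i_real by simp

text \<open>As \<open>\<alpha> / \<epsilon>\<close> is an integer, the cells tile the interval
  exactly: the cell of an interior point lies inside, and no boundary layer arises.\<close>

lemma floor_cell:
  assumes "0 < \<epsilon>" "\<alpha> / \<epsilon> = real N" "0 < x" "x < \<alpha>" "0 \<le> y" "y \<le> 1"
  obtains l :: nat where "\<lfloor>x / \<epsilon>\<rfloor> = int l" "l < N" "\<epsilon> * of_int \<lfloor>x / \<epsilon>\<rfloor> + \<epsilon> * y \<in> {0..\<alpha>}"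
    "\<bar>x - (\<epsilon> * of_int \<lfloor>x / \<epsilon>\<rfloor> + \<epsilon> * y)\<bar> \<le> \<epsilon>"
proof -
  define l where "l = nat \<lfloor>x / \<epsilon>\<rfloor>"
  have x0: "0 < x / \<epsilon>" using assms by simp
  have l: "\<lfloor>x / \<epsilon>\<rfloor> = int l" unfolding l_def using x0 by (simp add: less_imp_le)
  have le: "real l \<le> x / \<epsilon>" "x / \<epsilon> < real l + 1"
    using l floor_correct[of "x / \<epsilon>"] by (simp_all)
  have "x / \<epsilon> < \<alpha> / \<epsilon>" by (rule divide_strict_right_mono) (use assms in auto)
  then have "real l < real N" using le assms by linarith
  then have lN: "l < N" by simp
  have "\<alpha> = \<epsilon> * real N" using assms by (simp add: field_simps)
  moreover have "\<epsilon> * (real l + y) \<le> \<epsilon> * real N"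
    using lN assms by (intro mult_left_mono) auto
  ultimately have b: "\<epsilon> * real l + \<epsilon> * y \<in> {0..\<alpha>}" using assms by (simp add: distrib_left)
  have "\<epsilon> * real l \<le> x" "x < \<epsilon> * real l + \<epsilon>" using le assms(1) by (simp_all add: field_simps)
  moreover have "0 \<le> \<epsilon> * y" "\<epsilon> * y \<le> \<epsilon>" using assms by (simp_all add: mult_left_le)
  ultimately have "\<bar>x - (\<epsilon> * real l + \<epsilon> * y)\<bar> \<le> \<epsilon>" by linarith
  then show ?thesis using that[OF l lN] b l by simp
qed

text \<open>On the cell with number l the wave is \<open>\<omega> i ^ l\<close> times its values on
  the unit cell, and the transform adds the phase exp(-2 i pi s l). Up to a uniformly small error
  the transform is therefore a sum of products of an amplitude, a unimodular step function of
  \<open>x / \<epsilon> n\<close> with multiplier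
  \<open>\<omega> i * exp (- 2 * \<i> * pi * s)\<close>, and \<open>\<zeta> i y\<close>. Averaging
  in \<open>x\<close> keeps exactly the terms with multiplier 1.\<close>

theorem two_scale_rectangle_limit:
  fixes \<zeta> :: "'i \<Rightarrow> real \<Rightarrow> complex" and \<omega> :: "'i \<Rightarrow> complex" and B :: "nat \<Rightarrow> 'i \<Rightarrow> real \<Rightarrow> complex"
  assumes I: "finite I" and \<alpha>: "0 < \<alpha>" and \<epsilon>: "\<And>n. 0 < \<epsilon> n" "\<epsilon> \<longlonglongrightarrow> 0" "\<And>n. \<alpha> / \<epsilon> n = real (N n)"
    and B: "\<And>i. i \<in> I \<Longrightarrow> continuous_on UNIV (\<B> i)" "\<And>i. i \<in> I \<Longrightarrow> uniform_limit {0..\<alpha>} (\<lambda>n. B n i) (\<B> i) sequentially"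
    and \<zeta>: "\<And>i. i \<in> I \<Longrightarrow> loc_bounded (\<zeta> i)" "\<And>i y. i \<in> I \<Longrightarrow> \<zeta> i (y + 1) = \<omega> i * \<zeta> i y" "\<And>i. i \<in> I \<Longrightarrow> norm (\<omega> i) = 1"
    and V: "\<And>n. V n \<in> borel_measurable borel" "\<And>n x. V n x = (\<Sum>i\<in>I. \<zeta> i (x / \<epsilon> n) * B n i x)"
    and box: "0 < x1" "x1 \<le> x2" "x2 < \<alpha>" "0 < y1" "y1 \<le> y2" "y2 < 1"
  shows "(\<lambda>n. integral\<^sup>L lborel (\<lambda>z. indicator ({x1..x2} \<times> {y1..y2}) z *\<^sub>R tscale (\<epsilon> n) s (V n) z))
    \<longlonglongrightarrow> (\<Sum>i\<in>I. if \<omega> i * exp (- 2 * \<i> * pi * s) = 1 then integral {x1..x2} (\<B> i) * integral {y1..y2} (\<zeta> i) else 0)"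
proof -
  let ?R = "{x1..x2} \<times> {y1..y2} :: (real \<times> real) set"
  let ?e = "exp (- 2 * \<i> * pi * s)"
  define \<beta> where "\<beta> i x = exp (- 2 * \<i> * pi * s * of_real (of_int \<lfloor>x\<rfloor>)) * (\<omega> i powi \<lfloor>x\<rfloor>)" for i and x :: real
  have \<omega>0: "\<omega> i \<noteq> 0" if "i \<in> I" for i using \<zeta>(3)[OF that] by auto
  have \<beta>per: "\<beta> i (x + 1) = (\<omega> i * ?e) * \<beta> i x" if "i \<in> I" for i x
  proof -
    have "exp (- 2 * \<i> * pi * s * of_real (of_int \<lfloor>x + 1\<rfloor>)) = exp (- 2 * \<i> * pi * s * of_real (of_int \<lfloor>x\<rfloor>)) * ?e"
      unfolding exp_add[symmetric] by (rule arg_cong[of _ _ exp]) (simp add: algebra_simps)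
    moreover have "\<omega> i powi \<lfloor>x + 1\<rfloor> = \<omega> i powi \<lfloor>x\<rfloor> * \<omega> i" using \<omega>0[OF that] by (simp add: power_int_add)
    ultimately show ?thesis by (simp add: \<beta>_def)
  qed
  have \<beta>n: "norm (\<beta> i x) = 1" if "i \<in> I" for i x
    unfolding \<beta>_def norm_mult norm_exp_minus_i_real using \<zeta>(3)[OF that] by (simp add: norm_power_int)
  have \<beta>l: "loc_bounded (\<beta> i)" if "i \<in> I" for i
  proof (rule loc_boundedI)
    have [measurable]: "(\<lambda>x::real. complex_of_real (of_int \<lfloor>x\<rfloor>)) \<in> borel_measurable borel" by measurable
    have "(\<lambda>x::real. \<omega> i powi \<lfloor>x\<rfloor>) \<in> borel_measurable borel"
      by (rule measurable_compose[of floor borel "count_space UNIV"]) auto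
    then show "\<beta> i \<in> borel_measurable borel" unfolding \<beta>_def[abs_def] by measurable
    show "norm (\<beta> i x) \<le> 1" for x using \<beta>n[OF that] by simp
  qed
  \<comment> \<open>The phase is 1 on the cell with number 0, so a resonant step function has mean 1
    and the limit carries no extra constant.\<close>
  have \<beta>1: "integral {0..1} (\<beta> i) = 1" for i
  proof -
    have "integral {0..1} (\<beta> i) = integral {0..1::real} (\<lambda>_. 1)"
    proof (rule integral_spike[of "{1}"])
      fix x :: real assume "x \<in> {0..1} - {1}"
      then have "\<lfloor>x\<rfloor> = 0" by (simp add: floor_eq_iff)
      then show "1 = \<beta> i x" by (simp add: \<beta>_def)
    qed simp
    then show ?thesis by simp
  qed
  \<comment> \<open>The separated approximation: the amplitude is taken at \<open>x\<close> itself,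
    not at the point of the same cell that the transform addresses.\<close>
  define M where "M n z = (\<Sum>i\<in>I. (\<B> i (fst z) * \<beta> i (fst z / \<epsilon> n)) * \<zeta> i (snd z))" for n and z :: "real \<times> real"
  have lM: "loc_bounded (\<lambda>x. \<B> i x * \<beta> i (x / \<epsilon> n))" if "i \<in> I" for i n
    by (intro loc_bounded_mult loc_bounded_continuous B \<beta>l loc_bounded_scale that)
  have Msum: "indicator ?R z *\<^sub>R M n z = (\<Sum>i\<in>I. indicator ?R z *\<^sub>R ((\<B> i (fst z) * \<beta> i (fst z / \<epsilon> n)) * \<zeta> i (snd z)))" for n z
    unfolding M_def by (rule scaleR_sum_right)
  have Mi: "integrable lborel (\<lambda>z. indicator ?R z *\<^sub>R M n z)" for n
    unfolding Msum by (rule Bochner_Integration.integrable_sum) (rule rectangle_product_integral(1)[OF lM \<zeta>(1)])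
  have MI: "integral\<^sup>L lborel (\<lambda>z. indicator ?R z *\<^sub>R M n z) = (\<Sum>i\<in>I. integral {x1..x2} (\<lambda>x. \<B> i x * \<beta> i (x / \<epsilon> n)) * integral {y1..y2} (\<zeta> i))" for n
    unfolding Msum
  proof (subst Bochner_Integration.integral_sum)
    show "integrable lborel (\<lambda>z. indicator ?R z *\<^sub>R ((\<B> i (fst z) * \<beta> i (fst z / \<epsilon> n)) * \<zeta> i (snd z)))" if "i \<in> I" for i
      by (rule rectangle_product_integral(1)[OF lM[OF that] \<zeta>(1)[OF that]])
  qed (rule sum.cong[OF refl], rule rectangle_product_integral(2)[OF lM \<zeta>(1)])
  have Mlim: "(\<lambda>n. integral\<^sup>L lborel (\<lambda>z. indicator ?R z *\<^sub>R M n z)) \<longlonglongrightarrow>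
    (\<Sum>i\<in>I. if \<omega> i * ?e = 1 then integral {x1..x2} (\<B> i) * integral {y1..y2} (\<zeta> i) else 0)"
    unfolding MI
  proof (rule tendsto_sum)
    fix i assume i: "i \<in> I"
    have ne: "norm (\<omega> i * ?e) = 1"
      using norm_exp_minus_i_real[of s 1] \<zeta>(3)[OF i] by (simp add: norm_mult)
    have "(\<lambda>n. integral {x1..x2} (\<lambda>x. \<B> i x * \<beta> i (x / \<epsilon> n)) * integral {y1..y2} (\<zeta> i))
      \<longlonglongrightarrow> ((if \<omega> i * ?e = 1 then integral {0..1} (\<beta> i) else 0) * integral {x1..x2} (\<B> i)) * integral {y1..y2} (\<zeta> i)"
      using box by (intro tendsto_mult tendsto_const averaging_quasi_periodic[OF B(1)[OF i] \<beta>l[OF i] \<beta>per[OF i] ne \<epsilon>(2,1)]) auto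
    then show "(\<lambda>n. integral {x1..x2} (\<lambda>x. \<B> i x * \<beta> i (x / \<epsilon> n)) * integral {y1..y2} (\<zeta> i))
      \<longlonglongrightarrow> (if \<omega> i * ?e = 1 then integral {x1..x2} (\<B> i) * integral {y1..y2} (\<zeta> i) else 0)"
      by (simp add: \<beta>1 split: if_splits)
  qed
  have "\<exists>C>0. \<forall>i\<in>I. \<forall>y. norm (\<zeta> i y) \<le> C"
  proof -
    have "\<forall>i\<in>I. \<exists>C>0. \<forall>y. norm (\<zeta> i y) \<le> C" using quasi_periodic_bounded[OF \<zeta>(1) \<zeta>(2) \<zeta>(3)] by metis
    then obtain C where C: "\<And>i. i \<in> I \<Longrightarrow> C i > 0" "\<And>i y. i \<in> I \<Longrightarrow> norm (\<zeta> i y) \<le> C i" by metis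
    have le: "C i \<le> 1 + sum C I" if "i \<in> I" for i
      using member_le_sum[OF that _ I, of C] C(1) by (force intro: less_imp_le)
    have "0 < 1 + sum C I" using C(1) by (intro add_pos_nonneg sum_nonneg) (auto intro: less_imp_le)
    then show ?thesis using le C(2) order_trans by blast
  qed
  then obtain C where C: "C > 0" "\<And>i y. i \<in> I \<Longrightarrow> norm (\<zeta> i y) \<le> C" by blast
  have approx: "\<exists>n0. \<forall>n\<ge>n0. \<forall>z\<in>?R. norm (tscale (\<epsilon> n) s (V n) z - M n z) \<le> real (card I) * (C * e)" if e: "e > 0" for e
  proof -
    have "\<exists>n0. \<forall>n\<ge>n0. \<forall>x\<in>{x1..x2}. \<forall>y\<in>{y1..y2}. norm (B n i (\<epsilon> n * of_int \<lfloor>x / \<epsilon> n\<rfloor> + \<epsilon> n * y) - \<B> i x) \<le> e" if i: "i \<in> I" for i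
    proof -
      have "uniformly_continuous_on {0..\<alpha>} (\<B> i)"
        by (intro compact_uniformly_continuous continuous_on_subset[OF B(1)[OF i]]) auto
      then obtain \<delta> where \<delta>: "\<delta> > 0" "\<And>x y. x \<in> {0..\<alpha>} \<Longrightarrow> y \<in> {0..\<alpha>} \<Longrightarrow> dist y x < \<delta> \<Longrightarrow> dist (\<B> i y) (\<B> i x) < e / 2"
        unfolding uniformly_continuous_on_def using half_gt_zero[OF e] by metis
      obtain n1 where n1: "\<And>n t. n \<ge> n1 \<Longrightarrow> t \<in> {0..\<alpha>} \<Longrightarrow> dist (B n i t) (\<B> i t) < e / 2"
        using B(2)[OF i] half_gt_zero[OF e] unfolding uniform_limit_iff eventually_sequentially by blast
      obtain n2 where n2: "\<And>n. n \<ge> n2 \<Longrightarrow> \<epsilon> n < \<delta>"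
        using order_tendstoD(2)[OF \<epsilon>(2) \<delta>(1)] unfolding eventually_sequentially by blast
      show ?thesis
      proof (intro exI[of _ "max n1 n2"] allI impI ballI)
        fix n x y assume n: "max n1 n2 \<le> n" and xy: "x \<in> {x1..x2}" "y \<in> {y1..y2}"
        let ?t = "\<epsilon> n * of_int \<lfloor>x / \<epsilon> n\<rfloor> + \<epsilon> n * y"
        have c: "0 < x" "x < \<alpha>" "0 \<le> y" "y \<le> 1" using xy box by auto
        have t: "?t \<in> {0..\<alpha>}" "\<bar>x - ?t\<bar> \<le> \<epsilon> n"
          using floor_cell[OF \<epsilon>(1)[of n] \<epsilon>(3)[of n] c] by blast+
        have "dist (B n i ?t) (\<B> i ?t) < e / 2" using n1 n t by simp
        moreover have "dist (\<B> i ?t) (\<B> i x) < e / 2"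
          using \<delta>(2)[of x ?t] t n2[of n] n xy box by (simp add: dist_real_def abs_minus_commute)
        ultimately show "norm (B n i ?t - \<B> i x) \<le> e"
          using dist_triangle[of "B n i ?t" "\<B> i x" "\<B> i ?t"] by (simp add: dist_norm)
      qed
    qed
    then obtain n0 where n0: "\<And>i n x y. i \<in> I \<Longrightarrow> n \<ge> n0 i \<Longrightarrow> x \<in> {x1..x2} \<Longrightarrow> y \<in> {y1..y2} \<Longrightarrow>
      norm (B n i (\<epsilon> n * of_int \<lfloor>x / \<epsilon> n\<rfloor> + \<epsilon> n * y) - \<B> i x) \<le> e" by metis
    show ?thesis
    \<comment> \<open>The sum of the finitely many thresholds serves as a common one.\<close>
    proof (intro exI[of _ "\<Sum>i\<in>I. n0 i"] allI impI ballI)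
      fix n z assume n: "(\<Sum>i\<in>I. n0 i) \<le> n" and z: "z \<in> ?R"
      obtain x y where xy: "z = (x, y)" "x \<in> {x1..x2}" "y \<in> {y1..y2}" using z by (cases z) auto
      have c: "0 < x" "x < \<alpha>" "0 \<le> y" "y \<le> 1" using xy box by auto
      obtain l where l: "\<lfloor>x / \<epsilon> n\<rfloor> = int l"
        using floor_cell[OF \<epsilon>(1)[of n] \<epsilon>(3)[of n] c] by blast
      let ?t = "\<epsilon> n * of_int \<lfloor>x / \<epsilon> n\<rfloor> + \<epsilon> n * y"
      have te: "?t / \<epsilon> n = y + real l" using \<epsilon>(1)[of n] l by (simp add: field_simps)
      have "tscale (\<epsilon> n) s (V n) z = (\<Sum>i\<in>I. B n i ?t * \<beta> i (x / \<epsilon> n) * \<zeta> i y)"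
        unfolding tscale_def V(2) sum_distrib_left
      proof (rule sum.cong[OF refl])
        fix i assume i: "i \<in> I"
        have "\<zeta> i (?t / \<epsilon> n) = \<omega> i ^ l * \<zeta> i y" unfolding te by (rule quasi_periodic_nat) (rule \<zeta>(2)[OF i])
        then show "exp (- 2 * \<i> * pi * s * of_real (of_int \<lfloor>fst z / \<epsilon> n\<rfloor>)) *
          (\<zeta> i ((\<epsilon> n * of_int \<lfloor>fst z / \<epsilon> n\<rfloor> + \<epsilon> n * snd z) / \<epsilon> n) * B n i (\<epsilon> n * of_int \<lfloor>fst z / \<epsilon> n\<rfloor> + \<epsilon> n * snd z))
          = B n i ?t * \<beta> i (x / \<epsilon> n) * \<zeta> i y"
          using l xy(1) by (simp add: \<beta>_def)
      qed
      then have "tscale (\<epsilon> n) s (V n) z - M n z = (\<Sum>i\<in>I. (B n i ?t - \<B> i x) * \<beta> i (x / \<epsilon> n) * \<zeta> i y)"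
        unfolding M_def xy(1) by (simp add: left_diff_distrib sum_subtractf)
      then have "norm (tscale (\<epsilon> n) s (V n) z - M n z) = norm (\<Sum>i\<in>I. (B n i ?t - \<B> i x) * \<beta> i (x / \<epsilon> n) * \<zeta> i y)"
        by (rule arg_cong)
      also have "\<dots> \<le> (\<Sum>i\<in>I. norm ((B n i ?t - \<B> i x) * \<beta> i (x / \<epsilon> n) * \<zeta> i y))" by (rule norm_sum)
      also have "\<dots> \<le> (\<Sum>i\<in>I. C * e)"
      proof (rule sum_mono)
        fix i assume i: "i \<in> I"
        have "n0 i \<le> (\<Sum>i\<in>I. n0 i)" by (rule member_le_sum[OF i _ I]) auto
        then have "norm (B n i ?t - \<B> i x) \<le> e" using n0[OF i] n xy by auto
        then show "norm ((B n i ?t - \<B> i x) * \<beta> i (x / \<epsilon> n) * \<zeta> i y) \<le> C * e"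
          unfolding norm_mult \<beta>n[OF i] using C(2)[OF i, of y] C(1) e by (simp add: mult.commute) (intro mult_mono, auto)
      qed
      finally show "norm (tscale (\<epsilon> n) s (V n) z - M n z) \<le> real (card I) * (C * e)" by simp
    qed
  qed
  have Rf: "emeasure lborel ?R < \<infinity>" and Rs: "?R \<in> sets lborel"
  proof -
    have "?R = cbox (x1, y1) (x2, y2)" by (simp add: cbox_Pair_eq)
    then show "emeasure lborel ?R < \<infinity>" "?R \<in> sets lborel" using emeasure_bounded_finite[OF bounded_cbox[of "(x1, y1)" "(x2, y2)"]] by simp_all
  qed
  have [measurable]: "V n \<in> borel_measurable borel" for n by (rule V(1))
  have Mm: "(\<lambda>z. indicator ?R z *\<^sub>R M n z) \<in> borel_measurable lborel" for n using Mi by (rule borel_measurable_integrable)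
  have "(\<lambda>n. integral\<^sup>L lborel (\<lambda>z. indicator ?R z *\<^sub>R tscale (\<epsilon> n) s (V n) z) - integral\<^sup>L lborel (\<lambda>z. indicator ?R z *\<^sub>R M n z)) \<longlonglongrightarrow> 0"
  proof (rule LIMSEQ_I)
    fix r :: real assume r: "0 < r"
    define m where "m = measure lborel ?R"
    define K where "K = real (card I) * C * m + 1"
    have K: "0 < K" unfolding K_def m_def using C(1) by (intro add_nonneg_pos mult_nonneg_nonneg) auto
    define e where "e = r / (2 * K)"
    have e: "0 < e" using r K by (simp add: e_def)
    obtain n0 where n0: "\<And>n z. n \<ge> n0 \<Longrightarrow> z \<in> ?R \<Longrightarrow> norm (tscale (\<epsilon> n) s (V n) z - M n z) \<le> real (card I) * (C * e)"
      using approx[OF e] by blast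
    have "norm (integral\<^sup>L lborel (\<lambda>z. indicator ?R z *\<^sub>R tscale (\<epsilon> n) s (V n) z) - integral\<^sup>L lborel (\<lambda>z. indicator ?R z *\<^sub>R M n z) - 0) < r" if n: "n \<ge> n0" for n
    proof -
      let ?c = "real (card I) * (C * e)"
      have dm: "(\<lambda>z. indicator ?R z *\<^sub>R (tscale (\<epsilon> n) s (V n) z - indicator ?R z *\<^sub>R M n z)) \<in> borel_measurable lborel"
        using Mm[of n] Rs by measurable
      have eq: "indicator ?R z *\<^sub>R tscale (\<epsilon> n) s (V n) z - indicator ?R z *\<^sub>R M n z = indicator ?R z *\<^sub>R (tscale (\<epsilon> n) s (V n) z - indicator ?R z *\<^sub>R M n z)" for z
        by (auto simp: indicator_def)
      have ci: "integrable lborel (\<lambda>z. indicator ?R z * ?c)" using Rf Rs by (simp add: integrable_real_indicator)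
      have di: "integrable lborel (\<lambda>z. indicator ?R z *\<^sub>R (tscale (\<epsilon> n) s (V n) z - indicator ?R z *\<^sub>R M n z))"
      proof (rule Bochner_Integration.integrable_bound[OF ci dm])
        show "AE z in lborel. norm (indicator ?R z *\<^sub>R (tscale (\<epsilon> n) s (V n) z - indicator ?R z *\<^sub>R M n z)) \<le> norm (indicator ?R z * ?c)"
          using n0[OF n] by (intro AE_I2) (auto simp: indicator_def intro: order_trans[OF _ abs_ge_self])
      qed
      have ti: "integrable lborel (\<lambda>z. indicator ?R z *\<^sub>R tscale (\<epsilon> n) s (V n) z)"
        using Bochner_Integration.integrable_add[OF di Mi[of n]] unfolding eq[symmetric] by simp
      have "norm (integral\<^sup>L lborel (\<lambda>z. indicator ?R z *\<^sub>R (tscale (\<epsilon> n) s (V n) z - indicator ?R z *\<^sub>R M n z))) \<le> integral\<^sup>L lborel (\<lambda>z. indicator ?R z * ?c)"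
        by (rule Bochner_Integration.integral_norm_bound_integral[OF di ci]) (use n0[OF n] in \<open>auto simp: indicator_def\<close>)
      also have "\<dots> = m * ?c" using Rf Rs by (simp add: m_def)
      also have "\<dots> \<le> K * e" using e by (simp add: K_def algebra_simps)
      also have "\<dots> < r" using r K by (simp add: e_def)
      finally show ?thesis
        unfolding eq[symmetric] Bochner_Integration.integral_diff[OF ti Mi] by simp
    qed
    then show "\<exists>no. \<forall>n\<ge>no. norm (integral\<^sup>L lborel (\<lambda>z. indicator ?R z *\<^sub>R tscale (\<epsilon> n) s (V n) z) - integral\<^sup>L lborel (\<lambda>z. indicator ?R z *\<^sub>R M n z) - 0) < r"
      by blast
  qed
  from tendsto_add[OF this Mlim] show ?thesis by simp
qed

lemma cell_eq: "0 < \<epsilon> \<Longrightarrow> cell \<epsilon> l = {\<epsilon> * of_int l<..<\<epsilon> * of_int l + \<epsilon>}"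
proof
  assume e: "0 < \<epsilon>"
  show "cell \<epsilon> l \<subseteq> {\<epsilon> * of_int l<..<\<epsilon> * of_int l + \<epsilon>}" using e by (auto simp: cell_def)
  show "{\<epsilon> * of_int l<..<\<epsilon> * of_int l + \<epsilon>} \<subseteq> cell \<epsilon> l"
  proof
    fix x assume x: "x \<in> {\<epsilon> * of_int l<..<\<epsilon> * of_int l + \<epsilon>}"
    show "x \<in> cell \<epsilon> l" unfolding cell_def
      by (rule image_eqI[where x = "(x - \<epsilon> * of_int l) / \<epsilon>"]) (use x e in \<open>auto simp: field_simps\<close>)
  qed
qed

text \<open>A point off the lattice lies in exactly one open cell, the one numbered by the integer
  part, and that cell is contained in the interval because \<alpha> is a multiple of
  \<open>\<epsilon>\<close>.\<close>

lemma two_scale_eq_tscale: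
  assumes \<epsilon>: "0 < \<epsilon>" and N: "\<alpha> / \<epsilon> = real N" and x: "0 < x" "x < \<alpha>" "x / \<epsilon> \<notin> \<int>"
  shows "two_scale \<alpha> \<epsilon> k u (x, y) = tscale \<epsilon> k u (x, y)"
proof -
  have \<alpha>: "\<alpha> = \<epsilon> * real N" using \<epsilon> N by (simp add: field_simps)
  define L where "L = {l. cell \<epsilon> l \<subseteq> Omega \<alpha>}"
  \<comment> \<open>Finiteness has to be secured before a single term is isolated, since a sum over
    an infinite set is 0 by convention; the midpoint of a cell confines its number.\<close>
  have sub: "L \<subseteq> {0..int N}"
  proof
    fix l assume "l \<in> L"
    moreover have "\<epsilon> * of_int l + \<epsilon> / 2 \<in> cell \<epsilon> l" using \<epsilon> by (simp add: cell_eq)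
    ultimately have "\<epsilon> * of_int l + \<epsilon> / 2 \<in> Omega \<alpha>" by (auto simp: L_def)
    then have "0 < \<epsilon> * (of_int l + 1/2)" "\<epsilon> * (of_int l + 1/2) < \<epsilon> * real N" using \<alpha> by (auto simp: distrib_left)
    then have "0 < real_of_int l + 1/2" "real_of_int l + 1/2 < real N"
      using \<epsilon> by (simp_all add: zero_less_mult_iff mult_less_cancel_left_pos)
    then show "l \<in> {0..int N}" by auto
  qed
  have fin: "finite L" using sub finite_subset by blast
  define l0 where "l0 = \<lfloor>x / \<epsilon>\<rfloor>"
  have l0: "of_int l0 < x / \<epsilon>" "x / \<epsilon> < of_int l0 + 1"
  proof -
    have "of_int l0 \<le> x / \<epsilon>" "x / \<epsilon> < of_int l0 + 1" unfolding l0_def by linarith+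
    moreover have "of_int l0 \<noteq> x / \<epsilon>" using x(3) Ints_of_int by metis
    ultimately show "of_int l0 < x / \<epsilon>" "x / \<epsilon> < of_int l0 + 1" by linarith+
  qed
  have mem: "x \<in> cell \<epsilon> l \<longleftrightarrow> l = l0" for l
  proof
    assume "x \<in> cell \<epsilon> l"
    then have "of_int l < x / \<epsilon>" "x / \<epsilon> < of_int l + 1" using \<epsilon> by (auto simp: cell_eq field_simps)
    then show "l = l0" using l0 by linarith
  next
    assume "l = l0" then show "x \<in> cell \<epsilon> l" using l0 \<epsilon> by (auto simp: cell_eq field_simps)
  qed
  have "l0 \<in> L"
  proof -
    have "x / \<epsilon> < \<alpha> / \<epsilon>" by (rule divide_strict_right_mono) (use x \<epsilon> in auto)
    then have "x / \<epsilon> < real N" using N by simp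
    then have "real_of_int l0 < real_of_int (int N)" using l0 by simp
    then have lN: "l0 < int N" by (simp only: of_int_less_iff)
    have "0 < x / \<epsilon>" using x \<epsilon> by simp
    then have "- 1 < real_of_int l0" using l0 by linarith
    then have "0 \<le> l0" by linarith
    then have "0 \<le> \<epsilon> * of_int l0" using \<epsilon> by simp
    moreover have "\<epsilon> * (of_int l0 + 1) \<le> \<epsilon> * real N" using lN \<epsilon> by (intro mult_left_mono) linarith+
    ultimately show ?thesis using \<epsilon> \<alpha> by (auto simp: L_def cell_eq distrib_left)
  qed
  have "two_scale \<alpha> \<epsilon> k u (x, y) = (\<Sum>l\<in>L. if l = l0 then u (\<epsilon> * of_int l + \<epsilon> * y) * exp (- 2 * \<i> * pi * k * of_int l) else 0)"
    unfolding two_scale_def prod.case L_def[symmetric]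
    by (rule sum.cong[OF refl]) (auto simp: mem indicator_def)
  also have "\<dots> = u (\<epsilon> * of_int l0 + \<epsilon> * y) * exp (- 2 * \<i> * pi * k * of_int l0)"
    using fin \<open>l0 \<in> L\<close> by simp
  finally show ?thesis by (simp add: tscale_def l0_def mult.commute)
qed

lemma countable_imp_negligible: "countable (X :: real set) \<Longrightarrow> negligible X"
  by (simp add: negligible_iff_null_sets null_sets_completionI countable_imp_null_set_lborel)

lemma negligible_affine_preimage:
  fixes N :: "real set"
  assumes "negligible N" "\<epsilon> \<noteq> 0" shows "negligible {y. \<epsilon> * y + c \<in> N}"
proof -
  have "negligible ((\<lambda>t. (t - c) / \<epsilon>) ` N)"
  proof (intro negligible_differentiable_image_negligible)
    have "((\<lambda>t. (t - c) / \<epsilon>) has_derivative (\<lambda>t. t / \<epsilon>)) (at x within N)" for x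
      using assms(2) by (auto intro!: derivative_eq_intros)
    then show "(\<lambda>t. (t - c) / \<epsilon>) differentiable_on N" by (auto simp: differentiable_on_def differentiable_def)
  qed (use assms in auto)
  then show ?thesis
    by (rule negligible_subset) (use assms(2) in \<open>auto intro!: image_eqI[where x = "\<epsilon> * y + c" for y]\<close>)
qed

text \<open>A null set in the interval has a null preimage under each of the countably many maps
  from the unit cell onto cells. The phases do not enter, so one exceptional set serves every
  \<open>k\<close>.\<close>

lemma AE_two_scale:
  assumes \<epsilon>: "0 < \<epsilon>" and N: "\<alpha> / \<epsilon> = real N" and u: "AE x in lebesgue_on (Omega \<alpha>). u x = V x"
  shows "\<exists>M. negligible M \<and> (\<forall>z\<in>Omega \<alpha> \<times> Ycell. z \<notin> M \<longrightarrow> (\<forall>k. two_scale \<alpha> \<epsilon> k u z = tscale \<epsilon> k V z))"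
proof -
  obtain B where B: "negligible B" "\<And>x. x \<in> Omega \<alpha> \<Longrightarrow> x \<notin> B \<Longrightarrow> u x = V x"
    using u by (rule AE_lebesgue_on_open_intervalE) auto
  define Y where "Y = (\<Union>l::int. {y. \<epsilon> * y + \<epsilon> * of_int l \<in> B})"
  have Y: "negligible Y" unfolding Y_def
    using \<epsilon> by (intro negligible_countable_Union) (auto intro!: negligible_affine_preimage B)
  define X where "X = range (\<lambda>l::int. \<epsilon> * of_int l)"
  have X: "negligible X" unfolding X_def by (rule countable_imp_negligible) auto
  show ?thesis
  proof (intro exI[of _ "X \<times> UNIV \<union> UNIV \<times> Y"] conjI ballI impI allI)
    show "negligible (X \<times> UNIV \<union> UNIV \<times> Y)" by (intro negligible_Un negligible_strips X Y)
    fix z k assume z: "z \<in> Omega \<alpha> \<times> Ycell" "z \<notin> X \<times> UNIV \<union> UNIV \<times> Y"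
    obtain x y where xy: "z = (x, y)" by (cases z)
    have x: "0 < x" "x < \<alpha>" and y: "0 < y" "y < 1" using z xy by auto
    have "x \<notin> X" "y \<notin> Y" using z xy by auto
    have nZ: "x / \<epsilon> \<notin> \<int>"
    proof
      assume "x / \<epsilon> \<in> \<int>"
      then obtain l where "x / \<epsilon> = of_int l" by (auto elim: Ints_cases)
      then have "x = \<epsilon> * of_int l" using \<epsilon> by (simp add: field_simps)
      then show False using \<open>x \<notin> X\<close> by (auto simp: X_def)
    qed
    define t where "t = \<epsilon> * of_int \<lfloor>x / \<epsilon>\<rfloor> + \<epsilon> * y"
    have "t \<notin> B" using \<open>y \<notin> Y\<close> by (auto simp: Y_def t_def add.commute)
    moreover have "t \<in> Omega \<alpha>"
    proof -
      obtain l where l: "\<lfloor>x / \<epsilon>\<rfloor> = int l" "l < N" using floor_cell[OF \<epsilon> N x, of y] y by auto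
      have "\<alpha> = \<epsilon> * real N" using \<epsilon> N by (simp add: field_simps)
      moreover have "\<epsilon> * (real l + y) < \<epsilon> * real N"
        using l y \<epsilon> by (intro mult_strict_left_mono) linarith+
      moreover have "0 < \<epsilon> * y" "0 \<le> \<epsilon> * real l" using \<epsilon> y by auto
      ultimately show ?thesis using l(1) by (simp add: t_def distrib_left add_nonneg_pos)
    qed
    ultimately have "u t = V t" by (rule B(2)[rotated])
    then show "two_scale \<alpha> \<epsilon> k u z = tscale \<epsilon> k V z"
      unfolding xy two_scale_eq_tscale[OF \<epsilon> N x nZ] by (simp add: tscale_def t_def)
  qed
qed

text \<open>Bridge from the completed measure on \<open>S\<close>, in which L2 and weak limits are
  phrased, to Borel functions and \<open>lborel\<close>, where product measures are at hand.\<close>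

lemma lebesgue_on_AE_borel:
  fixes F H :: "'a::euclidean_space \<Rightarrow> 'b::euclidean_space"
  assumes S: "S \<in> sets borel" and H: "H \<in> borel_measurable borel" and M: "negligible M" "\<And>z. z \<in> S \<Longrightarrow> z \<notin> M \<Longrightarrow> F z = H z"
  shows "F \<in> borel_measurable (lebesgue_on S)"
    and "integrable (lebesgue_on S) F \<longleftrightarrow> integrable lborel (\<lambda>z. indicator S z *\<^sub>R H z)"
    and "integral\<^sup>L (lebesgue_on S) F = integral\<^sup>L lborel (\<lambda>z. indicator S z *\<^sub>R H z)"
proof -
  have Sl: "S \<in> sets lebesgue" using S by auto
  have [measurable]: "S \<in> sets lborel" "H \<in> borel_measurable lborel" using S H by auto
  have Hm: "(\<lambda>z. indicator S z *\<^sub>R H z) \<in> borel_measurable lborel" by measurable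
  then have Hl: "(\<lambda>z. indicator S z *\<^sub>R H z) \<in> borel_measurable lebesgue" by (rule measurable_completion)
  have "AE z in lebesgue. z \<notin> M" using M(1) by (simp add: AE_not_in negligible_iff_null_sets)
  then have ae: "AE z in lebesgue. indicator S z *\<^sub>R H z = indicator S z *\<^sub>R F z"
    by eventually_elim (use M(2) in \<open>auto simp: indicator_def\<close>)
  have Fl: "(\<lambda>z. indicator S z *\<^sub>R F z) \<in> borel_measurable lebesgue" by (rule borel_measurable_AE[OF Hl ae])
  then show "F \<in> borel_measurable (lebesgue_on S)"
    using Sl by (simp add: borel_measurable_restrict_space_iff)
  have "integrable (lebesgue_on S) F \<longleftrightarrow> integrable lebesgue (\<lambda>z. indicator S z *\<^sub>R F z)"
    using Sl by (simp add: integrable_restrict_space)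
  also have "\<dots> \<longleftrightarrow> integrable lebesgue (\<lambda>z. indicator S z *\<^sub>R H z)"
    by (rule integrable_cong_AE[OF Fl Hl]) (use ae in \<open>auto elim: eventually_mono\<close>)
  also have "\<dots> \<longleftrightarrow> integrable lborel (\<lambda>z. indicator S z *\<^sub>R H z)" by (rule integrable_completion[OF Hm])
  finally show "integrable (lebesgue_on S) F \<longleftrightarrow> integrable lborel (\<lambda>z. indicator S z *\<^sub>R H z)" .
  have "integral\<^sup>L (lebesgue_on S) F = integral\<^sup>L lebesgue (\<lambda>z. indicator S z *\<^sub>R F z)"
    using Sl by (simp add: integral_restrict_space)
  also have "\<dots> = integral\<^sup>L lebesgue (\<lambda>z. indicator S z *\<^sub>R H z)"
    by (rule integral_cong_AE[OF Fl Hl]) (use ae in \<open>auto elim: eventually_mono\<close>)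
  also have "\<dots> = integral\<^sup>L lborel (\<lambda>z. indicator S z *\<^sub>R H z)" by (rule integral_completion[OF Hm])
  finally show "integral\<^sup>L (lebesgue_on S) F = integral\<^sup>L lborel (\<lambda>z. indicator S z *\<^sub>R H z)" .
qed

text \<open>Unfolding preserves integrals: the strip over one cell has width
  \<open>\<epsilon>\<close>, and \<open>\<epsilon>\<close> times the integral over the unit cell
  variable is the integral of \<open>h\<close> over that cell.\<close>

lemma unfolding_integral:
  fixes h :: "real \<Rightarrow> real"
  assumes h: "loc_bounded h" and \<epsilon>: "0 < \<epsilon>" and N: "\<alpha> / \<epsilon> = real N"
  defines "g \<equiv> \<lambda>z :: real \<times> real. h (\<epsilon> * of_int \<lfloor>fst z / \<epsilon>\<rfloor> + \<epsilon> * snd z)"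
  shows "g \<in> borel_measurable borel" and "integrable lborel (\<lambda>z. indicator (Omega \<alpha> \<times> Ycell) z *\<^sub>R g z)"
    and "integral\<^sup>L lborel (\<lambda>z. indicator (Omega \<alpha> \<times> Ycell) z *\<^sub>R g z) = integral {0..\<alpha>} h"
proof -
  have \<alpha>: "\<alpha> = \<epsilon> * real N" using \<epsilon> N by (simp add: field_simps)
  have [measurable]: "h \<in> borel_measurable borel" by (rule loc_bounded_measurable[OF h])
  have "(\<lambda>z :: real \<times> real. h (\<epsilon> * of_int \<lfloor>fst z / \<epsilon>\<rfloor> + \<epsilon> * snd z)) \<in> borel_measurable (borel \<Otimes>\<^sub>M borel)"
    by measurable
  then show gm [measurable]: "g \<in> borel_measurable borel" unfolding g_def by (simp add: borel_prod)
  \<comment> \<open>Closed rectangles fit the product formula; they overlap only above lattice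
    points, which is a null set.\<close>
  define G where "G l z = indicator ({\<epsilon> * real l..\<epsilon> * real (Suc l)} \<times> {0..1}) z *\<^sub>R ((1::real) * h (\<epsilon> * snd z + \<epsilon> * real l))" for l and z :: "real \<times> real"
  have lh: "loc_bounded (\<lambda>y. h (\<epsilon> * y + \<epsilon> * real l))" for l by (rule loc_bounded_affine[OF h])
  have Gi: "integrable lborel (G l)" for l
    unfolding G_def by (rule rectangle_product_integral(1)[OF loc_bounded_const lh])
  have GI: "integral\<^sup>L lborel (G l) = integral {\<epsilon> * real l..\<epsilon> * real (Suc l)} h" for l
  proof -
    have "integral\<^sup>L lborel (G l) = integral {\<epsilon> * real l..\<epsilon> * real (Suc l)} (\<lambda>_. 1) * integral {0..1} (\<lambda>y. h (\<epsilon> * y + \<epsilon> * real l))"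
      unfolding G_def by (rule rectangle_product_integral(2)[OF loc_bounded_const lh])
    also have "integral {\<epsilon> * real l..\<epsilon> * real (Suc l)} (\<lambda>_. 1) = \<epsilon>" using \<epsilon> by (simp add: algebra_simps)
    also have "\<epsilon> * integral {0..1} (\<lambda>y. h (\<epsilon> * y + \<epsilon> * real l)) = integral {\<epsilon> * real l..\<epsilon> * real (Suc l)} h"
    proof -
      have "integral {0..1} (\<lambda>y. h (y / inverse \<epsilon> + \<epsilon> * real l)) = inverse \<epsilon> *\<^sub>R integral {0 / inverse \<epsilon> + \<epsilon> * real l..1 / inverse \<epsilon> + \<epsilon> * real l} h"
        by (rule integral_affine[OF h]) (use \<epsilon> in simp)
      then show ?thesis using \<epsilon> by (simp add: divide_inverse mult.commute algebra_simps)
    qed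
    finally show ?thesis .
  qed
  define X where "X = range (\<lambda>l::nat. \<epsilon> * real l)"
  have X: "negligible (X \<times> (UNIV :: real set))" unfolding X_def by (intro negligible_strips(2) countable_imp_negligible) auto
  have eq: "indicator (Omega \<alpha> \<times> Ycell) z *\<^sub>R g z = (\<Sum>l<N. G l z)"
    if z: "z \<notin> X \<times> UNIV \<union> UNIV \<times> {0, 1}" for z
  proof (cases "z \<in> Omega \<alpha> \<times> Ycell")
    case True
    obtain x y where xy: "z = (x, y)" by (cases z)
    have x: "0 < x" "x < \<alpha>" and y: "0 < y" "y < 1" using True xy by auto
    obtain l where l: "\<lfloor>x / \<epsilon>\<rfloor> = int l" "l < N" using floor_cell[OF \<epsilon> N x, of y] y by auto
    have bnd: "real l \<le> x / \<epsilon>" "x / \<epsilon> < real l + 1" using l floor_correct[of "x / \<epsilon>"] by simp_all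
    have mem: "x \<in> {\<epsilon> * real l'..\<epsilon> * real (Suc l')} \<longleftrightarrow> l' = l" for l'
    proof
      assume m: "x \<in> {\<epsilon> * real l'..\<epsilon> * real (Suc l')}"
      then have "real l' \<le> x / \<epsilon>" "x / \<epsilon> \<le> real l' + 1" using \<epsilon> by (auto simp: field_simps)
      moreover have "x / \<epsilon> \<noteq> real l' + 1"
      proof
        assume "x / \<epsilon> = real l' + 1"
        then have "x = \<epsilon> * real (Suc l')" using \<epsilon> by (simp add: field_simps)
        then have "x \<in> X" unfolding X_def by (rule range_eqI)
        then show False using z xy by auto
      qed
      ultimately show "l' = l" using bnd by linarith
    next
      assume "l' = l" then show "x \<in> {\<epsilon> * real l'..\<epsilon> * real (Suc l')}" using bnd \<epsilon> by (auto simp: field_simps)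
    qed
    have "(\<Sum>l'<N. G l' z) = (\<Sum>l'<N. if l' = l then h (\<epsilon> * y + \<epsilon> * real l) else 0)"
      by (rule sum.cong[OF refl]) (use mem y in \<open>auto simp: G_def xy indicator_def\<close>)
    also have "\<dots> = h (\<epsilon> * y + \<epsilon> * real l)" using l by simp
    finally show ?thesis using True xy l by (simp add: g_def add.commute)
  next
    case False
    have "G l z = 0" if "l < N" for l
    proof (rule ccontr)
      assume "G l z \<noteq> 0"
      then have m: "fst z \<in> {\<epsilon> * real l..\<epsilon> * real (Suc l)}" "snd z \<in> {0..1}" by (auto simp: G_def indicator_def split: if_splits)
      have "\<epsilon> * real (Suc l) \<le> \<epsilon> * real N" using that \<epsilon> by (intro mult_left_mono) auto
      moreover have "\<epsilon> * real l \<le> fst z \<and> fst z \<le> \<epsilon> * real (Suc l)" using m(1) by (simp only: atLeastAtMost_iff)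
      moreover have "0 \<le> \<epsilon> * real l" using \<epsilon> by simp
      ultimately have "0 \<le> fst z" "fst z \<le> \<alpha>" using \<alpha> by linarith+
      moreover have "fst z \<noteq> 0" "fst z \<noteq> \<alpha>"
      proof -
        have "0 \<in> X" "\<alpha> \<in> X" unfolding X_def \<alpha> by (auto intro: image_eqI[where x = "0::nat"])
        then show "fst z \<noteq> 0" "fst z \<noteq> \<alpha>" using z by (metis UNIV_I UnI1 mem_Times_iff)+
      qed
      moreover have "snd z \<noteq> 0" "snd z \<noteq> 1" using z by (metis UNIV_I UnI2 insertCI mem_Times_iff)+
      ultimately have "z \<in> Omega \<alpha> \<times> Ycell" using m(2) by (auto simp: mem_Times_iff)
      then show False using False by simp
    qed
    then show ?thesis using False by simp
  qed
  have bad: "negligible (X \<times> UNIV \<union> UNIV \<times> {0, 1::real})"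
    by (intro negligible_Un X negligible_strips(1)) auto
  have "AE z in lebesgue. z \<notin> X \<times> UNIV \<union> UNIV \<times> {0, 1::real}"
    using bad AE_not_in unfolding negligible_iff_null_sets by blast
  then have "AE z in lborel. z \<notin> X \<times> UNIV \<union> UNIV \<times> {0, 1::real}" unfolding AE_completion_iff .
  then have ae: "AE z in lborel. indicator (Omega \<alpha> \<times> Ycell) z *\<^sub>R g z = (\<Sum>l<N. G l z)"
    by eventually_elim (use eq in blast)
  have Sm: "Omega \<alpha> \<times> Ycell \<in> sets (lborel :: (real \<times> real) measure)" by (simp add: open_Times borel_open)
  have m1: "(\<lambda>z. indicator (Omega \<alpha> \<times> Ycell) z *\<^sub>R g z) \<in> borel_measurable lborel" using Sm by measurable
  have si: "integrable lborel (\<lambda>z. \<Sum>l<N. G l z)" by (intro Bochner_Integration.integrable_sum Gi)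
  then have m2: "(\<lambda>z. \<Sum>l<N. G l z) \<in> borel_measurable lborel" by (rule borel_measurable_integrable)
  show "integrable lborel (\<lambda>z. indicator (Omega \<alpha> \<times> Ycell) z *\<^sub>R g z)"
    using integrable_cong_AE[OF m1 m2 ae] si by simp
  have "integral\<^sup>L lborel (\<lambda>z. indicator (Omega \<alpha> \<times> Ycell) z *\<^sub>R g z) = integral\<^sup>L lborel (\<lambda>z. \<Sum>l<N. G l z)"
    by (rule integral_cong_AE[OF m1 m2 ae])
  also have "\<dots> = (\<Sum>l<N. integral {\<epsilon> * real l..\<epsilon> * real (Suc l)} h)"
    by (subst Bochner_Integration.integral_sum) (auto simp: Gi GI simp del: of_nat_Suc)
  also have "\<dots> = integral {0..\<epsilon> * real N} h"
  proof (induction N)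
    case (Suc N)
    have "integral {0..\<epsilon> * real N} h + integral {\<epsilon> * real N..\<epsilon> * real (Suc N)} h = integral {0..\<epsilon> * real (Suc N)} h"
      using \<epsilon> by (intro loc_bounded_integral_combine[OF h] mult_left_mono) auto
    then show ?case using Suc by simp
  qed simp
  finally show "integral\<^sup>L lborel (\<lambda>z. indicator (Omega \<alpha> \<times> Ycell) z *\<^sub>R g z) = integral {0..\<alpha>} h" using \<alpha> by simp
qed

text \<open>The phases have modulus 1, so each transform has the modulus of the unfolded function.
  The sum is at most \<open>card S\<close> times that, and unfolding turns the integral of the
  square into one over the interval.\<close>

lemma two_scale_sum_L2:
  assumes \<epsilon>: "0 < \<epsilon>" and N: "\<alpha> / \<epsilon> = real N" and S: "finite S"
    and V: "loc_bounded V1" "loc_bounded V2"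
    and U: "AE x in lebesgue_on (Omega \<alpha>). U x = (V1 x, V2 x)"
  shows "\<exists>M. negligible M \<and> (\<forall>z\<in>Omega \<alpha> \<times> Ycell. z \<notin> M \<longrightarrow>
      (\<Sum>\<sigma>\<in>S. two_scale2 \<alpha> \<epsilon> \<sigma> U z) = (\<Sum>\<sigma>\<in>S. tscale \<epsilon> \<sigma> V1 z, \<Sum>\<sigma>\<in>S. tscale \<epsilon> \<sigma> V2 z))" (is ?A)
    and "L2_on (Omega \<alpha> \<times> Ycell) (\<lambda>z. \<Sum>\<sigma>\<in>S. two_scale2 \<alpha> \<epsilon> \<sigma> U z)" (is ?B)
    and "L2_norm (Omega \<alpha> \<times> Ycell) (\<lambda>z. \<Sum>\<sigma>\<in>S. two_scale2 \<alpha> \<epsilon> \<sigma> U z)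
      \<le> sqrt ((real (card S))\<^sup>2 * integral {0..\<alpha>} (\<lambda>x. (cmod (V1 x))\<^sup>2 + (cmod (V2 x))\<^sup>2))" (is ?C)
proof -
  let ?S = "Omega \<alpha> \<times> Ycell"
  have U1: "AE x in lebesgue_on (Omega \<alpha>). fst (U x) = V1 x" "AE x in lebesgue_on (Omega \<alpha>). snd (U x) = V2 x"
    using U by (auto elim: eventually_mono)
  obtain M1 where M1: "negligible M1" "\<And>z k. z \<in> ?S \<Longrightarrow> z \<notin> M1 \<Longrightarrow> two_scale \<alpha> \<epsilon> k (\<lambda>x. fst (U x)) z = tscale \<epsilon> k V1 z"
    using AE_two_scale[OF \<epsilon> N U1(1)] by blast
  obtain M2 where M2: "negligible M2" "\<And>z k. z \<in> ?S \<Longrightarrow> z \<notin> M2 \<Longrightarrow> two_scale \<alpha> \<epsilon> k (\<lambda>x. snd (U x)) z = tscale \<epsilon> k V2 z"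
    using AE_two_scale[OF \<epsilon> N U1(2)] by blast
  define F where "F z = (\<Sum>\<sigma>\<in>S. two_scale2 \<alpha> \<epsilon> \<sigma> U z)" for z
  define H where "H z = (\<Sum>\<sigma>\<in>S. tscale \<epsilon> \<sigma> V1 z, \<Sum>\<sigma>\<in>S. tscale \<epsilon> \<sigma> V2 z)" for z
  have M: "negligible (M1 \<union> M2)" by (intro negligible_Un M1 M2)
  have FH: "F z = H z" if "z \<in> ?S" "z \<notin> M1 \<union> M2" for z
    using M1(2)[of z] M2(2)[of z] that unfolding F_def H_def two_scale2_def by (simp add: prod_eq_iff fst_sum snd_sum)
  then show ?A using M unfolding F_def H_def by blast
  have [measurable]: "V1 \<in> borel_measurable borel" "V2 \<in> borel_measurable borel" using V by (auto intro: loc_bounded_measurable)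
  have Hm [measurable]: "H \<in> borel_measurable borel"
    unfolding H_def[abs_def] by (rule borel_measurable_Pair) measurable
  have Sb: "?S \<in> sets borel" by (simp add: open_Times borel_open)
  have Fm: "F \<in> borel_measurable (lebesgue_on ?S)" by (rule lebesgue_on_AE_borel(1)[OF Sb Hm M FH])
  define h where "h x = (real (card S))\<^sup>2 * ((cmod (V1 x))\<^sup>2 + (cmod (V2 x))\<^sup>2)" for x
  have lh: "loc_bounded h" unfolding h_def[abs_def]
    by (rule loc_bounded_mult[OF loc_bounded_const]) (intro loc_bounded_add loc_bounded_power2 loc_bounded_norm V)
  define g where "g z = h (\<epsilon> * of_int \<lfloor>fst z / \<epsilon>\<rfloor> + \<epsilon> * snd z)" for z :: "real \<times> real"
  note g = unfolding_integral[OF lh \<epsilon> N, folded g_def]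
  have Hg: "(norm (H z))\<^sup>2 \<le> g z" for z
  proof -
    let ?t = "\<epsilon> * of_int \<lfloor>fst z / \<epsilon>\<rfloor> + \<epsilon> * snd z"
    have b: "cmod (\<Sum>\<sigma>\<in>S. tscale \<epsilon> \<sigma> V z) \<le> real (card S) * cmod (V ?t)" for V
      using norm_sum[of "\<lambda>\<sigma>. tscale \<epsilon> \<sigma> V z" S] by (simp add: norm_tscale)
    have "(norm (H z))\<^sup>2 = (cmod (\<Sum>\<sigma>\<in>S. tscale \<epsilon> \<sigma> V1 z))\<^sup>2 + (cmod (\<Sum>\<sigma>\<in>S. tscale \<epsilon> \<sigma> V2 z))\<^sup>2"
      by (simp add: H_def norm_Pair)
    also have "\<dots> \<le> (real (card S) * cmod (V1 ?t))\<^sup>2 + (real (card S) * cmod (V2 ?t))\<^sup>2"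
      by (intro add_mono power_mono b) auto
    also have "\<dots> = g z" by (simp add: g_def h_def power_mult_distrib distrib_left)
    finally show ?thesis .
  qed
  have FH2: "(norm (F z))\<^sup>2 = (norm (H z))\<^sup>2" if "z \<in> ?S" "z \<notin> M1 \<union> M2" for z using FH[OF that] by simp
  have Hm2: "(\<lambda>z. (norm (H z))\<^sup>2) \<in> borel_measurable borel" by measurable
  have F2i: "integrable (lebesgue_on ?S) (\<lambda>z. (norm (F z))\<^sup>2) \<longleftrightarrow> integrable lborel (\<lambda>z. indicator ?S z *\<^sub>R (norm (H z))\<^sup>2)"
    by (rule lebesgue_on_AE_borel(2)[OF Sb Hm2 M]) (rule FH2)
  have F2: "integral\<^sup>L (lebesgue_on ?S) (\<lambda>z. (norm (F z))\<^sup>2) = integral\<^sup>L lborel (\<lambda>z. indicator ?S z *\<^sub>R (norm (H z))\<^sup>2)"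
    by (rule lebesgue_on_AE_borel(3)[OF Sb Hm2 M]) (rule FH2)
  have Hi: "integrable lborel (\<lambda>z. indicator ?S z *\<^sub>R (norm (H z))\<^sup>2)"
  proof (rule Bochner_Integration.integrable_bound[OF g(2)])
    show "(\<lambda>z. indicator ?S z *\<^sub>R (norm (H z))\<^sup>2) \<in> borel_measurable lborel" using Sb by measurable
    show "AE z in lborel. norm (indicator ?S z *\<^sub>R (norm (H z))\<^sup>2) \<le> norm (indicator ?S z *\<^sub>R g z)"
      using Hg by (intro AE_I2) (auto simp: indicator_def intro: order_trans[OF _ abs_ge_self])
  qed
  show ?B unfolding L2_on_def F_def[symmetric] using Fm F2i Hi by blast
  have "integral\<^sup>L lborel (\<lambda>z. indicator ?S z *\<^sub>R (norm (H z))\<^sup>2) \<le> integral\<^sup>L lborel (\<lambda>z. indicator ?S z *\<^sub>R g z)"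
    by (rule integral_mono[OF Hi g(2)]) (use Hg in \<open>auto simp: indicator_def\<close>)
  also have "\<dots> = (real (card S))\<^sup>2 * integral {0..\<alpha>} (\<lambda>x. (cmod (V1 x))\<^sup>2 + (cmod (V2 x))\<^sup>2)"
    unfolding g(3) h_def[abs_def] by (rule integral_mult_right)
  finally show ?C unfolding L2_norm_def F_def[symmetric] F2 by (rule real_sqrt_le_mono)
qed

lemma L2_imp_integrable:
  fixes g :: "'a::euclidean_space \<Rightarrow> 'b::{banach, second_countable_topology}"
  assumes "S \<in> lmeasurable" and "L2_on S g"
  shows "integrable (lebesgue_on S) g"
proof -
  have fm: "finite_measure (lebesgue_on S)" by (rule finite_measure_lebesgue_on[OF assms(1)])
  have i1: "integrable (lebesgue_on S) (\<lambda>_. 1::real)" by (rule finite_measure.integrable_const[OF fm])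
  have "integrable (lebesgue_on S) (\<lambda>z. 1 + (norm (g z))\<^sup>2)"
    using assms(2) by (intro Bochner_Integration.integrable_add i1) (simp add: L2_on_def)
  then show ?thesis
  proof (rule Bochner_Integration.integrable_bound)
    show "g \<in> borel_measurable (lebesgue_on S)" using assms(2) by (simp add: L2_on_def)
    have "norm (g z) \<le> 1 + (norm (g z))\<^sup>2" for z
    proof -
      have "0 \<le> (norm (g z) - 1)\<^sup>2" by simp
      then have "2 * norm (g z) \<le> (norm (g z))\<^sup>2 + 1" unfolding power2_diff by simp
      then show ?thesis using norm_ge_zero[of "g z"] by linarith
    qed
    then show "AE z in lebesgue_on S. norm (g z) \<le> norm (1 + (norm (g z))\<^sup>2)"
      by (intro AE_I2) (auto intro: order_trans[OF _ abs_ge_self])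
  qed
qed

text \<open>Rectangles compactly inside the domain suffice to identify an integrable function, and
  for these the limits of the transforms have been computed.\<close>

lemma AE_eq_if_rectangle_integrals_eq:
  fixes g :: "real \<times> real \<Rightarrow> complex" and b \<zeta> :: "'p \<Rightarrow> real \<Rightarrow> complex"
  assumes g: "integrable (lebesgue_on (Omega \<alpha> \<times> Ycell)) g"
    and P: "finite P" and b: "\<And>p. p \<in> P \<Longrightarrow> loc_bounded (b p)" "\<And>p. p \<in> P \<Longrightarrow> loc_bounded (\<zeta> p)"
    and eq: "\<And>x1 x2 y1 y2. \<lbrakk>0 < x1; x1 \<le> x2; x2 < \<alpha>; 0 < y1; y1 \<le> y2; y2 < 1\<rbrakk> \<Longrightarrow>
      integral\<^sup>L (lebesgue_on (Omega \<alpha> \<times> Ycell)) (\<lambda>z. indicator ({x1..x2} \<times> {y1..y2}) z *\<^sub>R g z)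
        = (\<Sum>p\<in>P. integral {x1..x2} (b p) * integral {y1..y2} (\<zeta> p))"
  shows "AE z in lebesgue_on (Omega \<alpha> \<times> Ycell). g z = (\<Sum>p\<in>P. b p (fst z) * \<zeta> p (snd z))"
proof -
  let ?S = "Omega \<alpha> \<times> Ycell"
  define G where "G z = (\<Sum>p\<in>P. b p (fst z) * \<zeta> p (snd z))" for z
  have "?S \<in> sets borel" by (simp add: open_Times borel_open)
  then have Sl: "?S \<in> sets lebesgue" by auto
  have box_eq: "indicator ({x1..x2} \<times> {y1..y2}) z *\<^sub>R G z = (\<Sum>p\<in>P. indicator ({x1..x2} \<times> {y1..y2}) z *\<^sub>R (b p (fst z) * \<zeta> p (snd z)))"
    for x1 x2 y1 y2 z unfolding G_def by (rule scaleR_sum_right)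
  have Gi: "integrable lborel (\<lambda>z. indicator ({x1..x2} \<times> {y1..y2}) z *\<^sub>R G z)" for x1 x2 y1 y2
    unfolding box_eq by (rule Bochner_Integration.integrable_sum) (rule rectangle_product_integral(1)[OF b])
  have GI: "integral\<^sup>L lborel (\<lambda>z. indicator ({x1..x2} \<times> {y1..y2}) z *\<^sub>R G z) = (\<Sum>p\<in>P. integral {x1..x2} (b p) * integral {y1..y2} (\<zeta> p))" for x1 x2 y1 y2
    unfolding box_eq
  proof (subst Bochner_Integration.integral_sum)
    show "integrable lborel (\<lambda>z. indicator ({x1..x2} \<times> {y1..y2}) z *\<^sub>R (b p (fst z) * \<zeta> p (snd z)))" if "p \<in> P" for p
      by (rule rectangle_product_integral(1)[OF b[OF that]])
  qed (rule sum.cong[OF refl], rule rectangle_product_integral(2)[OF b])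
  have Ga: "G absolutely_integrable_on {x1..x2} \<times> {y1..y2}" for x1 x2 y1 y2
  proof -
    have "integrable lebesgue (\<lambda>z. indicator ({x1..x2} \<times> {y1..y2}) z *\<^sub>R G z)"
      using Gi by (intro integrable_completion[THEN iffD2] borel_measurable_integrable)
    then show ?thesis by (simp add: set_integrable_def)
  qed
  have GS: "G absolutely_integrable_on ?S"
    by (rule set_integrable_subset[OF Ga[of 0 \<alpha> 0 1] Sl]) auto
  have gS: "g absolutely_integrable_on ?S"
    using g Sl by (simp add: set_integrable_def integrable_restrict_space)
  have "AE z in lebesgue_on ?S. g z - G z = 0"
  proof (rule AE_zero_if_box_integrals_zero)
    show "open ?S" by (intro open_Times) auto
    show "(\<lambda>z. g z - G z) absolutely_integrable_on ?S" by (intro set_integral_diff(1) gS GS)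
    fix c d :: "real \<times> real" assume sub: "cbox c d \<subseteq> ?S"
    obtain x1 y1 x2 y2 where cd: "c = (x1, y1)" "d = (x2, y2)" by (cases c, cases d)
    have box: "cbox c d = {x1..x2} \<times> {y1..y2}" by (simp add: cd cbox_Pair_eq)
    show "integral (cbox c d) (\<lambda>z. g z - G z) = 0"
    proof (cases "x1 \<le> x2 \<and> y1 \<le> y2")
      case False
      then have "cbox c d = {}" unfolding box by auto
      then show ?thesis by simp
    next
      case True
      then have "(x1, y1) \<in> {x1..x2} \<times> {y1..y2}" "(x2, y2) \<in> {x1..x2} \<times> {y1..y2}" by auto
      then have "(x1, y1) \<in> ?S" "(x2, y2) \<in> ?S" using sub unfolding box by blast+
      then have o: "0 < x1" "x1 \<le> x2" "x2 < \<alpha>" "0 < y1" "y1 \<le> y2" "y2 < 1" using True by auto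
      have ga: "g absolutely_integrable_on ({x1..x2} \<times> {y1..y2})"
        using absolutely_integrable_on_subcbox[OF gS sub] unfolding box .
      have "integral ({x1..x2} \<times> {y1..y2}) g = integral\<^sup>L lebesgue (\<lambda>z. indicator ({x1..x2} \<times> {y1..y2}) z *\<^sub>R g z)"
        using set_lebesgue_integral_eq_integral(2)[OF ga] by (simp add: set_lebesgue_integral_def)
      also have "\<dots> = integral\<^sup>L lebesgue (\<lambda>z. indicator ?S z *\<^sub>R (indicator ({x1..x2} \<times> {y1..y2}) z *\<^sub>R g z))"
        using sub unfolding box by (intro Bochner_Integration.integral_cong) (auto simp: indicator_def)
      also have "\<dots> = integral\<^sup>L (lebesgue_on ?S) (\<lambda>z. indicator ({x1..x2} \<times> {y1..y2}) z *\<^sub>R g z)"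
        using Sl by (simp add: integral_restrict_space)
      also have "\<dots> = (\<Sum>p\<in>P. integral {x1..x2} (b p) * integral {y1..y2} (\<zeta> p))" by (rule eq[OF o])
      finally have 1: "integral (cbox c d) g = (\<Sum>p\<in>P. integral {x1..x2} (b p) * integral {y1..y2} (\<zeta> p))" unfolding box .
      have "integral ({x1..x2} \<times> {y1..y2}) G = integral\<^sup>L lebesgue (\<lambda>z. indicator ({x1..x2} \<times> {y1..y2}) z *\<^sub>R G z)"
        using set_lebesgue_integral_eq_integral(2)[OF Ga] by (simp add: set_lebesgue_integral_def)
      also have "\<dots> = integral\<^sup>L lborel (\<lambda>z. indicator ({x1..x2} \<times> {y1..y2}) z *\<^sub>R G z)"
        by (rule integral_completion[OF borel_measurable_integrable[OF Gi]])
      finally have 2: "integral (cbox c d) G = (\<Sum>p\<in>P. integral {x1..x2} (b p) * integral {y1..y2} (\<zeta> p))" unfolding box GI .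
      have "g integrable_on cbox c d" "G integrable_on cbox c d"
        unfolding box using ga Ga set_lebesgue_integral_eq_integral(1) by blast+
      then show ?thesis by (simp add: Henstock_Kurzweil_Integration.integral_diff 1 2)
    qed
  qed
  then show ?thesis unfolding G_def[symmetric] by (auto elim: eventually_mono)
qed

lemma uniform_limit_scaled:
  fixes f :: "nat \<Rightarrow> real \<Rightarrow> complex"
  assumes f: "uniform_limit {c..d} f g sequentially" and g: "continuous_on UNIV g" and s: "s \<longlonglongrightarrow> t"
  shows "uniform_limit {c..d} (\<lambda>n x. s n * f n x) (\<lambda>x. t * g x) sequentially"
proof (rule uniform_lim_mult)
  show "uniform_limit {c..d} (\<lambda>n x. s n) (\<lambda>x. t) sequentially"
    using s unfolding uniform_limit_iff tendsto_iff by (auto elim!: eventually_mono)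
  show "bounded (g ` {c..d})"
    by (intro compact_imp_bounded compact_continuous_image continuous_on_subset[OF g]) auto
qed (use f in \<open>auto intro: bounded_subset[of "{t}"]\<close>)

section \<open>Identification of the weak limits\<close>

context coefficients
begin

lemma loc_bounded_sqrt_a: "loc_bounded (\<lambda>y. sqrt (a y) * inverse (a y))"
  by (intro loc_bounded_mult loc_bounded_inverse_a loc_bounded_continuous continuous_intros a_cont)

lemma loc_bounded_sqrt_r: "loc_bounded (\<lambda>y. sqrt (r y))"
proof (rule loc_boundedI)
  have [measurable]: "r \<in> borel_measurable borel" by (rule r_meas)
  show "(\<lambda>y. sqrt (r y)) \<in> borel_measurable borel" by measurable
  show "norm (sqrt (r y)) \<le> sqrt r1" for y using r_le[of y] r_pos[of y] by (simp add: less_imp_le)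
qed

end

context homogenization
begin

text \<open>The square root in the weight comes from the definition of the physical vector, the
  inverse from the weak derivative of the eigenfunction being \<open>Q\<close> divided by the
  coefficient.\<close>

definition U1 :: "nat \<Rightarrow> real \<Rightarrow> complex" where
  "U1 j x = of_real (sqrt (osc (\<epsilon> j) a x) * inverse (osc (\<epsilon> j) a x)) * Q j x / (\<i> * of_real (sqrt (\<Lambda> j)))"

definition U2 :: "nat \<Rightarrow> real \<Rightarrow> complex" where
  "U2 j x = of_real (sqrt (osc (\<epsilon> j) r x)) * W j x"

lemma loc_bounded_U: "loc_bounded (U1 j)" "loc_bounded (U2 j)"
proof -
  have "loc_bounded (\<lambda>x. of_real (sqrt (osc (\<epsilon> j) a x) * inverse (osc (\<epsilon> j) a x)) * Q j x * inverse (\<i> * of_real (sqrt (\<Lambda> j))))"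
    unfolding osc_def
    by (intro loc_bounded_mult loc_bounded_const loc_bounded_sols loc_bounded_of_real loc_bounded_scale[OF loc_bounded_sqrt_a])
  then show "loc_bounded (U1 j)" unfolding U1_def[abs_def] divide_inverse .
  show "loc_bounded (U2 j)" unfolding U2_def[abs_def] osc_def
    by (intro loc_bounded_mult loc_bounded_sols loc_bounded_of_real loc_bounded_scale[OF loc_bounded_sqrt_r])
qed

text \<open>One scheme for both components: \<open>s\<close> is the periodic weight,
  \<open>\<zeta>\<close> the flux or the wave, and \<open>c\<close> the scalar in front, which tends
  to \<open>1 / (\<i> * \<mu>0)\<close> for the flux component and is 1 for the other.\<close>

lemma component_rectangle_limit:
  assumes k: "strict_mono (k :: nat \<Rightarrow> nat)" and \<A>c: "\<And>i. i \<in> I \<Longrightarrow> continuous_on UNIV (\<A> i)"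
    and \<A>u: "\<And>i. i \<in> I \<Longrightarrow> uniform_limit {0..\<alpha>} (\<lambda>n. A i (k n)) (\<A> i) sequentially"
    and N: "\<And>j. \<alpha> / \<epsilon> j = real (N j)"
    and s: "loc_bounded s" "\<And>y. s (y + 1) = s y" and c: "c \<longlonglongrightarrow> t"
    and \<zeta>: "\<And>i. i \<in> I \<Longrightarrow> loc_bounded (\<zeta> i)" "\<And>i y. i \<in> I \<Longrightarrow> \<zeta> i (y + 1) = exp (2 * \<i> * pi * \<sigma> i) * \<zeta> i y"
    and V: "\<And>j. V j \<in> borel_measurable borel"
      "\<And>j x. V j x = of_real (s (x / \<epsilon> j)) * (\<Sum>i\<in>I. \<zeta> i (x / \<epsilon> j) * A i j x) * c j"
    and box: "0 < x1" "x1 \<le> x2" "x2 < \<alpha>" "0 < y1" "y1 \<le> y2" "y2 < 1"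
  shows "(\<lambda>n. integral\<^sup>L lborel (\<lambda>z. indicator ({x1..x2} \<times> {y1..y2}) z *\<^sub>R tscale (\<epsilon> (k n)) \<tau> (V (k n)) z))
    \<longlonglongrightarrow> (\<Sum>i\<in>I. if exp (2 * \<i> * pi * \<sigma> i) * exp (- 2 * \<i> * pi * \<tau>) = 1
         then integral {x1..x2} (\<lambda>x. t * \<A> i x) * integral {y1..y2} (\<lambda>y. of_real (s y) * \<zeta> i y) else 0)"
proof (rule two_scale_rectangle_limit[OF fin \<alpha> _ _ _ _ _ _ _ _ V(1) _ box, where B = "\<lambda>n i x. c (k n) * A i (k n) x" and N = "\<lambda>n. N (k n)"])
  show "0 < \<epsilon> (k n)" "\<alpha> / \<epsilon> (k n) = real (N (k n))" for n by (rule \<epsilon>_pos, rule N)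
  show "(\<lambda>n. \<epsilon> (k n)) \<longlonglongrightarrow> 0" using LIMSEQ_subseq_LIMSEQ[OF \<epsilon>_lim k] by (simp add: o_def)
  have ck: "(\<lambda>n. c (k n)) \<longlonglongrightarrow> t" using LIMSEQ_subseq_LIMSEQ[OF c k] by (simp add: o_def)
  show "continuous_on UNIV (\<lambda>x. t * \<A> i x)" if "i \<in> I" for i by (intro continuous_intros \<A>c that)
  show "uniform_limit {0..\<alpha>} (\<lambda>n x. c (k n) * A i (k n) x) (\<lambda>x. t * \<A> i x) sequentially" if "i \<in> I" for i
    by (rule uniform_limit_scaled[OF \<A>u[OF that] \<A>c[OF that] ck])
  show "loc_bounded (\<lambda>y. of_real (s y) * \<zeta> i y)" if "i \<in> I" for i
    by (intro loc_bounded_mult loc_bounded_of_real s \<zeta> that)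
  show "of_real (s (y + 1)) * \<zeta> i (y + 1) = exp (2 * \<i> * pi * \<sigma> i) * (of_real (s y) * \<zeta> i y)" if "i \<in> I" for i y
    unfolding s(2) \<zeta>(2)[OF that] by simp
  show "norm (exp (2 * \<i> * pi * \<sigma> i)) = 1" for i by (rule norm_exp_i_real)
  show "V (k n) x = (\<Sum>i\<in>I. of_real (s (x / \<epsilon> (k n))) * \<zeta> i (x / \<epsilon> (k n)) * (c (k n) * A i (k n) x))" for n x
    unfolding V(2) sum_distrib_left sum_distrib_right by (rule sum.cong) auto
qed

text \<open>The weak limit along the whole sequence is given, so it may be computed along the
  subsequence on which the amplitudes converge.\<close>

theorem weak_limit_identification:
  assumes k: "strict_mono (k :: nat \<Rightarrow> nat)" and \<A>c: "\<And>i. i \<in> I \<Longrightarrow> continuous_on UNIV (\<A> i)"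
    and \<A>u: "\<And>i. i \<in> I \<Longrightarrow> uniform_limit {0..\<alpha>} (\<lambda>n. A i (k n)) (\<A> i) sequentially"
    and N: "\<And>j. \<alpha> / \<epsilon> j = real (N j)" and S: "finite S"
    and U: "\<And>j. AE x in lebesgue_on (Omega \<alpha>). U j x = (U1 j x, U2 j x)"
    and w: "weakly_tendsto (Omega \<alpha> \<times> Ycell) (\<lambda>j z. \<Sum>\<tau>\<in>S. two_scale2 \<alpha> (\<epsilon> j) \<tau> (U j) z) G"
  shows "AE z in lebesgue_on (Omega \<alpha> \<times> Ycell). G z =
    (\<Sum>\<tau>\<in>S. \<Sum>i\<in>I. if exp (2 * \<i> * pi * \<sigma> i) * exp (- 2 * \<i> * pi * \<tau>) = 1
       then cscale2 (\<A> i (fst z)) (of_real (sqrt (a (snd z)) * inverse (a (snd z))) * q i (snd z) / (\<i> * \<mu>0), of_real (sqrt (r (snd z))) * \<phi> i (snd z))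
       else 0)"
proof -
  let ?S = "Omega \<alpha> \<times> Ycell"
  let ?on = "\<lambda>(\<tau>, i). exp (2 * \<i> * pi * \<sigma> i) * exp (- 2 * \<i> * pi * \<tau>) = 1"
  define F where "F j z = (\<Sum>\<tau>\<in>S. two_scale2 \<alpha> (\<epsilon> j) \<tau> (U j) z)" for j z
  have Sb: "?S \<in> sets borel" by (simp add: open_Times borel_open)
  have Sm: "?S \<in> lmeasurable"
  proof -
    have "bounded ?S" by (intro bounded_Times) auto
    then show ?thesis by (intro lmeasurable_open) (auto intro: open_Times)
  qed
  have wF: "\<And>\<Psi>. L2_on ?S \<Psi> \<Longrightarrow> (\<lambda>j. integral\<^sup>L (lebesgue_on ?S) (\<lambda>z. cinner2 (F j z) (\<Psi> z))) \<longlonglongrightarrow> integral\<^sup>L (lebesgue_on ?S) (\<lambda>z. cinner2 (G z) (\<Psi> z))"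
    and LG: "L2_on ?S G"
    using w unfolding weakly_tendsto_def F_def by auto
  have FU: "\<exists>M. negligible M \<and> (\<forall>z\<in>?S. z \<notin> M \<longrightarrow> F j z = (\<Sum>\<tau>\<in>S. tscale (\<epsilon> j) \<tau> (U1 j) z, \<Sum>\<tau>\<in>S. tscale (\<epsilon> j) \<tau> (U2 j) z))" for j
    unfolding F_def by (rule two_scale_sum_L2(1)[OF \<epsilon>_pos N S loc_bounded_U U])
  have Gint: "integrable (lebesgue_on ?S) G" by (rule L2_imp_integrable[OF Sm LG])
  \<comment> \<open>Both components at once: \<open>\<pi>\<close> is a coordinate and
    \<open>\<iota>\<close> the embedding adjoint to it, which makes a vector test function out of a
    scalar one.\<close>
  have comp: "AE z in lebesgue_on ?S. \<pi> (G z) = (\<Sum>p\<in>S \<times> I. (if ?on p then t * \<A> (snd p) (fst z) else 0) * (of_real (s (snd z)) * \<zeta> (snd p) (snd z)))"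
    if bl: "bounded_linear \<pi>" and \<pi>: "\<And>p e. cinner2 p (\<iota> e) = cnj e * \<pi> p" and \<iota>: "\<iota> \<in> borel_measurable borel" "\<iota> 0 = 0" "\<And>e. norm (\<iota> e) = norm e"
      and VF: "\<And>j. \<exists>M. negligible M \<and> (\<forall>z\<in>?S. z \<notin> M \<longrightarrow> \<pi> (F j z) = (\<Sum>\<tau>\<in>S. tscale (\<epsilon> j) \<tau> (V j) z))"
      and s: "loc_bounded s" "\<And>y. s (y + 1) = s y" and c: "c \<longlonglongrightarrow> t"
      and \<zeta>: "\<And>i. i \<in> I \<Longrightarrow> loc_bounded (\<zeta> i)" "\<And>i y. i \<in> I \<Longrightarrow> \<zeta> i (y + 1) = exp (2 * \<i> * pi * \<sigma> i) * \<zeta> i y"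
      and V: "\<And>j. loc_bounded (V j)"
        "\<And>j x. V j x = of_real (s (x / \<epsilon> j)) * (\<Sum>i\<in>I. \<zeta> i (x / \<epsilon> j) * A i j x) * c j"
    for \<pi> :: "complex \<times> complex \<Rightarrow> complex" and \<iota> :: "complex \<Rightarrow> complex \<times> complex" and V s c t \<zeta>
  proof (rule AE_eq_if_rectangle_integrals_eq)
    show "integrable (lebesgue_on ?S) (\<lambda>z. \<pi> (G z))" by (rule integrable_bounded_linear[OF bl Gint])
    show "finite (S \<times> I)" using S fin by simp
    show "loc_bounded (\<lambda>x. if ?on p then t * \<A> (snd p) x else 0)" if "p \<in> S \<times> I" for p
    proof (cases "?on p")
      case True
      have "loc_bounded (\<lambda>x. t * \<A> (snd p) x)"
        using that by (intro loc_bounded_mult loc_bounded_const loc_bounded_continuous \<A>c) auto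
      then show ?thesis using True by simp
    qed (simp add: loc_bounded_const)
    show "loc_bounded (\<lambda>y. of_real (s y) * \<zeta> (snd p) y)" if "p \<in> S \<times> I" for p
      using that by (intro loc_bounded_mult loc_bounded_of_real s \<zeta>) auto
    fix x1 x2 y1 y2 assume box: "0 < x1" "x1 \<le> x2" "x2 < \<alpha>" "0 < y1" "y1 \<le> y2" "(y2::real) < 1"
    let ?R = "{x1..x2} \<times> {y1..y2}"
    define \<Psi> where "\<Psi> z = \<iota> (indicator ?R z)" for z :: "real \<times> real"
    have RS: "?R \<subseteq> ?S" using box by auto
    have Rb [measurable]: "?R \<in> sets borel" by (intro borel_closed closed_Times) auto
    have ind: "(\<lambda>z. (indicator ?R z :: complex)) \<in> borel_measurable borel" by measurable
    have \<Psi>m: "\<Psi> \<in> borel_measurable borel" unfolding \<Psi>_def[abs_def] by (rule measurable_compose[OF ind \<iota>(1)])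
    have \<Psi>L: "L2_on ?S \<Psi>"
    proof -
      have "integrable (lebesgue_on ?S) (\<lambda>z. (norm (\<Psi> z))\<^sup>2)"
      proof (rule Bochner_Integration.integrable_bound[where f = "\<lambda>_. 1::real"])
        have "finite_measure (lebesgue_on ?S)"
          by (rule finite_measure_lebesgue_on[OF Sm])
        then show "integrable (lebesgue_on ?S) (\<lambda>_. 1::real)" by (rule finite_measure.integrable_const)
        show "(\<lambda>z. (norm (\<Psi> z))\<^sup>2) \<in> borel_measurable (lebesgue_on ?S)"
          by (rule lebesgue_on_AE_borel(1)[OF Sb, where M = "{}" and H = "\<lambda>z. (norm (\<Psi> z))\<^sup>2"]) (use \<Psi>m in auto)
        show "AE z in lebesgue_on ?S. norm ((norm (\<Psi> z))\<^sup>2) \<le> norm (1::real)"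
          by (intro AE_I2) (auto simp: \<Psi>_def \<iota>(3) indicator_def)
      qed
      moreover have "\<Psi> \<in> borel_measurable (lebesgue_on ?S)"
        by (rule lebesgue_on_AE_borel(1)[OF Sb \<Psi>m, where M = "{}"]) auto
      ultimately show ?thesis by (simp add: L2_on_def)
    qed
    have inner: "cinner2 p (\<Psi> z) = indicator ?R z *\<^sub>R \<pi> p" for p z
      unfolding \<Psi>_def \<pi> by (simp add: indicator_def)
    have Vm: "V j \<in> borel_measurable borel" for j by (rule loc_bounded_measurable[OF V(1)])
    have Fint: "integral\<^sup>L (lebesgue_on ?S) (\<lambda>z. cinner2 (F j z) (\<Psi> z)) = (\<Sum>\<tau>\<in>S. integral\<^sup>L lborel (\<lambda>z. indicator ?R z *\<^sub>R tscale (\<epsilon> j) \<tau> (V j) z))" for j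
    proof -
      obtain M where M: "negligible M" "\<And>z. z \<in> ?S \<Longrightarrow> z \<notin> M \<Longrightarrow> \<pi> (F j z) = (\<Sum>\<tau>\<in>S. tscale (\<epsilon> j) \<tau> (V j) z)"
        using VF[of j] by auto
      have tm: "tscale (\<epsilon> j) \<tau> (V j) \<in> borel_measurable borel" for \<tau> by (rule tscale_measurable[OF Vm])
      then have m: "(\<lambda>z. indicator ?R z *\<^sub>R (\<Sum>\<tau>\<in>S. tscale (\<epsilon> j) \<tau> (V j) z)) \<in> borel_measurable borel" by measurable
      have "integral\<^sup>L (lebesgue_on ?S) (\<lambda>z. cinner2 (F j z) (\<Psi> z)) = integral\<^sup>L lborel (\<lambda>z. indicator ?S z *\<^sub>R (indicator ?R z *\<^sub>R (\<Sum>\<tau>\<in>S. tscale (\<epsilon> j) \<tau> (V j) z)))"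
      proof (rule lebesgue_on_AE_borel(3)[OF Sb m M(1)])
        fix z assume "z \<in> ?S" "z \<notin> M"
        then show "cinner2 (F j z) (\<Psi> z) = indicator ?R z *\<^sub>R (\<Sum>\<tau>\<in>S. tscale (\<epsilon> j) \<tau> (V j) z)"
          unfolding inner using M(2) by metis
      qed
      also have "\<dots> = integral\<^sup>L lborel (\<lambda>z. \<Sum>\<tau>\<in>S. indicator ?R z *\<^sub>R tscale (\<epsilon> j) \<tau> (V j) z)"
        using RS by (intro Bochner_Integration.integral_cong refl) (auto simp: indicator_def)
      also have "\<dots> = (\<Sum>\<tau>\<in>S. integral\<^sup>L lborel (\<lambda>z. indicator ?R z *\<^sub>R tscale (\<epsilon> j) \<tau> (V j) z))"
      proof (rule Bochner_Integration.integral_sum)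
        fix \<tau>
        obtain B where B: "\<And>x. 0 \<le> x \<Longrightarrow> x \<le> \<alpha> \<Longrightarrow> norm (V j x) \<le> B" using loc_boundedE[OF V(1)] by blast
        show "integrable lborel (\<lambda>z. indicator ?R z *\<^sub>R tscale (\<epsilon> j) \<tau> (V j) z)"
        proof (rule integrableI_bounded_set_indicator[where B = B])
          have "?R = cbox (x1, y1) (x2, y2)" by (simp add: cbox_Pair_eq)
          then show "emeasure lborel ?R < \<infinity>" using emeasure_bounded_finite[OF bounded_cbox[of "(x1, y1)" "(x2, y2)"]] by simp
          show "AE z in lborel. z \<in> ?R \<longrightarrow> norm (tscale (\<epsilon> j) \<tau> (V j) z) \<le> B"
          proof (intro AE_I2 impI)
            fix z assume z: "z \<in> ?R"
            then have c: "0 < fst z" "fst z < \<alpha>" "0 \<le> snd z" "snd z \<le> 1" using box by auto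
            have "\<epsilon> j * of_int \<lfloor>fst z / \<epsilon> j\<rfloor> + \<epsilon> j * snd z \<in> {0..\<alpha>}"
              using floor_cell[OF \<epsilon>_pos[of j] N[of j] c] by blast
            then show "norm (tscale (\<epsilon> j) \<tau> (V j) z) \<le> B" unfolding norm_tscale using B by simp
          qed
        qed (use tm Rb in auto)
      qed
      finally show ?thesis .
    qed
    have "(\<lambda>n. integral\<^sup>L (lebesgue_on ?S) (\<lambda>z. cinner2 (F (k n) z) (\<Psi> z))) \<longlonglongrightarrow> integral\<^sup>L (lebesgue_on ?S) (\<lambda>z. indicator ?R z *\<^sub>R \<pi> (G z))"
      using LIMSEQ_subseq_LIMSEQ[OF wF[OF \<Psi>L] k] unfolding inner by (simp add: o_def)
    moreover have "(\<lambda>n. integral\<^sup>L (lebesgue_on ?S) (\<lambda>z. cinner2 (F (k n) z) (\<Psi> z))) \<longlonglongrightarrow>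
      (\<Sum>\<tau>\<in>S. \<Sum>i\<in>I. if exp (2 * \<i> * pi * \<sigma> i) * exp (- 2 * \<i> * pi * \<tau>) = 1
         then integral {x1..x2} (\<lambda>x. t * \<A> i x) * integral {y1..y2} (\<lambda>y. of_real (s y) * \<zeta> i y) else 0)"
      unfolding Fint by (intro tendsto_sum component_rectangle_limit[OF k \<A>c \<A>u N s c \<zeta> Vm V(2) box])
    ultimately have "integral\<^sup>L (lebesgue_on ?S) (\<lambda>z. indicator ?R z *\<^sub>R \<pi> (G z)) = (\<Sum>\<tau>\<in>S. \<Sum>i\<in>I. if exp (2 * \<i> * pi * \<sigma> i) * exp (- 2 * \<i> * pi * \<tau>) = 1
         then integral {x1..x2} (\<lambda>x. t * \<A> i x) * integral {y1..y2} (\<lambda>y. of_real (s y) * \<zeta> i y) else 0)"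
      by (rule LIMSEQ_unique)
    also have "\<dots> = (\<Sum>p\<in>S \<times> I. integral {x1..x2} (\<lambda>x. if ?on p then t * \<A> (snd p) x else 0) * integral {y1..y2} (\<lambda>y. of_real (s y) * \<zeta> (snd p) y))"
      unfolding sum.cartesian_product by (rule sum.cong) auto
    finally show "integral\<^sup>L (lebesgue_on ?S) (\<lambda>z. indicator ?R z *\<^sub>R \<pi> (G z)) = \<dots>" .
  qed
  have c1: "AE z in lebesgue_on ?S. fst (G z) = (\<Sum>p\<in>S \<times> I. (if ?on p then inverse (\<i> * \<mu>0) * \<A> (snd p) (fst z) else 0) * (of_real (sqrt (a (snd z)) * inverse (a (snd z))) * q (snd p) (snd z)))"
  \<comment> \<open>The expansion holds for \<open>\<epsilon> j * Q j\<close>, so an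
    \<open>\<epsilon> j\<close> moves to the denominator, where
    \<open>\<epsilon> j * sqrt (\<Lambda> j)\<close> tends to \<open>\<mu>0\<close>.\<close>
  proof (rule comp[where \<iota> = "\<lambda>e. (e, 0)" and V = U1 and c = "\<lambda>j. inverse (\<i> * of_real (\<epsilon> j * sqrt (\<Lambda> j)))"])
    show "cinner2 p (e, 0) = cnj e * fst p" for p e by (simp add: cinner2_def)
    show "(\<lambda>e::complex. (e, 0::complex)) \<in> borel_measurable borel" by (intro borel_measurable_Pair) auto
    show "\<exists>M. negligible M \<and> (\<forall>z\<in>?S. z \<notin> M \<longrightarrow> fst (F j z) = (\<Sum>\<tau>\<in>S. tscale (\<epsilon> j) \<tau> (U1 j) z))" for j
      using FU[of j] by (metis fst_conv)
    show "(\<lambda>j. inverse (\<i> * of_real (\<epsilon> j * sqrt (\<Lambda> j)))) \<longlonglongrightarrow> inverse (\<i> * \<mu>0)"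
      using \<mu>0 by (intro tendsto_inverse tendsto_mult tendsto_const tendsto_of_real nu_lim) auto
    show "sqrt (a (y + 1)) * inverse (a (y + 1)) = sqrt (a y) * inverse (a y)" for y by (simp add: a_periodic)
    show "U1 j x = of_real (sqrt (a (x / \<epsilon> j)) * inverse (a (x / \<epsilon> j))) * (\<Sum>i\<in>I. q i (x / \<epsilon> j) * A i j x) * inverse (\<i> * of_real (\<epsilon> j * sqrt (\<Lambda> j)))" for j x
      unfolding Q_expand[symmetric] U1_def osc_def using \<epsilon>_pos[of j] by (simp add: divide_inverse)
  qed (auto simp: zero_prod_def intro: bounded_linear_fst loc_bounded_sqrt_a loc_bounded_bloch q_per loc_bounded_U)
  have c2: "AE z in lebesgue_on ?S. snd (G z) = (\<Sum>p\<in>S \<times> I. (if ?on p then 1 * \<A> (snd p) (fst z) else 0) * (of_real (sqrt (r (snd z))) * \<phi> (snd p) (snd z)))"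
  proof (rule comp[where \<iota> = "\<lambda>e. (0, e)" and V = U2 and c = "\<lambda>j. 1"])
    show "cinner2 p (0, e) = cnj e * snd p" for p e by (simp add: cinner2_def)
    show "(\<lambda>e::complex. (0::complex, e)) \<in> borel_measurable borel" by (intro borel_measurable_Pair) auto
    show "\<exists>M. negligible M \<and> (\<forall>z\<in>?S. z \<notin> M \<longrightarrow> snd (F j z) = (\<Sum>\<tau>\<in>S. tscale (\<epsilon> j) \<tau> (U2 j) z))" for j
      using FU[of j] by (metis snd_conv)
    show "sqrt (r (y + 1)) = sqrt (r y)" for y by (simp add: r_periodic)
    show "U2 j x = of_real (sqrt (r (x / \<epsilon> j))) * (\<Sum>i\<in>I. \<phi> i (x / \<epsilon> j) * A i j x) * 1" for j x
      unfolding W_expand[symmetric] U2_def osc_def by simp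
  qed (auto simp: zero_prod_def intro: bounded_linear_snd loc_bounded_sqrt_r loc_bounded_bloch \<phi>_per loc_bounded_U)
  from c1 c2 show ?thesis
  proof eventually_elim
    case (elim z)
    show ?case
    proof (rule prod_eqI)
      show "fst (G z) = fst (\<Sum>\<tau>\<in>S. \<Sum>i\<in>I. if exp (2 * \<i> * pi * \<sigma> i) * exp (- 2 * \<i> * pi * \<tau>) = 1
       then cscale2 (\<A> i (fst z)) (of_real (sqrt (a (snd z)) * inverse (a (snd z))) * q i (snd z) / (\<i> * \<mu>0), of_real (sqrt (r (snd z))) * \<phi> i (snd z)) else 0)"
        unfolding elim(1) fst_sum sum.cartesian_product by (rule sum.cong) (auto simp: cscale2_def divide_inverse)
      show "snd (G z) = snd (\<Sum>\<tau>\<in>S. \<Sum>i\<in>I. if exp (2 * \<i> * pi * \<sigma> i) * exp (- 2 * \<i> * pi * \<tau>) = 1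
       then cscale2 (\<A> i (fst z)) (of_real (sqrt (a (snd z)) * inverse (a (snd z))) * q i (snd z) / (\<i> * \<mu>0), of_real (sqrt (r (snd z))) * \<phi> i (snd z)) else 0)"
        unfolding elim(2) snd_sum sum.cartesian_product by (rule sum.cong) (auto simp: cscale2_def)
    qed
  qed
qed

end

section \<open>The macroscopic problem\<close>

lemma AE_osc:
  assumes "AE x in lebesgue. f x = g x" "0 < \<epsilon>"
  shows "AE x in lebesgue. osc \<epsilon> f x = osc \<epsilon> g x"
proof -
  obtain N where N: "negligible N" "\<And>x. x \<notin> N \<Longrightarrow> f x = g x" using assms(1) by (rule AE_lebesgueE) blast
  show ?thesis
  proof (rule AE_lebesgueI)
    show "negligible {x. (1 / \<epsilon>) * x + 0 \<in> N}" using assms(2) by (intro negligible_affine_preimage N) auto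
  qed (use N in \<open>auto simp: osc_def\<close>)
qed

lemma AE_lebesgue_imp_on:
  assumes "AE x in lebesgue. P x" "S \<in> sets lebesgue" shows "AE x in lebesgue_on S. P x"
  using assms by (subst AE_restrict_space_iff) (auto elim: eventually_mono)

lemma loc_bounded_integrable_Ycell:
  assumes "loc_bounded f" shows "integrable (lebesgue_on Ycell) f"
proof -
  have "f absolutely_integrable_on {0<..<1}"
    using loc_bounded_absolutely_integrable[OF assms] absolutely_integrable_on_Icc_iff_Ioo by blast
  then show ?thesis by (simp add: set_integrable_def integrable_restrict_space)
qed

lemma exp_minus_eq_cnj: "exp (- 2 * \<i> * pi * s) = cnj (exp (2 * \<i> * pi * s))" for s :: real
  by (simp add: exp_cnj)

text \<open>Two quasi-momenta in the open interval differ by less than 1, so their phases agree only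
  if they are equal. In particular k and -k are not in resonance for nonzero k.\<close>

lemma exp_phase_eq_1_iff:
  assumes "h \<in> Ystar" "l \<in> Ystar"
  shows "exp (2 * \<i> * pi * h) * cnj (exp (2 * \<i> * pi * l)) = 1 \<longleftrightarrow> h = l"
proof -
  have e: "exp (2 * \<i> * pi * h) * cnj (exp (2 * \<i> * pi * l)) = exp (2 * \<i> * pi * of_real (h - l))"
    unfolding exp_minus_eq_cnj[symmetric] exp_add[symmetric] by (simp add: algebra_simps)
  show ?thesis
  proof
    assume "exp (2 * \<i> * pi * h) * cnj (exp (2 * \<i> * pi * l)) = 1"
    then obtain n :: int where n: "2 * pi * (h - l) = of_int (2 * n) * pi"
      unfolding e exp_eq_1 by auto
    then have "h - l = of_int n" by simp
    moreover have "\<bar>h - l\<bar> < 1" using assms by auto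
    ultimately have "n = 0" by linarith
    then show "h = l" using \<open>h - l = of_int n\<close> by simp
  next
    assume "h = l"
    then show "exp (2 * \<i> * pi * h) * cnj (exp (2 * \<i> * pi * l)) = 1" unfolding e by simp
  qed
qed

text \<open>Translates an integral equation back into Sobolev functions and \<open>wderiv\<close>,
  the terms in which the macroscopic problem is stated.\<close>

lemma Sob1_continuous_primitive:
  fixes u g :: "real \<Rightarrow> complex"
  assumes u: "continuous_on UNIV u" and g: "continuous_on UNIV g" and \<alpha>: "0 < \<alpha>"
    and eq: "\<And>x. 0 \<le> x \<Longrightarrow> x \<le> \<alpha> \<Longrightarrow> u x = u 0 + integral {0..x} g"
  shows "Sob 1 (Omega \<alpha>) u" and "AE x in lebesgue_on (Omega \<alpha>). wderiv (Omega \<alpha>) u x = g x"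
proof -
  have d: "(u has_vector_derivative g x) (at x)" if x: "0 < x" "x < \<alpha>" for x
  proof -
    have "((\<lambda>x. integral {0..x} g) has_vector_derivative g x) (at x within {0..\<alpha>})"
      using x by (intro integral_has_vector_derivative continuous_on_subset[OF g]) auto
    from has_vector_derivative_add[OF has_vector_derivative_const[of "u 0"] this]
    have "((\<lambda>x. u 0 + integral {0..x} g) has_vector_derivative g x) (at x within {0..\<alpha>})" by simp
    then have "(u has_vector_derivative g x) (at x within {0..\<alpha>})"
    proof (rule has_vector_derivative_transform[rotated 2])
      show "x \<in> {0..\<alpha>}" using x by simp
      show "u z = u 0 + integral {0..z} g" if "z \<in> {0..\<alpha>}" for z using eq[of z] that by simp
    qed
    then show ?thesis using x by (simp add: at_within_Icc_at)
  qed
  have w: "weak_deriv (Omega \<alpha>) u g"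
    by (rule weak_deriv_C1) (use d continuous_on_subset[OF g] in auto)
  have L2: "L2_on (Omega \<alpha>) f" if f: "continuous_on UNIV f" for f :: "real \<Rightarrow> complex"
  proof -
    have "loc_bounded (\<lambda>x. (cmod (f x))\<^sup>2)" by (intro loc_bounded_power2 loc_bounded_norm loc_bounded_continuous f)
    then have "(\<lambda>x. (cmod (f x))\<^sup>2) absolutely_integrable_on {0<..<\<alpha>}"
      using loc_bounded_absolutely_integrable absolutely_integrable_on_Icc_iff_Ioo by blast
    then have "integrable (lebesgue_on (Omega \<alpha>)) (\<lambda>x. (cmod (f x))\<^sup>2)"
      by (simp add: set_integrable_def integrable_restrict_space)
    moreover have "f \<in> borel_measurable (lebesgue_on (Omega \<alpha>))"
      by (intro continuous_imp_measurable_on_sets_lebesgue continuous_on_subset[OF f]) auto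
    ultimately show ?thesis by (simp add: L2_on_def)
  qed
  show "Sob 1 (Omega \<alpha>) u" using w L2[OF u] L2[OF g] by auto
  show "AE x in lebesgue_on (Omega \<alpha>). wderiv (Omega \<alpha>) u x = g x" by (rule wderiv_unique[OF w])
qed

context periodic_coefficients
begin

text \<open>The energy identity yields both the sign of the eigenvalue and the bound on the physical
  vector: for nonzero \<open>\<Lambda>\<close> its components have the same energy, the integral of
  \<open>osc \<epsilon> r x * (cmod (W x))\<^sup>2\<close>, which the normalization bounds by
  \<open>r1\<close>.\<close>

lemma physical_data:
  assumes p: "physical_eigen \<alpha> (osc \<epsilon> a') (osc \<epsilon> r') \<Lambda> w" and \<alpha>: "0 < \<alpha>" and \<epsilon>: "0 < \<epsilon>"
    and aa: "AE x in lebesgue. a' x = a x" and rr: "AE x in lebesgue. r' x = r x"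
  obtains W Q where "int_sol (osc \<epsilon> a) (osc \<epsilon> r) \<Lambda> \<alpha> W Q" "W 0 = 0" "W \<alpha> = 0"
    "integral {0..\<alpha>} (\<lambda>x. (cmod (W x))\<^sup>2) = 1" "0 \<le> \<Lambda>"
    "AE x in lebesgue_on (Omega \<alpha>). phys_vec \<alpha> (osc \<epsilon> a') (osc \<epsilon> r') \<Lambda> w x =
       (of_real (sqrt (osc \<epsilon> a x) * inverse (osc \<epsilon> a x)) * Q x / (\<i> * of_real (sqrt \<Lambda>)), of_real (sqrt (osc \<epsilon> r x)) * W x)"
    "integral {0..\<alpha>} (\<lambda>x. (cmod (of_real (sqrt (osc \<epsilon> a x) * inverse (osc \<epsilon> a x)) * Q x / (\<i> * of_real (sqrt \<Lambda>))))\<^sup>2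
       + (cmod (of_real (sqrt (osc \<epsilon> r x)) * W x))\<^sup>2) \<le> 2 * r1"
proof -
  interpret o: coefficients "osc \<epsilon> a" "osc \<epsilon> r" a0 a1 r0 r1 by (rule int_sol_osc[OF \<epsilon>])
  note aa' = AE_osc[OF aa \<epsilon>] and rr' = AE_osc[OF rr \<epsilon>]
  obtain W Q where WQ: "int_sol (osc \<epsilon> a) (osc \<epsilon> r) \<Lambda> \<alpha> W Q" "\<And>x. 0 \<le> x \<Longrightarrow> x \<le> \<alpha> \<Longrightarrow> W x = w x"
    "AE x in lebesgue_on (Omega \<alpha>). wderiv (Omega \<alpha>) w x = of_real (inverse (osc \<epsilon> a x)) * Q x"
    using o.physical_representation[OF p \<alpha> aa' rr'] by blast
  note s = int_solD[OF WQ(1)]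
  have bc: "W 0 = 0" "W \<alpha> = 0" using WQ(2)[of 0] WQ(2)[of \<alpha>] p \<alpha> by (auto simp: physical_eigen_def)
  have lW: "loc_bounded (\<lambda>x. (cmod (W x))\<^sup>2)" and lQ: "loc_bounded (\<lambda>x. (cmod (Q x))\<^sup>2)"
    by (intro loc_bounded_power2 loc_bounded_norm s)+
  have n1: "integral {0..\<alpha>} (\<lambda>x. (cmod (W x))\<^sup>2) = 1"
  proof -
    have "Sob 2 (Omega \<alpha>) w" using p by (simp add: physical_eigen_def)
    then have "L2_on (Omega \<alpha>) w" by (simp add: numeral_2_eq_2)
    then have i: "integrable (lebesgue_on (Omega \<alpha>)) (\<lambda>x. (cmod (w x))\<^sup>2)" by (simp add: L2_on_def)
    have "sqrt (integral\<^sup>L (lebesgue_on (Omega \<alpha>)) (\<lambda>x. (cmod (w x))\<^sup>2)) = 1" using p by (simp add: physical_eigen_def L2_norm_def)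
    then have "1 = integral\<^sup>L (lebesgue_on (Omega \<alpha>)) (\<lambda>x. (cmod (w x))\<^sup>2)" by (metis real_sqrt_eq_1_iff)
    also have "\<dots> = integral (Omega \<alpha>) (\<lambda>x. (cmod (w x))\<^sup>2)" by (rule lebesgue_integral_eq_integral[OF i]) auto
    also have "\<dots> = integral (Omega \<alpha>) (\<lambda>x. (cmod (W x))\<^sup>2)" by (rule integral_cong) (use WQ(2) in auto)
    also have "\<dots> = integral {0..\<alpha>} (\<lambda>x. (cmod (W x))\<^sup>2)" by (simp add: integral_open_interval_real)
    finally show ?thesis by simp
  qed
  have en: "integral {0..\<alpha>} (\<lambda>t. inverse (osc \<epsilon> a t) * (cmod (Q t))\<^sup>2) = \<Lambda> * integral {0..\<alpha>} (\<lambda>t. osc \<epsilon> r t * (cmod (W t))\<^sup>2)"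
    by (rule o.energy_identity[OF WQ(1)]) (use \<alpha> bc in auto)
  have lr: "loc_bounded (\<lambda>t. osc \<epsilon> r t * (cmod (W t))\<^sup>2)" by (intro loc_bounded_mult o.loc_bounded_r lW)
  have la: "loc_bounded (\<lambda>t. inverse (osc \<epsilon> a t) * (cmod (Q t))\<^sup>2)" by (intro loc_bounded_mult o.loc_bounded_inverse_a lQ)
  \<comment> \<open>A positive lower bound on the mass, so that \<open>\<Lambda>\<close> inherits
    the sign of the nonnegative energy.\<close>
  have R0: "r0 \<le> integral {0..\<alpha>} (\<lambda>t. osc \<epsilon> r t * (cmod (W t))\<^sup>2)"
  proof -
    have "integral {0..\<alpha>} (\<lambda>t. r0 * (cmod (W t))\<^sup>2) \<le> integral {0..\<alpha>} (\<lambda>t. osc \<epsilon> r t * (cmod (W t))\<^sup>2)"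
      by (intro integral_le loc_bounded_integrable loc_bounded_mult loc_bounded_const lW o.loc_bounded_r mult_right_mono o.r_ge) auto
    then show ?thesis unfolding integral_mult_right n1 by simp
  qed
  have R1: "integral {0..\<alpha>} (\<lambda>t. osc \<epsilon> r t * (cmod (W t))\<^sup>2) \<le> r1"
  proof -
    have "integral {0..\<alpha>} (\<lambda>t. osc \<epsilon> r t * (cmod (W t))\<^sup>2) \<le> integral {0..\<alpha>} (\<lambda>t. r1 * (cmod (W t))\<^sup>2)"
      by (intro integral_le loc_bounded_integrable loc_bounded_mult loc_bounded_const lW o.loc_bounded_r mult_right_mono o.r_le) auto
    then show ?thesis unfolding integral_mult_right n1 by simp
  qed
  have \<Lambda>: "0 \<le> \<Lambda>"
  proof -
    have "0 \<le> integral {0..\<alpha>} (\<lambda>t. inverse (osc \<epsilon> a t) * (cmod (Q t))\<^sup>2)"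
      using o.a_pos by (intro integral_nonneg loc_bounded_integrable la) (auto simp: less_imp_le)
    then show ?thesis unfolding en using R0 r0 by (simp add: zero_le_mult_iff)
  qed
  have U: "AE x in lebesgue_on (Omega \<alpha>). phys_vec \<alpha> (osc \<epsilon> a') (osc \<epsilon> r') \<Lambda> w x =
       (of_real (sqrt (osc \<epsilon> a x) * inverse (osc \<epsilon> a x)) * Q x / (\<i> * of_real (sqrt \<Lambda>)), of_real (sqrt (osc \<epsilon> r x)) * W x)"
  proof -
    have "AE x in lebesgue_on (Omega \<alpha>). osc \<epsilon> a' x = osc \<epsilon> a x" "AE x in lebesgue_on (Omega \<alpha>). osc \<epsilon> r' x = osc \<epsilon> r x"
      by (intro AE_lebesgue_imp_on aa' rr', simp)+
    moreover have "AE x in lebesgue_on (Omega \<alpha>). x \<in> Omega \<alpha>" by (rule AE_I2) simp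
    ultimately show ?thesis using WQ(3)
      by eventually_elim (simp add: phys_vec_def WQ(2))
  qed
  have E: "integral {0..\<alpha>} (\<lambda>x. (cmod (of_real (sqrt (osc \<epsilon> a x) * inverse (osc \<epsilon> a x)) * Q x / (\<i> * of_real (sqrt \<Lambda>))))\<^sup>2
       + (cmod (of_real (sqrt (osc \<epsilon> r x)) * W x))\<^sup>2) \<le> 2 * r1"
  proof -
    have "(cmod (of_real (sqrt (osc \<epsilon> a x) * inverse (osc \<epsilon> a x)) * Q x / (\<i> * of_real (sqrt \<Lambda>))))\<^sup>2 + (cmod (of_real (sqrt (osc \<epsilon> r x)) * W x))\<^sup>2
      = inverse \<Lambda> * (inverse (osc \<epsilon> a x) * (cmod (Q x))\<^sup>2) + osc \<epsilon> r x * (cmod (W x))\<^sup>2" for x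
    proof -
      have "(sqrt (osc \<epsilon> a x) * inverse (osc \<epsilon> a x))\<^sup>2 = inverse (osc \<epsilon> a x)"
      proof -
        have "(sqrt (osc \<epsilon> a x))\<^sup>2 = osc \<epsilon> a x" using o.a_pos[of x] by simp
        then show ?thesis using o.a_pos[of x] unfolding power_mult_distrib by (simp add: power2_eq_square)
      qed
      then show ?thesis using o.r_pos[of x] \<Lambda>
        unfolding norm_divide norm_mult norm_ii norm_of_real power_mult_distrib power_divide power2_abs
        by (simp add: divide_inverse mult_ac less_imp_le power_mult_distrib)
    qed
    then have "integral {0..\<alpha>} (\<lambda>x. (cmod (of_real (sqrt (osc \<epsilon> a x) * inverse (osc \<epsilon> a x)) * Q x / (\<i> * of_real (sqrt \<Lambda>))))\<^sup>2 + (cmod (of_real (sqrt (osc \<epsilon> r x)) * W x))\<^sup>2)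
      = integral {0..\<alpha>} (\<lambda>x. inverse \<Lambda> * (inverse (osc \<epsilon> a x) * (cmod (Q x))\<^sup>2) + osc \<epsilon> r x * (cmod (W x))\<^sup>2)" by simp
    also have "\<dots> = integral {0..\<alpha>} (\<lambda>x. inverse \<Lambda> * (inverse (osc \<epsilon> a x) * (cmod (Q x))\<^sup>2)) + integral {0..\<alpha>} (\<lambda>x. osc \<epsilon> r x * (cmod (W x))\<^sup>2)"
      by (intro Henstock_Kurzweil_Integration.integral_add loc_bounded_integrable lr loc_bounded_mult[OF loc_bounded_const la])
    also have "\<dots> = inverse \<Lambda> * \<Lambda> * integral {0..\<alpha>} (\<lambda>x. osc \<epsilon> r x * (cmod (W x))\<^sup>2) + integral {0..\<alpha>} (\<lambda>x. osc \<epsilon> r x * (cmod (W x))\<^sup>2)"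
      unfolding integral_mult_right en by simp
    also have "\<dots> \<le> 1 * r1 + r1"
    proof (intro add_mono mult_mono R1)
      \<comment> \<open>Equal to 1 unless \<open>\<Lambda> = 0\<close>, where the inverse is 0 by
        convention; hence an inequality rather than an equation.\<close>
      show "inverse \<Lambda> * \<Lambda> \<le> 1" by (cases "\<Lambda> = 0") auto
    qed (use R0 r0 in auto)
    finally show ?thesis by simp
  qed
  show ?thesis by (rule that[OF WQ(1) bc n1 \<Lambda> U E])
qed

text \<open>For equal eigenvalues the Wronskian is constant on nonnegative arguments, and over a
  period it is multiplied by \<open>\<omega> * cnj \<omega>'\<close>; so it vanishes unless this
  multiplier is 1. Shifting by enough periods covers negative arguments.\<close>

lemma wronskian_quasi_periodic:
  assumes s: "\<And>d. int_sol a r \<Lambda> d W Q" and t: "\<And>d. int_sol a r \<Lambda> d V P"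
    and per: "\<And>y. W (y + 1) = \<omega> * W y" "\<And>y. Q (y + 1) = \<omega> * Q y" "\<And>y. V (y + 1) = \<omega>' * V y" "\<And>y. P (y + 1) = \<omega>' * P y"
    and n: "norm \<omega> = 1" "norm \<omega>' = 1"
  defines "w \<equiv> \<lambda>y. Q y * cnj (V y) - W y * cnj (P y)"
  shows "\<omega> * cnj \<omega>' = 1 \<Longrightarrow> w y = w 0" and "\<omega> * cnj \<omega>' \<noteq> 1 \<Longrightarrow> w y = 0"
proof -
  have c: "w y = w 0" if "0 \<le> y" for y
    using wronskian_identity[OF s t that order_refl] by (simp add: w_def)
  have p: "w (y + 1) = (\<omega> * cnj \<omega>') * w y" for y
    unfolding w_def per by (simp add: algebra_simps)
  obtain m :: nat where m: "- y \<le> real m" using real_arch_simple by blast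
  have "(\<omega> * cnj \<omega>') ^ m * w y = w 0"
    using quasi_periodic_nat[of w, OF p, of y m] c[of "y + real m"] m by simp
  then show "\<omega> * cnj \<omega>' = 1 \<Longrightarrow> w y = w 0" by simp
  assume ne: "\<omega> * cnj \<omega>' \<noteq> 1"
  have "w 0 = (\<omega> * cnj \<omega>') * w 0" using p[of 0] c[of 1] by simp
  then have "w 0 = 0" using ne by (metis mult_cancel_right1)
  moreover have "\<omega> * cnj \<omega>' \<noteq> 0" using n by auto
  ultimately show "w y = 0" using \<open>(\<omega> * cnj \<omega>') ^ m * w y = w 0\<close> by simp
qed

end

section \<open>Bloch waves: fluxes, Wronskians and the coefficients c and b\<close>

text \<open>The coefficients as given, \<open>a\<close> and \<open>r\<close>, occur in the notions
  of the statement; their regular versions \<open>ah\<close> and \<open>rh\<close> occur in the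
  integral equations.\<close>

locale bloch_setting = periodic_coefficients ah rh a0 a1 r0 r1
  for ah rh :: "real \<Rightarrow> real" and a0 a1 r0 r1 :: real +
  fixes a r :: "real \<Rightarrow> real" and lam :: "real \<Rightarrow> nat \<Rightarrow> real" and \<phi> :: "real \<Rightarrow> nat \<Rightarrow> real \<Rightarrow> complex"
  assumes aa: "AE x in lebesgue. a x = ah x" and rr: "AE x in lebesgue. r x = rh x"
    and family: "bloch_family a r lam \<phi>"
begin

lemma eigen:
  assumes "s \<in> Ystar"
  shows "\<And>i. i \<ge> 1 \<Longrightarrow> L2_norm Ycell (\<phi> s i) = 1"
    and "\<And>i. i \<ge> 1 \<Longrightarrow> bloch_solution a r s (lam s i) (\<phi> s i)"
    and "\<And>\<Lambda>. solution_basis a r s \<Lambda> {n. n \<ge> 1 \<and> lam s n = \<Lambda>} (\<phi> s)"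
proof -
  have b: "bloch_eigenelements a r s (lam s) (\<phi> s)" using family assms unfolding bloch_family_def by blast
  then show 1: "\<And>i. i \<ge> 1 \<Longrightarrow> L2_norm Ycell (\<phi> s i) = 1"
    and 2: "\<And>\<Lambda>. solution_basis a r s \<Lambda> {n. n \<ge> 1 \<and> lam s n = \<Lambda>} (\<phi> s)"
    unfolding bloch_eigenelements_def by blast+
  show "\<And>i. i \<ge> 1 \<Longrightarrow> bloch_solution a r s (lam s i) (\<phi> s i)"
    using 2 unfolding solution_basis_def by blast
qed

text \<open>An explicit formula in place of a choice, so that conjugation of a wave passes to its
  flux by differentiation.\<close>

definition flux :: "real \<Rightarrow> nat \<Rightarrow> real \<Rightarrow> complex" where
  "flux s i y = of_real (ah y) * vector_derivative (\<phi> s i) (at y)"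

lemma flux:
  assumes s: "s \<in> Ystar" and i: "i \<ge> 1"
  shows "int_sol ah rh (lam s i) d (\<phi> s i) (flux s i)"
    "\<phi> s i (y + 1) = exp (2 * \<i> * pi * s) * \<phi> s i y" "flux s i (y + 1) = exp (2 * \<i> * pi * s) * flux s i y"
    "AE y in lebesgue_on Ycell. of_real (a y) * wderiv Ycell (\<phi> s i) y = flux s i y"
    "AE y in lebesgue_on Ycell. wderiv Ycell (\<phi> s i) y = of_real (inverse (ah y)) * flux s i y"
    "(\<phi> s i has_vector_derivative of_real (inverse (ah y)) * flux s i y) (at y)"
proof -
  obtain q where q: "\<And>d. int_sol ah rh (lam s i) d (\<phi> s i) q"
    "\<And>y. \<phi> s i (y + 1) = exp (2 * \<i> * pi * s) * \<phi> s i y" "\<And>y. q (y + 1) = exp (2 * \<i> * pi * s) * q y"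
    "AE y in lebesgue_on Ycell. of_real (a y) * wderiv Ycell (\<phi> s i) y = q y"
    "AE y in lebesgue_on Ycell. wderiv Ycell (\<phi> s i) y = of_real (inverse (ah y)) * q y"
    "\<And>y. (\<phi> s i has_vector_derivative of_real (inverse (ah y)) * q y) (at y)"
    using bloch_representation[OF eigen(2)[OF s i] aa rr] by blast
  have "flux s i = q"
    using vector_derivative_at[OF q(6)] a_pos by (simp add: fun_eq_iff flux_def less_imp_neq[symmetric])
  then show "int_sol ah rh (lam s i) d (\<phi> s i) (flux s i)"
    "\<phi> s i (y + 1) = exp (2 * \<i> * pi * s) * \<phi> s i y" "flux s i (y + 1) = exp (2 * \<i> * pi * s) * flux s i y"
    "AE y in lebesgue_on Ycell. of_real (a y) * wderiv Ycell (\<phi> s i) y = flux s i y"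
    "AE y in lebesgue_on Ycell. wderiv Ycell (\<phi> s i) y = of_real (inverse (ah y)) * flux s i y"
    "(\<phi> s i has_vector_derivative of_real (inverse (ah y)) * flux s i y) (at y)"
    using q by auto
qed

lemma flux_cnj:
  assumes "\<And>y. \<phi> s' i y = cnj (\<phi> s i y)" and s: "s \<in> Ystar" and i: "i \<ge> 1"
  shows "flux s' i y = cnj (flux s i y)"
proof -
  have "((\<lambda>y. cnj (\<phi> s i y)) has_vector_derivative cnj (of_real (inverse (ah y)) * flux s i y)) (at y)"
    by (rule has_vector_derivative_cnj[OF flux(6)[OF s i]])
  moreover have "\<phi> s' i = (\<lambda>y. cnj (\<phi> s i y))" using assms(1) by auto
  ultimately have "vector_derivative (\<phi> s' i) (at y) = cnj (of_real (inverse (ah y)) * flux s i y)"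
    by (simp add: vector_derivative_at)
  then show ?thesis using a_pos[of y] by (simp add: flux_def[of s'])
qed

definition wr :: "real \<Rightarrow> nat \<Rightarrow> nat \<Rightarrow> complex" where
  "wr s i l = flux s l 0 * cnj (\<phi> s i 0) - \<phi> s l 0 * cnj (flux s i 0)"

lemma wr_const:
  assumes s: "s \<in> Ystar" and i: "i \<ge> 1" and l: "l \<ge> 1" and e: "lam s i = lam s l"
  shows "flux s l y * cnj (\<phi> s i y) - \<phi> s l y * cnj (flux s i y) = wr s i l"
proof -
  have 1: "exp (2 * \<i> * pi * s) * cnj (exp (2 * \<i> * pi * s)) = 1" using exp_phase_eq_1_iff[OF s s] by simp
  have i': "int_sol ah rh (lam s l) d (\<phi> s i) (flux s i)" for d using flux(1)[OF s i, of d] e by simp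
  show ?thesis unfolding wr_def
  proof (rule wronskian_quasi_periodic(1)[where W = "\<phi> s l" and Q = "flux s l" and V = "\<phi> s i" and P = "flux s i"])
    show "int_sol ah rh (lam s l) d (\<phi> s l) (flux s l)" for d by (rule flux(1)[OF s l])
    show "int_sol ah rh (lam s l) d (\<phi> s i) (flux s i)" for d by (rule i')
  qed (rule flux(2,3)[OF s l] flux(2,3)[OF s i] norm_exp_i_real 1)+
qed

text \<open>The integrand of c is almost everywhere the Wronskian of the two waves, which is
  constant, and the cell has length 1.\<close>

lemma coef_c_eq_wr:
  assumes s: "s \<in> Ystar" and i: "i \<ge> 1" and l: "l \<ge> 1" and e: "lam s i = lam s l"
  shows "coef_c a \<phi> s i l = wr s i l"
proof -
  obtain N1 where N1: "negligible N1" "\<And>y. y \<in> Ycell \<Longrightarrow> y \<notin> N1 \<Longrightarrow> of_real (a y) * wderiv Ycell (\<phi> s i) y = flux s i y"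
    using flux(4)[OF s i] by (rule AE_lebesgue_on_open_intervalE) auto
  obtain N2 where N2: "negligible N2" "\<And>y. y \<in> Ycell \<Longrightarrow> y \<notin> N2 \<Longrightarrow> of_real (a y) * wderiv Ycell (\<phi> s l) y = flux s l y"
    using flux(4)[OF s l] by (rule AE_lebesgue_on_open_intervalE) auto
  have "coef_c a \<phi> s i l = integral\<^sup>L lborel (\<lambda>y. indicator Ycell y *\<^sub>R wr s i l)"
    unfolding coef_c_def
  proof (rule lebesgue_on_AE_borel(3)[OF _ _ negligible_Un[OF N1(1) N2(1)]])
    fix y assume y: "y \<in> Ycell" "y \<notin> N1 \<union> N2"
    have "\<phi> s l y * of_real (a y) * cnj (wderiv Ycell (\<phi> s i) y) = \<phi> s l y * cnj (of_real (a y) * wderiv Ycell (\<phi> s i) y)" by simp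
    also have "\<dots> = \<phi> s l y * cnj (flux s i y)" by (subst N1(2)) (use y in auto)
    finally have x: "\<phi> s l y * of_real (a y) * cnj (wderiv Ycell (\<phi> s i) y) = \<phi> s l y * cnj (flux s i y)" .
    have x': "of_real (a y) * wderiv Ycell (\<phi> s l) y = flux s l y" by (rule N2(2)) (use y in auto)
    show "of_real (a y) * wderiv Ycell (\<phi> s l) y * cnj (\<phi> s i y) - \<phi> s l y * of_real (a y) * cnj (wderiv Ycell (\<phi> s i) y) = wr s i l"
      unfolding x x' by (rule wr_const[OF s i l e])
  qed auto
  also have "\<dots> = wr s i l" by simp
  finally show ?thesis .
qed

lemma coef_b_eq:
  assumes s: "s \<in> Ystar" and i: "i \<ge> 1" and l: "l \<ge> 1"
  shows "coef_b r \<phi> s i l = integral {0..1} (\<lambda>y. of_real (rh y) * \<phi> s l y * cnj (\<phi> s i y))"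
proof -
  obtain N where N: "negligible N" "\<And>y. y \<notin> N \<Longrightarrow> r y = rh y" using rr by (rule AE_lebesgueE) blast
  have lb: "loc_bounded (\<lambda>y. of_real (rh y) * \<phi> s l y * cnj (\<phi> s i y))"
    by (intro loc_bounded_mult loc_bounded_of_real loc_bounded_r loc_bounded_cnj int_solD(3)[OF flux(1)[OF s i]] int_solD(3)[OF flux(1)[OF s l]])
  have "coef_b r \<phi> s i l = integral\<^sup>L lborel (\<lambda>y. indicator Ycell y *\<^sub>R (of_real (rh y) * \<phi> s l y * cnj (\<phi> s i y)))"
    unfolding coef_b_def
    by (rule lebesgue_on_AE_borel(3)[OF _ loc_bounded_measurable[OF lb] N(1)]) (use N(2) in auto)
  also have "\<dots> = integral\<^sup>L (lebesgue_on Ycell) (\<lambda>y. of_real (rh y) * \<phi> s l y * cnj (\<phi> s i y))"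
    by (rule lebesgue_on_AE_borel(3)[OF _ loc_bounded_measurable[OF lb] negligible_empty, symmetric]) auto
  also have "\<dots> = integral Ycell (\<lambda>y. of_real (rh y) * \<phi> s l y * cnj (\<phi> s i y))"
  proof (rule lebesgue_integral_eq_integral)
    show "integrable (lebesgue_on Ycell) (\<lambda>y. of_real (rh y) * \<phi> s l y * cnj (\<phi> s i y))"
      by (rule loc_bounded_integrable_Ycell[OF lb])
  qed auto
  also have "\<dots> = integral {0..1} (\<lambda>y. of_real (rh y) * \<phi> s l y * cnj (\<phi> s i y))" by (rule integral_open_interval_real[symmetric])
  finally show ?thesis .
qed

text \<open>Energy identity over one period, where the boundary terms cancel because the multiplier
  has modulus 1; the normalization keeps the mass positive.\<close>

lemma eigenvalue_nonneg:
  assumes s: "s \<in> Ystar" and i: "i \<ge> 1"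
  shows "0 \<le> lam s i"
proof (rule ccontr)
  assume neg: "\<not> 0 \<le> lam s i"
  note f = int_solD[OF flux(1)[OF s i]]
  have ph: "cnj (exp (2 * \<i> * pi * s)) * exp (2 * \<i> * pi * s) = 1" using exp_phase_eq_1_iff[OF s s] by (simp add: mult.commute)
  have bc: "flux s i 1 * cnj (\<phi> s i 1) = flux s i 0 * cnj (\<phi> s i 0)"
    using flux(2,3)[OF s i, of 0] ph by (simp add: mult_ac)
  have en: "integral {0..1} (\<lambda>t. inverse (ah t) * (cmod (flux s i t))\<^sup>2) = lam s i * integral {0..1} (\<lambda>t. rh t * (cmod (\<phi> s i t))\<^sup>2)"
    by (rule energy_identity[OF flux(1)[OF s i] _ bc]) simp
  have l\<phi>: "loc_bounded (\<lambda>t. (cmod (\<phi> s i t))\<^sup>2)" "loc_bounded (\<lambda>t. (cmod (flux s i t))\<^sup>2)"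
    by (intro loc_bounded_power2 loc_bounded_norm f)+
  have n1: "integral {0..1} (\<lambda>t. (cmod (\<phi> s i t))\<^sup>2) = 1"
  proof -
    have i1: "integrable (lebesgue_on Ycell) (\<lambda>y. (cmod (\<phi> s i y))\<^sup>2)"
      by (rule loc_bounded_integrable_Ycell[OF l\<phi>(1)])
    have "sqrt (integral\<^sup>L (lebesgue_on Ycell) (\<lambda>x. (cmod (\<phi> s i x))\<^sup>2)) = 1" using eigen(1)[OF s i] by (simp add: L2_norm_def)
    then have "1 = integral\<^sup>L (lebesgue_on Ycell) (\<lambda>x. (cmod (\<phi> s i x))\<^sup>2)" by (metis real_sqrt_eq_1_iff)
    also have "\<dots> = integral Ycell (\<lambda>x. (cmod (\<phi> s i x))\<^sup>2)" by (rule lebesgue_integral_eq_integral[OF i1]) auto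
    also have "\<dots> = integral {0..1} (\<lambda>x. (cmod (\<phi> s i x))\<^sup>2)" by (rule integral_open_interval_real[symmetric])
    finally show ?thesis by simp
  qed
  have "integral {0..1} (\<lambda>t. r0 * (cmod (\<phi> s i t))\<^sup>2) \<le> integral {0..1} (\<lambda>t. rh t * (cmod (\<phi> s i t))\<^sup>2)"
    by (intro integral_le loc_bounded_integrable loc_bounded_mult loc_bounded_const l\<phi> loc_bounded_r mult_right_mono r_ge) auto
  then have "0 < integral {0..1} (\<lambda>t. rh t * (cmod (\<phi> s i t))\<^sup>2)" unfolding integral_mult_right n1 using r0 by simp
  moreover have "0 \<le> integral {0..1} (\<lambda>t. inverse (ah t) * (cmod (flux s i t))\<^sup>2)"
    using a_pos by (intro integral_nonneg loc_bounded_integrable loc_bounded_mult loc_bounded_inverse_a l\<phi>) (auto simp: less_imp_le)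
  ultimately show False using neg unfolding en by (simp add: zero_le_mult_iff)
qed

lemma bloch_mu_pos:
  assumes s: "s \<in> Ystar" and i: "i \<noteq> 0" and pos: "0 < bloch_mu lam s i"
  shows "0 < i" "lam s (nabs i) = (bloch_mu lam s i)\<^sup>2" "nabs i \<ge> 1"
proof -
  show i1: "nabs i \<ge> 1" using i by simp
  have nn: "0 \<le> lam s (nabs i)" by (rule eigenvalue_nonneg[OF s i1])
  show ip: "0 < i"
  proof (rule ccontr)
    assume "\<not> 0 < i"
    then have "sgn i = -1" using i by simp
    then have "bloch_mu lam s i \<le> 0" using nn by (simp add: bloch_mu_def)
    then show False using pos by simp
  qed
  show "lam s (nabs i) = (bloch_mu lam s i)\<^sup>2" using ip nn by (simp add: bloch_mu_def)
qed

text \<open>For a positive index the factor \<open>- \<i>\<close> is \<open>1 / \<i>\<close>, as in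
  the physical vector, and \<open>sqrt 2\<close> undoes the normalization of the Bloch
  vector.\<close>

lemma bloch_vec_eq:
  assumes s: "s \<in> Ystar" and i: "i \<noteq> 0" and pos: "0 < bloch_mu lam s i"
  shows "\<exists>N. negligible N \<and> (\<forall>y\<in>Ycell. y \<notin> N \<longrightarrow> cscale2 (of_real (sqrt 2)) (bloch_vec a r lam \<phi> s i y) =
    (of_real (sqrt (ah y) * inverse (ah y)) * flux s (nabs i) y / (\<i> * bloch_mu lam s i), of_real (sqrt (rh y)) * \<phi> s (nabs i) y))"
proof -
  note ip = bloch_mu_pos[OF s i pos]
  obtain N1 where N1: "negligible N1" "\<And>y. y \<in> Ycell \<Longrightarrow> y \<notin> N1 \<Longrightarrow> wderiv Ycell (\<phi> s (nabs i)) y = of_real (inverse (ah y)) * flux s (nabs i) y"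
    using flux(5)[OF s ip(3)] by (rule AE_lebesgue_on_open_intervalE) auto
  obtain N2 where N2: "negligible N2" "\<And>y. y \<notin> N2 \<Longrightarrow> r y = rh y" using rr by (rule AE_lebesgueE) blast
  obtain N3 where N3: "negligible N3" "\<And>y. y \<notin> N3 \<Longrightarrow> a y = ah y" using aa by (rule AE_lebesgueE) blast
  have sq: "sqrt (lam s (nabs i)) = bloch_mu lam s i" using ip by (simp add: bloch_mu_def)
  have s2: "complex_of_real (sqrt 2) * (1 / complex_of_real (sqrt 2) * z) = z" for z by simp
  show ?thesis
  proof (intro exI[of _ "N1 \<union> N2 \<union> N3"] conjI ballI impI)
    show "negligible (N1 \<union> N2 \<union> N3)" by (intro negligible_Un N1 N2 N3)
    fix y assume y: "y \<in> Ycell" "y \<notin> N1 \<union> N2 \<union> N3"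
    have "- \<i> * of_int (sgn i) / of_real (sqrt (lam s (nabs i))) * of_real (sqrt (a y)) * wderiv Ycell (\<phi> s (nabs i)) y
      = of_real (sqrt (ah y) * inverse (ah y)) * flux s (nabs i) y / (\<i> * bloch_mu lam s i)"
    proof -
      have i: "X / (\<i> * z) = - \<i> * X / z" for X z :: complex by (simp add: divide_inverse)
      show ?thesis using N1(2)[of y] N3(2)[of y] y ip(1) pos unfolding sq i by (simp add: divide_inverse mult_ac)
    qed
    then show "cscale2 (of_real (sqrt 2)) (bloch_vec a r lam \<phi> s i y) =
    (of_real (sqrt (ah y) * inverse (ah y)) * flux s (nabs i) y / (\<i> * bloch_mu lam s i), of_real (sqrt (rh y)) * \<phi> s (nabs i) y)"
      using N2(2)[of y] y unfolding bloch_vec_def cscale2_def fst_conv snd_conv s2 by simp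
  qed
qed

end

text \<open>Cramer's rule in dimension two: \<open>f\<close> and \<open>f'\<close> are values of two
  waves, \<open>g\<close> and \<open>g'\<close> those of their fluxes, \<open>c\<close> is the
  determinant; primes do not denote derivatives. The second wave gets \<open>- c\<close> because
  exchanging the waves changes the sign.\<close>

lemma two_wave_reconstruction:
  fixes f g f' g' u v :: complex
  assumes c: "c = g * f' - f * g'" "c \<noteq> 0"
  shows "u = f * ((1 / c) * (v * f' - u * g')) + f' * ((1 / (- c)) * (v * f - u * g))"
    and "v = g * ((1 / c) * (v * f' - u * g')) + g' * ((1 / (- c)) * (v * f - u * g))"
proof -
  have "f * ((1 / c) * (v * f' - u * g')) + f' * ((1 / (- c)) * (v * f - u * g)) = (u * (g * f' - f * g')) / c"
    by (simp add: algebra_simps flip: add_divide_distrib diff_divide_distrib)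
  then show "u = f * ((1 / c) * (v * f' - u * g')) + f' * ((1 / (- c)) * (v * f - u * g))"
    using c by simp
  have "g * ((1 / c) * (v * f' - u * g')) + g' * ((1 / (- c)) * (v * f - u * g)) = (v * (g * f' - f * g')) / c"
    by (simp add: algebra_simps flip: add_divide_distrib diff_divide_distrib)
  then show "v = g * ((1 / c) * (v * f' - u * g')) + g' * ((1 / (- c)) * (v * f - u * g))"
    using c by simp
qed

text \<open>As \<open>\<alpha> / e j\<close> is the integer \<open>N j\<close>, the power is the
  exponential at \<open>\<alpha> * k / e j\<close>, where the integer part does not matter.\<close>

lemma phase_power_limit:
  assumes N: "\<And>j. \<alpha> / e j = real (N j)"
    and l: "(\<lambda>j. \<alpha> * k / e j - of_int \<lfloor>\<alpha> * k / e j\<rfloor>) \<longlonglongrightarrow> lk"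
  shows "(\<lambda>j. exp (2 * \<i> * pi * k) ^ N j) \<longlonglongrightarrow> exp (2 * \<i> * pi * lk)"
proof -
  have "exp (2 * \<i> * pi * k) ^ N j = exp (2 * \<i> * pi * of_real (\<alpha> * k / e j - of_int \<lfloor>\<alpha> * k / e j\<rfloor>))" for j
  proof -
    have e: "\<alpha> * k / e j = real (N j) * k" using N[of j] by (metis times_divide_eq_left)
    have "exp (2 * \<i> * pi * of_real (\<alpha> * k / e j - of_int \<lfloor>\<alpha> * k / e j\<rfloor>)) = exp (2 * \<i> * pi * of_real (real (N j) * k)) / exp (2 * \<i> * pi * of_int \<lfloor>\<alpha> * k / e j\<rfloor>)"
      unfolding exp_diff[symmetric] e by (simp add: algebra_simps)
    also have "exp (2 * \<i> * pi * of_int \<lfloor>\<alpha> * k / e j\<rfloor>) = (1::complex)"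
      unfolding exp_eq_1 by (auto intro!: exI[of _ "\<lfloor>\<alpha> * k / e j\<rfloor>"])
    also have "exp (2 * \<i> * pi * of_real (real (N j) * k)) = exp (of_nat (N j) * (2 * \<i> * pi * k))"
      by (rule arg_cong[of _ _ exp]) simp
    finally show ?thesis by (simp add: exp_of_nat_mult)
  qed
  moreover have "(\<lambda>j. exp (2 * \<i> * pi * of_real (\<alpha> * k / e j - of_int \<lfloor>\<alpha> * k / e j\<rfloor>))) \<longlonglongrightarrow> exp (2 * \<i> * pi * of_real lk)"
    by (intro tendsto_intros l)
  ultimately show ?thesis by simp
qed

lemma cscale2_cscale2: "cscale2 u (cscale2 v p) = cscale2 (u * v) p"
  by (simp add: cscale2_def mult.assoc)

section \<open>The macroscopic problem for nonzero and for zero quasi-momentum\<close>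

locale bloch_sequence = bloch_setting ah rh a0 a1 r0 r1 a r lam \<phi>
  for ah rh :: "real \<Rightarrow> real" and a0 a1 r0 r1 :: real and a r :: "real \<Rightarrow> real"
    and lam :: "real \<Rightarrow> nat \<Rightarrow> real" and \<phi> :: "real \<Rightarrow> nat \<Rightarrow> real \<Rightarrow> complex" +
  fixes \<alpha> \<mu>0 \<mu>1 :: real and e \<Lambda> :: "nat \<Rightarrow> real" and N :: "nat \<Rightarrow> nat" and W Q :: "nat \<Rightarrow> real \<Rightarrow> complex"
    and U :: "nat \<Rightarrow> real \<Rightarrow> complex \<times> complex"
  assumes \<alpha>: "0 < \<alpha>" and \<mu>0: "0 < \<mu>0" and e_pos: "\<And>j. 0 < e j" and e_lim: "e \<longlonglongrightarrow> 0"
    and N: "\<And>j. \<alpha> / e j = real (N j)"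
    and sol: "\<And>j. int_sol (osc (e j) ah) (osc (e j) rh) (\<Lambda> j) \<alpha> (W j) (Q j)"
    and bc: "\<And>j. W j 0 = 0" "\<And>j. W j \<alpha> = 0"
    and norm1: "\<And>j. integral {0..\<alpha>} (\<lambda>x. (cmod (W j x))\<^sup>2) = 1"
    and \<Lambda>_nonneg: "\<And>j. 0 \<le> \<Lambda> j"
    and \<mu>_lim: "(\<lambda>j. sqrt (\<Lambda> j) - \<mu>0 / e j) \<longlonglongrightarrow> \<mu>1"
    and U: "\<And>j. AE x in lebesgue_on (Omega \<alpha>). U j x =
       (of_real (sqrt (osc (e j) ah x) * inverse (osc (e j) ah x)) * Q j x / (\<i> * of_real (sqrt (\<Lambda> j))),
        of_real (sqrt (osc (e j) rh x)) * W j x)"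
begin

text \<open>The two waves are conjugate to each other, so the mixed Wronskians vanish, and products
  of waves with different phases average out. The matrices of Wronskians and of masses are thus
  diagonal, and each amplitude solves its own equation.\<close>

lemma macroscopic_problem_nonzero:
  assumes k: "k \<in> Ystar" "k \<noteq> 0" and n: "n \<noteq> 0" and \<mu>0n: "\<mu>0 = bloch_mu lam k n"
    and nd: "\<And>\<sigma>. \<sigma> \<in> Ik k \<Longrightarrow> coef_c a \<phi> \<sigma> (nabs n) (nabs n) \<noteq> 0"
    and l: "(\<lambda>j. \<alpha> * k / e j - of_int \<lfloor>\<alpha> * k / e j\<rfloor>) \<longlonglongrightarrow> lk"
    and G: "weakly_tendsto (Omega \<alpha> \<times> Ycell) (\<lambda>j z. \<Sum>\<sigma>\<in>Ik k. two_scale2 \<alpha> (e j) \<sigma> (U j) z) G"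
  shows "\<exists>u :: real \<Rightarrow> int \<Rightarrow> real \<Rightarrow> complex.
           (\<forall>\<sigma>\<in>Ik k. \<forall>j\<in>bloch_M lam \<sigma> n.
              Sob 1 (Omega \<alpha>) (u \<sigma> j) \<and> continuous_on {0..\<alpha>} (u \<sigma> j)) \<and>
           (AE z in lebesgue_on (Omega \<alpha> \<times> Ycell).
              G z = (\<Sum>\<sigma>\<in>Ik k. \<Sum>j\<in>bloch_M lam \<sigma> n.
                       cscale2 (u \<sigma> j (fst z)) (bloch_vec a r lam \<phi> \<sigma> j (snd z)))) \<and>
              (\<forall>\<sigma>\<in>Ik k. bloch_M lam \<sigma> n = {n} \<and>
                 (AE x in lebesgue_on (Omega \<alpha>).
                    coef_c a \<phi> \<sigma> (nabs n) (nabs n) * wderiv (Omega \<alpha>) (u \<sigma> n) x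
                    + of_real (2 * \<mu>0 * \<mu>1) * coef_b r \<phi> \<sigma> (nabs n) (nabs n) * u \<sigma> n x = 0)) \<and>
              (\<forall>x\<in>{0, \<alpha>}.
                 u k n x * \<phi> k (nabs n) 0 * exp (2 * \<i> * pi * lk * x / \<alpha>)
                 + u (-k) n x * \<phi> (-k) (nabs n) 0 * exp (- 2 * \<i> * pi * lk * x / \<alpha>) = 0)"
proof -
  let ?m = "nabs n"
  have m1: "?m \<ge> 1" using n by simp
  have Ik: "Ik k = {k, -k}" and kk: "k \<noteq> - k" using k by (auto simp: Ik_def)
  have Y: "s \<in> Ystar" if "s \<in> Ik k" for s using that k by (auto simp: Ik)
  have sym: "lam (-k) i = lam k i" "\<phi> (-k) i y = cnj (\<phi> k i y)" if "i \<ge> 1" for i y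
    using family k that unfolding bloch_family_def by blast+
  have muS: "bloch_mu lam s n = \<mu>0" if "s \<in> Ik k" for s
    using that \<mu>0n sym(1)[OF m1] by (auto simp: Ik bloch_mu_def)
  have lamS: "lam s ?m = \<mu>0\<^sup>2" if "s \<in> Ik k" for s
    using bloch_mu_pos(2)[OF Y[OF that] n] \<mu>0 muS[OF that] by simp
  have fluxm: "flux (-k) i y = cnj (flux k i y)" if "i \<ge> 1" for i y
    by (rule flux_cnj[OF sym(2)[OF that] k(1) that])
  define c where "c s = wr s ?m ?m" for s
  have cc: "coef_c a \<phi> s ?m ?m = c s" if "s \<in> Ik k" for s
    unfolding c_def by (rule coef_c_eq_wr[OF Y[OF that] m1 m1 refl])
  have c0: "c s \<noteq> 0" if "s \<in> Ik k" for s using nd[OF that] cc[OF that] by simp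
  have ck: "c k = flux k ?m y * cnj (\<phi> k ?m y) - \<phi> k ?m y * cnj (flux k ?m y)" for y
    unfolding c_def by (rule wr_const[OF k(1) m1 m1 refl, symmetric])
  have cm: "c (-k) = - c k"
    unfolding c_def wr_def sym(2)[OF m1] fluxm[OF m1] by simp
  define D where "D s l = (if s = l then 1 / c s else 0)" for s l :: real
  have rec: "u = (\<Sum>i\<in>Ik k. \<phi> i ?m y * (\<Sum>l\<in>Ik k. D i l * (v * cnj (\<phi> l ?m y) - u * cnj (flux l ?m y))))"
    "v = (\<Sum>i\<in>Ik k. flux i ?m y * (\<Sum>l\<in>Ik k. D i l * (v * cnj (\<phi> l ?m y) - u * cnj (flux l ?m y))))" for y u v
  proof -
    have "c k \<noteq> 0" using c0 by (simp add: Ik)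
    note t = two_wave_reconstruction[where u = u and v = v, OF ck[of y] this]
    show "u = (\<Sum>i\<in>Ik k. \<phi> i ?m y * (\<Sum>l\<in>Ik k. D i l * (v * cnj (\<phi> l ?m y) - u * cnj (flux l ?m y))))"
      using t(1) kk unfolding Ik by (simp add: D_def cm sym(2)[OF m1] fluxm[OF m1])
    show "v = (\<Sum>i\<in>Ik k. flux i ?m y * (\<Sum>l\<in>Ik k. D i l * (v * cnj (\<phi> l ?m y) - u * cnj (flux l ?m y))))"
      using t(2) kk unfolding Ik by (simp add: D_def cm sym(2)[OF m1] fluxm[OF m1])
  qed
  interpret H: homogenization ah rh a0 a1 r0 r1 \<alpha> "Ik k" "\<lambda>s. s" "\<lambda>s. \<phi> s ?m" "\<lambda>s. flux s ?m" D \<mu>0 \<mu>1 e \<Lambda> W Q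
  proof
    show "finite (Ik k)" by (simp add: Ik)
    show "int_sol ah rh (\<mu>0\<^sup>2) d (\<phi> i ?m) (flux i ?m)" if "i \<in> Ik k" for i d
      using flux(1)[OF Y[OF that] m1, of d] lamS[OF that] by simp
    show "\<phi> i ?m (y + 1) = exp (2 * \<i> * pi * i) * \<phi> i ?m y" "flux i ?m (y + 1) = exp (2 * \<i> * pi * i) * flux i ?m y"
      if "i \<in> Ik k" for i y by (rule flux(2,3)[OF Y[OF that] m1])+
  qed (rule \<alpha> \<mu>0 rec e_pos e_lim sol bc norm1 \<Lambda>_nonneg \<mu>_lim)+
  obtain kk' \<A> where K: "strict_mono (kk' :: nat \<Rightarrow> nat)" "\<And>i. i \<in> Ik k \<Longrightarrow> continuous_on UNIV (\<A> i)"
    "\<And>i. i \<in> Ik k \<Longrightarrow> uniform_limit {0..\<alpha>} (\<lambda>n. H.A i (kk' n)) (\<A> i) sequentially"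
    "\<And>i x. i \<in> Ik k \<Longrightarrow> 0 \<le> x \<Longrightarrow> x \<le> \<alpha> \<Longrightarrow>
      \<A> i x = \<A> i 0 - of_real (2 * \<mu>0 * \<mu>1) * (\<Sum>l\<in>Ik k. D i l * (\<Sum>h\<in>Ik k. H.bloch_mass l h * integral {0..x} (\<A> h)))"
    using H.homogenized_limit by blast
  have mass: "H.bloch_mass s h = (if h = s then coef_b r \<phi> s ?m ?m else 0)" if "s \<in> Ik k" "h \<in> Ik k" for s h
    unfolding H.bloch_mass_def exp_phase_eq_1_iff[OF Y[OF that(2)] Y[OF that(1)]]
    using coef_b_eq[OF Y[OF that(1)] m1 m1] by auto
  define u :: "real \<Rightarrow> int \<Rightarrow> real \<Rightarrow> complex" where "u s j x = of_real (sqrt 2) * \<A> s x" for s j x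
  have uc: "continuous_on UNIV (u s j)" if "s \<in> Ik k" for s j
    unfolding u_def[abs_def] by (intro continuous_intros K that)
  \<comment> \<open>The macroscopic equation solved for the derivative; \<open>c s\<close> is the
    coefficient in front of it.\<close>
  define g where "g s x = - (of_real (2 * \<mu>0 * \<mu>1) * coef_b r \<phi> s ?m ?m / c s) * u s n x" for s x
  have ueq: "u s j x = u s j 0 + integral {0..x} (g s)" if s: "s \<in> Ik k" and x: "0 \<le> x" "x \<le> \<alpha>" for s j x
  proof -
    have "(\<Sum>l\<in>Ik k. D s l * (\<Sum>h\<in>Ik k. H.bloch_mass l h * integral {0..x} (\<A> h))) = 1 / c s * (coef_b r \<phi> s ?m ?m * integral {0..x} (\<A> s))"
    proof -
      have "(\<Sum>h\<in>Ik k. H.bloch_mass l h * integral {0..x} (\<A> h)) = coef_b r \<phi> l ?m ?m * integral {0..x} (\<A> l)" if l: "l \<in> Ik k" for l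
      proof -
        have "(\<Sum>h\<in>Ik k. H.bloch_mass l h * integral {0..x} (\<A> h)) = (\<Sum>h\<in>Ik k. if h = l then coef_b r \<phi> l ?m ?m * integral {0..x} (\<A> l) else 0)"
          by (rule sum.cong) (auto simp: mass l)
        then show ?thesis using l H.fin by simp
      qed
      then have "(\<Sum>l\<in>Ik k. D s l * (\<Sum>h\<in>Ik k. H.bloch_mass l h * integral {0..x} (\<A> h))) = (\<Sum>l\<in>Ik k. if l = s then 1 / c s * (coef_b r \<phi> s ?m ?m * integral {0..x} (\<A> s)) else 0)"
        by (intro sum.cong) (auto simp: D_def)
      then show ?thesis using s H.fin by simp
    qed
    then have A: "\<A> s x = \<A> s 0 - of_real (2 * \<mu>0 * \<mu>1) * (1 / c s * (coef_b r \<phi> s ?m ?m * integral {0..x} (\<A> s)))"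
      using K(4)[OF s x] by simp
    have I: "integral {0..x} (g s) = - (of_real (2 * \<mu>0 * \<mu>1) * coef_b r \<phi> s ?m ?m / c s) * (of_real (sqrt 2) * integral {0..x} (\<A> s))"
      unfolding g_def u_def integral_mult_right ..
    show ?thesis unfolding u_def I by (subst A) (simp add: right_diff_distrib divide_inverse mult_ac del: of_real_mult)
  qed
  have gc: "continuous_on UNIV (g s)" if "s \<in> Ik k" for s
    unfolding g_def[abs_def] by (intro continuous_intros uc that)
  have sob1: "Sob 1 (Omega \<alpha>) (u s j)" if "s \<in> Ik k" for s j
    by (rule Sob1_continuous_primitive(1)[OF uc[OF that] gc[OF that] \<alpha> ueq[OF that]])
  have sob2: "AE x in lebesgue_on (Omega \<alpha>). wderiv (Omega \<alpha>) (u s j) x = g s x" if "s \<in> Ik k" for s j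
    by (rule Sob1_continuous_primitive(2)[OF uc[OF that] gc[OF that] \<alpha> ueq[OF that]])
  \<comment> \<open>A further eigenfunction with the same eigenvalue and quasi-momentum would be a
    multiple of the first one, against the linear independence of the family.\<close>
  have BM: "bloch_M lam s n = {n}" if s: "s \<in> Ik k" for s
  proof
    show "{n} \<subseteq> bloch_M lam s n" using n by (auto simp: bloch_M_def)
    show "bloch_M lam s n \<subseteq> {n}"
    proof
      fix i assume "i \<in> bloch_M lam s n"
      then have i: "i \<noteq> 0" "bloch_mu lam s i = \<mu>0" using muS[OF s] by (auto simp: bloch_M_def)
      have ip: "0 < i" "lam s (nabs i) = \<mu>0\<^sup>2" "nabs i \<ge> 1" using bloch_mu_pos[OF Y[OF s] i(1)] i(2) \<mu>0 by auto
      have np: "0 < n" using bloch_mu_pos(1)[OF Y[OF s] n] muS[OF s] \<mu>0 by simp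
      show "i \<in> {n}"
      proof (rule ccontr)
        assume "i \<notin> {n}"
        then have ne: "nabs i \<noteq> ?m" using ip(1) np by auto
        have ms: "- s \<in> Ik k" "s \<noteq> - s" using s k(2) by (auto simp: Ik)
        \<comment> \<open>In the reconstruction formula the coefficient of the wave with opposite
          quasi-momentum is a Wronskian of waves with different phases, hence 0.\<close>
        have lin: "\<phi> s (nabs i) y = (wr s ?m (nabs i) / c s) * \<phi> s ?m y" for y
        proof -
          have w1: "flux s (nabs i) y * cnj (\<phi> s ?m y) - \<phi> s (nabs i) y * cnj (flux s ?m y) = wr s ?m (nabs i)"
            by (rule wr_const[OF Y[OF s] m1 ip(3)]) (simp add: ip lamS[OF s])
          have w2: "flux s (nabs i) y * cnj (\<phi> (-s) ?m y) - \<phi> s (nabs i) y * cnj (flux (-s) ?m y) = 0"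
          proof (rule wronskian_quasi_periodic(2)[where W = "\<phi> s (nabs i)" and Q = "flux s (nabs i)" and V = "\<phi> (-s) ?m" and P = "flux (-s) ?m"])
            show "int_sol ah rh (\<mu>0\<^sup>2) d (\<phi> s (nabs i)) (flux s (nabs i))" for d using flux(1)[OF Y[OF s] ip(3), of d] ip by simp
            show "int_sol ah rh (\<mu>0\<^sup>2) d (\<phi> (-s) ?m) (flux (-s) ?m)" for d using H.bloch[OF ms(1)] .
            show "exp (2 * \<i> * pi * s) * cnj (exp (2 * \<i> * pi * (- s))) \<noteq> 1"
              using exp_phase_eq_1_iff[OF Y[OF s] Y[OF ms(1)]] ms(2) by simp
          qed (rule flux(2,3)[OF Y[OF s] ip(3)] flux(2,3)[OF Y[OF ms(1)] m1] norm_exp_i_real)+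
          have I: "Ik k = {s, -s}" using s by (auto simp: Ik)
          have "\<phi> s (nabs i) y = \<phi> s ?m y * (1 / c s * wr s ?m (nabs i))"
            using rec(1)[of "\<phi> s (nabs i) y" y "flux s (nabs i) y"] ms(2) w1 w2 unfolding I by (simp add: D_def)
          then show ?thesis by simp
        qed
        let ?J = "{j. j \<ge> 1 \<and> lam s j = \<mu>0\<^sup>2}"
        define d where "d j = (if j = nabs i then 1 else if j = ?m then - (wr s ?m (nabs i) / c s) else 0)" for j
        have basis: "finite ?J" "(\<forall>y. (\<Sum>j\<in>?J. d j * \<phi> s j y) = 0) \<longrightarrow> (\<forall>j\<in>?J. d j = 0)"
          using eigen(3)[OF Y[OF s], of "\<mu>0\<^sup>2"] unfolding solution_basis_def by blast+
        have mem: "nabs i \<in> ?J" "?m \<in> ?J" using ip m1 lamS[OF s] by auto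
        have "(\<Sum>j\<in>?J. d j * \<phi> s j y) = 0" for y
        proof -
          have "(\<Sum>j\<in>?J. d j * \<phi> s j y) = (\<Sum>j\<in>{nabs i, ?m}. d j * \<phi> s j y)"
            by (rule sum.mono_neutral_right[OF basis(1)]) (use mem in \<open>auto simp: d_def\<close>)
          also have "\<dots> = 0" using ne lin[of y] by (simp add: d_def)
          finally show ?thesis .
        qed
        then have "d (nabs i) = 0" using basis(2) mem(1) by blast
        then show False by (simp add: d_def)
      qed
    qed
  qed
  have AEG: "AE z in lebesgue_on (Omega \<alpha> \<times> Ycell).
              G z = (\<Sum>\<sigma>\<in>Ik k. \<Sum>j\<in>bloch_M lam \<sigma> n.
                       cscale2 (u \<sigma> j (fst z)) (bloch_vec a r lam \<phi> \<sigma> j (snd z)))"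
  proof -
    have U': "AE x in lebesgue_on (Omega \<alpha>). U j x = (H.U1 j x, H.U2 j x)" for j
      using U[of j] by (simp add: H.U1_def H.U2_def)
    have id: "AE z in lebesgue_on (Omega \<alpha> \<times> Ycell). G z =
    (\<Sum>\<tau>\<in>Ik k. \<Sum>i\<in>Ik k. if exp (2 * \<i> * pi * i) * exp (- 2 * \<i> * pi * \<tau>) = 1
       then cscale2 (\<A> i (fst z)) (of_real (sqrt (ah (snd z)) * inverse (ah (snd z))) * flux i ?m (snd z) / (\<i> * \<mu>0), of_real (sqrt (rh (snd z))) * \<phi> i ?m (snd z))
       else 0)"
      by (rule H.weak_limit_identification[OF K(1) K(2) K(3) N H.fin U' G])
    have "\<forall>s\<in>Ik k. \<exists>M. negligible M \<and> (\<forall>y\<in>Ycell. y \<notin> M \<longrightarrow> cscale2 (of_real (sqrt 2)) (bloch_vec a r lam \<phi> s n y) =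
       (of_real (sqrt (ah y) * inverse (ah y)) * flux s ?m y / (\<i> * \<mu>0), of_real (sqrt (rh y)) * \<phi> s ?m y))"
      using bloch_vec_eq[OF Y n] muS \<mu>0 by simp
    then obtain M where M: "\<And>s. s \<in> Ik k \<Longrightarrow> negligible (M s)"
      "\<And>s y. s \<in> Ik k \<Longrightarrow> y \<in> Ycell \<Longrightarrow> y \<notin> M s \<Longrightarrow> cscale2 (of_real (sqrt 2)) (bloch_vec a r lam \<phi> s n y) =
       (of_real (sqrt (ah y) * inverse (ah y)) * flux s ?m y / (\<i> * \<mu>0), of_real (sqrt (rh y)) * \<phi> s ?m y)"
      by metis
    have "negligible ((UNIV :: real set) \<times> (\<Union>s\<in>Ik k. M s))"
      by (intro negligible_strips(1) negligible_Union) (use H.fin M(1) in auto)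
    then have "AE z in lebesgue_on (Omega \<alpha> \<times> Ycell). snd z \<in> Ycell \<and> snd z \<notin> (\<Union>s\<in>Ik k. M s)"
    proof (rule AE_lebesgue_on_negligible)
      have "Omega \<alpha> \<times> Ycell \<in> sets borel" by (simp add: open_Times borel_open)
      then show "Omega \<alpha> \<times> Ycell \<in> sets lebesgue" by auto
    qed auto
    with id show ?thesis
    proof eventually_elim
      case (elim z)
      have "(\<Sum>i\<in>Ik k. if exp (2 * \<i> * pi * i) * exp (- 2 * \<i> * pi * \<tau>) = 1
       then cscale2 (\<A> i (fst z)) (of_real (sqrt (ah (snd z)) * inverse (ah (snd z))) * flux i ?m (snd z) / (\<i> * \<mu>0), of_real (sqrt (rh (snd z))) * \<phi> i ?m (snd z))
       else 0) = (\<Sum>j\<in>bloch_M lam \<tau> n. cscale2 (u \<tau> j (fst z)) (bloch_vec a r lam \<phi> \<tau> j (snd z)))" if \<tau>: "\<tau> \<in> Ik k" for \<tau>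
      proof -
        have "(\<Sum>i\<in>Ik k. if exp (2 * \<i> * pi * i) * exp (- 2 * \<i> * pi * \<tau>) = 1
       then cscale2 (\<A> i (fst z)) (of_real (sqrt (ah (snd z)) * inverse (ah (snd z))) * flux i ?m (snd z) / (\<i> * \<mu>0), of_real (sqrt (rh (snd z))) * \<phi> i ?m (snd z))
       else 0) = (\<Sum>i\<in>Ik k. if i = \<tau> then cscale2 (\<A> \<tau> (fst z)) (cscale2 (of_real (sqrt 2)) (bloch_vec a r lam \<phi> \<tau> n (snd z))) else 0)"
          unfolding exp_minus_eq_cnj
          by (rule sum.cong) (use exp_phase_eq_1_iff[OF Y Y[OF \<tau>]] M(2)[OF \<tau>, of "snd z"] elim(2) \<tau> in auto)
        also have "\<dots> = cscale2 (u \<tau> n (fst z)) (bloch_vec a r lam \<phi> \<tau> n (snd z))"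
          using \<tau> H.fin by (simp add: cscale2_cscale2 u_def mult.commute)
        finally show ?thesis using BM[OF \<tau>] by simp
      qed
      then show ?case unfolding elim(1) by (rule sum.cong[OF refl])
    qed
  qed
  have BC: "u k n x * \<phi> k ?m 0 * exp (2 * \<i> * pi * lk * x / \<alpha>) + u (-k) n x * \<phi> (-k) ?m 0 * exp (- 2 * \<i> * pi * lk * x / \<alpha>) = 0"
    if "x \<in> {0, \<alpha>}" for x
  proof -
    \<comment> \<open>For -k the limit of the powers is obtained by conjugation from that for
      k.\<close>
    define \<rho> where "\<rho> s = (if s = k then exp (2 * \<i> * pi * lk) else exp (- 2 * \<i> * pi * lk))" for s
    have pk: "(\<lambda>j. exp (2 * \<i> * pi * k) ^ N j) \<longlonglongrightarrow> exp (2 * \<i> * pi * lk)" by (rule phase_power_limit[OF N l])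
    have \<rho>lim: "(\<lambda>j. exp (2 * \<i> * pi * s) ^ N j) \<longlonglongrightarrow> \<rho> s" if "s \<in> Ik k" for s
    proof (cases "s = k")
      case True then show ?thesis using pk by (simp add: \<rho>_def)
    next
      case False
      then have "s = -k" using that by (auto simp: Ik)
      have "(\<lambda>j. cnj (exp (2 * \<i> * pi * k) ^ N j)) \<longlonglongrightarrow> cnj (exp (2 * \<i> * pi * lk))" by (intro tendsto_cnj pk)
      moreover have "cnj (exp (2 * \<i> * pi * k) ^ N j) = exp (2 * \<i> * pi * s) ^ N j" for j
        unfolding complex_cnj_power exp_minus_eq_cnj[symmetric] \<open>s = -k\<close> by simp
      moreover have "cnj (exp (2 * \<i> * pi * lk)) = \<rho> s" using False unfolding \<rho>_def exp_minus_eq_cnj[symmetric] by simp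
      ultimately show ?thesis by simp
    qed
    have b\<alpha>: "(\<Sum>i\<in>Ik k. \<rho> i * \<phi> i ?m 0 * \<A> i \<alpha>) = 0"
      by (rule H.boundary_limit(2)[OF K(1,3) \<rho>lim N])
    have b0: "(\<Sum>i\<in>Ik k. \<phi> i ?m 0 * \<A> i 0) = 0" by (rule H.boundary_limit(1)[OF K(1,3)])
    show ?thesis
    proof (cases "x = 0")
      case True
      have "u k n 0 * \<phi> k ?m 0 + u (-k) n 0 * \<phi> (-k) ?m 0 = of_real (sqrt 2) * (\<Sum>i\<in>Ik k. \<phi> i ?m 0 * \<A> i 0)"
        using kk by (simp add: Ik u_def algebra_simps)
      then show ?thesis using True b0 by simp
    next
      case False
      then have x: "x = \<alpha>" using that by simp
      have "u k n \<alpha> * \<phi> k ?m 0 * \<rho> k + u (-k) n \<alpha> * \<phi> (-k) ?m 0 * \<rho> (-k) = of_real (sqrt 2) * (\<Sum>i\<in>Ik k. \<rho> i * \<phi> i ?m 0 * \<A> i \<alpha>)"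
        using kk by (simp add: Ik u_def algebra_simps)
      then have "u k n \<alpha> * \<phi> k ?m 0 * \<rho> k + u (-k) n \<alpha> * \<phi> (-k) ?m 0 * \<rho> (-k) = 0" unfolding b\<alpha> by simp
      moreover have "\<rho> k = exp (2 * \<i> * pi * lk * x / \<alpha>)" "\<rho> (-k) = exp (- 2 * \<i> * pi * lk * x / \<alpha>)"
        using kk \<alpha> unfolding x by (auto simp: \<rho>_def)
      ultimately show ?thesis using x by simp
    qed
  qed
  have ODE: "AE x in lebesgue_on (Omega \<alpha>).
                    coef_c a \<phi> s ?m ?m * wderiv (Omega \<alpha>) (u s n) x
                    + of_real (2 * \<mu>0 * \<mu>1) * coef_b r \<phi> s ?m ?m * u s n x = 0" if s: "s \<in> Ik k" for s
    using sob2[OF s, of n] by eventually_elim (use c0[OF s] in \<open>simp add: cc[OF s] g_def\<close>)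
  show ?thesis
  proof (intro exI[of _ u] conjI ballI)
    fix s j assume s: "s \<in> Ik k"
    show "Sob 1 (Omega \<alpha>) (u s j)" by (rule sob1[OF s])
    show "continuous_on {0..\<alpha>} (u s j)" by (rule continuous_on_subset[OF uc[OF s]]) simp
  qed (use AEG BM ODE BC in blast)+
qed

text \<open>The Wronskian of a real wave with itself is 0, so the equation with index p contains the
  derivative of the other amplitude only, while the masses may couple both.\<close>

lemma macroscopic_problem_zero:
  assumes n: "n \<noteq> 0" and \<mu>0n: "\<mu>0 = bloch_mu lam 0 n"
    and nd: "nondegenerate a r lam \<phi> 0 n m"
    and G: "weakly_tendsto (Omega \<alpha> \<times> Ycell) (\<lambda>j z. \<Sum>\<sigma>\<in>Ik 0. two_scale2 \<alpha> (e j) \<sigma> (U j) z) G"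
  shows "\<exists>u :: real \<Rightarrow> int \<Rightarrow> real \<Rightarrow> complex.
           (\<forall>\<sigma>\<in>Ik 0. \<forall>j\<in>bloch_M lam \<sigma> n.
              Sob 1 (Omega \<alpha>) (u \<sigma> j) \<and> continuous_on {0..\<alpha>} (u \<sigma> j)) \<and>
           (AE z in lebesgue_on (Omega \<alpha> \<times> Ycell).
              G z = (\<Sum>\<sigma>\<in>Ik 0. \<Sum>j\<in>bloch_M lam \<sigma> n.
                       cscale2 (u \<sigma> j (fst z)) (bloch_vec a r lam \<phi> \<sigma> j (snd z)))) \<and>
              bloch_M lam 0 n = {n, m} \<and>
              (\<forall>p\<in>{n, m}. AE x in lebesgue_on (Omega \<alpha>).
                 (\<Sum>q\<in>{n, m}.
                    coef_c a \<phi> 0 (nabs p) (nabs q) * wderiv (Omega \<alpha>) (u 0 q) x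
                    + of_real (2 * \<mu>0 * \<mu>1) * coef_b r \<phi> 0 (nabs p) (nabs q) * u 0 q x) = 0) \<and>
              (\<forall>x\<in>{0, \<alpha>}. (\<Sum>q\<in>{n, m}. u 0 q x * \<phi> 0 (nabs q) 0) = 0)"
proof -
  have Y: "0 \<in> Ystar" by simp
  have Ik: "Ik 0 = {0}" by (simp add: Ik_def)
  have m: "m \<noteq> 0" "nabs m \<noteq> nabs n" "bloch_mu lam 0 m = \<mu>0"
    and basis: "solution_basis a r 0 (lam 0 (nabs n)) {nabs n, nabs m} (\<phi> 0)"
    and re: "\<And>y. \<phi> 0 (nabs n) y \<in> \<real>" "\<And>y. \<phi> 0 (nabs m) y \<in> \<real>"
    and c0: "coef_c a \<phi> 0 (nabs n) (nabs m) \<noteq> 0"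
    using nd \<mu>0n unfolding nondegenerate_def by auto
  have nm: "n \<noteq> m" using m by auto
  let ?I = "{n, m}"
  have i0: "i \<noteq> 0" "bloch_mu lam 0 i = \<mu>0" if "i \<in> ?I" for i using that n m \<mu>0n by auto
  have ip: "0 < i" "lam 0 (nabs i) = \<mu>0\<^sup>2" "nabs i \<ge> 1" if "i \<in> ?I" for i
    using bloch_mu_pos[OF Y i0(1)[OF that]] i0(2)[OF that] \<mu>0 by simp_all
  have \<phi>re: "cnj (\<phi> 0 (nabs i) y) = \<phi> 0 (nabs i) y" if "i \<in> ?I" for i y
    using re that by (auto simp: Reals_cnj_iff)
  have fre: "cnj (flux 0 (nabs i) y) = flux 0 (nabs i) y" if "i \<in> ?I" for i y
    using flux_cnj[OF \<phi>re[OF that, symmetric] Y ip(3)[OF that], of y] by simp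
  have lameq: "lam 0 (nabs i) = lam 0 (nabs l)" if "i \<in> ?I" "l \<in> ?I" for i l using ip(2) that by simp
  have cw: "coef_c a \<phi> 0 (nabs i) (nabs l) = flux 0 (nabs l) y * \<phi> 0 (nabs i) y - \<phi> 0 (nabs l) y * flux 0 (nabs i) y"
    if "i \<in> ?I" "l \<in> ?I" for i l y
    using coef_c_eq_wr[OF Y ip(3)[OF that(1)] ip(3)[OF that(2)] lameq[OF that]]
      wr_const[OF Y ip(3)[OF that(1)] ip(3)[OF that(2)] lameq[OF that], of y] \<phi>re[OF that(1)] fre[OF that(1)] by simp
  define c where "c = coef_c a \<phi> 0 (nabs m) (nabs n)"
  have cy: "c = flux 0 (nabs n) y * \<phi> 0 (nabs m) y - \<phi> 0 (nabs n) y * flux 0 (nabs m) y" for y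
    unfolding c_def by (rule cw) auto
  have cnm: "coef_c a \<phi> 0 (nabs n) (nabs m) = - c" unfolding cy[of 0] by (subst cw[of n m 0]) auto
  have cdiag: "coef_c a \<phi> 0 (nabs i) (nabs i) = 0" if "i \<in> ?I" for i using cw[OF that that, of 0] by simp
  have cne: "c \<noteq> 0" using c0 cnm by simp
  \<comment> \<open>The inverse of an antisymmetric 2 by 2 matrix with zero diagonal.\<close>
  define D where "D i l = (if i = n \<and> l = m then 1 / c else if i = m \<and> l = n then 1 / (- c) else 0)" for i l :: int
  have rec: "u = (\<Sum>i\<in>?I. \<phi> 0 (nabs i) y * (\<Sum>l\<in>?I. D i l * (v * cnj (\<phi> 0 (nabs l) y) - u * cnj (flux 0 (nabs l) y))))"
    "v = (\<Sum>i\<in>?I. flux 0 (nabs i) y * (\<Sum>l\<in>?I. D i l * (v * cnj (\<phi> 0 (nabs l) y) - u * cnj (flux 0 (nabs l) y))))" for y u v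
  proof -
    note t = two_wave_reconstruction[where u = u and v = v, OF cy[of y] cne]
    show "u = (\<Sum>i\<in>?I. \<phi> 0 (nabs i) y * (\<Sum>l\<in>?I. D i l * (v * cnj (\<phi> 0 (nabs l) y) - u * cnj (flux 0 (nabs l) y))))"
      using t(1) nm by (simp add: D_def \<phi>re fre)
    show "v = (\<Sum>i\<in>?I. flux 0 (nabs i) y * (\<Sum>l\<in>?I. D i l * (v * cnj (\<phi> 0 (nabs l) y) - u * cnj (flux 0 (nabs l) y))))"
      using t(2) nm by (simp add: D_def \<phi>re fre)
  qed
  interpret H: homogenization ah rh a0 a1 r0 r1 \<alpha> ?I "\<lambda>_. 0" "\<lambda>i. \<phi> 0 (nabs i)" "\<lambda>i. flux 0 (nabs i)" D \<mu>0 \<mu>1 e \<Lambda> W Q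
  proof
    show "finite ?I" by simp
    show "int_sol ah rh (\<mu>0\<^sup>2) d (\<phi> 0 (nabs i)) (flux 0 (nabs i))" if "i \<in> ?I" for i d
      using flux(1)[OF Y ip(3)[OF that], of d] ip(2)[OF that] by simp
    show "\<phi> 0 (nabs i) (y + 1) = exp (2 * \<i> * pi * of_real 0) * \<phi> 0 (nabs i) y"
      "flux 0 (nabs i) (y + 1) = exp (2 * \<i> * pi * of_real 0) * flux 0 (nabs i) y"
      if "i \<in> ?I" for i y by (rule flux(2,3)[OF Y ip(3)[OF that]])+
  qed (rule \<alpha> \<mu>0 rec e_pos e_lim sol bc norm1 \<Lambda>_nonneg \<mu>_lim)+
  obtain kk \<A> where K: "strict_mono (kk :: nat \<Rightarrow> nat)" "\<And>i. i \<in> ?I \<Longrightarrow> continuous_on UNIV (\<A> i)"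
    "\<And>i. i \<in> ?I \<Longrightarrow> uniform_limit {0..\<alpha>} (\<lambda>n. H.A i (kk n)) (\<A> i) sequentially"
    "\<And>i x. i \<in> ?I \<Longrightarrow> 0 \<le> x \<Longrightarrow> x \<le> \<alpha> \<Longrightarrow>
      \<A> i x = \<A> i 0 - of_real (2 * \<mu>0 * \<mu>1) * (\<Sum>l\<in>?I. D i l * (\<Sum>h\<in>?I. H.bloch_mass l h * integral {0..x} (\<A> h)))"
    using H.homogenized_limit by blast
  have mass: "H.bloch_mass l h = coef_b r \<phi> 0 (nabs l) (nabs h)" if "l \<in> ?I" "h \<in> ?I" for l h
    unfolding H.bloch_mass_def using coef_b_eq[OF Y ip(3)[OF that(1)] ip(3)[OF that(2)]] by simp
  define u :: "real \<Rightarrow> int \<Rightarrow> real \<Rightarrow> complex" where "u s j x = of_real (sqrt 2) * \<A> j x" for s j x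
  have uc: "continuous_on UNIV (u s j)" if "j \<in> ?I" for s j
    unfolding u_def[abs_def] by (intro continuous_intros K that)
  define b where "b l x = (\<Sum>h\<in>?I. coef_b r \<phi> 0 (nabs l) (nabs h) * u 0 h x)" for l :: int and x :: real
  have bc': "continuous_on UNIV (b l)" for l unfolding b_def[abs_def] by (intro continuous_intros uc)
  define g where "g i x = - (of_real (2 * \<mu>0 * \<mu>1)) * (\<Sum>l\<in>?I. D i l * b l x)" for i :: int and x :: real
  have Dbc: "continuous_on UNIV (\<lambda>x. D i l * b l x)" for i l by (rule continuous_on_mult_left[OF bc'])
  have gc: "continuous_on UNIV (g i)" for i unfolding g_def[abs_def]
  proof (rule continuous_on_mult_left, rule continuous_on_sum)
    show "continuous_on UNIV (\<lambda>x. D i l * b l x)" for l by (rule Dbc)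
  qed
  have ueq: "u 0 i x = u 0 i 0 + integral {0..x} (g i)" if i: "i \<in> ?I" and x: "0 \<le> x" "x \<le> \<alpha>" for i x
  proof -
    have lu: "loc_bounded (u 0 h)" if "h \<in> ?I" for h by (intro loc_bounded_continuous uc that)
    have "integral {0..x} (b l) = (\<Sum>h\<in>?I. coef_b r \<phi> 0 (nabs l) (nabs h) * integral {0..x} (u 0 h))" for l
    proof -
      have "integral {0..x} (b l) = (\<Sum>h\<in>?I. integral {0..x} (\<lambda>t. coef_b r \<phi> 0 (nabs l) (nabs h) * u 0 h t))"
        unfolding b_def[abs_def] by (rule integral_sum) (auto intro!: loc_bounded_integrable loc_bounded_mult loc_bounded_const lu)
      then show ?thesis unfolding integral_mult_right .
    qed
    moreover have "integral {0..x} (u 0 h) = of_real (sqrt 2) * integral {0..x} (\<A> h)" for h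
      unfolding u_def[abs_def] by (rule integral_mult_right)
    ultimately have bI: "integral {0..x} (b l) = of_real (sqrt 2) * (\<Sum>h\<in>?I. coef_b r \<phi> 0 (nabs l) (nabs h) * integral {0..x} (\<A> h))" for l
      by (simp only: sum_distrib_left mult.left_commute)
    have "integral {0..x} (\<lambda>t. \<Sum>l\<in>?I. D i l * b l t) = (\<Sum>l\<in>?I. integral {0..x} (\<lambda>t. D i l * b l t))"
      by (rule integral_sum) (auto intro!: loc_bounded_integrable loc_bounded_continuous Dbc)
    also have "\<dots> = of_real (sqrt 2) * (\<Sum>l\<in>?I. D i l * (\<Sum>h\<in>?I. coef_b r \<phi> 0 (nabs l) (nabs h) * integral {0..x} (\<A> h)))"
      unfolding integral_mult_right bI by (simp only: sum_distrib_left[of "of_real (sqrt 2)" "\<lambda>l. D i l * (\<Sum>h\<in>?I. coef_b r \<phi> 0 (nabs l) (nabs h) * integral {0..x} (\<A> h))"] mult.left_commute)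
    also have "(\<Sum>l\<in>?I. D i l * (\<Sum>h\<in>?I. coef_b r \<phi> 0 (nabs l) (nabs h) * integral {0..x} (\<A> h)))
      = (\<Sum>l\<in>?I. D i l * (\<Sum>h\<in>?I. H.bloch_mass l h * integral {0..x} (\<A> h)))" (is "_ = ?X")
      by (intro sum.cong refl arg_cong2[where f = "(*)"] mass[symmetric])
    finally have gI: "integral {0..x} (g i) = - (of_real (2 * \<mu>0 * \<mu>1)) * (of_real (sqrt 2) * ?X)"
      unfolding g_def[abs_def] integral_mult_right by simp
    show ?thesis unfolding gI unfolding u_def by (subst K(4)[OF i x]) (simp only: right_diff_distrib mult_minus_left mult_minus_right mult.left_commute add_uminus_conv_diff)
  qed
  have sob1: "Sob 1 (Omega \<alpha>) (u 0 i)" if "i \<in> ?I" for i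
    by (rule Sob1_continuous_primitive(1)[OF uc[OF that] gc \<alpha> ueq[OF that]])
  have sob2: "AE x in lebesgue_on (Omega \<alpha>). wderiv (Omega \<alpha>) (u 0 i) x = g i x" if "i \<in> ?I" for i
    by (rule Sob1_continuous_primitive(2)[OF uc[OF that] gc \<alpha> ueq[OF that]])
  \<comment> \<open>The two given waves span the eigenspace, so a third eigenfunction of the family
    would depend linearly on them.\<close>
  have BM: "bloch_M lam 0 n = ?I"
  proof
    show "?I \<subseteq> bloch_M lam 0 n" using n m \<mu>0n by (auto simp: bloch_M_def)
    show "bloch_M lam 0 n \<subseteq> ?I"
    proof
      fix i assume "i \<in> bloch_M lam 0 n"
      then have i: "i \<noteq> 0" "bloch_mu lam 0 i = \<mu>0" using \<mu>0n by (auto simp: bloch_M_def)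
      have iip: "0 < i" "lam 0 (nabs i) = \<mu>0\<^sup>2" "nabs i \<ge> 1" using bloch_mu_pos[OF Y i(1)] i(2) \<mu>0 by auto
      show "i \<in> ?I"
      proof (rule ccontr)
        assume "i \<notin> ?I"
        then have ne: "nabs i \<noteq> nabs n" "nabs i \<noteq> nabs m" using iip(1) ip(1)[of n] ip(1)[of m] by auto
        let ?J = "{j. j \<ge> 1 \<and> lam 0 j = \<mu>0\<^sup>2}"
        have "bloch_solution a r 0 (lam 0 (nabs n)) (\<phi> 0 (nabs i))"
          using eigen(2)[OF Y iip(3)] iip(2) ip(2)[of n] by simp
        then obtain d where d: "\<And>y. \<phi> 0 (nabs i) y = (\<Sum>j\<in>{nabs n, nabs m}. d j * \<phi> 0 j y)"
          using basis unfolding solution_basis_def by blast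
        define d' where "d' j = (if j = nabs i then 1 else if j \<in> {nabs n, nabs m} then - d j else 0)" for j
        have J: "finite ?J" "(\<forall>y. (\<Sum>j\<in>?J. d' j * \<phi> 0 j y) = 0) \<longrightarrow> (\<forall>j\<in>?J. d' j = 0)"
          using eigen(3)[OF Y, of "\<mu>0\<^sup>2"] unfolding solution_basis_def by blast+
        have mem: "nabs i \<in> ?J" "nabs n \<in> ?J" "nabs m \<in> ?J" using iip ip[of n] ip[of m] by auto
        have "(\<Sum>j\<in>?J. d' j * \<phi> 0 j y) = 0" for y
        proof -
          have "(\<Sum>j\<in>?J. d' j * \<phi> 0 j y) = (\<Sum>j\<in>{nabs i, nabs n, nabs m}. d' j * \<phi> 0 j y)"
            by (rule sum.mono_neutral_right[OF J(1)]) (use mem in \<open>auto simp: d'_def\<close>)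
          also have "\<dots> = 0" using ne m(2) d[of y] by (simp add: d'_def)
          finally show ?thesis .
        qed
        then have "d' (nabs i) = 0" using J(2) mem(1) by blast
        then show False by (simp add: d'_def)
      qed
    qed
  qed
  have AEG: "AE z in lebesgue_on (Omega \<alpha> \<times> Ycell).
              G z = (\<Sum>\<sigma>\<in>Ik 0. \<Sum>j\<in>bloch_M lam \<sigma> n.
                       cscale2 (u \<sigma> j (fst z)) (bloch_vec a r lam \<phi> \<sigma> j (snd z)))"
  proof -
    have U': "AE x in lebesgue_on (Omega \<alpha>). U j x = (H.U1 j x, H.U2 j x)" for j
      using U[of j] by (simp add: H.U1_def H.U2_def)
    have finI: "finite (Ik 0)" by (simp add: Ik)
    have id: "AE z in lebesgue_on (Omega \<alpha> \<times> Ycell). G z =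
    (\<Sum>\<tau>\<in>Ik 0. \<Sum>i\<in>?I. if exp (2 * \<i> * pi * of_real 0) * exp (- 2 * \<i> * pi * \<tau>) = 1
       then cscale2 (\<A> i (fst z)) (of_real (sqrt (ah (snd z)) * inverse (ah (snd z))) * flux 0 (nabs i) (snd z) / (\<i> * \<mu>0), of_real (sqrt (rh (snd z))) * \<phi> 0 (nabs i) (snd z))
       else 0)"
      by (rule H.weak_limit_identification[OF K(1) K(2) K(3) N finI U' G])
    have "\<forall>i\<in>?I. \<exists>M. negligible M \<and> (\<forall>y\<in>Ycell. y \<notin> M \<longrightarrow> cscale2 (of_real (sqrt 2)) (bloch_vec a r lam \<phi> 0 i y) =
       (of_real (sqrt (ah y) * inverse (ah y)) * flux 0 (nabs i) y / (\<i> * \<mu>0), of_real (sqrt (rh y)) * \<phi> 0 (nabs i) y))"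
    proof
      fix i assume i: "i \<in> ?I"
      show "\<exists>M. negligible M \<and> (\<forall>y\<in>Ycell. y \<notin> M \<longrightarrow> cscale2 (of_real (sqrt 2)) (bloch_vec a r lam \<phi> 0 i y) =
       (of_real (sqrt (ah y) * inverse (ah y)) * flux 0 (nabs i) y / (\<i> * \<mu>0), of_real (sqrt (rh y)) * \<phi> 0 (nabs i) y))"
        using bloch_vec_eq[OF Y i0(1)[OF i]] i0(2)[OF i] \<mu>0 by simp
    qed
    then obtain M where M: "\<And>i. i \<in> ?I \<Longrightarrow> negligible (M i)"
      "\<And>i y. i \<in> ?I \<Longrightarrow> y \<in> Ycell \<Longrightarrow> y \<notin> M i \<Longrightarrow> cscale2 (of_real (sqrt 2)) (bloch_vec a r lam \<phi> 0 i y) =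
       (of_real (sqrt (ah y) * inverse (ah y)) * flux 0 (nabs i) y / (\<i> * \<mu>0), of_real (sqrt (rh y)) * \<phi> 0 (nabs i) y)"
      by metis
    have "negligible ((UNIV :: real set) \<times> (\<Union>i\<in>?I. M i))"
      by (intro negligible_strips(1) negligible_Union) (use M(1) in auto)
    then have "AE z in lebesgue_on (Omega \<alpha> \<times> Ycell). snd z \<in> Ycell \<and> snd z \<notin> (\<Union>i\<in>?I. M i)"
    proof (rule AE_lebesgue_on_negligible)
      have "Omega \<alpha> \<times> Ycell \<in> sets borel" by (simp add: open_Times borel_open)
      then show "Omega \<alpha> \<times> Ycell \<in> sets lebesgue" by auto
    qed auto
    with id show ?thesis
    proof eventually_elim
      case (elim z)
      have "(\<Sum>i\<in>?I. cscale2 (\<A> i (fst z)) (of_real (sqrt (ah (snd z)) * inverse (ah (snd z))) * flux 0 (nabs i) (snd z) / (\<i> * \<mu>0), of_real (sqrt (rh (snd z))) * \<phi> 0 (nabs i) (snd z)))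
        = (\<Sum>j\<in>?I. cscale2 (u 0 j (fst z)) (bloch_vec a r lam \<phi> 0 j (snd z)))"
      proof (rule sum.cong[OF refl])
        fix i assume i: "i \<in> ?I"
        then have "snd z \<in> Ycell" "snd z \<notin> M i" using elim(2) by auto
        from M(2)[OF i this, symmetric]
        show "cscale2 (\<A> i (fst z)) (of_real (sqrt (ah (snd z)) * inverse (ah (snd z))) * flux 0 (nabs i) (snd z) / (\<i> * \<mu>0), of_real (sqrt (rh (snd z))) * \<phi> 0 (nabs i) (snd z))
          = cscale2 (u 0 i (fst z)) (bloch_vec a r lam \<phi> 0 i (snd z))"
          by (simp only: cscale2_cscale2 u_def mult.commute)
      qed
      then show ?case unfolding elim(1) Ik by (simp add: BM)
    qed
  qed
  have BC: "(\<Sum>q\<in>?I. u 0 q x * \<phi> 0 (nabs q) 0) = 0" if "x \<in> {0, \<alpha>}" for x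
  proof -
    have \<rho>lim: "(\<lambda>j. exp (2 * \<i> * pi * of_real 0) ^ N j) \<longlonglongrightarrow> (1::complex)" by simp
    have b\<alpha>: "(\<Sum>i\<in>?I. 1 * \<phi> 0 (nabs i) 0 * \<A> i \<alpha>) = 0"
      by (rule H.boundary_limit(2)[OF K(1,3) \<rho>lim N])
    have b0: "(\<Sum>i\<in>?I. \<phi> 0 (nabs i) 0 * \<A> i 0) = 0" by (rule H.boundary_limit(1)[OF K(1,3)])
    have "(\<Sum>q\<in>?I. u 0 q x * \<phi> 0 (nabs q) 0) = of_real (sqrt 2) * (\<Sum>i\<in>?I. \<phi> 0 (nabs i) 0 * \<A> i x)"
      unfolding u_def sum_distrib_left by (rule sum.cong) auto
    also have "\<dots> = 0" using that b0 b\<alpha> by auto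
    finally show ?thesis .
  qed
  have ODE: "AE x in lebesgue_on (Omega \<alpha>). (\<Sum>q\<in>?I.
                    coef_c a \<phi> 0 (nabs p) (nabs q) * wderiv (Omega \<alpha>) (u 0 q) x
                    + of_real (2 * \<mu>0 * \<mu>1) * coef_b r \<phi> 0 (nabs p) (nabs q) * u 0 q x) = 0" if p: "p \<in> ?I" for p
  proof -
    have I: "n \<in> ?I" "m \<in> ?I" by auto
    \<comment> \<open>Inverting the off-diagonal matrix swaps indices: the derivative of the
      amplitude \<open>n\<close> carries the mass term \<open>b m\<close>, and conversely.\<close>
    have gn: "c * g n x = - (of_real (2 * \<mu>0 * \<mu>1) * b m x)" and gm: "(- c) * g m x = - (of_real (2 * \<mu>0 * \<mu>1) * b n x)" for x
      using cne nm by (simp_all add: g_def D_def)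
    have sb: "(\<Sum>q\<in>?I. coef_c a \<phi> 0 (nabs p) (nabs q) * D' q + of_real (2 * \<mu>0 * \<mu>1) * coef_b r \<phi> 0 (nabs p) (nabs q) * u 0 q x)
      = (\<Sum>q\<in>?I. coef_c a \<phi> 0 (nabs p) (nabs q) * D' q) + of_real (2 * \<mu>0 * \<mu>1) * b p x" for D' x
      unfolding sum.distrib b_def sum_distrib_left by (simp only: mult.assoc)
    show ?thesis using sob2[OF I(1)] sob2[OF I(2)]
    proof eventually_elim
      case (elim x)
      have "(\<Sum>q\<in>?I. coef_c a \<phi> 0 (nabs p) (nabs q) * wderiv (Omega \<alpha>) (u 0 q) x) = - (of_real (2 * \<mu>0 * \<mu>1) * b p x)"
      proof (cases "p = n")
        case True
        have "(\<Sum>q\<in>?I. coef_c a \<phi> 0 (nabs p) (nabs q) * wderiv (Omega \<alpha>) (u 0 q) x) = (- c) * g m x"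
          using nm elim by (simp add: True cdiag cnm)
        then show ?thesis using gm True by simp
      next
        case False
        then have pm: "p = m" using p by simp
        have "(\<Sum>q\<in>?I. coef_c a \<phi> 0 (nabs p) (nabs q) * wderiv (Omega \<alpha>) (u 0 q) x) = c * g n x"
          using nm elim by (simp add: pm cdiag c_def[symmetric])
        then show ?thesis using gn pm by simp
      qed
      then show ?case unfolding sb by simp
    qed
  qed
  show ?thesis
  proof (intro exI[of _ u] conjI ballI)
    fix s j assume s: "s \<in> Ik 0" and j: "j \<in> bloch_M lam s n"
    have s0: "s = 0" and jI: "j \<in> ?I" using s j BM by (auto simp: Ik)
    show "Sob 1 (Omega \<alpha>) (u s j)" unfolding s0 by (rule sob1[OF jI])
    show "continuous_on {0..\<alpha>} (u s j)" by (rule continuous_on_subset[OF uc[OF jI]]) simp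
  qed (use AEG BM ODE BC in blast)+
qed

end

section \<open>Reduction of the theorem to the two cases\<close>

theorem theorem16:
  fixes \<alpha> a0 a1 r0 r1 k :: real
    and a r :: "real \<Rightarrow> real"
    and lam :: "real \<Rightarrow> nat \<Rightarrow> real" and \<phi> :: "real \<Rightarrow> nat \<Rightarrow> real \<Rightarrow> complex"
    and lamE :: "real \<Rightarrow> real" and w :: "real \<Rightarrow> real \<Rightarrow> complex"
    and U :: "real \<Rightarrow> real \<Rightarrow> complex \<times> complex" and \<mu> :: "real \<Rightarrow> real"
  assumes "0 < \<alpha>"
    and "Linf_real r" and "periodic_coeff r0 r1 r"
    and "W1inf_real a" and "periodic_coeff a0 a1 a"
    and "bloch_family a r lam \<phi>"
    and "k \<in> Ystar"
    and "\<And>\<epsilon>. \<epsilon> \<in> eps_values \<alpha> \<Longrightarrow> physical_eigen \<alpha> (osc \<epsilon> a) (osc \<epsilon> r) (lamE \<epsilon>) (w \<epsilon>)"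
    and "\<And>\<epsilon>. \<epsilon> \<in> eps_values \<alpha> \<Longrightarrow> \<mu> \<epsilon> = sqrt (lamE \<epsilon>)"
    and "\<And>\<epsilon>. \<epsilon> \<in> eps_values \<alpha> \<Longrightarrow> U \<epsilon> = phys_vec \<alpha> (osc \<epsilon> a) (osc \<epsilon> r) (lamE \<epsilon>) (w \<epsilon>)"
    and "\<And>\<epsilon>. \<epsilon> \<in> eps_values \<alpha> \<Longrightarrow> A_eigen \<alpha> (osc \<epsilon> a) (osc \<epsilon> r) (\<mu> \<epsilon>) (U \<epsilon>)"
  shows
    "(\<exists>C. \<forall>\<epsilon>\<in>eps_values \<alpha>.
        L2_on (Omega \<alpha> \<times> Ycell) (\<lambda>z. \<Sum>\<sigma>\<in>Ik k. two_scale2 \<alpha> \<epsilon> \<sigma> (U \<epsilon>) z) \<and>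
        L2_norm (Omega \<alpha> \<times> Ycell) (\<lambda>z. \<Sum>\<sigma>\<in>Ik k. two_scale2 \<alpha> \<epsilon> \<sigma> (U \<epsilon>) z) \<le> C)
     \<and>
     (\<forall>(E :: real set) lk \<mu>0 \<mu>1 (n :: int) (m :: int) G.
        admissible_eps \<alpha> k E lk \<and>
        ((\<lambda>\<epsilon>. \<mu> \<epsilon> - (\<mu>0 / \<epsilon> + \<mu>1)) \<longlongrightarrow> 0) (at 0 within E) \<and>
        n \<noteq> 0 \<and> \<mu>0 = bloch_mu lam k n \<and> \<mu>0 \<noteq> 0 \<and>
        nondegenerate a r lam \<phi> k n m \<and>
        (\<forall>H. weak_limit (Omega \<alpha> \<times> Ycell) E (\<lambda>\<epsilon>. two_scale2 \<alpha> \<epsilon> k (U \<epsilon>)) H \<longrightarrow>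
             \<not> (AE z in lebesgue_on (Omega \<alpha> \<times> Ycell). H z = 0)) \<and>
        weak_limit (Omega \<alpha> \<times> Ycell) E (\<lambda>\<epsilon> z. \<Sum>\<sigma>\<in>Ik k. two_scale2 \<alpha> \<epsilon> \<sigma> (U \<epsilon>) z) G
        \<longrightarrow>
        (\<exists>u :: real \<Rightarrow> int \<Rightarrow> real \<Rightarrow> complex.
           (\<forall>\<sigma>\<in>Ik k. \<forall>j\<in>bloch_M lam \<sigma> n.
              Sob 1 (Omega \<alpha>) (u \<sigma> j) \<and> continuous_on {0..\<alpha>} (u \<sigma> j)) \<and>
           (AE z in lebesgue_on (Omega \<alpha> \<times> Ycell).
              G z = (\<Sum>\<sigma>\<in>Ik k. \<Sum>j\<in>bloch_M lam \<sigma> n.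
                       cscale2 (u \<sigma> j (fst z)) (bloch_vec a r lam \<phi> \<sigma> j (snd z)))) \<and>
           (k \<noteq> 0 \<longrightarrow>
              (\<forall>\<sigma>\<in>Ik k. bloch_M lam \<sigma> n = {n} \<and>
                 (AE x in lebesgue_on (Omega \<alpha>).
                    coef_c a \<phi> \<sigma> (nabs n) (nabs n) * wderiv (Omega \<alpha>) (u \<sigma> n) x
                    + of_real (2 * \<mu>0 * \<mu>1) * coef_b r \<phi> \<sigma> (nabs n) (nabs n) * u \<sigma> n x = 0)) \<and>
              (\<forall>x\<in>{0, \<alpha>}.
                 u k n x * \<phi> k (nabs n) 0 * exp (2 * \<i> * pi * lk * x / \<alpha>)
                 + u (-k) n x * \<phi> (-k) (nabs n) 0 * exp (- 2 * \<i> * pi * lk * x / \<alpha>) = 0)) \<and>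
           (k = 0 \<longrightarrow>
              bloch_M lam 0 n = {n, m} \<and>
              (\<forall>p\<in>{n, m}. AE x in lebesgue_on (Omega \<alpha>).
                 (\<Sum>q\<in>{n, m}.
                    coef_c a \<phi> 0 (nabs p) (nabs q) * wderiv (Omega \<alpha>) (u 0 q) x
                    + of_real (2 * \<mu>0 * \<mu>1) * coef_b r \<phi> 0 (nabs p) (nabs q) * u 0 q x) = 0) \<and>
              (\<forall>x\<in>{0, \<alpha>}. (\<Sum>q\<in>{n, m}. u 0 q x * \<phi> 0 (nabs q) 0) = 0))))"
proof -
  let ?s = "\<lambda>\<epsilon> z. \<Sum>\<sigma>\<in>Ik k. two_scale2 \<alpha> \<epsilon> \<sigma> (U \<epsilon>) z"
  obtain rh where rh: "rh \<in> borel_measurable borel" "\<And>x. r0 \<le> rh x" "\<And>x. rh x \<le> r1" "\<And>x. rh (x + 1) = rh x"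
    "AE x in lebesgue. r x = rh x"
    by (rule ex_regular_density[OF assms(2,3)]) blast
  obtain ah where ah: "continuous_on UNIV ah" "\<And>x. a0 \<le> ah x" "\<And>x. ah x \<le> a1" "\<And>x. ah (x + 1) = ah x"
    "AE x in lebesgue. a x = ah x"
    by (rule ex_regular_stiffness[OF assms(4,5)]) blast
  have pos: "0 < a0" "0 < r0" using assms(3,5) by (simp_all add: periodic_coeff_def)
  interpret P: bloch_setting ah rh a0 a1 r0 r1 a r lam \<phi>
    by unfold_locales (rule ah rh pos assms(6))+
  have ev: "0 < \<epsilon>" "\<exists>N. \<alpha> / \<epsilon> = real N" if "\<epsilon> \<in> eps_values \<alpha>" for \<epsilon>
    using that assms(1) by (auto simp: eps_values_def)
  let ?V1 = "\<lambda>\<epsilon> Q x. of_real (sqrt (osc \<epsilon> ah x) * inverse (osc \<epsilon> ah x)) * Q x / (\<i> * of_real (sqrt (lamE \<epsilon>)))"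
  let ?V2 = "\<lambda>\<epsilon> W x. of_real (sqrt (osc \<epsilon> rh x)) * W x :: complex"
  \<comment> \<open>Everything known for a fixed \<epsilon> is bundled, so that one choice of
    solutions serves both the uniform bound and all sequences.\<close>
  define good where "good \<epsilon> W Q \<longleftrightarrow> int_sol (osc \<epsilon> ah) (osc \<epsilon> rh) (lamE \<epsilon>) \<alpha> W Q \<and> W 0 = 0 \<and> W \<alpha> = 0 \<and>
    integral {0..\<alpha>} (\<lambda>x. (cmod (W x))\<^sup>2) = 1 \<and> 0 \<le> lamE \<epsilon> \<and>
    (AE x in lebesgue_on (Omega \<alpha>). U \<epsilon> x = (?V1 \<epsilon> Q x, ?V2 \<epsilon> W x)) \<and>
    integral {0..\<alpha>} (\<lambda>x. (cmod (?V1 \<epsilon> Q x))\<^sup>2 + (cmod (?V2 \<epsilon> W x))\<^sup>2) \<le> 2 * r1" for \<epsilon> W Q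
  have "\<exists>W Q. good \<epsilon> W Q" if e: "\<epsilon> \<in> eps_values \<alpha>" for \<epsilon>
  proof -
    show ?thesis
      unfolding good_def assms(10)[OF e]
      by (rule P.physical_data[OF assms(8)[OF e] assms(1) ev(1)[OF e] ah(5) rh(5)]) blast
  qed
  then obtain WW QQ where "\<And>\<epsilon>. \<epsilon> \<in> eps_values \<alpha> \<Longrightarrow> good \<epsilon> (WW \<epsilon>) (QQ \<epsilon>)" by metis
  note good = this[unfolded good_def]
  have "\<exists>C. \<forall>\<epsilon>\<in>eps_values \<alpha>. L2_on (Omega \<alpha> \<times> Ycell) (?s \<epsilon>) \<and> L2_norm (Omega \<alpha> \<times> Ycell) (?s \<epsilon>) \<le> C"
  proof (intro exI ballI conjI)
    fix \<epsilon> assume e: "\<epsilon> \<in> eps_values \<alpha>"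
    interpret o: coefficients "osc \<epsilon> ah" "osc \<epsilon> rh" a0 a1 r0 r1 by (rule P.int_sol_osc[OF ev(1)[OF e]])
    obtain N where N: "\<alpha> / \<epsilon> = real N" using ev(2)[OF e] by blast
    have s: "int_sol (osc \<epsilon> ah) (osc \<epsilon> rh) (lamE \<epsilon>) \<alpha> (WW \<epsilon>) (QQ \<epsilon>)"
      and Ue: "AE x in lebesgue_on (Omega \<alpha>). U \<epsilon> x = (?V1 \<epsilon> (QQ \<epsilon>) x, ?V2 \<epsilon> (WW \<epsilon>) x)"
      and bd: "integral {0..\<alpha>} (\<lambda>x. (cmod (?V1 \<epsilon> (QQ \<epsilon>) x))\<^sup>2 + (cmod (?V2 \<epsilon> (WW \<epsilon>) x))\<^sup>2) \<le> 2 * r1"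
      using good[OF e] by auto
    have l1: "loc_bounded (?V1 \<epsilon> (QQ \<epsilon>))"
      unfolding divide_inverse
      by (intro loc_bounded_mult loc_bounded_of_real loc_bounded_const int_solD(4)[OF s] o.loc_bounded_sqrt_a)
    have l2: "loc_bounded (?V2 \<epsilon> (WW \<epsilon>))"
      by (intro loc_bounded_mult loc_bounded_of_real int_solD(3)[OF s] o.loc_bounded_sqrt_r)
    have fin: "finite (Ik k)" by (simp add: Ik_def)
    note t = two_scale_sum_L2[OF ev(1)[OF e] N fin l1 l2 Ue]
    show "L2_on (Omega \<alpha> \<times> Ycell) (?s \<epsilon>)" by (rule t(2))
    \<comment> \<open>Uniform in \<epsilon>: \<open>2 * r1\<close> is the energy bound on
      \<open>U \<epsilon>\<close>, and the squared number of quasi-momenta comes from the sum of the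
      transforms.\<close>
    show "L2_norm (Omega \<alpha> \<times> Ycell) (?s \<epsilon>) \<le> sqrt ((real (card (Ik k)))\<^sup>2 * (2 * r1))"
      by (rule order_trans[OF t(3)]) (intro real_sqrt_le_mono mult_left_mono bd, simp)
  qed
  moreover have "\<exists>u :: real \<Rightarrow> int \<Rightarrow> real \<Rightarrow> complex.
           (\<forall>\<sigma>\<in>Ik k. \<forall>j\<in>bloch_M lam \<sigma> n.
              Sob 1 (Omega \<alpha>) (u \<sigma> j) \<and> continuous_on {0..\<alpha>} (u \<sigma> j)) \<and>
           (AE z in lebesgue_on (Omega \<alpha> \<times> Ycell).
              G z = (\<Sum>\<sigma>\<in>Ik k. \<Sum>j\<in>bloch_M lam \<sigma> n.
                       cscale2 (u \<sigma> j (fst z)) (bloch_vec a r lam \<phi> \<sigma> j (snd z)))) \<and>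
           (k \<noteq> 0 \<longrightarrow>
              (\<forall>\<sigma>\<in>Ik k. bloch_M lam \<sigma> n = {n} \<and>
                 (AE x in lebesgue_on (Omega \<alpha>).
                    coef_c a \<phi> \<sigma> (nabs n) (nabs n) * wderiv (Omega \<alpha>) (u \<sigma> n) x
                    + of_real (2 * \<mu>0 * \<mu>1) * coef_b r \<phi> \<sigma> (nabs n) (nabs n) * u \<sigma> n x = 0)) \<and>
              (\<forall>x\<in>{0, \<alpha>}.
                 u k n x * \<phi> k (nabs n) 0 * exp (2 * \<i> * pi * lk * x / \<alpha>)
                 + u (-k) n x * \<phi> (-k) (nabs n) 0 * exp (- 2 * \<i> * pi * lk * x / \<alpha>) = 0)) \<and>
           (k = 0 \<longrightarrow>
              bloch_M lam 0 n = {n, m} \<and>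
              (\<forall>p\<in>{n, m}. AE x in lebesgue_on (Omega \<alpha>).
                 (\<Sum>q\<in>{n, m}.
                    coef_c a \<phi> 0 (nabs p) (nabs q) * wderiv (Omega \<alpha>) (u 0 q) x
                    + of_real (2 * \<mu>0 * \<mu>1) * coef_b r \<phi> 0 (nabs p) (nabs q) * u 0 q x) = 0) \<and>
              (\<forall>x\<in>{0, \<alpha>}. (\<Sum>q\<in>{n, m}. u 0 q x * \<phi> 0 (nabs q) 0) = 0))" (is "\<exists>u. ?goal u")
    if E: "admissible_eps \<alpha> k E lk" and \<mu>l: "((\<lambda>\<epsilon>. \<mu> \<epsilon> - (\<mu>0 / \<epsilon> + \<mu>1)) \<longlongrightarrow> 0) (at 0 within E)"
      and n: "n \<noteq> 0" and \<mu>0n: "\<mu>0 = bloch_mu lam k n" and \<mu>0: "\<mu>0 \<noteq> 0"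
      and nd: "nondegenerate a r lam \<phi> k n m"
      and G: "weak_limit (Omega \<alpha> \<times> Ycell) E ?s G"
    for E lk \<mu>0 \<mu>1 n m G
  proof -
    obtain e :: "nat \<Rightarrow> real" where eE: "\<And>j. e j \<in> E" and e0: "e \<longlonglongrightarrow> 0"
      and wG: "weakly_tendsto (Omega \<alpha> \<times> Ycell) (\<lambda>j. ?s (e j)) G"
      using G unfolding weak_limit_def by blast
    have eV: "e j \<in> eps_values \<alpha>" for j using eE E unfolding admissible_eps_def by blast
    have ep: "0 < e j" for j by (rule ev(1)[OF eV])
    have fe: "filterlim e (at 0 within E) sequentially"
      unfolding filterlim_at using e0 eE ep by (auto simp: less_imp_neq[symmetric])
    obtain N where N: "\<And>j. \<alpha> / e j = real (N j)" using ev(2)[OF eV] by metis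
    have "(\<lambda>j. \<mu> (e j) - (\<mu>0 / e j + \<mu>1)) \<longlonglongrightarrow> 0" by (rule filterlim_compose[OF \<mu>l fe])
    from tendsto_add[OF this tendsto_const[of \<mu>1]]
    have lim: "(\<lambda>j. sqrt (lamE (e j)) - \<mu>0 / e j) \<longlonglongrightarrow> \<mu>1" by (simp add: assms(9)[OF eV])
    have "(\<lambda>j. e j * (sqrt (lamE (e j)) - \<mu>0 / e j) + \<mu>0) \<longlonglongrightarrow> 0 * \<mu>1 + \<mu>0" by (intro tendsto_intros e0 lim)
    moreover have "e j * (sqrt (lamE (e j)) - \<mu>0 / e j) + \<mu>0 = e j * sqrt (lamE (e j))" for j
      using ep[of j] by (simp add: right_diff_distrib)
    moreover have "0 \<le> e j * sqrt (lamE (e j))" for j using ep[of j] good[OF eV[of j]] by simp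
    \<comment> \<open>\<mu>0 is the limit of \<epsilon> times the square root of the eigenvalue,
      hence not negative; being nonzero, it is positive.\<close>
    ultimately have "0 \<le> 0 * \<mu>1 + \<mu>0" by (intro LIMSEQ_le_const) auto
    then have \<mu>0_pos: "0 < \<mu>0" using \<mu>0 by simp
    interpret S: bloch_sequence ah rh a0 a1 r0 r1 a r lam \<phi> \<alpha> \<mu>0 \<mu>1 e "\<lambda>j. lamE (e j)" N "\<lambda>j. WW (e j)" "\<lambda>j. QQ (e j)" "\<lambda>j. U (e j)"
      by unfold_locales (use assms(1) \<mu>0_pos ep e0 N lim good[OF eV] in auto)
    show ?thesis
    proof (cases "k = 0")
      case True
      have "\<exists>u. ?goal u" unfolding True
        using S.macroscopic_problem_zero[OF n \<mu>0n[unfolded True] nd[unfolded True] wG[unfolded True]] by auto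
      then show ?thesis .
    next
      case False
      have nd': "coef_c a \<phi> \<sigma> (nabs n) (nabs n) \<noteq> 0" if "\<sigma> \<in> Ik k" for \<sigma>
        using nd that False by (simp add: nondegenerate_def)
      have l: "(\<lambda>j. \<alpha> * k / e j - of_int \<lfloor>\<alpha> * k / e j\<rfloor>) \<longlonglongrightarrow> lk"
        by (rule filterlim_compose[OF _ fe]) (use E in \<open>simp add: admissible_eps_def\<close>)
      obtain u where u: "(\<forall>\<sigma>\<in>Ik k. \<forall>j\<in>bloch_M lam \<sigma> n.
              Sob 1 (Omega \<alpha>) (u \<sigma> j) \<and> continuous_on {0..\<alpha>} (u \<sigma> j))"
        "AE z in lebesgue_on (Omega \<alpha> \<times> Ycell).
              G z = (\<Sum>\<sigma>\<in>Ik k. \<Sum>j\<in>bloch_M lam \<sigma> n.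
                       cscale2 (u \<sigma> j (fst z)) (bloch_vec a r lam \<phi> \<sigma> j (snd z)))"
        "(\<forall>\<sigma>\<in>Ik k. bloch_M lam \<sigma> n = {n} \<and>
                 (AE x in lebesgue_on (Omega \<alpha>).
                    coef_c a \<phi> \<sigma> (nabs n) (nabs n) * wderiv (Omega \<alpha>) (u \<sigma> n) x
                    + of_real (2 * \<mu>0 * \<mu>1) * coef_b r \<phi> \<sigma> (nabs n) (nabs n) * u \<sigma> n x = 0))"
        "(\<forall>x\<in>{0, \<alpha>}.
                 u k n x * \<phi> k (nabs n) 0 * exp (2 * \<i> * pi * lk * x / \<alpha>)
                 + u (-k) n x * \<phi> (-k) (nabs n) 0 * exp (- 2 * \<i> * pi * lk * x / \<alpha>) = 0)"
        using S.macroscopic_problem_nonzero[OF assms(7) False n \<mu>0n nd' l wG] by blast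
      show ?thesis
        by (rule exI[of _ u], intro conjI impI u) (use False in simp_all)
    qed
  qed
  ultimately show ?thesis by blast
qed

end
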